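(* Let $G\times M\to M$ be a smooth action of a Lie group $G$ with Lie algebra $\mathfrak g$ and let $r\in\bigwedge^2\mathfrak g$ satisfy $[r,r]=0$. Let $\xi\colon T^*M\to M$ be the cotangent bundle, let $\pi_0$ be the canonical Poisson structure of $T^*M$, and consider the lifted action of $G$ on $T^*M$. Then 1. $r_M$ is a Poisson bi-vector field on $M$; 2. $r_{T^*M}$ is a Poisson bi-vector field on $T^*M$ and $\xi_*r_{T^*M}=r_M$; 3. $\pi_{T^*M}:=r_{T^*M}+\pi_0$ is a Poisson bi-vector field on $T^*M$ and $\xi_*\pi_{T^*M}=r_M$. Moreover $\pi_{T^*M}$ is non-degenerate in a neighbourhood of the zero section of $T^*M$.
   Context: $[\cdot,\cdot]$ is the Schouten bracket (algebraic on $\bigwedge\mathfrak g$). For an action of $G$ on a manifold $N$ and $w\in\bigwedge^k\mathfrak g$, $w_N$ denotes the $k$-vector field on $N$ whose value at $x$ is the push-forward of $w$ by the orbit map $g\mapsto gx$ at the unit of $G$. A bi-vector field is Poisson if its Schouten bracket with itself vanishes. The notation $\xi_*\pi=\pi'$ means that the bi-vector fields $\pi$ on $T^*M$ and $\pi'$ on $M$ are $\xi$-related. *)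

theory Defs
  imports
    "HOL-Analysis.Analysis"
    "HOL-Combinatorics.Permutations"
    "HOL-Algebra.Group_Action"
begin

section \<open>Model spaces\<close>

text \<open>
  Charts take values in a finite-dimensional inner product space. The class below differs from
  the class \<open>euclidean_space\<close> only in admitting dimension 0, so that 0-dimensional manifolds and
  discrete Lie groups are covered (as for the type \<open>zero_space\<close>).
\<close>

class finite_dim_inner = real_inner +
  assumes finite_orthonormal_basis:
    "\<exists>B. finite B \<and> (\<forall>u\<in>B. \<forall>v\<in>B. inner u v = (if u = v then 1 else 0)) \<and>
         (\<forall>x. (\<forall>u\<in>B. inner x u = 0) \<longrightarrow> x = 0)"

definition orthonormal_basis :: "'a::real_inner set \<Rightarrow> bool" where
  "orthonormal_basis B \<longleftrightarrow>
     finite B \<and> (\<forall>u\<in>B. \<forall>v\<in>B. inner u v = (if u = v then 1 else 0)) \<and>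
     (\<forall>x. (\<forall>u\<in>B. inner x u = 0) \<longrightarrow> x = 0)"

definition onb :: "'a::finite_dim_inner set" where
  "onb = (SOME B. orthonormal_basis B)"

lemma orthonormal_basis_onb: "orthonormal_basis (onb :: 'a::finite_dim_inner set)"
proof -
  have "\<exists>B. orthonormal_basis (B :: 'a set)"
    unfolding orthonormal_basis_def by (rule finite_orthonormal_basis)
  then show ?thesis
    unfolding onb_def by (rule someI_ex)
qed

subclass (in euclidean_space) finite_dim_inner
proof
  show "\<exists>B. finite B \<and> (\<forall>u\<in>B. \<forall>v\<in>B. inner u v = (if u = v then 1 else 0)) \<and>
      (\<forall>x. (\<forall>u\<in>B. inner x u = 0) \<longrightarrow> x = 0)"
    by (intro exI[of _ Basis] conjI ballI allI impI)
      (simp_all only: finite_Basis inner_Basis euclidean_all_zero_iff)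
qed

lemma finite_onb [simp]: "finite (onb :: 'a::finite_dim_inner set)"
  using orthonormal_basis_onb[where 'a = 'a] unfolding orthonormal_basis_def by blast

lemma inner_onb:
  fixes u v :: "'a::finite_dim_inner"
  shows "u \<in> onb \<Longrightarrow> v \<in> onb \<Longrightarrow> inner u v = (if u = v then 1 else 0)"
  using orthonormal_basis_onb[where 'a = 'a]
  unfolding orthonormal_basis_def
  by (elim conjE) (drule bspec, assumption, drule bspec, assumption, assumption)

lemma onb_all_zero:
  fixes x :: "'a::finite_dim_inner"
  shows "(\<And>u. u \<in> onb \<Longrightarrow> inner x u = 0) \<Longrightarrow> x = 0"
  using orthonormal_basis_onb[where 'a = 'a] unfolding orthonormal_basis_def by blast

lemma zero_notin_onb [simp]: "(0 :: 'a::finite_dim_inner) \<notin> onb"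
proof
  assume "0 \<in> (onb :: 'a set)"
  from inner_onb[OF this this] show False by simp
qed

instance prod :: (finite_dim_inner, finite_dim_inner) finite_dim_inner
proof
  let ?B = "(\<lambda>b. (b, 0)) ` (onb :: 'a set) \<union> (\<lambda>b. (0, b)) ` (onb :: 'b set)"
  have "finite ?B" by simp
  moreover have "\<forall>u\<in>?B. \<forall>v\<in>?B. inner u v = (if u = v then 1 else 0)"
    by (simp add: ball_Un inner_onb)
  moreover have "x = 0" if "\<forall>u\<in>?B. inner x u = 0" for x :: "'a \<times> 'b"
  proof -
    have "inner (fst x) u = 0" if "u \<in> onb" for u
      using \<open>\<forall>u\<in>?B. inner x u = 0\<close> that by (force simp: inner_prod_def)
    moreover have "inner (snd x) u = 0" if "u \<in> onb" for u
      using \<open>\<forall>u\<in>?B. inner x u = 0\<close> that by (force simp: inner_prod_def)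
    ultimately have "fst x = 0" "snd x = 0" by (metis onb_all_zero)+
    then show ?thesis by (simp add: prod_eq_iff)
  qed
  ultimately show "\<exists>B::('a \<times> 'b) set. finite B \<and>
      (\<forall>u\<in>B. \<forall>v\<in>B. inner u v = (if u = v then 1 else 0)) \<and>
      (\<forall>x. (\<forall>u\<in>B. inner x u = 0) \<longrightarrow> x = 0)"
    by (intro exI[of _ ?B]) simp
qed

datatype zero_space = Zero_Space

lemma zero_space_eq: "x = (y :: zero_space)"
  by (cases x, cases y) simp

instantiation zero_space :: finite_dim_inner
begin

definition zero_zero_space :: zero_space where "zero_zero_space = Zero_Space"
definition plus_zero_space :: "zero_space \<Rightarrow> zero_space \<Rightarrow> zero_space"
  where "plus_zero_space x y = Zero_Space"
definition minus_zero_space :: "zero_space \<Rightarrow> zero_space \<Rightarrow> zero_space"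
  where "minus_zero_space x y = Zero_Space"
definition uminus_zero_space :: "zero_space \<Rightarrow> zero_space"
  where "uminus_zero_space x = Zero_Space"
definition scaleR_zero_space :: "real \<Rightarrow> zero_space \<Rightarrow> zero_space"
  where "scaleR_zero_space c x = Zero_Space"
definition inner_zero_space :: "zero_space \<Rightarrow> zero_space \<Rightarrow> real"
  where "inner_zero_space x y = 0"
definition norm_zero_space :: "zero_space \<Rightarrow> real" where "norm_zero_space x = 0"
definition dist_zero_space :: "zero_space \<Rightarrow> zero_space \<Rightarrow> real"
  where "dist_zero_space x y = 0"
definition sgn_zero_space :: "zero_space \<Rightarrow> zero_space" where "sgn_zero_space x = Zero_Space"
definition uniformity_zero_space :: "(zero_space \<times> zero_space) filter" where
  "uniformity_zero_space = (INF e\<in>{0<..}. principal {(x, y). dist x y < e})"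
definition open_zero_space :: "zero_space set \<Rightarrow> bool" where
  "open_zero_space U \<longleftrightarrow> (\<forall>x\<in>U. eventually (\<lambda>(x', y). x' = x \<longrightarrow> y \<in> U) uniformity)"

instance
proof
  fix a b :: real and x y z :: zero_space
  show "x + y + z = x + (y + z)" by (rule zero_space_eq)
  show "x + y = y + x" by (rule zero_space_eq)
  show "0 + x = x" by (rule zero_space_eq)
  show "- x + x = 0" by (rule zero_space_eq)
  show "x - y = x + - y" by (rule zero_space_eq)
  show "a *\<^sub>R (x + y) = a *\<^sub>R x + a *\<^sub>R y" by (rule zero_space_eq)
  show "(a + b) *\<^sub>R x = a *\<^sub>R x + b *\<^sub>R x" by (rule zero_space_eq)
  show "a *\<^sub>R b *\<^sub>R x = (a * b) *\<^sub>R x" by (rule zero_space_eq)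
  show "1 *\<^sub>R x = x" by (rule zero_space_eq)
  show "sgn x = inverse (norm x) *\<^sub>R x" by (rule zero_space_eq)
  show "dist x y = norm (x - y)" by (simp add: dist_zero_space_def norm_zero_space_def)
  show "norm x = sqrt (inner x x)" by (simp add: norm_zero_space_def inner_zero_space_def)
  show "inner x y = inner y x" by (simp add: inner_zero_space_def)
  show "inner (x + y) z = inner x z + inner y z" by (simp add: inner_zero_space_def)
  show "inner (a *\<^sub>R x) y = a * inner x y" by (simp add: inner_zero_space_def)
  show "0 \<le> inner x x" by (simp add: inner_zero_space_def)
  show "inner x x = 0 \<longleftrightarrow> x = 0" using zero_space_eq[of x 0] by (simp add: inner_zero_space_def)
next
  show "uniformity = (INF e\<in>{0<..}. principal {(x :: zero_space, y). dist x y < e})"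
    by (rule uniformity_zero_space_def)
next
  fix U :: "zero_space set"
  show "open U \<longleftrightarrow> (\<forall>x\<in>U. eventually (\<lambda>(x', y). x' = x \<longrightarrow> y \<in> U) uniformity)"
    by (rule open_zero_space_def)
next
  have "\<forall>x::zero_space. x = 0" using zero_space_eq by blast
  then show "\<exists>B::zero_space set. finite B \<and>
      (\<forall>u\<in>B. \<forall>v\<in>B. inner u v = (if u = v then 1 else 0)) \<and>
      (\<forall>x. (\<forall>u\<in>B. inner x u = 0) \<longrightarrow> x = 0)"
    by (intro exI[of _ "{}"]) blast
qed

end


section \<open>Smooth maps between open subsets of model spaces\<close>

text \<open>In finite dimensions, \<open>C_diff k S f\<close> says that \<open>f\<close> is \<open>k\<close> times continuously
  differentiable on the open set \<open>S\<close>.\<close>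

primrec C_diff ::
    "nat \<Rightarrow> 'a::real_normed_vector set \<Rightarrow> ('a \<Rightarrow> 'b::real_normed_vector) \<Rightarrow> bool" where
  "C_diff 0 S f \<longleftrightarrow> continuous_on S f"
| "C_diff (Suc k) S f \<longleftrightarrow>
     (\<forall>x\<in>S. f differentiable (at x)) \<and> (\<forall>v. C_diff k S (\<lambda>x. frechet_derivative f (at x) v))"

definition smooth_on ::
    "'a::real_normed_vector set \<Rightarrow> ('a \<Rightarrow> 'b::real_normed_vector) \<Rightarrow> bool" where
  "smooth_on S f \<longleftrightarrow> (\<forall>k. C_diff k S f)"


section \<open>Manifolds\<close>

text \<open>
  A manifold is given by a smooth atlas, i.e. a set of injective charts \<open>(U, \<phi>)\<close> with open images
  and smooth transition maps; the atlas determines the points and the topology (in which the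
  charts are homeomorphisms), which is required to be Hausdorff and second countable.
\<close>

type_synonym ('m, 'a) chart = "'m set \<times> ('m \<Rightarrow> 'a)"
type_synonym ('m, 'a) atlas = "('m, 'a) chart set"

definition points :: "('m, 'a) atlas \<Rightarrow> 'm set" where
  "points A = \<Union> (fst ` A)"

definition atlas_topology :: "('m, 'a::topological_space) atlas \<Rightarrow> 'm topology" where
  "atlas_topology A =
     topology_generated_by {U \<inter> \<phi> -` S | U \<phi> S. (U, \<phi>) \<in> A \<and> open S}"

definition smooth_manifold :: "('m, 'a::finite_dim_inner) atlas \<Rightarrow> bool" where
  "smooth_manifold A \<longleftrightarrow>
     (\<forall>(U, \<phi>)\<in>A. inj_on \<phi> U) \<and>
     (\<forall>(U, \<phi>)\<in>A. \<forall>(V, \<psi>)\<in>A.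
        open (\<phi> ` (U \<inter> V)) \<and> smooth_on (\<phi> ` (U \<inter> V)) (\<psi> \<circ> inv_into U \<phi>)) \<and>
     Hausdorff_space (atlas_topology A) \<and> second_countable (atlas_topology A)"

definition smooth_map ::
    "('m, 'a::real_normed_vector) atlas \<Rightarrow> ('n, 'b::real_normed_vector) atlas \<Rightarrow> ('m \<Rightarrow> 'n) \<Rightarrow> bool"
  where
  "smooth_map A B f \<longleftrightarrow>
     continuous_map (atlas_topology A) (atlas_topology B) f \<and>
     (\<forall>(U, \<phi>)\<in>A. \<forall>(V, \<psi>)\<in>B.
        smooth_on (\<phi> ` (U \<inter> f -` V)) (\<psi> \<circ> f \<circ> inv_into U \<phi>))"

definition product_atlas :: "('m, 'a) atlas \<Rightarrow> ('n, 'b) atlas \<Rightarrow> ('m \<times> 'n, 'a \<times> 'b) atlas" where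
  "product_atlas A B = {(U \<times> V, map_prod \<phi> \<psi>) | U \<phi> V \<psi>. (U, \<phi>) \<in> A \<and> (V, \<psi>) \<in> B}"

definition smooth_fun_on ::
    "('m, 'a::real_normed_vector) atlas \<Rightarrow> 'm set \<Rightarrow> ('m \<Rightarrow> real) \<Rightarrow> bool" where
  "smooth_fun_on A W f \<longleftrightarrow>
     openin (atlas_topology A) W \<and> (\<forall>(U, \<phi>)\<in>A. smooth_on (\<phi> ` (U \<inter> W)) (f \<circ> inv_into U \<phi>))"

definition smooth_near ::
    "('m, 'a::real_normed_vector) atlas \<Rightarrow> 'm \<Rightarrow> ('m \<Rightarrow> real) \<Rightarrow> bool" where
  "smooth_near A x f \<longleftrightarrow> (\<exists>W. x \<in> W \<and> smooth_fun_on A W f)"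


section \<open>Duals and exterior powers\<close>

text \<open>
  Vectors are real functions on some set, added and scaled pointwise, and \<open>V\<close> is a
  finite-dimensional space of such vectors. Linear forms are 0 outside \<open>V\<close>. The exterior power
  is identified with the space of alternating multilinear functions of \<open>k\<close> linear forms, where
  \<open>v\<^sub>1 \<and> ... \<and> v\<^sub>k\<close> is \<open>(\<alpha>\<^sub>1, ..., \<alpha>\<^sub>k) \<mapsto> det (\<alpha>\<^sub>i v\<^sub>j)\<close>.
\<close>

type_synonym 's vec = "'s \<Rightarrow> real"
type_synonym 's form = "'s vec \<Rightarrow> real"
type_synonym 's multivec = "'s form list \<Rightarrow> real"

definition lincomb :: "real \<Rightarrow> ('s \<Rightarrow> real) \<Rightarrow> real \<Rightarrow> ('s \<Rightarrow> real) \<Rightarrow> 's \<Rightarrow> real" where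
  "lincomb a u b v = (\<lambda>s. a * u s + b * v s)"

definition dual_space :: "'s vec set \<Rightarrow> 's form set" where
  "dual_space V =
     {\<alpha>. (\<forall>u\<in>V. \<forall>v\<in>V. \<forall>a b. \<alpha> (lincomb a u b v) = a * \<alpha> u + b * \<alpha> v) \<and> (\<forall>u. u \<notin> V \<longrightarrow> \<alpha> u = 0)}"

definition form_lists :: "nat \<Rightarrow> 's vec set \<Rightarrow> 's form list set" where
  "form_lists k V = {\<alpha>s. length \<alpha>s = k \<and> set \<alpha>s \<subseteq> dual_space V}"

definition exterior_power :: "nat \<Rightarrow> 's vec set \<Rightarrow> 's multivec set" where
  "exterior_power k V =
     {w. (\<forall>\<alpha>s\<in>form_lists k V. \<forall>i<k. \<forall>\<beta>\<in>dual_space V. \<forall>\<gamma>\<in>dual_space V. \<forall>a b.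
            w (\<alpha>s[i := lincomb a \<beta> b \<gamma>]) = a * w (\<alpha>s[i := \<beta>]) + b * w (\<alpha>s[i := \<gamma>])) \<and>
         (\<forall>\<alpha>s\<in>form_lists k V. \<not> distinct \<alpha>s \<longrightarrow> w \<alpha>s = 0) \<and>
         (\<forall>\<alpha>s. \<alpha>s \<notin> form_lists k V \<longrightarrow> w \<alpha>s = 0)}"

definition wedge :: "'s vec set \<Rightarrow> 's vec list \<Rightarrow> 's multivec" where
  "wedge V vs = (\<lambda>\<alpha>s.
     if \<alpha>s \<in> form_lists (length vs) V
     then \<Sum>p | p permutes {..<length vs}.
            of_int (sign p) * (\<Prod>i<length vs. (\<alpha>s ! p i) (vs ! i))
     else 0)"


section \<open>The algebraic Schouten bracket\<close>

definition remove_nth :: "nat \<Rightarrow> 'b list \<Rightarrow> 'b list" where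
  "remove_nth i xs = take i xs @ drop (Suc i) xs"

text \<open>The bracket of \<open>x\<^sub>1 \<and> ... \<and> x\<^sub>k\<close> and \<open>y\<^sub>1 \<and> ... \<and> y\<^sub>l\<close> is the sum of the terms
  \<open>(-1)^(i+j) [x\<^sub>i, y\<^sub>j] \<and> x\<^sub>1 \<and> ... \<and> x\<^sub>k \<and> y\<^sub>1 \<and> ... \<and> y\<^sub>l\<close> with \<open>x\<^sub>i\<close> and \<open>y\<^sub>j\<close> omitted.\<close>

definition decomposable_schouten ::
    "'s vec set \<Rightarrow> ('s vec \<Rightarrow> 's vec \<Rightarrow> 's vec) \<Rightarrow> 's vec list \<Rightarrow> 's vec list \<Rightarrow> 's multivec" where
  "decomposable_schouten V br xs ys = (\<lambda>\<alpha>s. \<Sum>i<length xs. \<Sum>j<length ys.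
     (- 1) ^ (i + j) *
     wedge V (br (xs ! i) (ys ! j) # remove_nth i xs @ remove_nth j ys) \<alpha>s)"

definition is_decomposition ::
    "nat \<Rightarrow> 's vec set \<Rightarrow> 's multivec \<Rightarrow> 's vec list list \<Rightarrow> bool" where
  "is_decomposition k V P Xs \<longleftrightarrow>
     (\<forall>xs\<in>set Xs. length xs = k \<and> set xs \<subseteq> V) \<and> P = (\<lambda>\<alpha>s. \<Sum>xs\<leftarrow>Xs. wedge V xs \<alpha>s)"

text \<open>Bilinear extension; the result does not depend on the decompositions chosen.\<close>

definition algebraic_schouten ::
    "'s vec set \<Rightarrow> ('s vec \<Rightarrow> 's vec \<Rightarrow> 's vec) \<Rightarrow>
     nat \<Rightarrow> 's multivec \<Rightarrow> nat \<Rightarrow> 's multivec \<Rightarrow> 's multivec" where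
  "algebraic_schouten V br k P l Q =
     (let Xs = (SOME Xs. is_decomposition k V P Xs); Ys = (SOME Ys. is_decomposition l V Q Ys)
      in (\<lambda>\<alpha>s. \<Sum>xs\<leftarrow>Xs. \<Sum>ys\<leftarrow>Ys. decomposable_schouten V br xs ys \<alpha>s))"


section \<open>Tangent and cotangent spaces\<close>

text \<open>A tangent vector is the operator \<open>f \<mapsto> (f \<circ> \<gamma>)'(0)\<close> of a smooth curve \<open>\<gamma>\<close>, where \<open>f\<close> is smooth
  near \<open>\<gamma> 0\<close> (elsewhere the value is set to 0).\<close>

type_synonym 'm tvec = "('m \<Rightarrow> real) vec"
type_synonym 'm covec = "('m \<Rightarrow> real) form"
type_synonym 'm mvec = "('m \<Rightarrow> real) multivec"

definition velocity :: "('m, 'a::real_normed_vector) atlas \<Rightarrow> (real \<Rightarrow> 'm) \<Rightarrow> 'm tvec" where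
  "velocity A \<gamma> = (\<lambda>f. if smooth_near A (\<gamma> 0) f then deriv (f \<circ> \<gamma>) 0 else 0)"

definition tangent_space :: "('m, 'a::real_normed_vector) atlas \<Rightarrow> 'm \<Rightarrow> 'm tvec set" where
  "tangent_space A x =
     {velocity A \<gamma> | \<gamma> e. e > 0 \<and> smooth_map {({- e<..<e}, \<lambda>t::real. t)} A \<gamma> \<and> \<gamma> 0 = x}"

abbreviation cotangent_space :: "('m, 'a::real_normed_vector) atlas \<Rightarrow> 'm \<Rightarrow> 'm covec set" where
  "cotangent_space A x \<equiv> dual_space (tangent_space A x)"

definition fun_differential ::
    "('m, 'a::real_normed_vector) atlas \<Rightarrow> 'm \<Rightarrow> ('m \<Rightarrow> real) \<Rightarrow> 'm covec" where
  "fun_differential A x f = (\<lambda>v. if v \<in> tangent_space A x then v f else 0)"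

definition push_tvec ::
    "('n, 'b::real_normed_vector) atlas \<Rightarrow> ('m \<Rightarrow> 'n) \<Rightarrow> 'm \<Rightarrow> 'm tvec \<Rightarrow> 'n tvec" where
  "push_tvec B F x v = (\<lambda>h. if smooth_near B (F x) h then v (h \<circ> F) else 0)"

definition pull_covec ::
    "('m, 'a::real_normed_vector) atlas \<Rightarrow> ('n, 'b::real_normed_vector) atlas \<Rightarrow>
     ('m \<Rightarrow> 'n) \<Rightarrow> 'm \<Rightarrow> 'n covec \<Rightarrow> 'm covec" where
  "pull_covec A B F x \<alpha> = (\<lambda>v. if v \<in> tangent_space A x then \<alpha> (push_tvec B F x v) else 0)"

definition push_mvec ::
    "('m, 'a::real_normed_vector) atlas \<Rightarrow> ('n, 'b::real_normed_vector) atlas \<Rightarrow>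
     ('m \<Rightarrow> 'n) \<Rightarrow> 'm \<Rightarrow> 'm mvec \<Rightarrow> 'n mvec" where
  "push_mvec A B F x w =
     (\<lambda>\<alpha>s. if set \<alpha>s \<subseteq> cotangent_space B (F x) then w (map (pull_covec A B F x) \<alpha>s) else 0)"


section \<open>Multivector fields\<close>

definition mvec_apply ::
    "('m, 'a::real_normed_vector) atlas \<Rightarrow> ('m \<Rightarrow> 'm mvec) \<Rightarrow> ('m \<Rightarrow> real) list \<Rightarrow> 'm \<Rightarrow> real" where
  "mvec_apply A P fs = (\<lambda>x. P x (map (fun_differential A x) fs))"

definition multivector_field ::
    "('m, 'a::real_normed_vector) atlas \<Rightarrow> nat \<Rightarrow> ('m \<Rightarrow> 'm mvec) \<Rightarrow> bool" where
  "multivector_field A k P \<longleftrightarrow>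
     (\<forall>x\<in>points A. P x \<in> exterior_power k (tangent_space A x)) \<and>
     (\<forall>W fs. length fs = k \<and> openin (atlas_topology A) W \<and> (\<forall>f\<in>set fs. smooth_fun_on A W f) \<longrightarrow>
        smooth_fun_on A W (mvec_apply A P fs))"

definition related_mvec_fields ::
    "('m, 'a::real_normed_vector) atlas \<Rightarrow> ('n, 'b::real_normed_vector) atlas \<Rightarrow>
     ('m \<Rightarrow> 'n) \<Rightarrow> ('m \<Rightarrow> 'm mvec) \<Rightarrow> ('n \<Rightarrow> 'n mvec) \<Rightarrow> bool" where
  "related_mvec_fields A B F P Q \<longleftrightarrow> (\<forall>x\<in>points A. push_mvec A B F x (P x) = Q (F x))"

text \<open>
  Schouten bracket of a \<open>p\<close>- and a \<open>q\<close>-vector field, viewed as multiderivations of smooth functions: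
  \<open>[P, Q] = P \<circ> Q - (-1)^((p-1)(q-1)) Q \<circ> P\<close>, where \<open>(P \<circ> Q)(f\<^sub>0, ..., f\<^sub>n)\<close> (with \<open>n + 2 = p + q\<close>)
  is the signed sum over all \<open>(q, p-1)\<close>-shuffles \<open>\<sigma>\<close> of
  \<open>P(Q(f\<^sub>\<sigma>\<^sub>(\<^sub>0\<^sub>), ..., f\<^sub>\<sigma>\<^sub>(\<^sub>q\<^sub>-\<^sub>1\<^sub>)), f\<^sub>\<sigma>\<^sub>(\<^sub>q\<^sub>), ..., f\<^sub>\<sigma>\<^sub>(\<^sub>n\<^sub>))\<close>.
  It is the extension of the Lie bracket of vector fields as a graded biderivation, with the sign
  convention used above for the algebraic bracket. Being a multiderivation, its value at \<open>x\<close> on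
  covectors does not depend on the functions chosen to represent them.
\<close>

definition shuffle_perms :: "nat \<Rightarrow> nat \<Rightarrow> (nat \<Rightarrow> nat) set" where
  "shuffle_perms m n =
     {\<sigma>. \<sigma> permutes {..<m + n} \<and> strict_mono_on {..<m} \<sigma> \<and> strict_mono_on {m..<m + n} \<sigma>}"

definition insertion_product ::
    "('m, 'a::real_normed_vector) atlas \<Rightarrow> nat \<Rightarrow> ('m \<Rightarrow> 'm mvec) \<Rightarrow> nat \<Rightarrow> ('m \<Rightarrow> 'm mvec) \<Rightarrow>
     ('m \<Rightarrow> real) list \<Rightarrow> 'm \<Rightarrow> real" where
  "insertion_product A p P q Q fs =
     (if p = 0 then (\<lambda>x. 0)
      else (\<lambda>x. \<Sum>\<sigma>\<in>shuffle_perms q (p - 1). of_int (sign \<sigma>) *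
        mvec_apply A P
          (mvec_apply A Q (map (\<lambda>i. fs ! \<sigma> i) [0..<q]) # map (\<lambda>i. fs ! \<sigma> i) [q..<q + (p - 1)]) x))"

definition schouten ::
    "('m, 'a::real_normed_vector) atlas \<Rightarrow> nat \<Rightarrow> ('m \<Rightarrow> 'm mvec) \<Rightarrow> nat \<Rightarrow> ('m \<Rightarrow> 'm mvec) \<Rightarrow>
     'm \<Rightarrow> 'm mvec" where
  "schouten A p P q Q = (\<lambda>x \<alpha>s.
     if \<alpha>s \<in> form_lists (p + q - 1) (tangent_space A x)
     then let fs = map (\<lambda>\<alpha>. SOME f. smooth_near A x f \<and> fun_differential A x f = \<alpha>) \<alpha>s in
            insertion_product A p P q Q fs x
            - (- 1) ^ ((p - 1) * (q - 1)) * insertion_product A q Q p P fs x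
     else 0)"

definition poisson_bivector_field ::
    "('m, 'a::real_normed_vector) atlas \<Rightarrow> ('m \<Rightarrow> 'm mvec) \<Rightarrow> bool" where
  "poisson_bivector_field A \<pi> \<longleftrightarrow>
     multivector_field A 2 \<pi> \<and> (\<forall>x\<in>points A. schouten A 2 \<pi> 2 \<pi> x = (\<lambda>\<alpha>s. 0))"

definition nondegenerate_at ::
    "('m, 'a::real_normed_vector) atlas \<Rightarrow> ('m \<Rightarrow> 'm mvec) \<Rightarrow> 'm \<Rightarrow> bool" where
  "nondegenerate_at A \<pi> x \<longleftrightarrow>
     (\<forall>\<alpha>\<in>cotangent_space A x. (\<forall>\<beta>\<in>cotangent_space A x. \<pi> x [\<alpha>, \<beta>] = 0) \<longrightarrow> \<alpha> = (\<lambda>v. 0))"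


section \<open>Lie groups and smooth actions\<close>

definition lie_group ::
    "('g, 'z) monoid_scheme \<Rightarrow> ('g, 'b::finite_dim_inner) atlas \<Rightarrow> bool" where
  "lie_group G L \<longleftrightarrow>
     group G \<and> smooth_manifold L \<and> points L = carrier G \<and>
     smooth_map (product_atlas L L) L (\<lambda>(g, h). g \<otimes>\<^bsub>G\<^esub> h) \<and> smooth_map L L (\<lambda>g. inv\<^bsub>G\<^esub> g)"

abbreviation lie_algebra ::
    "('g, 'z) monoid_scheme \<Rightarrow> ('g, 'b::real_normed_vector) atlas \<Rightarrow> 'g tvec set" where
  "lie_algebra G L \<equiv> tangent_space L \<one>\<^bsub>G\<^esub>"

definition left_invariant_field ::
    "('g, 'z) monoid_scheme \<Rightarrow> ('g, 'b::real_normed_vector) atlas \<Rightarrow> 'g tvec \<Rightarrow> 'g \<Rightarrow> 'g tvec" where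
  "left_invariant_field G L X = (\<lambda>g. push_tvec L (\<lambda>h. g \<otimes>\<^bsub>G\<^esub> h) \<one>\<^bsub>G\<^esub> X)"

definition field_bracket ::
    "('m, 'a::real_normed_vector) atlas \<Rightarrow> ('m \<Rightarrow> 'm tvec) \<Rightarrow> ('m \<Rightarrow> 'm tvec) \<Rightarrow> 'm \<Rightarrow> 'm tvec" where
  "field_bracket A X Y = (\<lambda>x f.
     if smooth_near A x f then X x (\<lambda>y. Y y f) - Y x (\<lambda>y. X y f) else 0)"

definition lie_bracket ::
    "('g, 'z) monoid_scheme \<Rightarrow> ('g, 'b::real_normed_vector) atlas \<Rightarrow>
     'g tvec \<Rightarrow> 'g tvec \<Rightarrow> 'g tvec" where
  "lie_bracket G L X Y =
     field_bracket L (left_invariant_field G L X) (left_invariant_field G L Y) \<one>\<^bsub>G\<^esub>"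

abbreviation lie_schouten ::
    "('g, 'z) monoid_scheme \<Rightarrow> ('g, 'b::real_normed_vector) atlas \<Rightarrow>
     nat \<Rightarrow> 'g mvec \<Rightarrow> nat \<Rightarrow> 'g mvec \<Rightarrow> 'g mvec" where
  "lie_schouten G L \<equiv> algebraic_schouten (lie_algebra G L) (lie_bracket G L)"

definition smooth_action ::
    "('g, 'z) monoid_scheme \<Rightarrow> ('g, 'b::real_normed_vector) atlas \<Rightarrow>
     ('m, 'a::real_normed_vector) atlas \<Rightarrow> ('g \<Rightarrow> 'm \<Rightarrow> 'm) \<Rightarrow> bool" where
  "smooth_action G L A act \<longleftrightarrow>
     group_action G (points A) act \<and> smooth_map (product_atlas L A) A (\<lambda>(g, x). act g x)"

definition induced_mvec_field ::
    "('g, 'z) monoid_scheme \<Rightarrow> ('g, 'b::real_normed_vector) atlas \<Rightarrow>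
     ('m, 'a::real_normed_vector) atlas \<Rightarrow> ('g \<Rightarrow> 'm \<Rightarrow> 'm) \<Rightarrow> 'g mvec \<Rightarrow> 'm \<Rightarrow> 'm mvec" where
  "induced_mvec_field G L A act w = (\<lambda>x. push_mvec L A (\<lambda>g. act g x) \<one>\<^bsub>G\<^esub> w)"


section \<open>The cotangent bundle\<close>

definition cotangent_points :: "('m, 'a::real_normed_vector) atlas \<Rightarrow> ('m \<times> 'm covec) set" where
  "cotangent_points A = (SIGMA x:points A. cotangent_space A x)"

abbreviation cotangent_projection :: "'m \<times> 'm covec \<Rightarrow> 'm" where
  "cotangent_projection \<equiv> fst"

definition coordinate_vector ::
    "('m, 'a::real_normed_vector) atlas \<Rightarrow> ('m, 'a) chart \<Rightarrow> 'm \<Rightarrow> 'a \<Rightarrow> 'm tvec" where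
  "coordinate_vector A c x u = (\<lambda>f.
     if smooth_near A x f
     then frechet_derivative (f \<circ> inv_into (fst c) (snd c)) (at (snd c x)) u else 0)"

text \<open>The coordinates \<open>(q, p)\<close> of a covector \<open>\<alpha>\<close> at \<open>x\<close>: \<open>q = \<phi> x\<close> and the components of \<open>p\<close> are
  the values of \<open>\<alpha>\<close> on the coordinate vectors of \<open>\<phi>\<close>.\<close>

definition cotangent_chart ::
    "('m, 'a::finite_dim_inner) atlas \<Rightarrow> ('m, 'a) chart \<Rightarrow> ('m \<times> 'm covec, 'a \<times> 'a) chart" where
  "cotangent_chart A c =
     ((SIGMA x:fst c. cotangent_space A x),
      (\<lambda>(x, \<alpha>). (snd c x, \<Sum>b\<in>onb. \<alpha> (coordinate_vector A c x b) *\<^sub>R b)))"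

definition cotangent_atlas ::
    "('m, 'a::finite_dim_inner) atlas \<Rightarrow> ('m \<times> 'm covec, 'a \<times> 'a) atlas" where
  "cotangent_atlas A = cotangent_chart A ` A"

definition zero_section :: "('m, 'a) atlas \<Rightarrow> ('m \<times> 'm covec) set" where
  "zero_section A = {(x, \<lambda>v. 0) | x. x \<in> points A}"

text \<open>The sum of \<open>\<partial>/\<partial>q\<^sub>b \<and> \<partial>/\<partial>p\<^sub>b\<close> over the coordinates \<open>b\<close>, so that \<open>{q\<^sub>b, p\<^sub>b} = 1\<close>; it does not
  depend on the chart of \<open>M\<close> that is chosen around the base point.\<close>

definition canonical_poisson ::
    "('m, 'a::finite_dim_inner) atlas \<Rightarrow> 'm \<times> 'm covec \<Rightarrow> ('m \<times> 'm covec) mvec" where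
  "canonical_poisson A z =
     (let T = cotangent_atlas A;
          c = cotangent_chart A (SOME c. c \<in> A \<and> fst z \<in> fst c)
      in (\<lambda>\<beta>s. \<Sum>b\<in>onb. wedge (tangent_space T z)
            [coordinate_vector T c z (b, 0), coordinate_vector T c z (0, b)] \<beta>s))"

text \<open>The lifted action maps a covector \<open>\<alpha>\<close> at \<open>x\<close> to its pull-back to \<open>g x\<close> along the action
  of the inverse of \<open>g\<close>.\<close>

definition lifted_action ::
    "('g, 'z) monoid_scheme \<Rightarrow> ('m, 'a::real_normed_vector) atlas \<Rightarrow> ('g \<Rightarrow> 'm \<Rightarrow> 'm) \<Rightarrow>
     'g \<Rightarrow> 'm \<times> 'm covec \<Rightarrow> 'm \<times> 'm covec" where
  "lifted_action G A act g =
     (\<lambda>(x, \<alpha>)\<in>cotangent_points A. (act g x, pull_covec A A (act (inv\<^bsub>G\<^esub> g)) (act g x) \<alpha>))"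

end

theory Submission
  imports Defs
begin

text \<open>
  Write \<open>r = \<Sum> c\<^sub>i\<^sub>j e\<^sub>i \<otimes> e\<^sub>j\<close> with \<open>c\<close> antisymmetric. On any \<open>G\<close>-manifold the bracket of functions is then
  \<open>{f, g} = \<Sum> c\<^sub>i\<^sub>j (E\<^sub>i f) (E\<^sub>j g)\<close> with the fundamental fields \<open>E\<^sub>i\<close>. In the Jacobiator the second-order
  terms combine to commutators, and since \<open>[E\<^sub>X, E\<^sub>Y] = - E\<^bsub>[X, Y]\<^esub>\<close>, what is left is a multiple of \<open>[r, r]\<close>
  evaluated on the pulled-back differentials. This applies to \<open>M\<close> and to \<open>T\<^sup>*M\<close>.

  Cotangent lifts of diffeomorphisms are symplectic, so \<open>\<pi>\<^sub>0\<close> does not depend on the chart and is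
  invariant under the lifted action. Differentiating the invariance along \<open>G\<close> shows that the \<open>E\<^sub>i\<close> are
  derivations of the canonical bracket, whence the mixed terms in the Jacobiator of \<open>r + \<pi>\<^sub>0\<close> cancel.
  The projection sends \<open>\<pi>\<^sub>0\<close> to 0 because the vectors \<open>\<partial>/\<partial>p\<close> are vertical. On the zero section the
  lifted fundamental fields have no momentum component; there \<open>r + \<pi>\<^sub>0\<close> has the block form
  \<open>((R, 1), (- 1, 0))\<close>, which is invertible, and invertibility is an open condition.
\<close>

section \<open>Differential calculus\<close>

text \<open>Analytically everything rests on the symmetry of second derivatives, used in four forms:
  brackets of vector fields are tangent, coordinate fields commute, the second derivatives of a base
  map drop out of the symplectic form, and derivatives along the two factors of a product atlas
  commute. The last form carries the argument: on \<open>G\<close> times \<open>G\<close> it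
  reverses the order of the two derivatives in the commutator of fundamental fields, which is where
  their minus sign comes from, and on \<open>G\<close> times the cotangent bundle it moves a
  derivative along \<open>G\<close> past those in the canonical bracket.

  Two definitions hide a choice. \<open>algebraic_schouten\<close> picks a decomposition of
  \<open>r\<close>; the proof computes with exactly that one and never compares decompositions.
  \<open>canonical_poisson\<close> picks a chart at each point; chart independence is obtained as
  invariance under the lift of the unit element, so one computation serves both.

  Nondegeneracy is quantitative: a matrix that vanishes on the zero section has norm less than 1
  nearby, so 1 is not an eigenvalue there.\<close>

lemma onb_expand:
  fixes x :: "'a::finite_dim_inner"
  shows "(\<Sum>b\<in>onb. inner x b *\<^sub>R b) = x"
proof -
  have "x - (\<Sum>b\<in>onb. inner x b *\<^sub>R b) = 0"
  proof (rule onb_all_zero)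
    fix u :: 'a assume u: "u \<in> onb"
    have "inner (\<Sum>b\<in>onb. inner x b *\<^sub>R b) u = (\<Sum>b\<in>onb. if b = u then inner x b else 0)"
      unfolding inner_sum_left by (rule sum.cong) (simp_all add: u inner_onb)
    then show "inner (x - (\<Sum>b\<in>onb. inner x b *\<^sub>R b)) u = 0"
      using u by (simp add: inner_diff_left)
  qed
  then show ?thesis by simp
qed

lemma linear_onb_expand:
  fixes f :: "'a::finite_dim_inner \<Rightarrow> 'b::real_vector"
  assumes "linear f"
  shows "f x = (\<Sum>b\<in>onb. inner x b *\<^sub>R f b)"
proof -
  have "f x = f (\<Sum>b\<in>onb. inner x b *\<^sub>R b)" by (simp only: onb_expand)
  also have "\<dots> = (\<Sum>b\<in>onb. inner x b *\<^sub>R f b)"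
    by (simp add: linear_sum[OF assms] linear_cmul[OF assms])
  finally show ?thesis .
qed

abbreviation dd :: "('a::real_normed_vector \<Rightarrow> 'b::real_normed_vector) \<Rightarrow> 'a \<Rightarrow> 'a \<Rightarrow> 'b" where
  "dd f x v \<equiv> frechet_derivative f (at x) v"

lemma frechet_derivative_worksI:
  "f differentiable at x \<Longrightarrow> (f has_derivative frechet_derivative f (at x)) (at x)"
  by (simp add: frechet_derivative_works[symmetric])

lemma dd_eq: "(f has_derivative f') (at x) \<Longrightarrow> dd f x v = f' v"
  using frechet_derivative_at by metis

lemma linear_dd: "f differentiable at x \<Longrightarrow> linear (dd f x)"
  by (rule linear_frechet_derivative)

section \<open>Closure properties of smooth maps between model spaces\<close>

lemma C_diff_subset: "C_diff k S f \<Longrightarrow> T \<subseteq> S \<Longrightarrow> C_diff k T f"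
  by (induction k arbitrary: f) (auto intro: continuous_on_subset)

text \<open>\<open>frechet_derivative\<close> at a point sees a whole neighbourhood; openness of
  \<open>S\<close> lets equality on \<open>S\<close> pass to the derivatives, so that the induction
  continues.\<close>

lemma C_diff_cong:
  assumes "open S" and "\<And>x. x \<in> S \<Longrightarrow> f x = g x" and "C_diff k S f"
  shows "C_diff k S g"
  using assms(2,3)
proof (induction k arbitrary: f g)
  case 0
  then show ?case using continuous_on_cong[of S S f g] by simp
next
  case (Suc k)
  have 1: "g differentiable at x" if "x \<in> S" for x
  proof -
    from Suc.prems that obtain D where "(f has_derivative D) (at x)"
      by (auto simp: differentiable_def)
    then have "(g has_derivative D) (at x)"
      using has_derivative_transform_within_open[of f D x UNIV S g] Suc.prems(1) assms(1) that by blast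
    then show ?thesis by (auto simp: differentiable_def)
  qed
  have 2: "dd f x v = dd g x v" if "x \<in> S" for x v
    using Suc.prems assms(1) that frechet_derivative_transform_within_open[of f x S g] by auto
  show ?case
    using Suc.IH[of "\<lambda>x. dd f x v" "\<lambda>x. dd g x v" for v] 1 2 Suc.prems(2) by auto
qed

lemma C_diff_SucD: "C_diff (Suc k) S f \<Longrightarrow> C_diff k S f"
proof (induction k arbitrary: f)
  case 0
  then show ?case
    by (auto intro!: continuous_at_imp_continuous_on differentiable_imp_continuous_within)
next
  case (Suc k)
  then show ?case by (auto simp del: C_diff.simps(1))
qed

text \<open>Lets an induction on \<open>k\<close> name the derivative by its product or chain rule
  formula instead of by \<open>frechet_derivative\<close>; closure under sums, products and
  composition goes through it.\<close>

lemma C_diff_SucI: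
  assumes "open S" and "\<And>x. x \<in> S \<Longrightarrow> (f has_derivative f' x) (at x)"
    and "\<And>v. C_diff k S (\<lambda>x. f' x v)"
  shows "C_diff (Suc k) S f"
proof -
  have "C_diff k S (\<lambda>x. dd f x v)" for v
    by (rule C_diff_cong[OF assms(1) _ assms(3)[of v]]) (simp add: dd_eq[OF assms(2)])
  then show ?thesis using assms(2) by (auto simp: differentiable_def)
qed

lemma C_diff_local:
  assumes "\<And>x. x \<in> S \<Longrightarrow> \<exists>T. open T \<and> x \<in> T \<and> C_diff k T f"
  shows "C_diff k S f"
  using assms
proof (induction k arbitrary: f)
  case 0
  show ?case unfolding C_diff.simps
  proof (rule continuous_at_imp_continuous_on, rule ballI)
    fix x assume "x \<in> S"
    from 0[OF this] show "isCont f x" by (auto simp: continuous_on_eq_continuous_at)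
  qed
next
  case (Suc k)
  have "C_diff k S (\<lambda>x. dd f x v)" for v
  proof (rule Suc.IH)
    fix x assume "x \<in> S"
    from Suc.prems[OF this] show "\<exists>T. open T \<and> x \<in> T \<and> C_diff k T (\<lambda>x. dd f x v)" by auto
  qed
  moreover have "f differentiable at x" if "x \<in> S" for x
    using Suc.prems[OF that] by auto
  ultimately show ?case by simp
qed

lemma C_diff_const: "C_diff k S (\<lambda>x. c)"
  by (induction k arbitrary: c) (simp_all add: frechet_derivative_const)

lemma C_diff_bounded_linear: "bounded_linear f \<Longrightarrow> C_diff k S f"
proof (induction k)
  case 0
  then show ?case using bounded_linear.linear linear_continuous_on by auto
next
  case (Suc k)
  have "dd f x v = f v" for x v
    by (rule dd_eq, rule bounded_linear_imp_has_derivative, rule Suc.prems)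
  then show ?case
    using Suc.prems by (auto simp: C_diff_const differentiable_def intro: bounded_linear_imp_has_derivative)
qed

lemma C_diff_linear_compose:
  assumes "open S" "bounded_linear h" "C_diff k S f"
  shows "C_diff k S (\<lambda>x. h (f x))"
  using assms(3)
proof (induction k arbitrary: f)
  case 0
  then show ?case using assms(2) by (simp add: bounded_linear.continuous_on)
next
  case (Suc k)
  show ?case
  proof (rule C_diff_SucI[OF assms(1)])
    show "((\<lambda>x. h (f x)) has_derivative (\<lambda>v. h (dd f x v))) (at x)" if "x \<in> S" for x
      using Suc.prems that
      by (intro bounded_linear.has_derivative[OF assms(2)]) (simp add: frechet_derivative_worksI)
    show "C_diff k S (\<lambda>x. h (dd f x v))" for v using Suc by simp
  qed
qed

lemma C_diff_add:
  assumes "open S" "C_diff k S f" "C_diff k S g"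
  shows "C_diff k S (\<lambda>x. f x + g x)"
  using assms(2,3)
proof (induction k arbitrary: f g)
  case 0
  then show ?case by (simp add: continuous_on_add)
next
  case (Suc k)
  show ?case
  proof (rule C_diff_SucI[OF assms(1)])
    show "((\<lambda>x. f x + g x) has_derivative (\<lambda>v. dd f x v + dd g x v)) (at x)" if "x \<in> S" for x
      using Suc.prems that by (intro has_derivative_add) (simp_all add: frechet_derivative_worksI)
    show "C_diff k S (\<lambda>x. dd f x v + dd g x v)" for v using Suc by simp
  qed
qed

lemma C_diff_sum:
  assumes "open S" "\<And>i. i \<in> I \<Longrightarrow> C_diff k S (f i)"
  shows "C_diff k S (\<lambda>x. \<Sum>i\<in>I. f i x)"
  using assms(2)
  by (induction I rule: infinite_finite_induct) (simp_all add: C_diff_const C_diff_add[OF assms(1)])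

lemma C_diff_bilinear:
  assumes "open S" "bounded_bilinear h" "C_diff k S f" "C_diff k S g"
  shows "C_diff k S (\<lambda>x. h (f x) (g x))"
  using assms(3,4)
proof (induction k arbitrary: f g)
  case 0
  then show ?case using assms(2) by (simp add: bounded_bilinear.continuous_on)
next
  case (Suc k)
  show ?case
  proof (rule C_diff_SucI[OF assms(1)])
    show "((\<lambda>x. h (f x) (g x)) has_derivative (\<lambda>v. h (f x) (dd g x v) + h (dd f x v) (g x))) (at x)"
      if "x \<in> S" for x
      using Suc.prems that
      by (intro bounded_bilinear.FDERIV[OF assms(2)]) (simp_all add: frechet_derivative_worksI)
    show "C_diff k S (\<lambda>x. h (f x) (dd g x v) + h (dd f x v) (g x))" for v
      using Suc C_diff_SucD[OF Suc.prems(1)] C_diff_SucD[OF Suc.prems(2)]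
      by (intro C_diff_add[OF assms(1)]) simp_all
  qed
qed

text \<open>The chain rule produces \<open>dd g (f x) (dd f x v)\<close>, whose direction moves with
  \<open>x\<close>, while \<open>C_diff\<close> speaks of fixed directions. Expanding the direction
  in \<open>onb\<close> leaves products of a scalar function with \<open>dd g (f x) b\<close> for
  fixed \<open>b\<close>, to which the induction hypothesis applies. This is why the middle space is
  of class \<open>finite_dim_inner\<close>.\<close>

lemma C_diff_compose:
  fixes f :: "'a::real_normed_vector \<Rightarrow> 'b::finite_dim_inner"
  assumes "open S" "f ` S \<subseteq> T" "C_diff k S f" "C_diff k T g"
  shows "C_diff k S (\<lambda>x. g (f x))"
  using assms(3,4)
proof (induction k arbitrary: g)
  case 0
  then show ?case using assms(2) continuous_on_compose2 by (auto simp: image_subset_iff)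
next
  case (Suc k)
  have f: "(f has_derivative dd f x) (at x)" if "x \<in> S" for x
    using Suc.prems that by (simp add: frechet_derivative_worksI)
  have g: "(g has_derivative dd g (f x)) (at (f x))" if "x \<in> S" for x
    using Suc.prems that assms(2) by (auto simp: frechet_derivative_worksI)
  show ?case
  proof (rule C_diff_SucI[OF assms(1)])
    show "((\<lambda>x. g (f x)) has_derivative (\<lambda>v. \<Sum>b\<in>onb. inner (dd f x v) b *\<^sub>R dd g (f x) b)) (at x)"
      if "x \<in> S" for x
    proof -
      have "((\<lambda>x. g (f x)) has_derivative (\<lambda>v. dd g (f x) (dd f x v))) (at x)"
        using has_derivative_compose[OF f g] that by simp
      moreover have eq: "(\<lambda>v. dd g (f x) (dd f x v)) = (\<lambda>v. \<Sum>b\<in>onb. inner (dd f x v) b *\<^sub>R dd g (f x) b)"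
        by (rule ext, rule linear_onb_expand[OF has_derivative_linear[OF g[OF that]]])
      ultimately show ?thesis by (rule back_subst)
    qed
    fix v
    show "C_diff k S (\<lambda>x. \<Sum>b\<in>onb. inner (dd f x v) b *\<^sub>R dd g (f x) b)"
    proof (rule C_diff_sum[OF assms(1)])
      fix b :: 'b
      have "C_diff k S (\<lambda>x. inner (dd f x v) b)"
        using Suc.prems by (intro C_diff_bilinear[OF assms(1) bounded_bilinear_inner] C_diff_const) simp
      moreover have "C_diff k S (\<lambda>x. dd g (f x) b)"
        by (rule Suc.IH[OF C_diff_SucD[OF Suc.prems(1)]]) (use Suc.prems in simp)
      ultimately show "C_diff k S (\<lambda>x. inner (dd f x v) b *\<^sub>R dd g (f x) b)"
        by (intro C_diff_bilinear[OF assms(1) bounded_bilinear_scaleR])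
    qed
  qed
qed

lemma smooth_on_subset: "smooth_on S f \<Longrightarrow> T \<subseteq> S \<Longrightarrow> smooth_on T f"
  unfolding smooth_on_def using C_diff_subset by blast

lemma smooth_on_cong:
  "smooth_on S f \<Longrightarrow> open S \<Longrightarrow> (\<And>x. x \<in> S \<Longrightarrow> f x = g x) \<Longrightarrow> smooth_on S g"
  unfolding smooth_on_def by (intro allI, rule C_diff_cong[where f = f]) auto

lemma smooth_on_local:
  "(\<And>x. x \<in> S \<Longrightarrow> \<exists>T. open T \<and> x \<in> T \<and> smooth_on T f) \<Longrightarrow> smooth_on S f"
  unfolding smooth_on_def by (intro allI, rule C_diff_local) blast

lemma smooth_on_const: "smooth_on S (\<lambda>x. c)"
  unfolding smooth_on_def using C_diff_const by blast

lemma smooth_on_bounded_linear: "bounded_linear f \<Longrightarrow> smooth_on S f"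
  unfolding smooth_on_def using C_diff_bounded_linear by blast

lemma smooth_on_id: "smooth_on S (\<lambda>x. x)"
  by (rule smooth_on_bounded_linear) (rule bounded_linear_ident)

lemma smooth_on_linear_compose:
  "open S \<Longrightarrow> bounded_linear h \<Longrightarrow> smooth_on S f \<Longrightarrow> smooth_on S (\<lambda>x. h (f x))"
  unfolding smooth_on_def by (intro allI, rule C_diff_linear_compose) auto

lemma smooth_on_add:
  "open S \<Longrightarrow> smooth_on S f \<Longrightarrow> smooth_on S g \<Longrightarrow> smooth_on S (\<lambda>x. f x + g x)"
  unfolding smooth_on_def by (intro allI, rule C_diff_add) auto

lemma smooth_on_sum:
  "open S \<Longrightarrow> (\<And>i. i \<in> I \<Longrightarrow> smooth_on S (f i)) \<Longrightarrow> smooth_on S (\<lambda>x. \<Sum>i\<in>I. f i x)"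
  unfolding smooth_on_def by (intro allI, rule C_diff_sum) auto

lemma smooth_on_bilinear:
  "open S \<Longrightarrow> bounded_bilinear h \<Longrightarrow> smooth_on S f \<Longrightarrow> smooth_on S g \<Longrightarrow> smooth_on S (\<lambda>x. h (f x) (g x))"
  unfolding smooth_on_def by (intro allI, rule C_diff_bilinear) auto

lemmas smooth_on_scaleR = smooth_on_bilinear[OF _ bounded_bilinear_scaleR]
  and smooth_on_inner = smooth_on_bilinear[OF _ bounded_bilinear_inner]

lemma smooth_on_compose:
  fixes f :: "'a::real_normed_vector \<Rightarrow> 'b::finite_dim_inner"
  shows "open S \<Longrightarrow> smooth_on S f \<Longrightarrow> smooth_on T g \<Longrightarrow> f ` S \<subseteq> T \<Longrightarrow> smooth_on S (\<lambda>x. g (f x))"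
  unfolding smooth_on_def using C_diff_compose by blast

lemma smooth_on_Pair:
  assumes "open S" "smooth_on S f" "smooth_on S g"
  shows "smooth_on S (\<lambda>x. (f x, g x))"
proof -
  have "smooth_on S (\<lambda>x. (f x, 0))"
    by (rule smooth_on_linear_compose[OF assms(1) _ assms(2)])
      (rule bounded_linear_Pair[OF bounded_linear_ident bounded_linear_zero])
  moreover have "smooth_on S (\<lambda>x. (0, g x))"
    by (rule smooth_on_linear_compose[OF assms(1) _ assms(3)])
      (rule bounded_linear_Pair[OF bounded_linear_zero bounded_linear_ident])
  ultimately have "smooth_on S (\<lambda>x. (f x, 0) + (0, g x))"
    by (rule smooth_on_add[OF assms(1)])
  then show ?thesis by simp
qed

lemma smooth_on_dd: "smooth_on S f \<Longrightarrow> smooth_on S (\<lambda>x. dd f x v)"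
  unfolding smooth_on_def by (metis C_diff.simps(2))

lemma smooth_on_differentiable: "smooth_on S f \<Longrightarrow> x \<in> S \<Longrightarrow> f differentiable at x"
  unfolding smooth_on_def by (drule spec[of _ "Suc 0"]) simp

lemma smooth_on_has_derivative: "smooth_on S f \<Longrightarrow> x \<in> S \<Longrightarrow> (f has_derivative dd f x) (at x)"
  by (rule frechet_derivative_worksI, rule smooth_on_differentiable)

lemma smooth_on_continuous: "smooth_on S f \<Longrightarrow> continuous_on S f"
  unfolding smooth_on_def by (metis C_diff.simps(1))

text \<open>The moving direction is expanded in \<open>onb\<close>, as in the proof of
  \<open>C_diff_compose\<close>.\<close>

lemma smooth_on_dd_dir:
  fixes f :: "'a::finite_dim_inner \<Rightarrow> 'b::real_normed_vector"
  assumes "open S" "smooth_on S f" "smooth_on S v"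
  shows "smooth_on S (\<lambda>x. dd f x (v x))"
proof (rule smooth_on_cong[OF _ assms(1)])
  show "smooth_on S (\<lambda>x. \<Sum>b\<in>onb. inner (v x) b *\<^sub>R dd f x b)"
    using assms by (intro smooth_on_sum smooth_on_scaleR smooth_on_inner smooth_on_const smooth_on_dd)
  show "(\<Sum>b\<in>onb. inner (v x) b *\<^sub>R dd f x b) = dd f x (v x)" if "x \<in> S" for x
    by (rule linear_onb_expand[OF linear_dd[OF smooth_on_differentiable[OF assms(2) that]], symmetric])
qed

section \<open>Symmetry of second derivatives\<close>

lemma has_real_derivative_line:
  fixes f :: "'a::real_normed_vector \<Rightarrow> real"
  assumes "f differentiable at (y + t *\<^sub>R u)"
  shows "((\<lambda>s. f (y + s *\<^sub>R u)) has_real_derivative dd f (y + t *\<^sub>R u) u) (at t)"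
proof -
  have 1: "(f has_derivative dd f (y + t *\<^sub>R u)) (at (y + t *\<^sub>R u))"
    using assms frechet_derivative_worksI by blast
  have "((\<lambda>s. y + s *\<^sub>R u) has_derivative (\<lambda>s. s *\<^sub>R u)) (at t)"
    by (auto intro!: derivative_eq_intros)
  from has_derivative_compose[OF this 1]
  have "((\<lambda>s. f (y + s *\<^sub>R u)) has_derivative (\<lambda>s. dd f (y + t *\<^sub>R u) (s *\<^sub>R u))) (at t)" .
  moreover have "dd f (y + t *\<^sub>R u) (s *\<^sub>R u) = dd f (y + t *\<^sub>R u) u * s" for s
    using linear_cmul[OF linear_dd[OF assms]] by simp
  ultimately show ?thesis unfolding has_field_derivative_def by (simp add: fun_eq_iff)
qed

text \<open>The second difference is the increment of \<open>?g\<close> over \<open>[0, h]\<close>,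
  and the derivative of \<open>?g\<close> is itself an increment in direction \<open>v\<close>; the
  mean value theorem is applied to each.\<close>

lemma second_difference_mvt:
  fixes f :: "'a::real_normed_vector \<Rightarrow> real"
  assumes "smooth_on S f" "0 < h"
    and "\<And>a b. 0 \<le> a \<Longrightarrow> a \<le> h \<Longrightarrow> 0 \<le> b \<Longrightarrow> b \<le> h \<Longrightarrow> x + a *\<^sub>R u + b *\<^sub>R v \<in> S"
  shows "\<exists>a b. 0 < a \<and> a < h \<and> 0 < b \<and> b < h \<and>
    f (x + h *\<^sub>R u + h *\<^sub>R v) - f (x + h *\<^sub>R v) - f (x + h *\<^sub>R u) + f x =
    h * (h * dd (\<lambda>y. dd f y u) (x + a *\<^sub>R u + b *\<^sub>R v) v)"
proof -
  let ?g = "\<lambda>s. f (x + s *\<^sub>R u + h *\<^sub>R v) - f (x + s *\<^sub>R u)"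
  have d: "((\<lambda>s. f (x + s *\<^sub>R u + b *\<^sub>R v)) has_real_derivative dd f (x + s *\<^sub>R u + b *\<^sub>R v) u) (at s)"
    if "0 \<le> s" "s \<le> h" "0 \<le> b" "b \<le> h" for s b
    using has_real_derivative_line[of f "x + b *\<^sub>R v" s u]
      smooth_on_differentiable[OF assms(1) assms(3)[OF that]] by (simp add: algebra_simps)
  have "\<exists>a. 0 < a \<and> a < h \<and> ?g h - ?g 0 = (h - 0) * (dd f (x + a *\<^sub>R u + h *\<^sub>R v) u - dd f (x + a *\<^sub>R u) u)"
  proof (rule MVT2[OF assms(2)])
    fix s assume s: "0 \<le> s" "s \<le> h"
    show "(?g has_real_derivative dd f (x + s *\<^sub>R u + h *\<^sub>R v) u - dd f (x + s *\<^sub>R u) u) (at s)"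
      using DERIV_diff[OF d[OF s, of h] d[OF s, of 0]] assms(2) by simp
  qed
  then obtain a where a: "0 < a" "a < h"
    "?g h - ?g 0 = h * (dd f (x + a *\<^sub>R u + h *\<^sub>R v) u - dd f (x + a *\<^sub>R u) u)" by auto
  let ?k = "\<lambda>t. dd f (x + a *\<^sub>R u + t *\<^sub>R v) u"
  have "\<exists>b. 0 < b \<and> b < h \<and> ?k h - ?k 0 = (h - 0) * dd (\<lambda>y. dd f y u) (x + a *\<^sub>R u + b *\<^sub>R v) v"
  proof (rule MVT2[OF assms(2)])
    fix t assume t: "0 \<le> t" "t \<le> h"
    show "(?k has_real_derivative dd (\<lambda>y. dd f y u) (x + a *\<^sub>R u + t *\<^sub>R v) v) (at t)"
      using has_real_derivative_line[of "\<lambda>y. dd f y u" "x + a *\<^sub>R u" t v]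
        smooth_on_differentiable[OF smooth_on_dd[OF assms(1)] assms(3)[of a t]] a t by simp
  qed
  then obtain b where b: "0 < b" "b < h"
    "?k h - ?k 0 = h * dd (\<lambda>y. dd f y u) (x + a *\<^sub>R u + b *\<^sub>R v) v" by auto
  have "f (x + h *\<^sub>R u + h *\<^sub>R v) - f (x + h *\<^sub>R v) - f (x + h *\<^sub>R u) + f x = ?g h - ?g 0" by simp
  also have "\<dots> = h * (?k h - ?k 0)" using a(3) by simp
  finally show ?thesis using a(1,2) b by metis
qed

text \<open>Exchanging \<open>u\<close> and \<open>v\<close> does not change the second difference,
  so the two mixed derivatives take a common value at two points of an arbitrarily small
  parallelogram; continuity forces equality at \<open>x\<close>.\<close>

lemma dd_commute_real:
  fixes f :: "'a::real_normed_vector \<Rightarrow> real"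
  assumes "open S" "smooth_on S f" "x \<in> S"
  shows "dd (\<lambda>y. dd f y u) x v = dd (\<lambda>y. dd f y v) x u"
proof (rule ccontr)
  let ?A = "\<lambda>z. dd (\<lambda>y. dd f y u) z v" and ?B = "\<lambda>z. dd (\<lambda>y. dd f y v) z u"
  assume ne: "?A x \<noteq> ?B x"
  \<comment> \<open>Half of the gap: a common value cannot lie within \<open>e\<close> of both
    \<open>?A x\<close> and \<open>?B x\<close>.\<close>
  define e where "e = \<bar>?A x - ?B x\<bar> / 2"
  have e: "e > 0" using ne by (simp add: e_def)
  have cont: "isCont ?A x" "isCont ?B x"
    using assms smooth_on_continuous smooth_on_dd continuous_on_eq_continuous_at by metis+
  obtain d1 where d1: "d1 > 0" "\<And>y. dist y x < d1 \<Longrightarrow> dist (?A y) (?A x) < e"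
    using cont(1) e unfolding continuous_at_eps_delta by metis
  obtain d2 where d2: "d2 > 0" "\<And>y. dist y x < d2 \<Longrightarrow> dist (?B y) (?B x) < e"
    using cont(2) e unfolding continuous_at_eps_delta by metis
  obtain d3 where d3: "d3 > 0" "ball x d3 \<subseteq> S"
    using assms openE by metis
  define d where "d = min d1 (min d2 d3)"
  have d: "d > 0" using d1 d2 d3 by (simp add: d_def)
  \<comment> \<open>Keeps the parallelogram with sides \<open>h *\<^sub>R u\<close> and
    \<open>h *\<^sub>R v\<close> within distance \<open>d\<close> of \<open>x\<close>; the summand 1
    keeps the denominator positive when both vectors are 0.\<close>
  define h where "h = d / (2 * (norm u + norm v + 1))"
  have h: "h > 0" using d by (simp add: h_def add_nonneg_pos)
  have near: "dist (x + a *\<^sub>R u + b *\<^sub>R v) x < d" if "0 \<le> a" "a \<le> h" "0 \<le> b" "b \<le> h" for a b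
  proof -
    have "dist (x + a *\<^sub>R u + b *\<^sub>R v) x = norm (a *\<^sub>R u + b *\<^sub>R v)"
      by (simp add: dist_norm algebra_simps)
    also have "\<dots> \<le> a * norm u + b * norm v"
      using norm_triangle_ineq[of "a *\<^sub>R u" "b *\<^sub>R v"] that by simp
    also have "\<dots> \<le> h * norm u + h * norm v" using that by (intro add_mono mult_right_mono) auto
    also have "\<dots> < h * (2 * (norm u + norm v + 1))"
      using h by (simp add: algebra_simps add_pos_nonneg add_nonneg_pos)
    also have "\<dots> = d" unfolding h_def
      using norm_ge_zero[of u] norm_ge_zero[of v] by (simp add: field_simps add_nonneg_eq_0_iff)
    finally show ?thesis .
  qed
  have inS: "x + a *\<^sub>R u + b *\<^sub>R v \<in> S" if "0 \<le> a" "a \<le> h" "0 \<le> b" "b \<le> h" for a b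
    using near[OF that] d3 by (auto simp: d_def mem_ball dist_commute)
  obtain a b where ab: "0 < a" "a < h" "0 < b" "b < h"
    "f (x + h *\<^sub>R u + h *\<^sub>R v) - f (x + h *\<^sub>R v) - f (x + h *\<^sub>R u) + f x = h * (h * ?A (x + a *\<^sub>R u + b *\<^sub>R v))"
    using second_difference_mvt[OF assms(2) h inS] by blast
  have inS': "x + a *\<^sub>R v + b *\<^sub>R u \<in> S" if "0 \<le> a" "a \<le> h" "0 \<le> b" "b \<le> h" for a b
    using inS[OF that(3,4,1,2)] by (simp add: algebra_simps)
  obtain a' b' where ab': "0 < a'" "a' < h" "0 < b'" "b' < h"
    "f (x + h *\<^sub>R v + h *\<^sub>R u) - f (x + h *\<^sub>R u) - f (x + h *\<^sub>R v) + f x = h * (h * ?B (x + a' *\<^sub>R v + b' *\<^sub>R u))"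
    using second_difference_mvt[OF assms(2) h inS'] by blast
  have "x + h *\<^sub>R v + h *\<^sub>R u = x + h *\<^sub>R u + h *\<^sub>R v" by simp
  then have "h * (h * ?A (x + a *\<^sub>R u + b *\<^sub>R v)) = h * (h * ?B (x + a' *\<^sub>R v + b' *\<^sub>R u))"
    using ab(5) ab'(5) unfolding \<open>x + h *\<^sub>R v + h *\<^sub>R u = x + h *\<^sub>R u + h *\<^sub>R v\<close> by linarith
  then have "?A (x + a *\<^sub>R u + b *\<^sub>R v) = ?B (x + b' *\<^sub>R u + a' *\<^sub>R v)"
    using h by (simp add: algebra_simps)
  moreover have "dist (?A (x + a *\<^sub>R u + b *\<^sub>R v)) (?A x) < e"
    using ab near[of a b] by (intro d1(2)) (simp add: d_def)
  moreover have "dist (?B (x + b' *\<^sub>R u + a' *\<^sub>R v)) (?B x) < e"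
    using ab' near[of b' a'] by (intro d2(2)) (simp add: d_def)
  moreover have False if "a = b" "\<bar>a - A\<bar> < \<bar>A - B\<bar> / 2" "\<bar>b - B\<bar> < \<bar>A - B\<bar> / 2" for a b A B :: real
    using that by (smt (verit) field_sum_of_halves)
  ultimately show False unfolding e_def dist_real_def by metis
qed

lemma dd_inner:
  assumes "f differentiable at x"
  shows "dd (\<lambda>y. inner p (f y)) x v = inner p (dd f x v)"
  by (rule dd_eq) (use assms in \<open>auto intro!: derivative_eq_intros simp: frechet_derivative_worksI\<close>)

text \<open>If differentiability fails, \<open>frechet_derivative\<close> still makes the same
  choice, since \<open>f\<close> and \<open>g\<close> have the same derivatives at
  \<open>x\<close>.\<close>

lemma dd_cong:
  assumes "open S" "x \<in> S" "\<And>y. y \<in> S \<Longrightarrow> f y = g y"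
  shows "dd f x v = dd g x v"
proof (cases "f differentiable at x")
  case True
  then show ?thesis using frechet_derivative_transform_within_open[OF True assms(1,2), of g] assms(3) by simp
next
  case False
  have "(f has_derivative F) (at x) \<longleftrightarrow> (g has_derivative F) (at x)" for F
    using has_derivative_transform_within_open[of f F x UNIV S g]
      has_derivative_transform_within_open[of g F x UNIV S f] assms by auto
  then show ?thesis unfolding frechet_derivative_def by simp
qed

text \<open>Pairing with a vector \<open>p\<close> reduces to real values, since
  \<open>dd_inner\<close> moves the pairing through both derivatives.\<close>

lemma dd_commute:
  fixes f :: "'a::real_normed_vector \<Rightarrow> 'b::real_inner"
  assumes "open S" "smooth_on S f" "x \<in> S"
  shows "dd (\<lambda>y. dd f y u) x v = dd (\<lambda>y. dd f y v) x u"
proof (rule vector_eq_ldot[THEN iffD1], rule allI)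
  fix p :: 'b
  have "inner p (dd (\<lambda>y. dd f y u) x v) = dd (\<lambda>y. dd (\<lambda>z. inner p (f z)) y u) x v" for u v
  proof -
    have "inner p (dd (\<lambda>y. dd f y u) x v) = dd (\<lambda>y. inner p (dd f y u)) x v"
      using dd_inner[OF smooth_on_differentiable[OF smooth_on_dd[OF assms(2)] assms(3)]] by simp
    also have "\<dots> = dd (\<lambda>y. dd (\<lambda>z. inner p (f z)) y u) x v"
      by (rule dd_cong[OF assms(1,3)]) (simp add: dd_inner smooth_on_differentiable[OF assms(2)])
    finally show ?thesis .
  qed
  moreover have "smooth_on S (\<lambda>z. inner p (f z))"
    using assms by (intro smooth_on_inner smooth_on_const)
  ultimately show "inner p (dd (\<lambda>y. dd f y u) x v) = inner p (dd (\<lambda>y. dd f y v) x u)"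
    using dd_commute_real[OF assms(1) _ assms(3)] by simp
qed

lemma dd_compose:
  assumes "f differentiable at x" "g differentiable at (f x)"
  shows "dd (\<lambda>y. g (f y)) x v = dd g (f x) (dd f x v)"
  by (rule dd_eq, rule has_derivative_compose) (use assms in \<open>simp_all add: frechet_derivative_worksI\<close>)

lemma dd_mult:
  fixes f g :: "'a::real_normed_vector \<Rightarrow> real"
  assumes "f differentiable at x" "g differentiable at x"
  shows "dd (\<lambda>y. f y * g y) x v = f x * dd g x v + dd f x v * g x"
  by (rule dd_eq, rule has_derivative_mult) (use assms in \<open>simp_all add: frechet_derivative_worksI\<close>)

lemma dd_lincomb:
  fixes f g :: "'a::real_normed_vector \<Rightarrow> real"
  assumes "f differentiable at x" "g differentiable at x"
  shows "dd (\<lambda>y. a * f y + b * g y) x v = a * dd f x v + b * dd g x v"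
  by (rule dd_eq) (use assms in \<open>auto intro!: derivative_eq_intros simp: frechet_derivative_worksI\<close>)

section \<open>Smooth functions and maps on atlases\<close>

text \<open>The chart conditions of \<open>smooth_manifold\<close>, which pass to product and
  cotangent atlases by a computation in charts.\<close>

definition smooth_atlas :: "('m, 'a::finite_dim_inner) atlas \<Rightarrow> bool" where
  "smooth_atlas A \<longleftrightarrow>
     (\<forall>(U, \<phi>)\<in>A. inj_on \<phi> U) \<and>
     (\<forall>(U, \<phi>)\<in>A. \<forall>(V, \<psi>)\<in>A.
        open (\<phi> ` (U \<inter> V)) \<and> smooth_on (\<phi> ` (U \<inter> V)) (\<psi> \<circ> inv_into U \<phi>))"

lemma smooth_manifold_imp_atlas: "smooth_manifold A \<Longrightarrow> smooth_atlas A"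
  unfolding smooth_manifold_def smooth_atlas_def by blast

lemma chart_inj: "smooth_atlas A \<Longrightarrow> (U, \<phi>) \<in> A \<Longrightarrow> inj_on \<phi> U"
  unfolding smooth_atlas_def by blast

lemma chart_open_Int: "smooth_atlas A \<Longrightarrow> (U, \<phi>) \<in> A \<Longrightarrow> (V, \<psi>) \<in> A \<Longrightarrow> open (\<phi> ` (U \<inter> V))"
  unfolding smooth_atlas_def by blast

lemma chart_transition:
  "smooth_atlas A \<Longrightarrow> (U, \<phi>) \<in> A \<Longrightarrow> (V, \<psi>) \<in> A \<Longrightarrow>
    smooth_on (\<phi> ` (U \<inter> V)) (\<psi> \<circ> inv_into U \<phi>)"
  unfolding smooth_atlas_def by blast

lemma chart_open: "smooth_atlas A \<Longrightarrow> (U, \<phi>) \<in> A \<Longrightarrow> open (\<phi> ` U)"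
  using chart_open_Int[of A U \<phi> U \<phi>] by simp

lemma chart_inv: "smooth_atlas A \<Longrightarrow> (U, \<phi>) \<in> A \<Longrightarrow> x \<in> U \<Longrightarrow> inv_into U \<phi> (\<phi> x) = x"
  using chart_inj inv_into_f_f by metis

lemma chart_points: "(U, \<phi>) \<in> A \<Longrightarrow> U \<subseteq> points A"
  unfolding points_def by force

lemma points_chart:
  assumes "x \<in> points A"
  obtains U \<phi> where "(U, \<phi>) \<in> A" "x \<in> U"
  using assms unfolding points_def by force

text \<open>From left to right by induction on the generation of open sets: injectivity makes chart
  images commute with intersections, and a basic set of another chart is a preimage under a
  continuous transition map. From right to left, each \<open>U \<inter> W\<close> is itself a basic
  set.\<close>

lemma openin_atlas_iff:
  assumes A: "smooth_atlas A"
  shows "openin (atlas_topology A) W \<longleftrightarrow> W \<subseteq> points A \<and> (\<forall>(U, \<phi>)\<in>A. open (\<phi> ` (U \<inter> W)))"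
proof
  let ?B = "{U \<inter> \<phi> -` S | U \<phi> S. (U, \<phi>) \<in> A \<and> open S}"
  assume "openin (atlas_topology A) W"
  then have "generate_topology_on ?B W"
    unfolding atlas_topology_def openin_topology_generated_by_iff .
  then show "W \<subseteq> points A \<and> (\<forall>(U, \<phi>)\<in>A. open (\<phi> ` (U \<inter> W)))"
  proof induction
    case Empty
    then show ?case by auto
  next
    case (Int a b)
    have "open (\<phi> ` (U \<inter> (a \<inter> b)))" if U: "(U, \<phi>) \<in> A" for U \<phi>
    proof -
      have "\<phi> ` (U \<inter> (a \<inter> b)) = \<phi> ` (U \<inter> a) \<inter> \<phi> ` (U \<inter> b)"
        using chart_inj[OF A U] unfolding inj_on_def by blast
      then show ?thesis using Int.IH U by auto
    qed
    then show ?case using Int.IH by auto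
  next
    case (UN K)
    have "open (\<phi> ` (U \<inter> \<Union>K))" if U: "(U, \<phi>) \<in> A" for U \<phi>
    proof -
      have "\<phi> ` (U \<inter> \<Union>K) = (\<Union>k\<in>K. \<phi> ` (U \<inter> k))" by blast
      moreover have "open (\<phi> ` (U \<inter> k))" if "k \<in> K" for k
        using UN.IH[OF that] U by blast
      ultimately show ?thesis by (simp add: open_UN)
    qed
    then show ?case using UN.IH by auto
  next
    case (Basis s)
    then obtain V \<psi> S where s: "s = V \<inter> \<psi> -` S" "(V, \<psi>) \<in> A" "open S" by blast
    have "open (\<phi> ` (U \<inter> s))" if U: "(U, \<phi>) \<in> A" for U \<phi>
    proof -
      have "\<phi> ` (U \<inter> s) = \<phi> ` (U \<inter> V) \<inter> (\<psi> \<circ> inv_into U \<phi>) -` S"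
        using chart_inv[OF A U] by (auto simp: s(1))
      moreover have "open \<dots>"
        using smooth_on_continuous[OF chart_transition[OF A U s(2)]] chart_open_Int[OF A U s(2)] s(3)
        by (rule continuous_open_preimage)
      ultimately show ?thesis by simp
    qed
    then show ?case using s chart_points[OF s(2)] by auto
  qed
next
  assume W: "W \<subseteq> points A \<and> (\<forall>(U, \<phi>)\<in>A. open (\<phi> ` (U \<inter> W)))"
  show "openin (atlas_topology A) W"
  proof (subst openin_subopen, rule ballI)
    fix x assume x: "x \<in> W"
    then have "x \<in> points A" using W by blast
    then obtain U \<phi> where U: "(U, \<phi>) \<in> A" "x \<in> U" by (rule points_chart)
    have "open (\<phi> ` (U \<inter> W))" using W U(1) by blast
    then have "U \<inter> \<phi> -` (\<phi> ` (U \<inter> W)) \<in> {U \<inter> \<phi> -` S | U \<phi> S. (U, \<phi>) \<in> A \<and> open S}"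
      using U(1) by blast
    then have "openin (atlas_topology A) (U \<inter> \<phi> -` (\<phi> ` (U \<inter> W)))"
      unfolding atlas_topology_def by (rule topology_generated_by_Basis)
    moreover have "U \<inter> \<phi> -` (\<phi> ` (U \<inter> W)) = U \<inter> W"
      using chart_inj[OF A U(1)] unfolding inj_on_def by blast
    ultimately show "\<exists>T. openin (atlas_topology A) T \<and> x \<in> T \<and> T \<subseteq> W" using U x by auto
  qed
qed

lemma topspace_atlas: "topspace (atlas_topology A) = points A"
proof -
  have "\<Union>{U \<inter> \<phi> -` S | U \<phi> S. (U, \<phi>) \<in> A \<and> open S} = points A"
  proof
    show "points A \<subseteq> \<Union>{U \<inter> \<phi> -` S | U \<phi> S. (U, \<phi>) \<in> A \<and> open S}"
    proof
      fix x assume "x \<in> points A"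
      then obtain U \<phi> where "(U, \<phi>) \<in> A" "x \<in> U" by (rule points_chart)
      then have "U \<inter> \<phi> -` UNIV \<in> {U \<inter> \<phi> -` S | U \<phi> S. (U, \<phi>) \<in> A \<and> open S}" "x \<in> U \<inter> \<phi> -` UNIV"
        by blast+
      then show "x \<in> \<Union>{U \<inter> \<phi> -` S | U \<phi> S. (U, \<phi>) \<in> A \<and> open S}" by blast
    qed
  qed (auto simp: points_def)
  then show ?thesis unfolding atlas_topology_def by (simp add: topology_generated_by_topspace)
qed

lemma openin_points: "openin (atlas_topology A) (points A)"
  using openin_topspace[of "atlas_topology A"] by (simp add: topspace_atlas)

lemma openin_imp_points: "openin (atlas_topology A) W \<Longrightarrow> W \<subseteq> points A"
  using openin_subset[of "atlas_topology A" W] by (simp add: topspace_atlas)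

lemma openin_image:
  "smooth_atlas A \<Longrightarrow> openin (atlas_topology A) W \<Longrightarrow> (U, \<phi>) \<in> A \<Longrightarrow> open (\<phi> ` (U \<inter> W))"
  using openin_atlas_iff by blast

lemma openin_atlasI:
  assumes "smooth_atlas A" "W \<subseteq> points A" "\<And>U \<phi>. (U, \<phi>) \<in> A \<Longrightarrow> open (\<phi> ` (U \<inter> W))"
  shows "openin (atlas_topology A) W"
  unfolding openin_atlas_iff[OF assms(1)] using assms(2,3) by blast

lemma openin_chart: "smooth_atlas A \<Longrightarrow> (U, \<phi>) \<in> A \<Longrightarrow> openin (atlas_topology A) U"
  by (rule openin_atlasI) (simp_all add: chart_open_Int chart_points)

definition smooth_vec_on ::
    "('m, 'a::real_normed_vector) atlas \<Rightarrow> 'm set \<Rightarrow> ('m \<Rightarrow> 'v::real_normed_vector) \<Rightarrow> bool" where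
  "smooth_vec_on A W f \<longleftrightarrow>
     openin (atlas_topology A) W \<and> (\<forall>(U, \<phi>)\<in>A. smooth_on (\<phi> ` (U \<inter> W)) (f \<circ> inv_into U \<phi>))"

lemma smooth_fun_on_vec: "smooth_fun_on A W f \<longleftrightarrow> smooth_vec_on A W f"
  unfolding smooth_fun_on_def smooth_vec_on_def ..

lemma smooth_vec_on_open: "smooth_vec_on A W f \<Longrightarrow> openin (atlas_topology A) W"
  unfolding smooth_vec_on_def by blast

lemma smooth_vec_onD: "smooth_vec_on A W f \<Longrightarrow> (U, \<phi>) \<in> A \<Longrightarrow> smooth_on (\<phi> ` (U \<inter> W)) (f \<circ> inv_into U \<phi>)"
  unfolding smooth_vec_on_def by blast

lemma smooth_vec_onD':
  "smooth_vec_on A W f \<Longrightarrow> (U, \<phi>) \<in> A \<Longrightarrow> smooth_on (\<phi> ` (U \<inter> W)) (\<lambda>y. f (inv_into U \<phi> y))"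
  using smooth_vec_onD[of A W f U \<phi>] by (simp add: o_def)

lemma smooth_vec_on_charts:
  assumes "openin (atlas_topology A) W"
    and "\<And>U \<phi>. (U, \<phi>) \<in> A \<Longrightarrow> smooth_on (\<phi> ` (U \<inter> W)) (\<lambda>y. f (inv_into U \<phi> y))"
  shows "smooth_vec_on A W f"
  using assms unfolding smooth_vec_on_def o_def by blast

text \<open>One chart near each point is enough: the transition map carries smoothness to every
  other chart.\<close>

lemma smooth_vec_onI:
  assumes A: "smooth_atlas A" and W: "openin (atlas_topology A) W"
    and loc: "\<And>x. x \<in> W \<Longrightarrow> \<exists>U \<phi> S. (U, \<phi>) \<in> A \<and> x \<in> U \<and> open S \<and> \<phi> x \<in> S \<and> smooth_on S (f \<circ> inv_into U \<phi>)"
  shows "smooth_vec_on A W f"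
proof -
  have "smooth_on (\<psi> ` (V \<inter> W)) (f \<circ> inv_into V \<psi>)" if V: "(V, \<psi>) \<in> A" for V \<psi>
  proof (rule smooth_on_local)
    fix y assume "y \<in> \<psi> ` (V \<inter> W)"
    then obtain x where x: "x \<in> V" "x \<in> W" "y = \<psi> x" by blast
    from loc[OF x(2)] obtain U \<phi> S where U: "(U, \<phi>) \<in> A" "x \<in> U" "open S" "\<phi> x \<in> S"
      "smooth_on S (f \<circ> inv_into U \<phi>)" by blast
    define T where "T = \<psi> ` (V \<inter> U) \<inter> (\<phi> \<circ> inv_into V \<psi>) -` S"
    have tr: "smooth_on (\<psi> ` (V \<inter> U)) (\<phi> \<circ> inv_into V \<psi>)" by (rule chart_transition[OF A V U(1)])
    have T: "open T"
      unfolding T_def using smooth_on_continuous[OF tr] chart_open_Int[OF A V U(1)] U(3)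
      by (rule continuous_open_preimage)
    have "smooth_on T (\<lambda>y. (f \<circ> inv_into U \<phi>) ((\<phi> \<circ> inv_into V \<psi>) y))"
      by (rule smooth_on_compose[OF T smooth_on_subset[OF tr] U(5)]) (auto simp: T_def)
    then have "smooth_on T (f \<circ> inv_into V \<psi>)"
      by (rule smooth_on_cong[OF _ T]) (auto simp: T_def chart_inv[OF A V] chart_inv[OF A U(1)])
    moreover have "y \<in> T" using x U by (simp add: T_def chart_inv[OF A V])
    ultimately show "\<exists>T. open T \<and> y \<in> T \<and> smooth_on T (f \<circ> inv_into V \<psi>)" using T by blast
  qed
  then show ?thesis unfolding smooth_vec_on_def using W by blast
qed

lemma smooth_vec_on_subset:
  "smooth_vec_on A W f \<Longrightarrow> openin (atlas_topology A) W' \<Longrightarrow> W' \<subseteq> W \<Longrightarrow> smooth_vec_on A W' f"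
  by (rule smooth_vec_on_charts, assumption, rule smooth_on_subset[OF smooth_vec_onD']) auto

lemma smooth_vec_on_Int:
  "smooth_vec_on A W f \<Longrightarrow> openin (atlas_topology A) W' \<Longrightarrow> smooth_vec_on A (W \<inter> W') f"
  by (rule smooth_vec_on_subset) (auto simp: smooth_vec_on_open)

lemma smooth_vec_on_cong:
  assumes A: "smooth_atlas A" and f: "smooth_vec_on A W f" and "\<And>x. x \<in> W \<Longrightarrow> f x = g x"
  shows "smooth_vec_on A W g"
proof -
  have "smooth_on (\<phi> ` (U \<inter> W)) (g \<circ> inv_into U \<phi>)" if U: "(U, \<phi>) \<in> A" for U \<phi>
    by (rule smooth_on_cong[OF smooth_vec_onD[OF f U] openin_image[OF A smooth_vec_on_open[OF f] U]])
      (auto simp: chart_inv[OF A U] assms(3))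
  then show ?thesis using smooth_vec_on_open[OF f] unfolding smooth_vec_on_def by blast
qed

lemma smooth_vec_on_local:
  assumes A: "smooth_atlas A" and loc: "\<And>x. x \<in> W \<Longrightarrow> \<exists>W'. x \<in> W' \<and> W' \<subseteq> W \<and> smooth_vec_on A W' f"
  shows "smooth_vec_on A W f"
proof (rule smooth_vec_onI[OF A])
  show W: "openin (atlas_topology A) W"
  proof (subst openin_subopen, rule ballI)
    fix x assume "x \<in> W"
    from loc[OF this] obtain W' where "x \<in> W'" "W' \<subseteq> W" "smooth_vec_on A W' f" by blast
    then show "\<exists>T. openin (atlas_topology A) T \<and> x \<in> T \<and> T \<subseteq> W"
      by (intro exI[of _ W'] conjI smooth_vec_on_open)
  qed
  fix x assume "x \<in> W"
  from loc[OF this] obtain W' where W': "x \<in> W'" "W' \<subseteq> W" "smooth_vec_on A W' f" by blast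
  obtain U \<phi> where U: "(U, \<phi>) \<in> A" "x \<in> U"
    using points_chart[OF subsetD[OF openin_imp_points[OF W] subsetD[OF W'(2,1)]]] .
  show "\<exists>U \<phi> S. (U, \<phi>) \<in> A \<and> x \<in> U \<and> open S \<and> \<phi> x \<in> S \<and> smooth_on S (f \<circ> inv_into U \<phi>)"
    using U openin_image[OF A smooth_vec_on_open[OF W'(3)] U(1)] W'(1) smooth_vec_onD[OF W'(3) U(1)]
    by (intro exI[of _ U] exI[of _ \<phi>] exI[of _ "\<phi> ` (U \<inter> W')"] conjI imageI IntI)
qed

lemma smooth_vec_on_chart:
  assumes A: "smooth_atlas A" and U: "(U, \<phi>) \<in> A"
  shows "smooth_vec_on A U \<phi>"
proof (rule smooth_vec_onI[OF A openin_chart[OF A U]])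
  have "smooth_on (\<phi> ` U) (\<phi> \<circ> inv_into U \<phi>)" using chart_transition[OF A U U] by simp
  then show "\<exists>Ua \<phi>' S. (Ua, \<phi>') \<in> A \<and> x \<in> Ua \<and> open S \<and> \<phi>' x \<in> S \<and> smooth_on S (\<phi> \<circ> inv_into Ua \<phi>')"
    if "x \<in> U" for x using U that chart_open[OF A U] by blast
qed

lemma smooth_vec_on_const: "openin (atlas_topology A) W \<Longrightarrow> smooth_vec_on A W (\<lambda>x. c)"
  by (rule smooth_vec_on_charts) (simp_all add: smooth_on_const)

lemma smooth_vec_on_compose:
  fixes f :: "'m \<Rightarrow> 'v::finite_dim_inner"
  assumes A: "smooth_atlas A" and f: "smooth_vec_on A W f" and g: "smooth_on T g" "f ` W \<subseteq> T"
  shows "smooth_vec_on A W (\<lambda>x. g (f x))"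
proof -
  have "smooth_on (\<phi> ` (U \<inter> W)) (\<lambda>y. g ((f \<circ> inv_into U \<phi>) y))" if U: "(U, \<phi>) \<in> A" for U \<phi>
    by (rule smooth_on_compose[OF openin_image[OF A smooth_vec_on_open[OF f] U] smooth_vec_onD[OF f U] g(1)])
      (use g(2) chart_inv[OF A U] in auto)
  then show ?thesis by (intro smooth_vec_on_charts[OF smooth_vec_on_open[OF f]]) (simp add: o_def)
qed

lemma smooth_vec_on_Pair:
  assumes A: "smooth_atlas A" and "smooth_vec_on A W f" "smooth_vec_on A W g"
  shows "smooth_vec_on A W (\<lambda>x. (f x, g x))"
  by (rule smooth_vec_on_charts[OF smooth_vec_on_open[OF assms(2)]], rule smooth_on_Pair)
    (auto intro: smooth_vec_onD'[OF assms(2)] smooth_vec_onD'[OF assms(3)] openin_image[OF A smooth_vec_on_open[OF assms(2)]])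

lemma smooth_vec_on_bilinear:
  assumes A: "smooth_atlas A" and h: "bounded_bilinear h" and fg: "smooth_vec_on A W f" "smooth_vec_on A W g"
  shows "smooth_vec_on A W (\<lambda>x. h (f x) (g x))"
  by (rule smooth_vec_on_charts[OF smooth_vec_on_open[OF fg(1)]], rule smooth_on_bilinear[OF _ h])
    (auto intro: smooth_vec_onD'[OF fg(1)] smooth_vec_onD'[OF fg(2)] openin_image[OF A smooth_vec_on_open[OF fg(1)]])

lemmas smooth_vec_on_mult = smooth_vec_on_bilinear[OF _ bounded_bilinear_mult]
  and smooth_vec_on_scaleR = smooth_vec_on_bilinear[OF _ bounded_bilinear_scaleR]
  and smooth_vec_on_inner = smooth_vec_on_bilinear[OF _ bounded_bilinear_inner]

lemma smooth_vec_on_add: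
  assumes A: "smooth_atlas A" and fg: "smooth_vec_on A W f" "smooth_vec_on A W g"
  shows "smooth_vec_on A W (\<lambda>x. f x + g x)"
  by (rule smooth_vec_on_charts[OF smooth_vec_on_open[OF fg(1)]], rule smooth_on_add)
    (auto intro: smooth_vec_onD'[OF fg(1)] smooth_vec_onD'[OF fg(2)] openin_image[OF A smooth_vec_on_open[OF fg(1)]])

lemma smooth_vec_on_sum:
  assumes A: "smooth_atlas A" and W: "openin (atlas_topology A) W" and f: "\<And>i. i \<in> I \<Longrightarrow> smooth_vec_on A W (f i)"
  shows "smooth_vec_on A W (\<lambda>x. \<Sum>i\<in>I. f i x)"
  by (rule smooth_vec_on_charts[OF W], rule smooth_on_sum) (auto intro: smooth_vec_onD'[OF f] openin_image[OF A W])

lemma smooth_vec_on_cmult: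
  fixes f :: "'m \<Rightarrow> real"
  assumes A: "smooth_atlas A" and f: "smooth_vec_on A W f"
  shows "smooth_vec_on A W (\<lambda>x. c * f x)"
  by (rule smooth_vec_on_mult[OF A smooth_vec_on_const[OF smooth_vec_on_open[OF f]] f])

lemma smooth_vec_on_lincomb:
  fixes f g :: "'m \<Rightarrow> real"
  assumes A: "smooth_atlas A" and "smooth_vec_on A W f" "smooth_vec_on A W g"
  shows "smooth_vec_on A W (\<lambda>x. a * f x + b * g x)"
  by (intro smooth_vec_on_add smooth_vec_on_cmult assms)

lemma smooth_vec_on_diff:
  fixes f g :: "'m \<Rightarrow> real"
  assumes A: "smooth_atlas A" and "smooth_vec_on A W f" "smooth_vec_on A W g"
  shows "smooth_vec_on A W (\<lambda>x. f x - g x)"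
  using smooth_vec_on_lincomb[OF assms, of 1 "-1"] by simp

lemma openin_smooth_vimage:
  assumes A: "smooth_atlas A" and f: "smooth_vec_on A W f" and T: "open T"
  shows "openin (atlas_topology A) (W \<inter> f -` T)"
proof -
  have "open (\<phi> ` (U \<inter> (W \<inter> f -` T)))" if U: "(U, \<phi>) \<in> A" for U \<phi>
  proof -
    have "\<phi> ` (U \<inter> (W \<inter> f -` T)) = \<phi> ` (U \<inter> W) \<inter> (f \<circ> inv_into U \<phi>) -` T"
      using chart_inv[OF A U] by auto
    moreover have "open \<dots>"
      using smooth_on_continuous[OF smooth_vec_onD[OF f U]] openin_image[OF A smooth_vec_on_open[OF f] U] T
      by (rule continuous_open_preimage)
    ultimately show ?thesis by simp
  qed
  then show ?thesis
    using openin_imp_points[OF smooth_vec_on_open[OF f]] by (intro openin_atlasI[OF A]) auto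
qed

text \<open>Continuity is built in: \<open>smooth_vec_on\<close> makes the preimage of every chart
  domain open.\<close>

definition smooth_map_on ::
    "('m, 'a::real_normed_vector) atlas \<Rightarrow> 'm set \<Rightarrow> ('n, 'b::real_normed_vector) atlas \<Rightarrow> ('m \<Rightarrow> 'n) \<Rightarrow> bool" where
  "smooth_map_on A W B F \<longleftrightarrow>
     openin (atlas_topology A) W \<and> F ` W \<subseteq> points B \<and>
     (\<forall>(V, \<psi>)\<in>B. smooth_vec_on A (W \<inter> F -` V) (\<lambda>x. \<psi> (F x)))"

lemma smooth_map_on_open: "smooth_map_on A W B F \<Longrightarrow> openin (atlas_topology A) W"
  unfolding smooth_map_on_def by blast

lemma smooth_map_on_points: "smooth_map_on A W B F \<Longrightarrow> x \<in> W \<Longrightarrow> F x \<in> points B"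
  unfolding smooth_map_on_def by blast

lemma smooth_map_onD:
  "smooth_map_on A W B F \<Longrightarrow> (V, \<psi>) \<in> B \<Longrightarrow> smooth_vec_on A (W \<inter> F -` V) (\<lambda>x. \<psi> (F x))"
  unfolding smooth_map_on_def by blast

lemma smooth_map_imp_on:
  assumes A: "smooth_atlas A" and B: "smooth_atlas B" and F: "smooth_map A B F"
  shows "smooth_map_on A (points A) B F"
proof -
  have c: "continuous_map (atlas_topology A) (atlas_topology B) F"
    and s: "\<And>U \<phi> V \<psi>. (U, \<phi>) \<in> A \<Longrightarrow> (V, \<psi>) \<in> B \<Longrightarrow>
      smooth_on (\<phi> ` (U \<inter> F -` V)) (\<psi> \<circ> F \<circ> inv_into U \<phi>)"
    using F unfolding smooth_map_def by blast+
  have "smooth_vec_on A (points A \<inter> F -` V) (\<lambda>x. \<psi> (F x))" if V: "(V, \<psi>) \<in> B" for V \<psi>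
  proof (rule smooth_vec_on_charts)
    show "openin (atlas_topology A) (points A \<inter> F -` V)"
    proof -
      have "points A \<inter> F -` V = {x \<in> topspace (atlas_topology A). F x \<in> V}"
        by (auto simp: topspace_atlas)
      then show ?thesis using openin_continuous_map_preimage[OF c openin_chart[OF B V]] by simp
    qed
  next
    fix U \<phi> assume U: "(U, \<phi>) \<in> A"
    have "U \<inter> (points A \<inter> F -` V) = U \<inter> F -` V" using chart_points[OF U] by blast
    then show "smooth_on (\<phi> ` (U \<inter> (points A \<inter> F -` V))) (\<lambda>y. \<psi> (F (inv_into U \<phi> y)))"
      using s[OF U V] by (simp add: o_def)
  qed
  then show ?thesis
    unfolding smooth_map_on_def using c openin_points
    by (auto simp: continuous_map_def topspace_atlas)
qed

text \<open>Near \<open>x\<close> the composite is the expression of \<open>f\<close> in a chart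
  around \<open>F x\<close> after the chart representation of \<open>F\<close>, so composition on
  model spaces applies.\<close>

lemma smooth_vec_on_pullback:
  fixes B :: "('n, 'b::finite_dim_inner) atlas"
  assumes A: "smooth_atlas A" and B: "smooth_atlas B"
    and F: "smooth_map_on A W B F" and f: "smooth_vec_on B V f"
  shows "smooth_vec_on A (W \<inter> F -` V) (\<lambda>x. f (F x))"
proof (rule smooth_vec_on_local[OF A])
  fix x assume x: "x \<in> W \<inter> F -` V"
  then have "F x \<in> points B" using openin_imp_points[OF smooth_vec_on_open[OF f]] by blast
  then obtain U \<psi> where U: "(U, \<psi>) \<in> B" "F x \<in> U" by (rule points_chart)
  let ?T = "\<psi> ` (U \<inter> V)" and ?W = "(W \<inter> F -` U) \<inter> (\<lambda>x. \<psi> (F x)) -` (\<psi> ` (U \<inter> V))"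
  have T: "open ?T" by (rule openin_image[OF B smooth_vec_on_open[OF f] U(1)])
  have op: "openin (atlas_topology A) ?W"
    by (rule openin_smooth_vimage[OF A smooth_map_onD[OF F U(1)] T])
  have sub: "?W \<subseteq> W \<inter> F -` V"
    using chart_inj[OF B U(1)] by (auto simp: inj_on_def)
  have "smooth_vec_on A ?W (\<lambda>x. (f \<circ> inv_into U \<psi>) (\<psi> (F x)))"
    by (rule smooth_vec_on_compose[OF A smooth_vec_on_subset[OF smooth_map_onD[OF F U(1)] op] smooth_vec_onD[OF f U(1)]])
      auto
  then have "smooth_vec_on A ?W (\<lambda>x. f (F x))"
    by (rule smooth_vec_on_cong[OF A]) (auto simp: chart_inv[OF B U(1)])
  then show "\<exists>W'. x \<in> W' \<and> W' \<subseteq> W \<inter> F -` V \<and> smooth_vec_on A W' (\<lambda>x. f (F x))"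
    using sub x U by (intro exI[of _ ?W]) auto
qed

lemma smooth_map_on_vimage:
  fixes B :: "('n, 'b::finite_dim_inner) atlas"
  assumes A: "smooth_atlas A" and B: "smooth_atlas B"
    and F: "smooth_map_on A W B F" and V: "openin (atlas_topology B) V"
  shows "openin (atlas_topology A) (W \<inter> F -` V)"
  using smooth_vec_on_open[OF smooth_vec_on_pullback[OF A B F smooth_vec_on_const[OF V, of "0::real"]]] .

lemma smooth_map_on_compose:
  fixes B :: "('n, 'b::finite_dim_inner) atlas"
  assumes A: "smooth_atlas A" and B: "smooth_atlas B"
    and F: "smooth_map_on A W B F" and G: "smooth_map_on B V C G"
  shows "smooth_map_on A (W \<inter> F -` V) C (\<lambda>x. G (F x))"
  unfolding smooth_map_on_def
proof (intro conjI ballI)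
  show "openin (atlas_topology A) (W \<inter> F -` V)"
    by (rule smooth_map_on_vimage[OF A B F smooth_map_on_open[OF G]])
  show "(\<lambda>x. G (F x)) ` (W \<inter> F -` V) \<subseteq> points C" using smooth_map_on_points[OF G] by blast
  fix c assume c: "c \<in> C"
  obtain U \<psi> where U: "c = (U, \<psi>)" by fastforce
  have "W \<inter> F -` V \<inter> (\<lambda>x. G (F x)) -` U = W \<inter> F -` (V \<inter> G -` U)" by auto
  then show "case c of (U, \<psi>) \<Rightarrow> smooth_vec_on A (W \<inter> F -` V \<inter> (\<lambda>x. G (F x)) -` U) (\<lambda>x. \<psi> (G (F x)))"
    using smooth_vec_on_pullback[OF A B F smooth_map_onD[OF G c[unfolded U]]] by (simp add: U)
qed

lemma smooth_map_on_subset: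
  assumes "smooth_map_on A W B F" "openin (atlas_topology A) W'" "W' \<subseteq> W"
  shows "smooth_map_on A W' B F"
proof -
  have "smooth_vec_on A (W' \<inter> F -` V) (\<lambda>x. \<psi> (F x))" if "(V, \<psi>) \<in> B" for V \<psi>
  proof -
    have s: "smooth_vec_on A (W \<inter> F -` V) (\<lambda>x. \<psi> (F x))" using smooth_map_onD[OF assms(1) that] .
    have "W' \<inter> F -` V = W' \<inter> (W \<inter> F -` V)" using assms(3) by auto
    then have "openin (atlas_topology A) (W' \<inter> F -` V)"
      using openin_Int[OF assms(2) smooth_vec_on_open[OF s]] by simp
    then show ?thesis using smooth_vec_on_subset[OF s] assms(3) by blast
  qed
  then show ?thesis using assms unfolding smooth_map_on_def by blast
qed

lemma smooth_map_on_compose_subset: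
  fixes B :: "('n, 'b::finite_dim_inner) atlas"
  assumes A: "smooth_atlas A" and B: "smooth_atlas B"
    and F: "smooth_map_on A W B F" and G: "smooth_map_on B V C G"
    and W': "openin (atlas_topology A) W'" "W' \<subseteq> W" "F ` W' \<subseteq> V"
  shows "smooth_map_on A W' C (\<lambda>x. G (F x))"
  by (rule smooth_map_on_subset[OF smooth_map_on_compose[OF A B F G] W'(1)]) (use W' in auto)

text \<open>One chart around each \<open>F x\<close> suffices: transition maps give both the
  openness of the preimages of other chart domains and smoothness there.\<close>

lemma smooth_map_onI:
  fixes B :: "('n, 'b::finite_dim_inner) atlas"
  assumes A: "smooth_atlas A" and B: "smooth_atlas B" and W: "openin (atlas_topology A) W"
    and loc: "\<And>x. x \<in> W \<Longrightarrow> \<exists>W' V \<psi>. x \<in> W' \<and> (V, \<psi>) \<in> B \<and> F ` W' \<subseteq> V \<and> smooth_vec_on A W' (\<lambda>x. \<psi> (F x))"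
  shows "smooth_map_on A W B F"
  unfolding smooth_map_on_def
proof (intro conjI ballI)
  show "F ` W \<subseteq> points B" using loc chart_points by blast
  fix c assume c: "c \<in> B"
  obtain U \<phi> where U: "c = (U, \<phi>)" by fastforce
  have "smooth_vec_on A (W \<inter> F -` U) (\<lambda>x. \<phi> (F x))"
  proof (rule smooth_vec_on_local[OF A])
    fix x assume x: "x \<in> W \<inter> F -` U"
    then obtain W' V \<psi> where V: "x \<in> W'" "(V, \<psi>) \<in> B" "F ` W' \<subseteq> V" "smooth_vec_on A W' (\<lambda>x. \<psi> (F x))"
      using loc by blast
    let ?T = "\<psi> ` (V \<inter> U)"
    let ?W = "(W' \<inter> (\<lambda>x. \<psi> (F x)) -` ?T) \<inter> W"
    have cU: "(U, \<phi>) \<in> B" using c U by simp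
    have op: "openin (atlas_topology A) ?W"
      by (rule openin_Int[OF openin_smooth_vimage[OF A V(4) chart_open_Int[OF B V(2) cU]] W])
    have sub: "?W \<subseteq> W \<inter> F -` U"
      using chart_inj[OF B V(2)] V(3) by (fastforce simp: inj_on_def)
    have "smooth_vec_on A ?W (\<lambda>x. (\<phi> \<circ> inv_into V \<psi>) (\<psi> (F x)))"
      by (rule smooth_vec_on_compose[OF A smooth_vec_on_subset[OF V(4) op] chart_transition[OF B V(2) cU]]) auto
    then have "smooth_vec_on A ?W (\<lambda>x. \<phi> (F x))"
    proof (rule smooth_vec_on_cong[OF A])
      fix x assume "x \<in> ?W"
      then have "F x \<in> V" using V(3) by blast
      then show "(\<phi> \<circ> inv_into V \<psi>) (\<psi> (F x)) = \<phi> (F x)" by (simp add: chart_inv[OF B V(2)])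
    qed
    moreover have "x \<in> ?W" using x V by auto
    ultimately show "\<exists>W'. x \<in> W' \<and> W' \<subseteq> W \<inter> F -` U \<and> smooth_vec_on A W' (\<lambda>x. \<phi> (F x))"
      using sub by (intro exI[of _ ?W] conjI)
  qed
  then show "case c of (V, \<psi>) \<Rightarrow> smooth_vec_on A (W \<inter> F -` V) (\<lambda>x. \<psi> (F x))" by (simp add: U)
qed (rule W)

lemma smooth_map_on_const:
  "openin (atlas_topology A) W \<Longrightarrow> b \<in> points B \<Longrightarrow> smooth_map_on A W B (\<lambda>x. b)"
  unfolding smooth_map_on_def
  by (auto intro!: smooth_vec_on_const)

lemma smooth_map_on_id:
  assumes A: "smooth_atlas A" and W: "openin (atlas_topology A) W"
  shows "smooth_map_on A W A (\<lambda>x. x)"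
  unfolding smooth_map_on_def
  using W openin_imp_points[OF W] smooth_vec_on_Int[OF smooth_vec_on_chart[OF A] W]
  by (auto simp: Int_commute)

subsection \<open>Product atlases\<close>

lemma product_atlasI: "(U, \<phi>) \<in> A \<Longrightarrow> (V, \<psi>) \<in> B \<Longrightarrow> (U \<times> V, map_prod \<phi> \<psi>) \<in> product_atlas A B"
  unfolding product_atlas_def by blast

lemma points_product: "points (product_atlas A B) = points A \<times> points B"
  unfolding points_def product_atlas_def by force

lemma inv_into_map_prod:
  assumes "inj_on \<phi> U" "inj_on \<psi> V" "s \<in> \<phi> ` U" "t \<in> \<psi> ` V"
  shows "inv_into (U \<times> V) (map_prod \<phi> \<psi>) (s, t) = (inv_into U \<phi> s, inv_into V \<psi> t)"
proof (rule inv_into_f_eq)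
  show "inj_on (map_prod \<phi> \<psi>) (U \<times> V)" using assms(1,2) by (rule map_prod_inj_on)
qed (use assms in \<open>auto simp: inv_into_into f_inv_into_f\<close>)

lemma smooth_atlasI:
  assumes "\<And>U \<phi>. (U, \<phi>) \<in> A \<Longrightarrow> inj_on \<phi> U"
    and "\<And>U \<phi> V \<psi>. (U, \<phi>) \<in> A \<Longrightarrow> (V, \<psi>) \<in> A \<Longrightarrow> open (\<phi> ` (U \<inter> V))"
    and "\<And>U \<phi> V \<psi>. (U, \<phi>) \<in> A \<Longrightarrow> (V, \<psi>) \<in> A \<Longrightarrow>
      smooth_on (\<phi> ` (U \<inter> V)) (\<psi> \<circ> inv_into U \<phi>)"
  shows "smooth_atlas A"
  using assms unfolding smooth_atlas_def by blast

lemma smooth_atlas_product: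
  assumes A: "smooth_atlas A" and B: "smooth_atlas B"
  shows "smooth_atlas (product_atlas A B)"
proof (rule smooth_atlasI)
  fix W \<eta> assume "(W, \<eta>) \<in> product_atlas A B"
  then obtain U \<phi> V \<psi> where c: "W = U \<times> V" "\<eta> = map_prod \<phi> \<psi>" and U: "(U, \<phi>) \<in> A" and V: "(V, \<psi>) \<in> B"
    unfolding product_atlas_def by blast
  show "inj_on \<eta> W"
    unfolding c using map_prod_inj_on[OF chart_inj[OF A U] chart_inj[OF B V]] .
next
  fix W \<eta> W' \<eta>' assume "(W, \<eta>) \<in> product_atlas A B" "(W', \<eta>') \<in> product_atlas A B"
  then obtain U \<phi> V \<psi> U' \<phi>' V' \<psi>' where c: "W = U \<times> V" "\<eta> = map_prod \<phi> \<psi>" "W' = U' \<times> V'" "\<eta>' = map_prod \<phi>' \<psi>'"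
    and U: "(U, \<phi>) \<in> A" "(U', \<phi>') \<in> A" and V: "(V, \<psi>) \<in> B" "(V', \<psi>') \<in> B"
    unfolding product_atlas_def by blast
  have im: "\<eta> ` (W \<inter> W') = \<phi> ` (U \<inter> U') \<times> \<psi> ` (V \<inter> V')"
    unfolding c by (auto simp: Times_Int_Times)
  have op: "open (\<phi> ` (U \<inter> U') \<times> \<psi> ` (V \<inter> V'))"
    using chart_open_Int[OF A U] chart_open_Int[OF B V] by (rule open_Times)
  then show "open (\<eta> ` (W \<inter> W'))" by (simp only: im)
  have "smooth_on (\<phi> ` (U \<inter> U') \<times> \<psi> ` (V \<inter> V'))
    (\<lambda>z. ((\<phi>' \<circ> inv_into U \<phi>) (fst z), (\<psi>' \<circ> inv_into V \<psi>) (snd z)))"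
    by (intro smooth_on_Pair[OF op] smooth_on_compose[OF op _ chart_transition[OF A U]]
        smooth_on_compose[OF op _ chart_transition[OF B V]] smooth_on_bounded_linear bounded_linear_fst bounded_linear_snd)
      auto
  then have "smooth_on (\<phi> ` (U \<inter> U') \<times> \<psi> ` (V \<inter> V')) (map_prod \<phi>' \<psi>' \<circ> inv_into (U \<times> V) (map_prod \<phi> \<psi>))"
    by (rule smooth_on_cong[OF _ op])
      (use chart_inj[OF A U(1)] chart_inj[OF B V(1)] in \<open>auto simp: inv_into_map_prod\<close>)
  then show "smooth_on (\<eta> ` (W \<inter> W')) (\<eta>' \<circ> inv_into W \<eta>)"
    unfolding im by (simp only: c)
qed

lemma openin_Times_atlas:
  assumes A: "smooth_atlas A" and B: "smooth_atlas B"
    and W: "openin (atlas_topology A) W" "openin (atlas_topology B) W'"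
  shows "openin (atlas_topology (product_atlas A B)) (W \<times> W')"
proof -
  have "open (map_prod \<phi> \<psi> ` (U \<times> V \<inter> W \<times> W'))" if "(U, \<phi>) \<in> A" "(V, \<psi>) \<in> B" for U \<phi> V \<psi>
  proof -
    have "map_prod \<phi> \<psi> ` (U \<times> V \<inter> W \<times> W') = \<phi> ` (U \<inter> W) \<times> \<psi> ` (V \<inter> W')" by auto
    then show ?thesis using open_Times[OF openin_image[OF A W(1) that(1)] openin_image[OF B W(2) that(2)]] by simp
  qed
  then show ?thesis
    using openin_imp_points[OF W(1)] openin_imp_points[OF W(2)]
    by (intro openin_atlasI[OF smooth_atlas_product[OF A B]])
      (auto simp: points_product, auto simp: product_atlas_def)
qed

lemma smooth_map_on_fst_snd:
  fixes A :: "('m, 'a::finite_dim_inner) atlas" and B :: "('n, 'b::finite_dim_inner) atlas"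
  assumes A: "smooth_atlas A" and B: "smooth_atlas B"
    and W: "openin (atlas_topology (product_atlas A B)) W"
  shows "smooth_map_on (product_atlas A B) W A fst" "smooth_map_on (product_atlas A B) W B snd"
proof -
  note P = smooth_atlas_product[OF A B]
  have ch: "\<exists>U \<phi> V \<psi>. (U, \<phi>) \<in> A \<and> (V, \<psi>) \<in> B \<and> x \<in> U \<times> V" if "x \<in> W" for x
  proof -
    have p: "fst x \<in> points A" "snd x \<in> points B"
      using openin_imp_points[OF W] that by (auto simp: points_product)
    from p(1) obtain U \<phi> where "(U, \<phi>) \<in> A" "fst x \<in> U" by (rule points_chart)
    moreover from p(2) obtain V \<psi> where "(V, \<psi>) \<in> B" "snd x \<in> V" by (rule points_chart)
    ultimately show ?thesis by (metis mem_Times_iff)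
  qed
  have f: "smooth_vec_on (product_atlas A B) (U \<times> V) (\<lambda>x. \<phi> (fst x))"
    and s: "smooth_vec_on (product_atlas A B) (U \<times> V) (\<lambda>x. \<psi> (snd x))"
    if U: "(U, \<phi>) \<in> A" and V: "(V, \<psi>) \<in> B" for U \<phi> V \<psi>
  proof -
    have m: "smooth_vec_on (product_atlas A B) (U \<times> V) (map_prod \<phi> \<psi>)"
      by (rule smooth_vec_on_chart[OF P product_atlasI[OF U V]])
    have "smooth_vec_on (product_atlas A B) (U \<times> V) (\<lambda>x. fst (map_prod \<phi> \<psi> x))"
      by (rule smooth_vec_on_compose[OF P m smooth_on_bounded_linear[OF bounded_linear_fst, of UNIV]]) auto
    then show "smooth_vec_on (product_atlas A B) (U \<times> V) (\<lambda>x. \<phi> (fst x))" by simp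
    have "smooth_vec_on (product_atlas A B) (U \<times> V) (\<lambda>x. snd (map_prod \<phi> \<psi> x))"
      by (rule smooth_vec_on_compose[OF P m smooth_on_bounded_linear[OF bounded_linear_snd, of UNIV]]) auto
    then show "smooth_vec_on (product_atlas A B) (U \<times> V) (\<lambda>x. \<psi> (snd x))" by simp
  qed
  show "smooth_map_on (product_atlas A B) W A fst"
  proof (rule smooth_map_onI[OF P A W])
    fix x assume "x \<in> W"
    then obtain U \<phi> V \<psi> where c: "(U, \<phi>) \<in> A" "(V, \<psi>) \<in> B" "x \<in> U \<times> V" using ch by blast
    then show "\<exists>W' V \<psi>. x \<in> W' \<and> (V, \<psi>) \<in> A \<and> fst ` W' \<subseteq> V \<and>
        smooth_vec_on (product_atlas A B) W' (\<lambda>x. \<psi> (fst x))"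
      using f[OF c(1,2)] by (intro exI[of _ "U \<times> V"] exI[of _ U] exI[of _ \<phi>]) auto
  qed
  show "smooth_map_on (product_atlas A B) W B snd"
  proof (rule smooth_map_onI[OF P B W])
    fix x assume "x \<in> W"
    then obtain U \<phi> V \<psi> where c: "(U, \<phi>) \<in> A" "(V, \<psi>) \<in> B" "x \<in> U \<times> V" using ch by blast
    then show "\<exists>W' V \<psi>. x \<in> W' \<and> (V, \<psi>) \<in> B \<and> snd ` W' \<subseteq> V \<and>
        smooth_vec_on (product_atlas A B) W' (\<lambda>x. \<psi> (snd x))"
      using s[OF c(1,2)] by (intro exI[of _ "U \<times> V"] exI[of _ V] exI[of _ \<psi>]) auto
  qed
qed

lemma smooth_map_on_Pair:
  fixes A :: "('m, 'a::finite_dim_inner) atlas" and B :: "('n, 'b::finite_dim_inner) atlas"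
  assumes A: "smooth_atlas A" and B: "smooth_atlas B" and C: "smooth_atlas C"
    and F: "smooth_map_on C W A F" and G: "smooth_map_on C W B G"
  shows "smooth_map_on C W (product_atlas A B) (\<lambda>x. (F x, G x))"
proof (rule smooth_map_onI[OF C smooth_atlas_product[OF A B] smooth_map_on_open[OF F]])
  fix x assume x: "x \<in> W"
  obtain U \<phi> V \<psi> where U: "(U, \<phi>) \<in> A" "F x \<in> U" and V: "(V, \<psi>) \<in> B" "G x \<in> V"
    by (rule points_chart[OF smooth_map_on_points[OF F x]], rule points_chart[OF smooth_map_on_points[OF G x]])
  let ?W = "(W \<inter> F -` U) \<inter> (W \<inter> G -` V)"
  have f: "smooth_vec_on C (W \<inter> F -` U) (\<lambda>x. \<phi> (F x))" by (rule smooth_map_onD[OF F U(1)])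
  have g: "smooth_vec_on C (W \<inter> G -` V) (\<lambda>x. \<psi> (G x))" by (rule smooth_map_onD[OF G V(1)])
  have "smooth_vec_on C ?W (\<lambda>x. (\<phi> (F x), \<psi> (G x)))"
    using smooth_vec_on_Int[OF f smooth_vec_on_open[OF g]] smooth_vec_on_Int[OF g smooth_vec_on_open[OF f]]
    by (intro smooth_vec_on_Pair[OF C]) (simp_all add: Int_commute)
  then show "\<exists>W' V \<psi>. x \<in> W' \<and> (V, \<psi>) \<in> product_atlas A B \<and> (\<lambda>x. (F x, G x)) ` W' \<subseteq> V \<and>
      smooth_vec_on C W' (\<lambda>x. \<psi> (F x, G x))"
    using x U V product_atlasI[OF U(1) V(1)]
    by (intro exI[of _ ?W] exI[of _ "U \<times> V"] exI[of _ "map_prod \<phi> \<psi>"]) auto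
qed

section \<open>Tangent vectors and covectors\<close>

lemma smooth_near_vec: "smooth_near A x f \<longleftrightarrow> (\<exists>W. x \<in> W \<and> smooth_vec_on A W f)"
  unfolding smooth_near_def smooth_fun_on_vec ..

lemma smooth_nearI: "smooth_vec_on A W f \<Longrightarrow> x \<in> W \<Longrightarrow> smooth_near A x f"
  unfolding smooth_near_vec by blast

lemma smooth_nearE:
  assumes "smooth_near A x f"
  obtains W where "x \<in> W" "smooth_vec_on A W f"
  using assms unfolding smooth_near_vec by blast

text \<open>The way back to \<open>smooth_map\<close>, which \<open>tangent_space\<close> requires
  of its curves.\<close>

lemma smooth_map_on_imp_map:
  fixes B :: "('n, 'b::finite_dim_inner) atlas"
  assumes A: "smooth_atlas A" and B: "smooth_atlas B" and F: "smooth_map_on A (points A) B F"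
  shows "smooth_map A B F"
  unfolding smooth_map_def
proof (intro conjI)
  show "continuous_map (atlas_topology A) (atlas_topology B) F"
    unfolding continuous_map_def topspace_atlas
  proof (intro conjI allI impI)
    show "F \<in> points A \<rightarrow> points B" using smooth_map_on_points[OF F] by blast
    fix V assume V: "openin (atlas_topology B) V"
    have "{x \<in> points A. F x \<in> V} = points A \<inter> F -` V" by auto
    then show "openin (atlas_topology A) {x \<in> points A. F x \<in> V}"
      using smooth_map_on_vimage[OF A B F V] by simp
  qed
  have "smooth_on (\<phi> ` (U \<inter> F -` V)) (\<psi> \<circ> F \<circ> inv_into U \<phi>)"
    if U: "(U, \<phi>) \<in> A" and V: "(V, \<psi>) \<in> B" for U \<phi> V \<psi>
  proof -
    have "U \<inter> (points A \<inter> F -` V) = U \<inter> F -` V" using chart_points[OF U] by blast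
    then show ?thesis using smooth_vec_onD[OF smooth_map_onD[OF F V] U] by (simp add: o_def)
  qed
  then show "\<forall>(U, \<phi>)\<in>A. \<forall>(V, \<psi>)\<in>B. smooth_on (\<phi> ` (U \<inter> F -` V)) (\<psi> \<circ> F \<circ> inv_into U \<phi>)" by blast
qed

abbreviation interval_atlas :: "real \<Rightarrow> (real, real) atlas" where
  "interval_atlas e \<equiv> {({- e<..<e}, \<lambda>t::real. t)}"

lemma smooth_atlas_interval: "smooth_atlas (interval_atlas e)"
proof (rule smooth_atlasI)
  show "smooth_on (\<phi> ` (U \<inter> V)) (\<psi> \<circ> inv_into U \<phi>)"
    if "(U, \<phi>) \<in> interval_atlas e" "(V, \<psi>) \<in> interval_atlas e" for U \<phi> V \<psi>
  proof -
    have "smooth_on {- e<..<e} ((\<lambda>t::real. t) \<circ> inv_into {- e<..<e} (\<lambda>t. t))"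
      by (rule smooth_on_cong[OF smooth_on_id]) (auto intro!: inv_into_f_f[symmetric])
    then show ?thesis using that by simp
  qed
qed auto

lemma points_interval: "points (interval_atlas e) = {- e<..<e}"
  by (simp add: points_def)

lemma coordinate_vector_smooth:
  "smooth_near A x f \<Longrightarrow> coordinate_vector A (U, \<phi>) x u f = dd (\<lambda>y. f (inv_into U \<phi> y)) (\<phi> x) u"
  by (simp add: coordinate_vector_def o_def)

lemma coordinate_vector_not_smooth: "\<not> smooth_near A x f \<Longrightarrow> coordinate_vector A c x u f = 0"
  by (simp add: coordinate_vector_def)

lemma smooth_near_differentiable:
  assumes A: "smooth_atlas A" and f: "smooth_near A x f" and U: "(U, \<phi>) \<in> A" "x \<in> U"
  shows "(\<lambda>y. f (inv_into U \<phi> y)) differentiable at (\<phi> x)"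
  by (rule smooth_nearE[OF f], rule smooth_on_differentiable[OF smooth_vec_onD'[OF _ U(1)]]) (use U in auto)

text \<open>The curve is the coordinate line through \<open>x\<close> in direction \<open>u\<close>.
  Together with \<open>tangent_coordinate\<close> this describes the tangent space by the model
  space.\<close>

lemma coordinate_vector_tangent:
  assumes A: "smooth_atlas A" and U: "(U, \<phi>) \<in> A" "x \<in> U"
  shows "coordinate_vector A (U, \<phi>) x u \<in> tangent_space A x"
proof -
  obtain r where r: "r > 0" "ball (\<phi> x) r \<subseteq> \<phi> ` U"
    using chart_open[OF A U(1)] U(2) openE by blast
  \<comment> \<open>Gives \<open>\<bar>t\<bar> * norm u < r\<close> on the interval, so the line
    stays in the chart; the summand 1 covers \<open>u = 0\<close>.\<close>
  define e where "e = r / (norm u + 1)"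
  have e: "e > 0" using r by (simp add: e_def add_nonneg_pos)
  have in_U: "\<phi> x + t *\<^sub>R u \<in> \<phi> ` U" if "t \<in> {- e<..<e}" for t
  proof -
    have "\<bar>t\<bar> * norm u \<le> \<bar>t\<bar> * (norm u + 1)" by (simp add: mult_left_mono)
    also have "\<dots> < e * (norm u + 1)"
      using that by (intro mult_strict_right_mono) (auto simp: add_nonneg_pos)
    also have "\<dots> = r" by (simp add: e_def add_nonneg_eq_0_iff)
    finally show ?thesis using r(2) by (auto simp: dist_norm subset_iff)
  qed
  define \<gamma> where "\<gamma> = (\<lambda>t. inv_into U \<phi> (\<phi> x + t *\<^sub>R u))"
  let ?C = "interval_atlas e"
  note C = smooth_atlas_interval[of e]
  have \<phi>\<gamma>: "\<phi> (\<gamma> t) = \<phi> x + t *\<^sub>R u" if "t \<in> {- e<..<e}" for t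
    unfolding \<gamma>_def by (rule f_inv_into_f[OF in_U[OF that]])
  have "smooth_map_on ?C (points ?C) A \<gamma>"
  proof (rule smooth_map_onI[OF C A openin_points])
    fix t assume t: "t \<in> points ?C"
    have "smooth_on {- e<..<e} (\<lambda>t. \<phi> x + t *\<^sub>R u)"
      by (intro smooth_on_add smooth_on_const smooth_on_bounded_linear bounded_linear_scaleR_left) auto
    then have "smooth_vec_on ?C {- e<..<e} (\<lambda>t. \<phi> x + t *\<^sub>R u)"
      by (intro smooth_vec_on_compose[OF C smooth_vec_on_chart[OF C], of _ "\<lambda>t. t" "{- e<..<e}"]) auto
    then have "smooth_vec_on ?C {- e<..<e} (\<lambda>t. \<phi> (\<gamma> t))"
      by (rule smooth_vec_on_cong[OF C]) (simp add: \<phi>\<gamma>)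
    moreover have "\<gamma> ` {- e<..<e} \<subseteq> U"
      unfolding \<gamma>_def using in_U by (auto intro: inv_into_into)
    ultimately show "\<exists>W' V \<psi>. t \<in> W' \<and> (V, \<psi>) \<in> A \<and> \<gamma> ` W' \<subseteq> V \<and> smooth_vec_on ?C W' (\<lambda>x. \<psi> (\<gamma> x))"
      using t U(1) by (intro exI[of _ "{- e<..<e}"] exI[of _ U] exI[of _ \<phi>] conjI) (simp_all only: points_interval)
  qed
  then have "smooth_map ?C A \<gamma>" by (rule smooth_map_on_imp_map[OF C A])
  moreover have \<gamma>0: "\<gamma> 0 = x" by (simp add: \<gamma>_def chart_inv[OF A U])
  moreover have "velocity A \<gamma> = coordinate_vector A (U, \<phi>) x u"
  proof
    fix f
    show "velocity A \<gamma> f = coordinate_vector A (U, \<phi>) x u f"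
    proof (cases "smooth_near A x f")
      case True
      have "((\<lambda>t. f (inv_into U \<phi> (\<phi> x + t *\<^sub>R u))) has_real_derivative
          dd (\<lambda>y. f (inv_into U \<phi> y)) (\<phi> x) u) (at 0)"
        using has_real_derivative_line[of "\<lambda>y. f (inv_into U \<phi> y)" "\<phi> x" 0 u]
          smooth_near_differentiable[OF A True U] by simp
      then show ?thesis
        using True by (simp add: velocity_def \<gamma>0 coordinate_vector_smooth)
          (simp add: \<gamma>_def o_def DERIV_imp_deriv)
    qed (simp add: velocity_def \<gamma>0 coordinate_vector_not_smooth)
  qed
  ultimately show ?thesis
    unfolding tangent_space_def using e by (intro CollectI exI[of _ \<gamma>] exI[of _ e] conjI) simp_all
qed

lemma tangent_points: "v \<in> tangent_space A x \<Longrightarrow> x \<in> points A"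
  unfolding tangent_space_def smooth_map_def continuous_map_def topspace_atlas points_interval by auto

text \<open>The direction is the velocity of the curve read in the chart; by the chain rule the
  curve and the coordinate line differentiate functions alike.\<close>

lemma tangent_coordinate:
  assumes A: "smooth_atlas A" and U: "(U, \<phi>) \<in> A" "x \<in> U" and v: "v \<in> tangent_space A x"
  shows "\<exists>u. v = coordinate_vector A (U, \<phi>) x u"
proof -
  obtain \<gamma> e where \<gamma>: "v = velocity A \<gamma>" "e > 0" "smooth_map (interval_atlas e) A \<gamma>" "\<gamma> 0 = x"
    using v unfolding tangent_space_def by blast
  let ?C = "interval_atlas e"
  note C = smooth_atlas_interval[of e]
  have m: "smooth_map_on ?C (points ?C) A \<gamma>" by (rule smooth_map_imp_on[OF C A \<gamma>(3)])
  let ?W = "{- e<..<e} \<inter> \<gamma> -` U"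
  have s: "smooth_vec_on ?C ?W (\<lambda>t. \<phi> (\<gamma> t))"
    using smooth_map_onD[OF m U(1)] by (simp add: points_interval)
  have inv: "inv_into {- e<..<e} (\<lambda>t. t) t = t" if "t \<in> {- e<..<e}" for t :: real
    by (rule inv_into_f_f) (use that in auto)
  have W: "open ?W" using openin_image[OF C smooth_vec_on_open[OF s], of "{- e<..<e}" "\<lambda>t. t"] by simp
  have "smooth_on ?W (\<lambda>t. \<phi> (\<gamma> t))"
    by (rule smooth_on_cong[OF smooth_vec_onD'[OF s, of "{- e<..<e}" "\<lambda>t. t", simplified] W]) (simp add: inv)
  moreover have 0: "0 \<in> ?W" using \<gamma> U by simp
  ultimately have d: "((\<lambda>t. \<phi> (\<gamma> t)) has_derivative dd (\<lambda>t. \<phi> (\<gamma> t)) 0) (at 0)"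
    by (rule smooth_on_has_derivative)
  let ?u = "dd (\<lambda>t. \<phi> (\<gamma> t)) 0 1"
  have "v = coordinate_vector A (U, \<phi>) x ?u"
  proof
    fix f
    show "v f = coordinate_vector A (U, \<phi>) x ?u f"
    proof (cases "smooth_near A x f")
      case True
      let ?g = "\<lambda>y. f (inv_into U \<phi> y)"
      have g: "(?g has_derivative dd ?g (\<phi> (\<gamma> 0))) (at (\<phi> (\<gamma> 0)))"
        using smooth_near_differentiable[OF A True U] frechet_derivative_worksI \<gamma>(4) by blast
      have "((\<lambda>t. ?g (\<phi> (\<gamma> t))) has_derivative (\<lambda>s. dd ?g (\<phi> (\<gamma> 0)) (dd (\<lambda>t. \<phi> (\<gamma> t)) 0 s))) (at 0)"
        by (rule has_derivative_compose[OF d g])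
      then have h: "((\<lambda>t. f (\<gamma> t)) has_derivative (\<lambda>s. dd ?g (\<phi> (\<gamma> 0)) (dd (\<lambda>t. \<phi> (\<gamma> t)) 0 s))) (at 0)"
        by (rule has_derivative_transform_within_open[OF _ W 0]) (simp add: chart_inv[OF A U(1)])
      have "dd ?g (\<phi> x) (dd (\<lambda>t. \<phi> (\<gamma> t)) 0 s) = dd ?g (\<phi> x) ?u * s" for s
      proof -
        have "dd ?g (\<phi> x) (dd (\<lambda>t. \<phi> (\<gamma> t)) 0 (s *\<^sub>R 1)) = s *\<^sub>R dd ?g (\<phi> x) ?u"
          using linear_cmul[OF has_derivative_linear[OF d], of s 1] linear_cmul[OF has_derivative_linear[OF g], of s ?u] \<gamma>(4)
          by simp
        then show ?thesis by simp
      qed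
      then have "(\<lambda>s. dd ?g (\<phi> (\<gamma> 0)) (dd (\<lambda>t. \<phi> (\<gamma> t)) 0 s)) = (*) (dd ?g (\<phi> x) ?u)"
        unfolding \<gamma>(4) by (rule ext)
      then have "((\<lambda>t. f (\<gamma> t)) has_real_derivative dd ?g (\<phi> x) ?u) (at 0)"
        unfolding has_field_derivative_def by (rule has_derivative_eq_rhs[OF h])
      then show ?thesis
        using True \<gamma>(4) by (simp add: \<gamma>(1) velocity_def coordinate_vector_smooth)
          (simp add: o_def DERIV_imp_deriv)
    qed (simp add: \<gamma>(1,4) velocity_def coordinate_vector_not_smooth)
  qed
  then show ?thesis by blast
qed

lemma coordinate_vector_lincomb:
  assumes A: "smooth_atlas A" and U: "(U, \<phi>) \<in> A" "x \<in> U"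
  shows "coordinate_vector A (U, \<phi>) x (a *\<^sub>R u + b *\<^sub>R w) =
    lincomb a (coordinate_vector A (U, \<phi>) x u) b (coordinate_vector A (U, \<phi>) x w)"
proof
  fix f
  show "coordinate_vector A (U, \<phi>) x (a *\<^sub>R u + b *\<^sub>R w) f =
    lincomb a (coordinate_vector A (U, \<phi>) x u) b (coordinate_vector A (U, \<phi>) x w) f"
  proof (cases "smooth_near A x f")
    case True
    note l = linear_dd[OF smooth_near_differentiable[OF A True U]]
    show ?thesis
      using True by (simp add: lincomb_def coordinate_vector_smooth linear_add[OF l] linear_cmul[OF l])
  qed (simp add: coordinate_vector_not_smooth lincomb_def)
qed

text \<open>Curves cannot be added, so both vectors are written in one chart and their directions
  are combined.\<close>

lemma tangent_lincomb:
  assumes A: "smooth_atlas A" and uv: "u \<in> tangent_space A x" "v \<in> tangent_space A x"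
  shows "lincomb a u b v \<in> tangent_space A x"
proof -
  obtain U \<phi> where U: "(U, \<phi>) \<in> A" "x \<in> U" using points_chart[OF tangent_points[OF uv(1)]] .
  obtain u' v' where "u = coordinate_vector A (U, \<phi>) x u'" "v = coordinate_vector A (U, \<phi>) x v'"
    using tangent_coordinate[OF A U] uv by blast
  then show ?thesis
    using coordinate_vector_lincomb[OF A U, of a u' b v'] coordinate_vector_tangent[OF A U] by metis
qed

lemma coordinate_vector_compose_chart:
  assumes A: "smooth_atlas A" and U: "(U, \<phi>) \<in> A" "x \<in> U"
    and S: "open S" "\<phi> x \<in> S" "smooth_on S g"
  shows "coordinate_vector A (U, \<phi>) x u (\<lambda>y. g (\<phi> y)) = dd g (\<phi> x) u"
proof -
  have c: "smooth_vec_on A (U \<inter> \<phi> -` S) \<phi>"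
    by (rule smooth_vec_on_subset[OF smooth_vec_on_chart[OF A U(1)] openin_smooth_vimage[OF A smooth_vec_on_chart[OF A U(1)] S(1)]])
      auto
  have "smooth_vec_on A (U \<inter> \<phi> -` S) (\<lambda>y. g (\<phi> y))"
    by (rule smooth_vec_on_compose[OF A c S(3)]) auto
  then have "smooth_near A x (\<lambda>y. g (\<phi> y))" by (rule smooth_nearI) (use U S in auto)
  then have "coordinate_vector A (U, \<phi>) x u (\<lambda>y. g (\<phi> y)) = dd (\<lambda>y. g (\<phi> (inv_into U \<phi> y))) (\<phi> x) u"
    by (rule coordinate_vector_smooth)
  also have "\<dots> = dd g (\<phi> x) u"
    by (rule dd_cong[OF chart_open[OF A U(1)]]) (use U in \<open>auto simp: chart_inv[OF A U(1)]\<close>)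
  finally show ?thesis .
qed

lemma coordinate_vector_coordinate:
  assumes A: "smooth_atlas A" and U: "(U, \<phi>) \<in> A" "x \<in> U"
  shows "coordinate_vector A (U, \<phi>) x u (\<lambda>y. inner (\<phi> y) w) = inner u w"
proof -
  have "coordinate_vector A (U, \<phi>) x u (\<lambda>y. inner (\<phi> y) w) = dd (\<lambda>y. inner y w) (\<phi> x) u"
    by (rule coordinate_vector_compose_chart[OF A U open_UNIV]) (auto intro: smooth_on_bounded_linear bounded_linear_inner_left)
  also have "\<dots> = inner u w"
    by (rule dd_eq, rule bounded_linear_imp_has_derivative, rule bounded_linear_inner_left)
  finally show ?thesis .
qed

lemma tangent_expand:
  assumes A: "smooth_atlas A" and U: "(U, \<phi>) \<in> A" "x \<in> U" and v: "v \<in> tangent_space A x"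
  shows "v = coordinate_vector A (U, \<phi>) x (\<Sum>b\<in>onb. v (\<lambda>y. inner (\<phi> y) b) *\<^sub>R b)"
proof -
  obtain u where u: "v = coordinate_vector A (U, \<phi>) x u" using tangent_coordinate[OF A U v] by blast
  then show ?thesis by (simp add: coordinate_vector_coordinate[OF A U] onb_expand)
qed

text \<open>Locality, including the default value 0: \<open>f\<close> and \<open>g\<close> are
  smooth near \<open>x\<close> together or not at all.\<close>

lemma tangent_cong:
  assumes A: "smooth_atlas A" and v: "v \<in> tangent_space A x"
    and W: "openin (atlas_topology A) W" "x \<in> W" "\<And>y. y \<in> W \<Longrightarrow> f y = g y"
  shows "v f = v g"
proof -
  obtain U \<phi> where U: "(U, \<phi>) \<in> A" "x \<in> U" using points_chart[OF tangent_points[OF v]] .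
  obtain u where u: "v = coordinate_vector A (U, \<phi>) x u" using tangent_coordinate[OF A U v] by blast
  have tr: "smooth_near A x g'" if n: "smooth_near A x f'" "\<And>y. y \<in> W \<Longrightarrow> f' y = g' y" for f' g' :: "'a \<Rightarrow> real"
  proof -
    obtain W' where W': "x \<in> W'" "smooth_vec_on A W' f'" using smooth_nearE[OF n(1)] .
    have "smooth_vec_on A (W' \<inter> W) g'"
      by (rule smooth_vec_on_cong[OF A smooth_vec_on_Int[OF W'(2) W(1)]]) (simp add: n(2))
    then show ?thesis by (rule smooth_nearI) (use W' W in simp)
  qed
  have "smooth_near A x f \<longleftrightarrow> smooth_near A x g" using tr[of f g] tr[of g f] W(3) by auto
  moreover have "dd (\<lambda>y. f (inv_into U \<phi> y)) (\<phi> x) u = dd (\<lambda>y. g (inv_into U \<phi> y)) (\<phi> x) u"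
    by (rule dd_cong[OF openin_image[OF A W(1) U(1)]])
      (use U W(2,3) in \<open>auto simp: chart_inv[OF A U(1)]\<close>)
  ultimately show ?thesis unfolding u coordinate_vector_def by (simp add: o_def)
qed

lemma tangent_lincomb_fun:
  assumes A: "smooth_atlas A" and v: "v \<in> tangent_space A x"
    and fg: "smooth_near A x f" "smooth_near A x g"
  shows "v (\<lambda>y. a * f y + b * g y) = a * v f + b * v g"
proof -
  obtain U \<phi> where U: "(U, \<phi>) \<in> A" "x \<in> U" using points_chart[OF tangent_points[OF v]] .
  obtain u where u: "v = coordinate_vector A (U, \<phi>) x u" using tangent_coordinate[OF A U v] by blast
  obtain W W' where W: "x \<in> W" "smooth_vec_on A W f" "x \<in> W'" "smooth_vec_on A W' g"
    using smooth_nearE[OF fg(1)] smooth_nearE[OF fg(2)] by metis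
  have "smooth_vec_on A (W \<inter> W') (\<lambda>y. a * f y + b * g y)"
    using smooth_vec_on_Int[OF W(2) smooth_vec_on_open[OF W(4)]] smooth_vec_on_Int[OF W(4) smooth_vec_on_open[OF W(2)]]
    by (intro smooth_vec_on_lincomb[OF A]) (simp_all add: Int_commute)
  then have "smooth_near A x (\<lambda>y. a * f y + b * g y)" by (rule smooth_nearI) (use W in simp)
  then show ?thesis
    using fg by (simp add: u coordinate_vector_smooth dd_lincomb[OF smooth_near_differentiable[OF A fg(1) U] smooth_near_differentiable[OF A fg(2) U]])
qed

lemma tangent_mult:
  assumes A: "smooth_atlas A" and v: "v \<in> tangent_space A x"
    and fg: "smooth_near A x f" "smooth_near A x g"
  shows "v (\<lambda>y. f y * g y) = f x * v g + v f * g x"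
proof -
  obtain U \<phi> where U: "(U, \<phi>) \<in> A" "x \<in> U" using points_chart[OF tangent_points[OF v]] .
  obtain u where u: "v = coordinate_vector A (U, \<phi>) x u" using tangent_coordinate[OF A U v] by blast
  obtain W W' where W: "x \<in> W" "smooth_vec_on A W f" "x \<in> W'" "smooth_vec_on A W' g"
    using smooth_nearE[OF fg(1)] smooth_nearE[OF fg(2)] by metis
  have "smooth_vec_on A (W \<inter> W') (\<lambda>y. f y * g y)"
    using smooth_vec_on_Int[OF W(2) smooth_vec_on_open[OF W(4)]] smooth_vec_on_Int[OF W(4) smooth_vec_on_open[OF W(2)]]
    by (intro smooth_vec_on_mult[OF A]) (simp_all add: Int_commute)
  then have "smooth_near A x (\<lambda>y. f y * g y)" by (rule smooth_nearI) (use W in simp)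
  then show ?thesis
    using fg by (simp add: u coordinate_vector_smooth chart_inv[OF A U]
        dd_mult[OF smooth_near_differentiable[OF A fg(1) U] smooth_near_differentiable[OF A fg(2) U]])
qed

lemma smooth_near_const: "x \<in> points A \<Longrightarrow> smooth_near A x (\<lambda>y. c)"
  by (rule smooth_nearI[OF smooth_vec_on_const[OF openin_points]])

text \<open>The Leibniz rule for \<open>1 * 1 = 1\<close> kills the constant 1, and linearity does
  the rest.\<close>

lemma tangent_const:
  assumes A: "smooth_atlas A" and v: "v \<in> tangent_space A x"
  shows "v (\<lambda>y. c) = 0"
proof -
  have s: "smooth_near A x (\<lambda>y. 1)" by (rule smooth_near_const[OF tangent_points[OF v]])
  have "v (\<lambda>y. 1) = v (\<lambda>y. 1) + v (\<lambda>y. 1)" using tangent_mult[OF A v s s] by simp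
  then show ?thesis using tangent_lincomb_fun[OF A v s s, of c 0] by simp
qed

lemma smooth_near_sum:
  assumes A: "smooth_atlas A" and "finite I" "\<And>i. i \<in> I \<Longrightarrow> smooth_near A x (f i)" and x: "x \<in> points A"
  shows "smooth_near A x (\<lambda>y. \<Sum>i\<in>I. f i y)"
  using assms(2,3)
proof (induction I rule: finite_induct)
  case empty
  then show ?case using smooth_near_const[OF x] by simp
next
  case (insert i I)
  obtain W where W: "x \<in> W" "smooth_vec_on A W (f i)" using smooth_nearE[OF insert.prems[of i]] by auto
  obtain W' where W': "x \<in> W'" "smooth_vec_on A W' (\<lambda>y. \<Sum>i\<in>I. f i y)"
    using smooth_nearE insert by (metis insertCI)
  have "smooth_vec_on A (W \<inter> W') (\<lambda>y. f i y + (\<Sum>i\<in>I. f i y))"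
    using smooth_vec_on_Int[OF W(2) smooth_vec_on_open[OF W'(2)]] smooth_vec_on_Int[OF W'(2) smooth_vec_on_open[OF W(2)]]
    by (intro smooth_vec_on_add[OF A]) (simp_all add: Int_commute)
  then show ?case using W W' insert.hyps by (auto intro: smooth_nearI)
qed

lemma tangent_sum:
  assumes A: "smooth_atlas A" and v: "v \<in> tangent_space A x"
    and "finite I" "\<And>i. i \<in> I \<Longrightarrow> smooth_near A x (f i)"
  shows "v (\<lambda>y. \<Sum>i\<in>I. f i y) = (\<Sum>i\<in>I. v (f i))"
  using assms(3,4)
proof (induction I rule: finite_induct)
  case empty
  then show ?case using tangent_const[OF A v] by simp
next
  case (insert i I)
  have "v (\<lambda>y. 1 * f i y + 1 * (\<Sum>i\<in>I. f i y)) = 1 * v (f i) + 1 * v (\<lambda>y. \<Sum>i\<in>I. f i y)"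
    using insert by (intro tangent_lincomb_fun[OF A v] smooth_near_sum[OF A] tangent_points[OF v]) auto
  then show ?case using insert by simp
qed

text \<open>The sum is the derivative of \<open>F\<close> along \<open>v\<close>, put together from
  its components, so that the chain rule can be stated for the operator \<open>v\<close> alone,
  without a curve or a chart.\<close>

lemma tangent_chain:
  fixes F :: "'m \<Rightarrow> 'v::finite_dim_inner"
  assumes A: "smooth_atlas A" and v: "v \<in> tangent_space A x"
    and W: "x \<in> W" "smooth_vec_on A W F" and S: "open S" "F x \<in> S" "smooth_on S g"
  shows "v (\<lambda>y. g (F y)) = dd g (F x) (\<Sum>b\<in>onb. v (\<lambda>y. inner (F y) b) *\<^sub>R b)"
proof -
  obtain U \<phi> where U: "(U, \<phi>) \<in> A" "x \<in> U" using points_chart[OF tangent_points[OF v]] .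
  obtain u where u: "v = coordinate_vector A (U, \<phi>) x u" using tangent_coordinate[OF A U v] by blast
  let ?W = "W \<inter> F -` S"
  have op: "openin (atlas_topology A) ?W" by (rule openin_smooth_vimage[OF A W(2) S(1)])
  have "smooth_vec_on A ?W (\<lambda>y. g (F y))"
    by (rule smooth_vec_on_compose[OF A smooth_vec_on_subset[OF W(2) op] S(3)]) auto
  then have n: "smooth_near A x (\<lambda>y. g (F y))" by (rule smooth_nearI) (use W S in simp)
  have dF: "(\<lambda>y. F (inv_into U \<phi> y)) differentiable at (\<phi> x)"
    by (rule smooth_on_differentiable[OF smooth_vec_onD'[OF W(2) U(1)]]) (use U W in auto)
  have dg: "g differentiable at (F (inv_into U \<phi> (\<phi> x)))"
    using smooth_on_differentiable[OF S(3,2)] by (simp add: chart_inv[OF A U])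
  let ?d = "dd (\<lambda>y. F (inv_into U \<phi> y)) (\<phi> x) u"
  have "v (\<lambda>y. inner (F y) b) = inner ?d b" for b
  proof -
    have "smooth_near A x (\<lambda>y. inner (F y) b)"
      by (rule smooth_nearI[OF smooth_vec_on_inner[OF A W(2) smooth_vec_on_const[OF smooth_vec_on_open[OF W(2)]]] W(1)])
    then have "v (\<lambda>y. inner (F y) b) = dd (\<lambda>y. inner b (F (inv_into U \<phi> y))) (\<phi> x) u"
      by (simp add: u coordinate_vector_smooth inner_commute)
    then show ?thesis by (simp add: dd_inner[OF dF] inner_commute)
  qed
  then have "(\<Sum>b\<in>onb. v (\<lambda>y. inner (F y) b) *\<^sub>R b) = ?d" by (simp add: onb_expand)
  moreover have "v (\<lambda>y. g (F y)) = dd g (F x) ?d"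
    using n dd_compose[OF dF dg] by (simp add: u coordinate_vector_smooth chart_inv[OF A U])
  ultimately show ?thesis by simp
qed

section \<open>Covectors and differentials of functions\<close>

lemma dual_lincomb:
  "\<alpha> \<in> dual_space V \<Longrightarrow> u \<in> V \<Longrightarrow> v \<in> V \<Longrightarrow> \<alpha> (lincomb a u b v) = a * \<alpha> u + b * \<alpha> v"
  unfolding dual_space_def by blast

lemma dual_expand:
  assumes A: "smooth_atlas A" and U: "(U, \<phi>) \<in> A" "x \<in> U" and \<alpha>: "\<alpha> \<in> cotangent_space A x"
  shows "\<alpha> (coordinate_vector A (U, \<phi>) x u) = (\<Sum>b\<in>onb. inner u b * \<alpha> (coordinate_vector A (U, \<phi>) x b))"
proof -
  have "linear (\<lambda>u. \<alpha> (coordinate_vector A (U, \<phi>) x u))"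
  proof (rule linearI)
    fix u w c
    show "\<alpha> (coordinate_vector A (U, \<phi>) x (u + w)) = \<alpha> (coordinate_vector A (U, \<phi>) x u) + \<alpha> (coordinate_vector A (U, \<phi>) x w)"
      using coordinate_vector_lincomb[OF A U, of 1 u 1 w]
        dual_lincomb[OF \<alpha> coordinate_vector_tangent[OF A U] coordinate_vector_tangent[OF A U], of 1 u 1 w] by simp
    show "\<alpha> (coordinate_vector A (U, \<phi>) x (c *\<^sub>R u)) = c *\<^sub>R \<alpha> (coordinate_vector A (U, \<phi>) x u)"
      using coordinate_vector_lincomb[OF A U, of c u 0 u]
        dual_lincomb[OF \<alpha> coordinate_vector_tangent[OF A U] coordinate_vector_tangent[OF A U], of c u 0 u] by simp
  qed
  from linear_onb_expand[OF this, of u] show ?thesis by simp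
qed

lemma fun_differential_dual:
  assumes A: "smooth_atlas A"
  shows "fun_differential A x f \<in> cotangent_space A x"
  unfolding dual_space_def fun_differential_def
  using tangent_lincomb[OF A] by (auto simp: lincomb_def)

lemma smooth_vec_on_coordinate:
  assumes A: "smooth_atlas A" and U: "(U, \<phi>) \<in> A"
  shows "smooth_vec_on A U (\<lambda>y. inner (\<phi> y) b)"
  by (rule smooth_vec_on_inner[OF A smooth_vec_on_chart[OF A U] smooth_vec_on_const[OF openin_chart[OF A U]]])

text \<open>A function linear in the coordinates can have any prescribed differential at
  \<open>x\<close>. This gives the witnesses for the representing functions that
  \<open>schouten\<close> chooses.\<close>

lemma cotangent_differential:
  assumes A: "smooth_atlas A" and U: "(U, \<phi>) \<in> A" "x \<in> U" and \<alpha>: "\<alpha> \<in> cotangent_space A x"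
  shows "smooth_vec_on A U (\<lambda>y. \<Sum>b\<in>onb. \<alpha> (coordinate_vector A (U, \<phi>) x b) * inner (\<phi> y) b)"
    and "fun_differential A x (\<lambda>y. \<Sum>b\<in>onb. \<alpha> (coordinate_vector A (U, \<phi>) x b) * inner (\<phi> y) b) = \<alpha>"
proof -
  let ?c = "\<lambda>b. \<alpha> (coordinate_vector A (U, \<phi>) x b)"
  have s: "smooth_vec_on A U (\<lambda>y. ?c b * inner (\<phi> y) b)" for b
    by (rule smooth_vec_on_cmult[OF A smooth_vec_on_coordinate[OF A U(1)]])
  then show "smooth_vec_on A U (\<lambda>y. \<Sum>b\<in>onb. ?c b * inner (\<phi> y) b)"
    by (intro smooth_vec_on_sum[OF A openin_chart[OF A U(1)]])
  show "fun_differential A x (\<lambda>y. \<Sum>b\<in>onb. ?c b * inner (\<phi> y) b) = \<alpha>"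
  proof
    fix v
    show "fun_differential A x (\<lambda>y. \<Sum>b\<in>onb. ?c b * inner (\<phi> y) b) v = \<alpha> v"
    proof (cases "v \<in> tangent_space A x")
      case True
      obtain u where u: "v = coordinate_vector A (U, \<phi>) x u" using tangent_coordinate[OF A U True] by blast
      have n: "smooth_near A x (\<lambda>y. inner (\<phi> y) b)" for b
        by (rule smooth_nearI[OF smooth_vec_on_coordinate[OF A U(1)] U(2)])
      have "v (\<lambda>y. ?c b * inner (\<phi> y) b) = ?c b * inner u b" for b
        using tangent_lincomb_fun[OF A True n[of b] n[of b], of "?c b" 0]
          coordinate_vector_coordinate[OF A U, of u b] u by simp
      then have "v (\<lambda>y. \<Sum>b\<in>onb. ?c b * inner (\<phi> y) b) = (\<Sum>b\<in>onb. ?c b * inner u b)"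
        using tangent_sum[OF A True finite_onb smooth_nearI[OF s U(2)]] by simp
      also have "\<dots> = \<alpha> v" unfolding u dual_expand[OF A U \<alpha>, of u] by (simp add: mult.commute)
      finally show ?thesis using True by (simp add: fun_differential_def)
    next
      case False
      then show ?thesis using \<alpha> by (simp add: fun_differential_def dual_space_def)
    qed
  qed
qed

subsection \<open>Push-forward and pull-back\<close>

lemma smooth_near_pullback:
  fixes B :: "('n, 'b::finite_dim_inner) atlas"
  assumes A: "smooth_atlas A" and B: "smooth_atlas B" and F: "smooth_map_on A W B F" "x \<in> W"
    and h: "smooth_near B (F x) h"
  shows "smooth_near A x (\<lambda>y. h (F y))"
proof -
  obtain V where "F x \<in> V" "smooth_vec_on B V h" using smooth_nearE[OF h] .
  then show ?thesis by (intro smooth_nearI[OF smooth_vec_on_pullback[OF A B F(1)]]) (use F in auto)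
qed

text \<open>By the chain rule the push-forward is the coordinate vector whose direction collects the
  derivatives along \<open>v\<close> of the components of \<open>F\<close>.\<close>

lemma push_tvec_tangent:
  fixes B :: "('n, 'b::finite_dim_inner) atlas"
  assumes A: "smooth_atlas A" and B: "smooth_atlas B" and F: "smooth_map_on A W B F" "x \<in> W"
    and v: "v \<in> tangent_space A x"
  shows "push_tvec B F x v \<in> tangent_space B (F x)"
proof -
  obtain V \<psi> where V: "(V, \<psi>) \<in> B" "F x \<in> V" using points_chart[OF smooth_map_on_points[OF F]] .
  have s: "smooth_vec_on A (W \<inter> F -` V) (\<lambda>y. \<psi> (F y))" by (rule smooth_map_onD[OF F(1) V(1)])
  let ?u = "\<Sum>b\<in>onb. v (\<lambda>y. inner (\<psi> (F y)) b) *\<^sub>R b"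
  have "push_tvec B F x v = coordinate_vector B (V, \<psi>) (F x) ?u"
  proof
    fix h
    show "push_tvec B F x v h = coordinate_vector B (V, \<psi>) (F x) ?u h"
    proof (cases "smooth_near B (F x) h")
      case True
      then obtain V' where V': "F x \<in> V'" "smooth_vec_on B V' h" by (rule smooth_nearE)
      have "v (\<lambda>y. h (F y)) = v (\<lambda>y. h (inv_into V \<psi> (\<psi> (F y))))"
        by (rule tangent_cong[OF A v smooth_vec_on_open[OF s]]) (use F V in \<open>auto simp: chart_inv[OF B V(1)]\<close>)
      also have "\<dots> = dd (\<lambda>y. h (inv_into V \<psi> y)) (\<psi> (F x)) ?u"
        by (rule tangent_chain[OF A v _ s openin_image[OF B smooth_vec_on_open[OF V'(2)] V(1)] _ smooth_vec_onD'[OF V'(2) V(1)]])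
          (use F V V' in auto)
      finally show ?thesis using True by (simp add: push_tvec_def coordinate_vector_smooth o_def)
    qed (simp add: push_tvec_def coordinate_vector_not_smooth)
  qed
  then show ?thesis using coordinate_vector_tangent[OF B V] by simp
qed

lemma push_tvec_smooth: "smooth_near B (F x) h \<Longrightarrow> push_tvec B F x v h = v (\<lambda>y. h (F y))"
  by (simp add: push_tvec_def o_def)

lemma push_tvec_lincomb: "push_tvec B F x (lincomb a u b v) = lincomb a (push_tvec B F x u) b (push_tvec B F x v)"
  by (auto simp: push_tvec_def lincomb_def)

lemma push_tvec_compose:
  fixes B :: "('n, 'b::finite_dim_inner) atlas" and C :: "('k, 'c::finite_dim_inner) atlas"
  assumes B: "smooth_atlas B" and C: "smooth_atlas C" and G: "smooth_map_on B V C G" "F x \<in> V"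
  shows "push_tvec C G (F x) (push_tvec B F x v) = push_tvec C (\<lambda>y. G (F y)) x v"
proof
  fix h
  show "push_tvec C G (F x) (push_tvec B F x v) h = push_tvec C (\<lambda>y. G (F y)) x v h"
  proof (cases "smooth_near C (G (F x)) h")
    case True
    then show ?thesis
      using smooth_near_pullback[OF B C G True] by (simp add: push_tvec_smooth)
  qed (simp add: push_tvec_def)
qed

lemma push_tvec_cong:
  assumes A: "smooth_atlas A" and v: "v \<in> tangent_space A x"
    and W: "openin (atlas_topology A) W" "x \<in> W" "\<And>y. y \<in> W \<Longrightarrow> F y = G y"
  shows "push_tvec B F x v = push_tvec B G x v"
  unfolding push_tvec_def
  using tangent_cong[OF A v W(1,2), of "h \<circ> F" "h \<circ> G" for h] W by (auto simp: fun_eq_iff)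

lemma push_tvec_id:
  assumes "v \<in> tangent_space A x"
  shows "push_tvec A (\<lambda>y. y) x v = v"
proof -
  obtain \<gamma> where "v = velocity A \<gamma>" "\<gamma> 0 = x" using assms unfolding tangent_space_def by blast
  then show ?thesis by (auto simp: push_tvec_def velocity_def o_def fun_eq_iff)
qed

lemma pull_covec_dual:
  fixes B :: "('n, 'b::finite_dim_inner) atlas"
  assumes A: "smooth_atlas A" and B: "smooth_atlas B" and F: "smooth_map_on A W B F" "x \<in> W"
    and \<alpha>: "\<alpha> \<in> cotangent_space B (F x)"
  shows "pull_covec A B F x \<alpha> \<in> cotangent_space A x"
  unfolding dual_space_def pull_covec_def
  using tangent_lincomb[OF A] dual_lincomb[OF \<alpha> push_tvec_tangent[OF A B F] push_tvec_tangent[OF A B F]]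
  by (auto simp: push_tvec_lincomb)

lemma pull_covec_differential:
  fixes B :: "('n, 'b::finite_dim_inner) atlas"
  assumes A: "smooth_atlas A" and B: "smooth_atlas B" and F: "smooth_map_on A W B F" "x \<in> W"
    and h: "smooth_near B (F x) h"
  shows "pull_covec A B F x (fun_differential B (F x) h) = fun_differential A x (\<lambda>y. h (F y))"
  using push_tvec_tangent[OF A B F]
  by (auto simp: pull_covec_def fun_differential_def push_tvec_smooth[of B F x h, OF h] fun_eq_iff)

lemma pull_covec_compose:
  fixes B :: "('n, 'b::finite_dim_inner) atlas" and C :: "('k, 'c::finite_dim_inner) atlas"
  assumes A: "smooth_atlas A" and B: "smooth_atlas B" and C: "smooth_atlas C"
    and F: "smooth_map_on A W B F" "x \<in> W" and G: "smooth_map_on B V C G" "F x \<in> V"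
  shows "pull_covec A B F x (pull_covec B C G (F x) \<alpha>) = pull_covec A C (\<lambda>y. G (F y)) x \<alpha>"
proof
  fix v
  show "pull_covec A B F x (pull_covec B C G (F x) \<alpha>) v = pull_covec A C (\<lambda>y. G (F y)) x \<alpha> v"
    using push_tvec_tangent[OF A B F, of v] push_tvec_compose[OF B C G(1), of F x v] G(2)
    by (simp add: pull_covec_def)
qed

subsection \<open>Partial derivatives on products\<close>

lemma slice_smooth:
  fixes A :: "('m, 'a::finite_dim_inner) atlas" and B :: "('n, 'b::finite_dim_inner) atlas"
  assumes A: "smooth_atlas A" and B: "smooth_atlas B"
    and a: "a \<in> points A" and b: "b \<in> points B"
  shows "smooth_map_on B (points B) (product_atlas A B) (\<lambda>b. (a, b))"
    and "smooth_map_on A (points A) (product_atlas A B) (\<lambda>a. (a, b))"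
  by (intro smooth_map_on_Pair[OF A B B] smooth_map_on_Pair[OF A B A] smooth_map_on_const smooth_map_on_id A B a b openin_points)+

text \<open>\<open>K\<close> is \<open>f\<close> in the product chart; a derivative along one factor
  becomes a directional derivative of \<open>K\<close> with 0 in the other slot.\<close>

lemma partial_vector_chart:
  fixes A :: "('m, 'a::finite_dim_inner) atlas" and B :: "('n, 'b::finite_dim_inner) atlas"
  assumes A: "smooth_atlas A" and B: "smooth_atlas B"
    and f: "smooth_vec_on (product_atlas A B) \<Omega> f"
    and U: "(U, \<phi>) \<in> A" "a \<in> U" and V: "(V, \<psi>) \<in> B" "b \<in> V" and ab: "(a, b) \<in> \<Omega>"
  defines "K \<equiv> \<lambda>z. f (inv_into U \<phi> (fst z), inv_into V \<psi> (snd z))"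
  shows "coordinate_vector A (U, \<phi>) a u (\<lambda>a'. f (a', b)) = dd K (\<phi> a, \<psi> b) (u, 0)"
    and "coordinate_vector B (V, \<psi>) b w (\<lambda>b'. f (a, b')) = dd K (\<phi> a, \<psi> b) (0, w)"
    and "smooth_on (map_prod \<phi> \<psi> ` (U \<times> V \<inter> \<Omega>)) K"
proof -
  note P = smooth_atlas_product[OF A B]
  let ?S = "map_prod \<phi> \<psi> ` (U \<times> V \<inter> \<Omega>)"
  have S: "open ?S" by (rule openin_image[OF P smooth_vec_on_open[OF f] product_atlasI[OF U(1) V(1)]])
  show K: "smooth_on ?S K"
  proof (rule smooth_on_cong[OF smooth_vec_onD'[OF f product_atlasI[OF U(1) V(1)]] S])
    fix z assume "z \<in> ?S"
    then show "f (inv_into (U \<times> V) (map_prod \<phi> \<psi>) z) = K z"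
      using inv_into_map_prod[OF chart_inj[OF A U(1)] chart_inj[OF B V(1)], of "fst z" "snd z"]
      by (auto simp: K_def)
  qed
  have zS: "(\<phi> a, \<psi> b) \<in> ?S" using U V ab by force
  have dK: "K differentiable at (\<phi> a, \<psi> b)" by (rule smooth_on_differentiable[OF K zS])
  have a: "a \<in> points A" and b: "b \<in> points B" using chart_points U V by blast+
  note sl = slice_smooth[OF A B a b]
  have na: "smooth_near A a (\<lambda>a'. f (a', b))"
    by (rule smooth_nearI[OF smooth_vec_on_pullback[OF A P sl(2) f]]) (use a ab in simp)
  have nb: "smooth_near B b (\<lambda>b'. f (a, b'))"
    by (rule smooth_nearI[OF smooth_vec_on_pullback[OF B P sl(1) f]]) (use b ab in simp)
  have d1: "((\<lambda>s. (s, \<psi> b)) has_derivative (\<lambda>h. (h, 0))) (at (\<phi> a))"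
    by (auto intro!: derivative_eq_intros)
  have d2: "((\<lambda>t. (\<phi> a, t)) has_derivative (\<lambda>h. (0, h))) (at (\<psi> b))"
    by (auto intro!: derivative_eq_intros)
  have "coordinate_vector A (U, \<phi>) a u (\<lambda>a'. f (a', b)) = dd (\<lambda>s. K (s, \<psi> b)) (\<phi> a) u"
    by (simp add: coordinate_vector_smooth[OF na] K_def chart_inv[OF B V])
  also have "\<dots> = dd K (\<phi> a, \<psi> b) (u, 0)"
    by (rule dd_eq[OF has_derivative_compose[OF d1 frechet_derivative_worksI[OF dK]]])
  finally show "coordinate_vector A (U, \<phi>) a u (\<lambda>a'. f (a', b)) = dd K (\<phi> a, \<psi> b) (u, 0)" .
  have "coordinate_vector B (V, \<psi>) b w (\<lambda>b'. f (a, b')) = dd (\<lambda>t. K (\<phi> a, t)) (\<psi> b) w"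
    by (simp add: coordinate_vector_smooth[OF nb] K_def chart_inv[OF A U])
  also have "\<dots> = dd K (\<phi> a, \<psi> b) (0, w)"
    by (rule dd_eq[OF has_derivative_compose[OF d2 frechet_derivative_worksI[OF dK]]])
  finally show "coordinate_vector B (V, \<psi>) b w (\<lambda>b'. f (a, b')) = dd K (\<phi> a, \<psi> b) (0, w)" .
qed

text \<open>In the product chart the expression is a derivative of \<open>K\<close> in the fixed
  direction \<open>(u, 0)\<close>, hence smooth in the parameter. It yields the smoothness of left
  invariant and fundamental fields.\<close>

lemma smooth_partial:
  fixes A :: "('m, 'a::finite_dim_inner) atlas" and B :: "('n, 'b::finite_dim_inner) atlas"
  assumes A: "smooth_atlas A" and B: "smooth_atlas B"
    and f: "smooth_vec_on (product_atlas A B) \<Omega> f" and X: "X \<in> tangent_space A a"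
  shows "smooth_vec_on B {b. (a, b) \<in> \<Omega>} (\<lambda>b. X (\<lambda>a'. f (a', b)))"
proof (rule smooth_vec_on_local[OF B])
  fix b assume b: "b \<in> {b. (a, b) \<in> \<Omega>}"
  note P = smooth_atlas_product[OF A B]
  have a: "a \<in> points A" by (rule tangent_points[OF X])
  have bB: "b \<in> points B" using openin_imp_points[OF smooth_vec_on_open[OF f]] b by (auto simp: points_product)
  obtain U \<phi> where U: "(U, \<phi>) \<in> A" "a \<in> U" using points_chart[OF a] .
  obtain V \<psi> where V: "(V, \<psi>) \<in> B" "b \<in> V" using points_chart[OF bB] .
  obtain u where u: "X = coordinate_vector A (U, \<phi>) a u" using tangent_coordinate[OF A U X] by blast
  define K where "K = (\<lambda>z. f (inv_into U \<phi> (fst z), inv_into V \<psi> (snd z)))"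
  let ?W = "V \<inter> (points B \<inter> (\<lambda>b. (a, b)) -` \<Omega>)"
  have op: "openin (atlas_topology B) ?W"
    by (rule openin_Int[OF openin_chart[OF B V(1)]
        smooth_map_on_vimage[OF B P slice_smooth(1)[OF A B a bB] smooth_vec_on_open[OF f]]])
  have eq: "X (\<lambda>a'. f (a', b')) = dd K (\<phi> a, \<psi> b') (u, 0)" if "b' \<in> ?W" for b'
    unfolding u K_def using partial_vector_chart(1)[OF A B f U V(1)] that by simp
  have K: "smooth_on (map_prod \<phi> \<psi> ` (U \<times> V \<inter> \<Omega>)) K"
    unfolding K_def using partial_vector_chart(3)[OF A B f U V] b by simp
  have "smooth_vec_on B ?W (\<lambda>b'. (\<phi> a, \<psi> b'))"
    by (intro smooth_vec_on_Pair[OF B] smooth_vec_on_const op smooth_vec_on_subset[OF smooth_vec_on_chart[OF B V(1)] op]) auto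
  then have "smooth_vec_on B ?W (\<lambda>b'. dd K (\<phi> a, \<psi> b') (u, 0))"
    by (rule smooth_vec_on_compose[OF B _ smooth_on_dd[OF K]]) (use U in force)
  then have "smooth_vec_on B ?W (\<lambda>b. X (\<lambda>a'. f (a', b)))"
    by (rule smooth_vec_on_cong[OF B]) (simp add: eq)
  then show "\<exists>W'. b \<in> W' \<and> W' \<subseteq> {b. (a, b) \<in> \<Omega>} \<and> smooth_vec_on B W' (\<lambda>b. X (\<lambda>a'. f (a', b)))"
    using b V bB by (intro exI[of _ ?W] conjI) auto
qed

text \<open>In the product chart both sides are second derivatives of \<open>K\<close> along
  \<open>(u, 0)\<close> and \<open>(0, w)\<close>. With a group as first factor it yields the
  bracket of fundamental fields and the derivation property of the canonical bracket.\<close>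

lemma partial_commute:
  fixes A :: "('m, 'a::finite_dim_inner) atlas" and B :: "('n, 'b::finite_dim_inner) atlas"
  assumes A: "smooth_atlas A" and B: "smooth_atlas B"
    and f: "smooth_vec_on (product_atlas A B) \<Omega> f"
    and X: "X \<in> tangent_space A a" and Y: "Y \<in> tangent_space B b" and ab: "(a, b) \<in> \<Omega>"
  shows "X (\<lambda>a'. Y (\<lambda>b'. f (a', b'))) = Y (\<lambda>b'. X (\<lambda>a'. f (a', b')))"
proof -
  note P = smooth_atlas_product[OF A B]
  have a: "a \<in> points A" by (rule tangent_points[OF X])
  have b: "b \<in> points B" by (rule tangent_points[OF Y])
  obtain U \<phi> where U: "(U, \<phi>) \<in> A" "a \<in> U" using points_chart[OF a] .
  obtain V \<psi> where V: "(V, \<psi>) \<in> B" "b \<in> V" using points_chart[OF b] .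
  obtain u where u: "X = coordinate_vector A (U, \<phi>) a u" using tangent_coordinate[OF A U X] by blast
  obtain w where w: "Y = coordinate_vector B (V, \<psi>) b w" using tangent_coordinate[OF B V Y] by blast
  define K where "K = (\<lambda>z. f (inv_into U \<phi> (fst z), inv_into V \<psi> (snd z)))"
  let ?S = "map_prod \<phi> \<psi> ` (U \<times> V \<inter> \<Omega>)"
  have S: "open ?S" by (rule openin_image[OF P smooth_vec_on_open[OF f] product_atlasI[OF U(1) V(1)]])
  have K: "smooth_on ?S K"
    unfolding K_def by (rule partial_vector_chart(3)[OF A B f U V ab])
  let ?z = "(\<phi> a, \<psi> b)"
  have zS: "?z \<in> ?S" using U V ab by force
  have d: "((\<lambda>t. (\<phi> a, t)) has_derivative (\<lambda>h. (0, h))) (at (\<psi> b))" "((\<lambda>s. (s, \<psi> b)) has_derivative (\<lambda>h. (h, 0))) (at (\<phi> a))"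
    by (auto intro!: derivative_eq_intros)
  have "X (\<lambda>a'. Y (\<lambda>b'. f (a', b'))) = dd (\<lambda>z. dd K z (0, w)) ?z (u, 0)"
  proof -
    let ?W = "U \<inter> (points A \<inter> (\<lambda>a. (a, b)) -` \<Omega>)" and ?T = "(\<lambda>s. (s, \<psi> b)) -` ?S"
    have op: "openin (atlas_topology A) ?W"
      by (rule openin_Int[OF openin_chart[OF A U(1)]
          smooth_map_on_vimage[OF A P slice_smooth(2)[OF A B a b] smooth_vec_on_open[OF f]]])
    have T: "open ?T" by (rule open_vimage[OF S]) (intro continuous_intros)
    have "X (\<lambda>a'. Y (\<lambda>b'. f (a', b'))) = X (\<lambda>a'. dd K (\<phi> a', \<psi> b) (0, w))"
      by (rule tangent_cong[OF A X op])
        (use U V a ab partial_vector_chart(2)[OF A B f U(1) _ V] in \<open>auto simp: w K_def\<close>)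
    also have "\<dots> = dd (\<lambda>s. dd K (s, \<psi> b) (0, w)) (\<phi> a) u"
      unfolding u
    proof (rule coordinate_vector_compose_chart[OF A U T])
      show "smooth_on ?T (\<lambda>s. dd K (s, \<psi> b) (0, w))"
        by (rule smooth_on_compose[OF T smooth_on_Pair[OF T smooth_on_id smooth_on_const] smooth_on_dd[OF K]]) auto
    qed (use zS in simp)
    also have "\<dots> = dd (\<lambda>z. dd K z (0, w)) ?z (u, 0)"
      by (rule dd_eq[OF has_derivative_compose[OF d(2) smooth_on_has_derivative[OF smooth_on_dd[OF K] zS]]])
    finally show ?thesis .
  qed
  moreover have "Y (\<lambda>b'. X (\<lambda>a'. f (a', b'))) = dd (\<lambda>z. dd K z (u, 0)) ?z (0, w)"
  proof -
    let ?W = "V \<inter> (points B \<inter> (\<lambda>b. (a, b)) -` \<Omega>)" and ?T = "(\<lambda>t. (\<phi> a, t)) -` ?S"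
    have op: "openin (atlas_topology B) ?W"
      by (rule openin_Int[OF openin_chart[OF B V(1)]
          smooth_map_on_vimage[OF B P slice_smooth(1)[OF A B a b] smooth_vec_on_open[OF f]]])
    have T: "open ?T" by (rule open_vimage[OF S]) (intro continuous_intros)
    have "Y (\<lambda>b'. X (\<lambda>a'. f (a', b'))) = Y (\<lambda>b'. dd K (\<phi> a, \<psi> b') (u, 0))"
      by (rule tangent_cong[OF B Y op])
        (use U V b ab partial_vector_chart(1)[OF A B f U V(1)] in \<open>auto simp: u K_def\<close>)
    also have "\<dots> = dd (\<lambda>t. dd K (\<phi> a, t) (u, 0)) (\<psi> b) w"
      unfolding w
    proof (rule coordinate_vector_compose_chart[OF B V T])
      show "smooth_on ?T (\<lambda>t. dd K (\<phi> a, t) (u, 0))"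
        by (rule smooth_on_compose[OF T smooth_on_Pair[OF T smooth_on_const smooth_on_id] smooth_on_dd[OF K]]) auto
    qed (use zS in simp)
    also have "\<dots> = dd (\<lambda>z. dd K z (u, 0)) ?z (0, w)"
      by (rule dd_eq[OF has_derivative_compose[OF d(1) smooth_on_has_derivative[OF smooth_on_dd[OF K] zS]]])
    finally show ?thesis .
  qed
  ultimately show ?thesis using dd_commute[OF S K zS] by simp
qed

section \<open>Bivectors\<close>

lemma form_lists_2: "\<alpha> \<in> dual_space V \<Longrightarrow> \<beta> \<in> dual_space V \<Longrightarrow> [\<alpha>, \<beta>] \<in> form_lists 2 V"
  by (simp add: form_lists_def)

lemma form_lists_2E:
  assumes "\<alpha>s \<in> form_lists 2 V"
  obtains \<alpha> \<beta> where "\<alpha>s = [\<alpha>, \<beta>]" "\<alpha> \<in> dual_space V" "\<beta> \<in> dual_space V"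
proof -
  have "length \<alpha>s = Suc (Suc 0)" "set \<alpha>s \<subseteq> dual_space V" using assms by (auto simp: form_lists_def)
  then show ?thesis using that by (auto simp: length_Suc_conv)
qed

lemma form_lists_3E:
  assumes "\<alpha>s \<in> form_lists 3 V"
  obtains \<alpha> \<beta> \<gamma> where "\<alpha>s = [\<alpha>, \<beta>, \<gamma>]" "\<alpha> \<in> dual_space V" "\<beta> \<in> dual_space V" "\<gamma> \<in> dual_space V"
proof -
  have "length \<alpha>s = Suc (Suc (Suc 0))" "set \<alpha>s \<subseteq> dual_space V" using assms by (auto simp: form_lists_def)
  then show ?thesis using that by (auto simp: length_Suc_conv)
qed

lemma dual_space_lincomb:
  assumes "\<alpha> \<in> dual_space V" "\<beta> \<in> dual_space V"
  shows "lincomb a \<alpha> b \<beta> \<in> dual_space V"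
proof -
  have 1: "lincomb a \<alpha> b \<beta> (lincomb c u d v) = c * lincomb a \<alpha> b \<beta> u + d * lincomb a \<alpha> b \<beta> v"
    if "u \<in> V" "v \<in> V" for u v c d
    using dual_lincomb[OF assms(1) that, of c d] dual_lincomb[OF assms(2) that, of c d]
    unfolding lincomb_def[of a \<alpha>] by (simp add: algebra_simps)
  have "\<alpha> u = 0 \<and> \<beta> u = 0" if "u \<notin> V" for u using assms that unfolding dual_space_def by blast
  then have 2: "lincomb a \<alpha> b \<beta> u = 0" if "u \<notin> V" for u using that by (simp add: lincomb_def)
  show ?thesis unfolding dual_space_def using 1 2 by blast
qed

lemma dual_space_zero: "(\<lambda>v. 0) \<in> dual_space V"
  by (simp add: dual_space_def)

lemma dual_space_sum:
  assumes "finite I" "\<And>i. i \<in> I \<Longrightarrow> e i \<in> dual_space V"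
  shows "(\<lambda>v. \<Sum>i\<in>I. c i * e i v) \<in> dual_space V"
  using assms
proof (induction I rule: finite_induct)
  case empty
  show ?case by (simp add: dual_space_zero)
next
  case (insert i I)
  have "lincomb (c i) (e i) 1 (\<lambda>v. \<Sum>i\<in>I. c i * e i v) \<in> dual_space V"
    using insert by (intro dual_space_lincomb) auto
  then show ?case using insert.hyps by (simp add: lincomb_def)
qed

lemma exterior_powerD:
  assumes "w \<in> exterior_power k V" "\<alpha>s \<in> form_lists k V"
  shows "i < k \<Longrightarrow> \<beta> \<in> dual_space V \<Longrightarrow> \<gamma> \<in> dual_space V \<Longrightarrow>
      w (\<alpha>s[i := lincomb a \<beta> b \<gamma>]) = a * w (\<alpha>s[i := \<beta>]) + b * w (\<alpha>s[i := \<gamma>])"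
    and "\<not> distinct \<alpha>s \<Longrightarrow> w \<alpha>s = 0"
  using assms unfolding exterior_power_def by blast+

lemma exterior_power_off: "w \<in> exterior_power k V \<Longrightarrow> \<alpha>s \<notin> form_lists k V \<Longrightarrow> w \<alpha>s = 0"
  unfolding exterior_power_def by blast

lemma bivector_lincomb:
  assumes "w \<in> exterior_power 2 V" "\<alpha> \<in> dual_space V" "\<beta> \<in> dual_space V" "\<gamma> \<in> dual_space V"
  shows "w [lincomb a \<alpha> b \<beta>, \<gamma>] = a * w [\<alpha>, \<gamma>] + b * w [\<beta>, \<gamma>]"
    and "w [\<gamma>, lincomb a \<alpha> b \<beta>] = a * w [\<gamma>, \<alpha>] + b * w [\<gamma>, \<beta>]"
  using exterior_powerD(1)[OF assms(1) form_lists_2[OF assms(2,4)], of 0 \<alpha> \<beta> a b]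
    exterior_powerD(1)[OF assms(1) form_lists_2[OF assms(4,2)], of 1 \<alpha> \<beta> a b] assms
  by simp_all

text \<open>Polarization: \<open>w\<close> vanishes on the pair whose entries are both
  \<open>\<alpha> + \<beta>\<close>.\<close>

lemma bivector_antisym:
  assumes w: "w \<in> exterior_power 2 V" and \<alpha>: "\<alpha> \<in> dual_space V" and \<beta>: "\<beta> \<in> dual_space V"
  shows "w [\<alpha>, \<beta>] = - w [\<beta>, \<alpha>]"
proof -
  have 0: "w [\<gamma>, \<gamma>] = 0" if "\<gamma> \<in> dual_space V" for \<gamma>
    using exterior_powerD(2)[OF w form_lists_2[OF that that]] by simp
  let ?\<gamma> = "lincomb 1 \<alpha> 1 \<beta>"
  have \<gamma>: "?\<gamma> \<in> dual_space V" by (rule dual_space_lincomb[OF \<alpha> \<beta>])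
  have "w [?\<gamma>, ?\<gamma>] = w [\<alpha>, \<beta>] + w [\<beta>, \<alpha>]"
    using bivector_lincomb(1)[OF w \<alpha> \<beta> \<gamma>, of 1 1] bivector_lincomb(2)[OF w \<alpha> \<beta> \<alpha>, of 1 1]
      bivector_lincomb(2)[OF w \<alpha> \<beta> \<beta>, of 1 1] 0[OF \<alpha>] 0[OF \<beta>] by simp
  then show ?thesis using 0[OF \<gamma>] by simp
qed

lemma bivector_sum_left:
  assumes w: "w \<in> exterior_power 2 V" and "finite I" "\<And>i. i \<in> I \<Longrightarrow> e i \<in> dual_space V" and \<beta>: "\<beta> \<in> dual_space V"
  shows "w [\<lambda>v. \<Sum>i\<in>I. c i * e i v, \<beta>] = (\<Sum>i\<in>I. c i * w [e i, \<beta>])"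
  using assms(2,3)
proof (induction I rule: finite_induct)
  case empty
  have "lincomb 0 \<beta> 0 \<beta> = (\<lambda>v. 0)" by (simp add: lincomb_def)
  then show ?case using bivector_lincomb(1)[OF w \<beta> \<beta> \<beta>, of 0 0] by simp
next
  case (insert i I)
  have "w [lincomb (c i) (e i) 1 (\<lambda>v. \<Sum>i\<in>I. c i * e i v), \<beta>] = c i * w [e i, \<beta>] + 1 * w [\<lambda>v. \<Sum>i\<in>I. c i * e i v, \<beta>]"
    using insert by (intro bivector_lincomb(1)[OF w] dual_space_sum \<beta>) auto
  then show ?case using insert.hyps insert.IH[OF insert.prems[OF insertI2]] by (simp add: lincomb_def)
qed

lemma bivector_sum_right:
  assumes w: "w \<in> exterior_power 2 V" and I: "finite I" "\<And>i. i \<in> I \<Longrightarrow> e i \<in> dual_space V" and \<beta>: "\<beta> \<in> dual_space V"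
  shows "w [\<beta>, \<lambda>v. \<Sum>i\<in>I. c i * e i v] = (\<Sum>i\<in>I. c i * w [\<beta>, e i])"
proof -
  have "w [\<beta>, \<lambda>v. \<Sum>i\<in>I. c i * e i v] = - w [\<lambda>v. \<Sum>i\<in>I. c i * e i v, \<beta>]"
    by (rule bivector_antisym[OF w \<beta> dual_space_sum[OF I]])
  also have "\<dots> = (\<Sum>i\<in>I. c i * (- w [e i, \<beta>]))"
    by (subst bivector_sum_left[OF w I \<beta>]) (simp_all add: sum_negf)
  also have "\<dots> = (\<Sum>i\<in>I. c i * w [\<beta>, e i])"
    by (rule sum.cong) (use bivector_antisym[OF w \<beta> I(2)] in auto)
  finally show ?thesis .
qed

lemma covector_expand:
  assumes A: "smooth_atlas A" and U: "(U, \<phi>) \<in> A" "x \<in> U" and \<alpha>: "\<alpha> \<in> cotangent_space A x"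
  shows "\<alpha> = (\<lambda>v. \<Sum>i\<in>onb. \<alpha> (coordinate_vector A (U, \<phi>) x i) * fun_differential A x (\<lambda>y. inner (\<phi> y) i) v)"
proof
  fix v
  let ?\<epsilon> = "\<lambda>i. fun_differential A x (\<lambda>y. inner (\<phi> y) i)"
  show "\<alpha> v = (\<Sum>i\<in>onb. \<alpha> (coordinate_vector A (U, \<phi>) x i) * ?\<epsilon> i v)"
  proof (cases "v \<in> tangent_space A x")
    case True
    obtain u where u: "v = coordinate_vector A (U, \<phi>) x u" using tangent_coordinate[OF A U True] by blast
    have "?\<epsilon> i v = inner u i" for i
      using True coordinate_vector_coordinate[OF A U, of u i] by (simp add: fun_differential_def u)
    then show ?thesis using dual_expand[OF A U \<alpha>, of u] u by (simp add: mult.commute)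
  next
    case False
    then have "\<alpha> v = 0" using \<alpha> by (simp add: dual_space_def)
    then show ?thesis using False by (simp add: fun_differential_def)
  qed
qed

lemma bivector_expand_left:
  assumes A: "smooth_atlas A" and U: "(U, \<phi>) \<in> A" "x \<in> U"
    and w: "w \<in> exterior_power 2 (tangent_space A x)"
    and \<alpha>: "\<alpha> \<in> cotangent_space A x" and \<beta>: "\<beta> \<in> cotangent_space A x"
  shows "w [\<alpha>, \<beta>] = (\<Sum>i\<in>onb. \<alpha> (coordinate_vector A (U, \<phi>) x i) * w [fun_differential A x (\<lambda>y. inner (\<phi> y) i), \<beta>])"
  by (subst covector_expand[OF A U \<alpha>]) (rule bivector_sum_left[OF w finite_onb fun_differential_dual[OF A] \<beta>])

lemma bivector_expand:
  assumes A: "smooth_atlas A" and U: "(U, \<phi>) \<in> A" "x \<in> U"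
    and w: "w \<in> exterior_power 2 (tangent_space A x)"
    and \<alpha>: "\<alpha> \<in> cotangent_space A x" and \<beta>: "\<beta> \<in> cotangent_space A x"
  shows "w [\<alpha>, \<beta>] = (\<Sum>i\<in>onb. \<Sum>j\<in>onb.
    w [fun_differential A x (\<lambda>y. inner (\<phi> y) i), fun_differential A x (\<lambda>y. inner (\<phi> y) j)] *
    \<alpha> (coordinate_vector A (U, \<phi>) x i) * \<beta> (coordinate_vector A (U, \<phi>) x j))"
proof -
  let ?\<epsilon> = "\<lambda>i. fun_differential A x (\<lambda>y. inner (\<phi> y) i)"
  have "w [?\<epsilon> i, \<beta>] = (\<Sum>j\<in>onb. \<beta> (coordinate_vector A (U, \<phi>) x j) * w [?\<epsilon> i, ?\<epsilon> j])" for i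
    by (subst covector_expand[OF A U \<beta>])
      (rule bivector_sum_right[OF w finite_onb fun_differential_dual[OF A] fun_differential_dual[OF A]])
  then show ?thesis
    unfolding bivector_expand_left[OF A U w \<alpha> \<beta>] by (simp add: sum_distrib_left mult_ac)
qed

section \<open>Explicit wedge products in degrees two and three\<close>

lemma sum_permutes_2:
  "(\<Sum>p | p permutes {..<2::nat}. f p) = f id + f (Transposition.transpose 0 1)"
proof -
  have e: "{..<2::nat} = insert 0 {1}" by auto
  show ?thesis
    unfolding e by (subst sum_over_permutations_insert) (simp_all add: permutes_sing)
qed

lemma sum_permutes_3:
  "(\<Sum>p | p permutes {..<3::nat}. f p) =
     f id + f (Transposition.transpose 1 2) + f (Transposition.transpose 0 1) +
     f (Transposition.transpose 0 1 \<circ> Transposition.transpose 1 2) + f (Transposition.transpose 0 2) +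
     f (Transposition.transpose 0 2 \<circ> Transposition.transpose 1 2)"
proof -
  have e: "{..<3::nat} = insert 0 (insert 1 {2})" by auto
  show ?thesis
    unfolding e
    by (subst sum_over_permutations_insert, simp, simp, subst sum_over_permutations_insert)
      (simp_all add: permutes_sing sum_over_permutations_insert add_ac)
qed

lemma wedge_2:
  "wedge V [u, v] \<alpha>s =
    (if \<alpha>s \<in> form_lists 2 V then (\<alpha>s ! 0) u * (\<alpha>s ! 1) v - (\<alpha>s ! 1) u * (\<alpha>s ! 0) v else 0)"
proof -
  have l: "length [u, v] = 2" by simp
  have t: "{..<2::nat} = {0, 1}" by auto
  show ?thesis
    unfolding wedge_def l sum_permutes_2 by (simp add: t sign_swap_id mult.commute)
qed

text \<open>The determinant expanded along \<open>u\<close>, the place taken by the bracket in the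
  Schouten formula.\<close>

lemma wedge_3:
  assumes "\<alpha> \<in> dual_space V" "\<beta> \<in> dual_space V" "\<gamma> \<in> dual_space V"
  shows "wedge V [u, v, w] [\<alpha>, \<beta>, \<gamma>] =
    \<alpha> u * (\<beta> v * \<gamma> w - \<gamma> v * \<beta> w) - \<beta> u * (\<alpha> v * \<gamma> w - \<gamma> v * \<alpha> w) + \<gamma> u * (\<alpha> v * \<beta> w - \<beta> v * \<alpha> w)"
proof -
  have l: "length [u, v, w] = 3" by simp
  have f: "[\<alpha>, \<beta>, \<gamma>] \<in> form_lists 3 V" using assms by (simp add: form_lists_def)
  have s: "sign (Transposition.transpose a b \<circ> Transposition.transpose c d) =
    sign (Transposition.transpose a b) * sign (Transposition.transpose c d)" for a b c d :: nat
    by (rule sign_compose) (rule permutation_swap_id)+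
  have t: "{..<3::nat} = {0, 1, 2}" by auto
  show ?thesis
    unfolding wedge_def l sum_permutes_3 using f
    by (simp add: s sign_swap_id t Transposition.transpose_def) (simp add: algebra_simps)
qed

lemma exterior_power_2I:
  assumes "\<And>\<alpha>s. \<alpha>s \<notin> form_lists 2 V \<Longrightarrow> w \<alpha>s = 0"
    and "\<And>\<alpha>. \<alpha> \<in> dual_space V \<Longrightarrow> w [\<alpha>, \<alpha>] = 0"
    and "\<And>\<alpha> \<beta> \<gamma> a b. \<alpha> \<in> dual_space V \<Longrightarrow> \<beta> \<in> dual_space V \<Longrightarrow> \<gamma> \<in> dual_space V \<Longrightarrow>
      w [lincomb a \<alpha> b \<beta>, \<gamma>] = a * w [\<alpha>, \<gamma>] + b * w [\<beta>, \<gamma>]"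
    and "\<And>\<alpha> \<beta> \<gamma> a b. \<alpha> \<in> dual_space V \<Longrightarrow> \<beta> \<in> dual_space V \<Longrightarrow> \<gamma> \<in> dual_space V \<Longrightarrow>
      w [\<gamma>, lincomb a \<alpha> b \<beta>] = a * w [\<gamma>, \<alpha>] + b * w [\<gamma>, \<beta>]"
  shows "w \<in> exterior_power 2 V"
  unfolding exterior_power_def
proof (intro CollectI conjI ballI allI impI)
  fix \<alpha>s i \<beta> \<gamma> a b assume "\<alpha>s \<in> form_lists 2 V" and i: "i < (2::nat)" and bg: "\<beta> \<in> dual_space V" "\<gamma> \<in> dual_space V"
  then obtain \<alpha> \<alpha>' where a: "\<alpha>s = [\<alpha>, \<alpha>']" "\<alpha> \<in> dual_space V" "\<alpha>' \<in> dual_space V" by (elim form_lists_2E)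
  from i have "i = 0 \<or> i = 1" by auto
  then show "w (\<alpha>s[i := lincomb a \<beta> b \<gamma>]) = a * w (\<alpha>s[i := \<beta>]) + b * w (\<alpha>s[i := \<gamma>])"
    using assms(3)[OF bg a(3)] assms(4)[OF bg a(2)] a(1) by auto
next
  fix \<alpha>s assume "\<alpha>s \<in> form_lists 2 V" "\<not> distinct \<alpha>s"
  then show "w \<alpha>s = 0" using assms(2) by (elim form_lists_2E) auto
qed (rule assms(1))

lemma wedge_exterior: "wedge V [u, v] \<in> exterior_power 2 V"
  by (rule exterior_power_2I) (simp_all add: wedge_2 form_lists_2 dual_space_lincomb, simp_all add: lincomb_def algebra_simps)

lemma exterior_power_add:
  assumes "w \<in> exterior_power 2 V" "w' \<in> exterior_power 2 V"
  shows "(\<lambda>\<alpha>s. w \<alpha>s + w' \<alpha>s) \<in> exterior_power 2 V"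
proof (rule exterior_power_2I)
  show "w \<alpha>s + w' \<alpha>s = 0" if "\<alpha>s \<notin> form_lists 2 V" for \<alpha>s
    using exterior_power_off[OF assms(1) that] exterior_power_off[OF assms(2) that] by simp
  show "w [\<alpha>, \<alpha>] + w' [\<alpha>, \<alpha>] = 0" if "\<alpha> \<in> dual_space V" for \<alpha>
    using bivector_antisym[OF assms(1) that that] bivector_antisym[OF assms(2) that that] by simp
qed (simp_all add: bivector_lincomb[OF assms(1)] bivector_lincomb[OF assms(2)] algebra_simps)

lemma exterior_power_zero: "(\<lambda>\<alpha>s. 0) \<in> exterior_power 2 V"
  by (rule exterior_power_2I) simp_all

lemma exterior_power_sum:
  assumes "finite I" "\<And>i. i \<in> I \<Longrightarrow> w i \<in> exterior_power 2 V"
  shows "(\<lambda>\<alpha>s. \<Sum>i\<in>I. w i \<alpha>s) \<in> exterior_power 2 V"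
  using assms
  by (induction I rule: finite_induct) (simp_all add: exterior_power_zero exterior_power_add)

lemma pull_covec_lincomb:
  "pull_covec A B F x (lincomb a \<alpha> b \<beta>) = lincomb a (pull_covec A B F x \<alpha>) b (pull_covec A B F x \<beta>)"
  by (auto simp: pull_covec_def lincomb_def)

lemma push_mvec_exterior:
  fixes B :: "('n, 'b::finite_dim_inner) atlas"
  assumes A: "smooth_atlas A" and B: "smooth_atlas B" and F: "smooth_map_on A W B F" "x \<in> W"
    and w: "w \<in> exterior_power 2 (tangent_space A x)"
  shows "push_mvec A B F x w \<in> exterior_power 2 (tangent_space B (F x))"
proof (rule exterior_power_2I)
  let ?p = "pull_covec A B F x"
  note p = pull_covec_dual[OF A B F]
  show "push_mvec A B F x w \<alpha>s = 0" if "\<alpha>s \<notin> form_lists 2 (tangent_space B (F x))" for \<alpha>s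
  proof (cases "set \<alpha>s \<subseteq> cotangent_space B (F x)")
    case True
    then have "map ?p \<alpha>s \<notin> form_lists 2 (tangent_space A x)" using that by (simp add: form_lists_def)
    then show ?thesis using exterior_power_off[OF w] by (simp add: push_mvec_def)
  qed (simp add: push_mvec_def)
  show "push_mvec A B F x w [\<alpha>, \<alpha>] = 0" if "\<alpha> \<in> cotangent_space B (F x)" for \<alpha>
    using bivector_antisym[OF w p[OF that] p[OF that]] by (simp add: push_mvec_def)
qed (simp_all add: push_mvec_def dual_space_lincomb pull_covec_lincomb bivector_lincomb[OF w] pull_covec_dual[OF A B F])

text \<open>Provides the witness for the decomposition that \<open>algebraic_schouten\<close>
  chooses.\<close>

lemma bivector_decomposition:
  assumes A: "smooth_atlas A" and x: "x \<in> points A"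
    and w: "w \<in> exterior_power 2 (tangent_space A x)"
  shows "\<exists>Xs. is_decomposition 2 (tangent_space A x) w Xs"
proof -
  let ?V = "tangent_space A x"
  obtain U \<phi> where U: "(U, \<phi>) \<in> A" "x \<in> U" using points_chart[OF x] .
  obtain es where es: "set es = (onb :: 'b set)" "distinct es" using finite_distinct_list[OF finite_onb] by blast
  define R where "R = (\<lambda>i j. w [fun_differential A x (\<lambda>y. inner (\<phi> y) i), fun_differential A x (\<lambda>y. inner (\<phi> y) j)])"
  have R: "R j i = - R i j" for i j
    unfolding R_def by (rule bivector_antisym[OF w fun_differential_dual[OF A] fun_differential_dual[OF A]])
  let ?c = "coordinate_vector A (U, \<phi>) x"
  \<comment> \<open>Every pair of coordinates occurs in both orders, hence the division by 2; a
    decomposition has no coefficients, so the scalar goes into the first vector.\<close>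
  define t where "t = (\<lambda>(i, j). [?c ((R i j / 2) *\<^sub>R i), ?c j])"
  define Xs where "Xs = map t (List.product es es)"
  have c: "?c u \<in> ?V" for u by (rule coordinate_vector_tangent[OF A U])
  have "length xs = 2 \<and> set xs \<subseteq> ?V" if "xs \<in> set Xs" for xs
    using that c by (auto simp: Xs_def t_def)
  moreover have "w \<alpha>s = (\<Sum>xs\<leftarrow>Xs. wedge ?V xs \<alpha>s)" for \<alpha>s
  proof -
    have "(\<Sum>xs\<leftarrow>Xs. wedge ?V xs \<alpha>s) = (\<Sum>p\<in>onb \<times> onb. wedge ?V (t p) \<alpha>s)"
      unfolding Xs_def map_map o_def
      by (subst sum_list_distinct_conv_sum_set) (simp_all add: es distinct_product)
    also have "\<dots> = (\<Sum>i\<in>onb. \<Sum>j\<in>onb. wedge ?V [?c ((R i j / 2) *\<^sub>R i), ?c j] \<alpha>s)"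
      by (simp add: sum.cartesian_product t_def split_beta)
    finally have s: "(\<Sum>xs\<leftarrow>Xs. wedge ?V xs \<alpha>s) = (\<Sum>i\<in>onb. \<Sum>j\<in>onb. wedge ?V [?c ((R i j / 2) *\<^sub>R i), ?c j] \<alpha>s)" .
    show ?thesis
    proof (cases "\<alpha>s \<in> form_lists 2 ?V")
      case True
      then obtain \<alpha> \<beta> where ab: "\<alpha>s = [\<alpha>, \<beta>]" "\<alpha> \<in> dual_space ?V" "\<beta> \<in> dual_space ?V" by (rule form_lists_2E)
      have sc: "\<alpha> (?c (a *\<^sub>R i)) = a * \<alpha> (?c i)" if "\<alpha> \<in> dual_space ?V" for \<alpha> a i
        using coordinate_vector_lincomb[OF A U, of a i 0 i] dual_lincomb[OF that c c, of a i 0 i] by simp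
      have "(\<Sum>i\<in>onb. \<Sum>j\<in>onb. wedge ?V [?c ((R i j / 2) *\<^sub>R i), ?c j] \<alpha>s) =
        (\<Sum>i\<in>onb. \<Sum>j\<in>onb. R i j * \<alpha> (?c i) * \<beta> (?c j) / 2 - R i j * \<beta> (?c i) * \<alpha> (?c j) / 2)"
        using True by (intro sum.cong refl) (simp add: wedge_2 ab sc)
      also have "\<dots> = (\<Sum>i\<in>onb. \<Sum>j\<in>onb. R i j * \<alpha> (?c i) * \<beta> (?c j) / 2) -
          (\<Sum>i\<in>onb. \<Sum>j\<in>onb. R i j * \<beta> (?c i) * \<alpha> (?c j) / 2)"
        by (simp add: sum_subtractf)
      also have "(\<Sum>i\<in>onb. \<Sum>j\<in>onb. R i j * \<beta> (?c i) * \<alpha> (?c j) / 2) =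
          (\<Sum>j\<in>onb. \<Sum>i\<in>onb. R i j * \<beta> (?c i) * \<alpha> (?c j) / 2)" by (rule sum.swap)
      also have "\<dots> = - (\<Sum>i\<in>onb. \<Sum>j\<in>onb. R i j * \<alpha> (?c i) * \<beta> (?c j) / 2)"
        unfolding sum_negf[symmetric]
        by (intro sum.cong refl) (subst R, simp add: mult_ac)
      also have "(\<Sum>i\<in>onb. \<Sum>j\<in>onb. R i j * \<alpha> (?c i) * \<beta> (?c j) / 2) - - (\<Sum>i\<in>onb. \<Sum>j\<in>onb. R i j * \<alpha> (?c i) * \<beta> (?c j) / 2)
          = (\<Sum>i\<in>onb. \<Sum>j\<in>onb. R i j * \<alpha> (?c i) * \<beta> (?c j))"
        by (simp add: sum.distrib[symmetric] mult.assoc)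
      also have "\<dots> = w \<alpha>s" unfolding ab R_def by (rule bivector_expand[OF A U w ab(2,3), symmetric])
      finally show ?thesis using s by simp
    next
      case False
      then show ?thesis using s exterior_power_off[OF w False] by (simp add: wedge_2)
    qed
  qed
  ultimately show ?thesis unfolding is_decomposition_def by blast
qed

lemma sum_list_nth: "(\<Sum>x\<leftarrow>xs. f x) = (\<Sum>i<length xs. f (xs ! i))"
  by (simp add: sum_list_sum_nth atLeast0LessThan)

text \<open>\<open>c\<close> has one antisymmetric block with entries \<open>1\<close> and
  \<open>- 1\<close> for each \<open>n\<close>. It rewrites a sum of simple wedges as a double sum
  with antisymmetric coefficients, both for \<open>r\<close> and for the canonical
  structure.\<close>

lemma sum_UNIV_bool_pairs:
  fixes H :: "'n \<times> bool \<Rightarrow> 'n \<times> bool \<Rightarrow> real"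
  defines "c \<equiv> \<lambda>p q :: 'n \<times> bool. if fst p = fst q \<and> snd p \<noteq> snd q then (if snd p then - 1 else 1 :: real) else 0"
  assumes "finite N"
  shows "(\<Sum>p\<in>N \<times> UNIV. \<Sum>q\<in>N \<times> UNIV. c p q * H p q) =
    (\<Sum>n\<in>N. H (n, False) (n, True) - H (n, True) (n, False))"
proof -
  have "(\<Sum>q\<in>N \<times> UNIV. c p q * H p q) = c p (fst p, \<not> snd p) * H p (fst p, \<not> snd p)"
    if "p \<in> N \<times> UNIV" for p
  proof -
    have "(\<Sum>q\<in>N \<times> UNIV. c p q * H p q) = (\<Sum>q\<in>{(fst p, \<not> snd p)}. c p q * H p q)"
      using that assms(2) by (intro sum.mono_neutral_right) (auto simp: c_def)
    then show ?thesis by simp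
  qed
  then have "(\<Sum>p\<in>N \<times> UNIV. \<Sum>q\<in>N \<times> UNIV. c p q * H p q) =
      (\<Sum>p\<in>N \<times> UNIV. c p (fst p, \<not> snd p) * H p (fst p, \<not> snd p))"
    by (rule sum.cong[OF refl])
  also have "\<dots> = (\<Sum>n\<in>N. \<Sum>b\<in>UNIV. c (n, b) (n, \<not> b) * H (n, b) (n, \<not> b))"
    by (simp add: sum.cartesian_product split_beta)
  also have "\<dots> = (\<Sum>n\<in>N. H (n, False) (n, True) - H (n, True) (n, False))"
    by (simp add: UNIV_bool c_def)
  finally show ?thesis .
qed

text \<open>The same decomposition of \<open>r\<close> is chosen in both arguments of the bracket, so it can serve as
  a (not necessarily linearly independent) frame in which both \<open>r\<close> and \<open>[r, r]\<close> are expressed.\<close>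

lemma schouten_frame:
  assumes A: "smooth_atlas A" and x: "x \<in> points A"
    and w: "w \<in> exterior_power 2 (tangent_space A x)"
    and schouten: "algebraic_schouten (tangent_space A x) br 2 w 2 w = (\<lambda>\<alpha>s. 0)"
  obtains I :: "(nat \<times> bool) set" and e c where "finite I" "\<And>i. i \<in> I \<Longrightarrow> e i \<in> tangent_space A x"
    "\<And>i j. c j i = - c i j"
    "\<And>\<alpha> \<beta>. \<alpha> \<in> cotangent_space A x \<Longrightarrow> \<beta> \<in> cotangent_space A x \<Longrightarrow>
      w [\<alpha>, \<beta>] = (\<Sum>i\<in>I. \<Sum>j\<in>I. c i j * (\<alpha> (e i) * \<beta> (e j)))"
    "\<And>\<alpha>s. (\<Sum>i\<in>I. \<Sum>j\<in>I. c i j * (\<Sum>k\<in>I. \<Sum>l\<in>I. c k l * wedge (tangent_space A x) [br (e i) (e k), e j, e l] \<alpha>s)) = 0"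
proof -
  let ?V = "tangent_space A x"
  define Xs where "Xs = (SOME Xs. is_decomposition 2 ?V w Xs)"
  have dec: "is_decomposition 2 ?V w Xs"
    unfolding Xs_def by (rule someI_ex[OF bivector_decomposition[OF A x w]])
  define N where "N = length Xs"
  \<comment> \<open>The index \<open>(n, b)\<close> is factor \<open>b\<close> of the
    \<open>n\<close>-th wedge, \<open>False\<close> being the first factor.\<close>
  define I where "I = {..<N} \<times> (UNIV :: bool set)"
  define e where "e = (\<lambda>(n, b). Xs ! n ! (if b then 1 else 0))"
  define c where "c = (\<lambda>p q :: nat \<times> bool. if fst p = fst q \<and> snd p \<noteq> snd q then (if snd p then - 1 else 1 :: real) else 0)"
  have xs: "Xs ! n = [e (n, False), e (n, True)]" if "n < N" for n
  proof -
    have "length (Xs ! n) = 2" using dec that by (simp add: is_decomposition_def N_def)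
    then show ?thesis by (auto simp: e_def length_Suc_conv numeral_2_eq_2)
  qed
  have eV: "e i \<in> ?V" if i': "i \<in> I" for i
  proof -
    obtain n b where i: "i = (n, b)" "n < N" using i' by (cases i) (auto simp: I_def)
    have "set (Xs ! n) \<subseteq> ?V" using dec i by (simp add: is_decomposition_def N_def)
    then show ?thesis using xs[OF i(2)] i(1) by (cases b) auto
  qed
  have s: "(\<Sum>p\<in>I. \<Sum>q\<in>I. c p q * H p q) = (\<Sum>n<N. H (n, False) (n, True) - H (n, True) (n, False))" for H
    unfolding I_def c_def by (rule sum_UNIV_bool_pairs) simp
  show ?thesis
  proof (rule that[of I e c])
    show "finite I" by (simp add: I_def)
    show "c j i = - c i j" for i j
      unfolding c_def by (cases "fst i = fst j"; cases "snd i"; cases "snd j") simp_all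
    show "w [\<alpha>, \<beta>] = (\<Sum>i\<in>I. \<Sum>j\<in>I. c i j * (\<alpha> (e i) * \<beta> (e j)))"
      if "\<alpha> \<in> cotangent_space A x" "\<beta> \<in> cotangent_space A x" for \<alpha> \<beta>
    proof -
      have "w [\<alpha>, \<beta>] = (\<Sum>xs\<leftarrow>Xs. wedge ?V xs [\<alpha>, \<beta>])" using dec by (simp add: is_decomposition_def)
      also have "\<dots> = (\<Sum>n<N. wedge ?V (Xs ! n) [\<alpha>, \<beta>])" by (simp add: sum_list_nth N_def)
      also have "\<dots> = (\<Sum>n<N. \<alpha> (e (n, False)) * \<beta> (e (n, True)) - \<alpha> (e (n, True)) * \<beta> (e (n, False)))"
        by (rule sum.cong) (use that in \<open>auto simp: xs wedge_2 form_lists_2\<close>)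
      finally show ?thesis by (simp add: s)
    qed
    fix \<alpha>s
    \<comment> \<open>Taking the second factor of a wedge into the bracket costs \<open>- 1\<close>
      in both notations: the sign \<open>(- 1) ^ (i + j)\<close> is the product of the two
      coefficients \<open>c\<close>.\<close>
    have ds: "decomposable_schouten ?V br (Xs ! n) (Xs ! m) \<alpha>s =
        (let h = (\<lambda>i j k l. wedge ?V [br (e i) (e k), e j, e l] \<alpha>s) in
        (h (n, False) (n, True) (m, False) (m, True) - h (n, False) (n, True) (m, True) (m, False)) -
        (h (n, True) (n, False) (m, False) (m, True) - h (n, True) (n, False) (m, True) (m, False)))"
      if "n < N" "m < N" for n m
      unfolding decomposable_schouten_def xs[OF that(1)] xs[OF that(2)]
      by (simp add: remove_nth_def numeral_2_eq_2 Let_def)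
    have "0 = (\<Sum>xs\<leftarrow>Xs. \<Sum>ys\<leftarrow>Xs. decomposable_schouten ?V br xs ys \<alpha>s)"
      using fun_cong[OF schouten, of \<alpha>s] by (simp add: algebraic_schouten_def Xs_def Let_def)
    also have "\<dots> = (\<Sum>n<N. \<Sum>m<N. decomposable_schouten ?V br (Xs ! n) (Xs ! m) \<alpha>s)"
      by (simp add: sum_list_nth N_def)
    also have "\<dots> = (\<Sum>i\<in>I. \<Sum>j\<in>I. c i j * (\<Sum>k\<in>I. \<Sum>l\<in>I. c k l * wedge ?V [br (e i) (e k), e j, e l] \<alpha>s))"
      unfolding s sum_subtractf[symmetric] by (intro sum.cong refl) (simp add: ds Let_def)
    finally show "(\<Sum>i\<in>I. \<Sum>j\<in>I. c i j * (\<Sum>k\<in>I. \<Sum>l\<in>I. c k l * wedge ?V [br (e i) (e k), e j, e l] \<alpha>s)) = 0"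
      by simp
  qed (rule eV)
qed

section \<open>Poisson bivector fields and the Jacobi identity\<close>

text \<open>The first two values increase, so a shuffle is determined by its value at 2.\<close>

lemma shuffle_perms_2_1:
  "shuffle_perms 2 1 = {id, Transposition.transpose 1 2, Transposition.transpose 0 2 \<circ> Transposition.transpose 0 1}"
proof
  show "shuffle_perms 2 1 \<subseteq> {id, Transposition.transpose 1 2, Transposition.transpose 0 2 \<circ> Transposition.transpose 0 1}"
  proof
    fix \<sigma> assume "\<sigma> \<in> shuffle_perms 2 1"
    then have p: "\<sigma> permutes {..<3}" and m: "strict_mono_on {..<2} \<sigma>" by (auto simp: shuffle_perms_def)
    have lt: "\<sigma> 0 < \<sigma> 1" using strict_mono_onD[OF m, of 0 1] by simp
    have b: "\<sigma> i < 3" if "i < 3" for i using permutes_in_image[OF p, of i] that by simp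
    have inj: "\<sigma> 0 \<noteq> \<sigma> 2" "\<sigma> 1 \<noteq> \<sigma> 2" by (simp_all add: inj_eq[OF permutes_inj[OF p]])
    have out: "\<sigma> i = i" if "i \<ge> 3" for i using permutes_not_in[OF p, of i] that by simp
    have "(\<sigma> 0 = 0 \<and> \<sigma> 1 = 1 \<and> \<sigma> 2 = 2) \<or> (\<sigma> 0 = 0 \<and> \<sigma> 1 = 2 \<and> \<sigma> 2 = 1) \<or> (\<sigma> 0 = 1 \<and> \<sigma> 1 = 2 \<and> \<sigma> 2 = 0)"
    proof -
      have "(a = 0 \<and> b = 1 \<and> d = 2) \<or> (a = 0 \<and> b = 2 \<and> d = 1) \<or> (a = 1 \<and> b = 2 \<and> d = 0)"
        if "a < b" "b < 3" "d < 3" "a \<noteq> d" "b \<noteq> d" for a b d :: nat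
        using that by presburger
      from this[OF lt b b inj] show ?thesis by simp
    qed
    moreover have "\<sigma> = \<tau>" if "\<sigma> 0 = \<tau> 0" "\<sigma> 1 = \<tau> 1" "\<sigma> 2 = \<tau> 2" "\<And>i. i \<ge> 3 \<Longrightarrow> \<tau> i = i" for \<tau>
    proof
      fix i :: nat
      have "i = 0 \<or> i = 1 \<or> i = 2 \<or> i \<ge> 3" by presburger
      then show "\<sigma> i = \<tau> i" using that out by metis
    qed
    from this[of id] this[of "Transposition.transpose 1 2"] this[of "Transposition.transpose 0 2 \<circ> Transposition.transpose 0 1"]
    have "(\<sigma> 0 = 0 \<and> \<sigma> 1 = 1 \<and> \<sigma> 2 = 2 \<longrightarrow> \<sigma> = id) \<and> (\<sigma> 0 = 0 \<and> \<sigma> 1 = 2 \<and> \<sigma> 2 = 1 \<longrightarrow> \<sigma> = Transposition.transpose 1 2) \<and>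
      (\<sigma> 0 = 1 \<and> \<sigma> 1 = 2 \<and> \<sigma> 2 = 0 \<longrightarrow> \<sigma> = Transposition.transpose 0 2 \<circ> Transposition.transpose 0 1)"
      by (simp add: Transposition.transpose_def)
    ultimately show "\<sigma> \<in> {id, Transposition.transpose 1 2, Transposition.transpose 0 2 \<circ> Transposition.transpose 0 1}" by blast
  qed
  have "strict_mono_on {2..<3} \<sigma>" for \<sigma> :: "nat \<Rightarrow> nat" by (auto simp: strict_mono_on_def)
  moreover have "strict_mono_on {..<2} \<sigma>" if "\<sigma> 0 < \<sigma> 1" for \<sigma> :: "nat \<Rightarrow> nat"
    unfolding strict_mono_on_def
  proof (intro allI impI)
    fix r s :: nat assume "r \<in> {..<2} \<and> s \<in> {..<2} \<and> r < s"
    then have "r = 0" "s = 1" by auto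
    then show "\<sigma> r < \<sigma> s" using that by simp
  qed
  ultimately show "{id, Transposition.transpose 1 2, Transposition.transpose 0 2 \<circ> Transposition.transpose 0 1} \<subseteq> shuffle_perms 2 1"
    unfolding shuffle_perms_def
    by (auto simp: permutes_id permutes_swap_id permutes_compose)
qed

text \<open>The three signs are those of the shuffles in \<open>shuffle_perms_2_1\<close>; for an
  antisymmetric bracket the sum is the cyclic Jacobi expression.\<close>

lemma insertion_product_bivector:
  fixes A :: "('m, 'a::real_normed_vector) atlas" and P :: "'m \<Rightarrow> 'm mvec"
  defines "B \<equiv> \<lambda>f g. mvec_apply A P [f, g]"
  shows "insertion_product A 2 P 2 P [f, g, h] x = B (B f g) h x - B (B f h) g x + B (B g h) f x"
proof -
  have d: "id \<noteq> Transposition.transpose (1::nat) 2"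
    "id \<noteq> Transposition.transpose (0::nat) 2 \<circ> Transposition.transpose 0 1"
    "Transposition.transpose (1::nat) 2 \<noteq> Transposition.transpose (0::nat) 2 \<circ> Transposition.transpose 0 1"
    by (auto simp: Transposition.transpose_def fun_eq_iff dest: spec[of _ "0::nat"] spec[of _ "1::nat"])
  have s: "sign (Transposition.transpose (0::nat) 2 \<circ> Transposition.transpose 0 1) = 1"
    by (subst sign_compose) (simp_all add: permutation_swap_id sign_swap_id)
  have l: "[0..<2] = [0, 1::nat]" "[2..<2 + (2 - 1)] = [2::nat]" by (simp_all add: upt_rec)
  have t: "2 - 1 = (1::nat)" by simp
  show ?thesis
    unfolding insertion_product_def l shuffle_perms_2_1 t
    using d by (simp add: s s[unfolded One_nat_def] sign_swap_id B_def)
qed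

text \<open>The functions that \<open>schouten\<close> chooses for three covectors are smooth on a
  common neighbourhood of \<open>x\<close>, so the Jacobi identity for functions on open sets is
  enough.\<close>

lemma poisson_bivectorI:
  assumes A: "smooth_atlas A" and mf: "multivector_field A 2 \<pi>"
    and jacobi: "\<And>x W f g h. x \<in> W \<Longrightarrow> smooth_vec_on A W f \<Longrightarrow> smooth_vec_on A W g \<Longrightarrow> smooth_vec_on A W h \<Longrightarrow>
      mvec_apply A \<pi> [mvec_apply A \<pi> [f, g], h] x - mvec_apply A \<pi> [mvec_apply A \<pi> [f, h], g] x +
      mvec_apply A \<pi> [mvec_apply A \<pi> [g, h], f] x = 0"
  shows "poisson_bivector_field A \<pi>"
  unfolding poisson_bivector_field_def
proof (intro conjI mf ballI ext)
  fix x \<alpha>s assume x: "x \<in> points A"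
  show "schouten A 2 \<pi> 2 \<pi> x \<alpha>s = 0"
  proof (cases "\<alpha>s \<in> form_lists 3 (tangent_space A x)")
    case True
    then obtain \<alpha> \<beta> \<gamma> where al: "\<alpha>s = [\<alpha>, \<beta>, \<gamma>]"
      "\<alpha> \<in> cotangent_space A x" "\<beta> \<in> cotangent_space A x" "\<gamma> \<in> cotangent_space A x" by (rule form_lists_3E)
    obtain U \<phi> where U: "(U, \<phi>) \<in> A" "x \<in> U" using points_chart[OF x] .
    define F where "F = (\<lambda>\<alpha>. SOME f. smooth_near A x f \<and> fun_differential A x f = \<alpha>)"
    have F: "smooth_near A x (F \<alpha>)" if "\<alpha> \<in> cotangent_space A x" for \<alpha>
    proof -
      have "\<exists>f. smooth_near A x f \<and> fun_differential A x f = \<alpha>"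
        using smooth_nearI[OF cotangent_differential(1)[OF A U that] U(2)] cotangent_differential(2)[OF A U that] by blast
      then show ?thesis unfolding F_def by (rule someI2_ex) blast
    qed
    obtain W1 where W1: "x \<in> W1" "smooth_vec_on A W1 (F \<alpha>)" using smooth_nearE[OF F[OF al(2)]] .
    obtain W2 where W2: "x \<in> W2" "smooth_vec_on A W2 (F \<beta>)" using smooth_nearE[OF F[OF al(3)]] .
    obtain W3 where W3: "x \<in> W3" "smooth_vec_on A W3 (F \<gamma>)" using smooth_nearE[OF F[OF al(4)]] .
    let ?W = "W1 \<inter> W2 \<inter> W3"
    have op: "openin (atlas_topology A) ?W"
      using W1 W2 W3 by (intro openin_Int smooth_vec_on_open)
    have "insertion_product A 2 \<pi> 2 \<pi> [F \<alpha>, F \<beta>, F \<gamma>] x = 0"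
      unfolding insertion_product_bivector
      by (rule jacobi[of _ ?W]) (use W1 W2 W3 op in \<open>auto intro: smooth_vec_on_subset\<close>)
    \<comment> \<open>In bidegree (2, 2) both insertion products in \<open>schouten\<close> are the
      same Jacobi sum.\<close>
    then show ?thesis using True by (simp add: schouten_def al F_def[symmetric] Let_def)
  qed (simp add: schouten_def)
qed

lemma multivector_field_2I:
  assumes "\<And>x. x \<in> points A \<Longrightarrow> P x \<in> exterior_power 2 (tangent_space A x)"
    and "\<And>W f g. smooth_vec_on A W f \<Longrightarrow> smooth_vec_on A W g \<Longrightarrow> smooth_vec_on A W (mvec_apply A P [f, g])"
  shows "multivector_field A 2 P"
  unfolding multivector_field_def smooth_fun_on_vec
proof (intro conjI ballI allI impI)
  fix W and fs :: "('a \<Rightarrow> real) list"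
  assume *: "length fs = 2 \<and> openin (atlas_topology A) W \<and> (\<forall>f\<in>set fs. smooth_vec_on A W f)"
  then obtain f g where "fs = [f, g]" by (auto simp: length_Suc_conv numeral_2_eq_2)
  then show "smooth_vec_on A W (mvec_apply A P fs)" using assms(2)[of W f g] * by simp
qed (rule assms(1))

text \<open>\<open>BB\<close> is a double bracket \<open>{{f, g}, h}\<close> with the inner
  derivative expanded by the Leibniz rule; \<open>Df k i\<close> stands for the second derivative
  \<open>X\<^sub>k X\<^sub>i f\<close>. In the alternating sum each function carries two
  second-order terms, which agree up to sign and an exchange of the index pairs
  \<open>(i, j)\<close> and \<open>(k, l)\<close>; together they form a commutator. The other claims
  are the relabelling and linearity rules for \<open>Q\<close>.\<close>

lemma jacobi_algebra:
  fixes I :: "'i set" and c :: "'i \<Rightarrow> 'i \<Rightarrow> real" and a b d :: "'i \<Rightarrow> real" and Da Db Dd :: "'i \<Rightarrow> 'i \<Rightarrow> real"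
  assumes c: "\<And>i j. c j i = - c i j"
  defines "Q \<equiv> \<lambda>F. \<Sum>i\<in>I. \<Sum>j\<in>I. c i j * (\<Sum>k\<in>I. \<Sum>l\<in>I. c k l * F i j k l)"
  defines "BB \<equiv> \<lambda>f g h Df Dg. \<Sum>k\<in>I. \<Sum>l\<in>I. c k l * (\<Sum>i\<in>I. \<Sum>j\<in>I. c i j * (Df k i * g j + f i * Dg k j)) * h l"
  shows "BB a b d Da Db - BB a d b Da Dd + BB b d a Db Dd =
    Q (\<lambda>i j k l. (Da k i - Da i k) * b j * d l + (Db k i - Db i k) * d j * a l + (Dd k i - Dd i k) * a j * b l)"
    and "Q F = - Q (\<lambda>i j k l. F j i k l)" and "Q F = Q (\<lambda>i j k l. F k l i j)"
    and "Q (\<lambda>i j k l. F i j k l + F' i j k l) = Q F + Q F'" and "Q (\<lambda>i j k l. F i j k l - F' i j k l) = Q F - Q F'"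
proof -
  show add: "Q (\<lambda>i j k l. F i j k l + F' i j k l) = Q F + Q F'" for F F'
    unfolding Q_def by (simp add: sum.distrib distrib_left)
  show diff: "Q (\<lambda>i j k l. F i j k l - F' i j k l) = Q F - Q F'" for F F'
    unfolding Q_def by (simp add: sum_subtractf right_diff_distrib)
  have prod: "(\<Sum>k\<in>I. \<Sum>l\<in>I. H k l) = (\<Sum>q\<in>I\<times>I. H (fst q) (snd q))" for H :: "'i \<Rightarrow> 'i \<Rightarrow> real"
    by (simp add: sum.cartesian_product split_beta)
  have Qx: "Q F = (\<Sum>p\<in>I\<times>I. \<Sum>q\<in>I\<times>I. c (fst p) (snd p) * c (fst q) (snd q) * F (fst p) (snd p) (fst q) (snd q))" for F
    unfolding Q_def prod by (simp add: sum_distrib_left mult.assoc)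
  show sw: "Q F = Q (\<lambda>i j k l. F k l i j)" for F
    unfolding Qx by (subst sum.swap) (simp add: mult_ac)
  show an: "Q F = - Q (\<lambda>i j k l. F j i k l)" for F
  proof -
    have "Q F = (\<Sum>j\<in>I. \<Sum>i\<in>I. c i j * (\<Sum>k\<in>I. \<Sum>l\<in>I. c k l * F i j k l))"
      unfolding Q_def by (rule sum.swap)
    also have "\<dots> = (\<Sum>j\<in>I. \<Sum>i\<in>I. - c j i * (\<Sum>k\<in>I. \<Sum>l\<in>I. c k l * F i j k l))"
      by (intro sum.cong refl) (rule arg_cong2[where f = "(*)", OF c refl])
    finally show ?thesis unfolding Q_def by (simp add: sum_negf)
  qed
  define S where "S = (\<lambda>Df g h. Q (\<lambda>i j k l. Df k i * g j * h l))"
  have BB: "BB f g h Df Dg = S Df g h - S Dg f h" for f g h Df Dg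
  proof -
    have "BB f g h Df Dg = (\<Sum>q\<in>I\<times>I. \<Sum>p\<in>I\<times>I. c (fst p) (snd p) * c (fst q) (snd q) *
        ((Df (fst q) (fst p) * g (snd p) + f (fst p) * Dg (fst q) (snd p)) * h (snd q)))"
      unfolding BB_def prod by (simp add: sum_distrib_left sum_distrib_right mult_ac)
    also have "\<dots> = Q (\<lambda>i j k l. (Df k i * g j + f i * Dg k j) * h l)"
      unfolding Qx by (rule sum.swap)
    also have "\<dots> = Q (\<lambda>i j k l. Df k i * g j * h l) + Q (\<lambda>i j k l. f i * Dg k j * h l)"
      unfolding add[symmetric] by (simp add: algebra_simps)
    also have "Q (\<lambda>i j k l. f i * Dg k j * h l) = - S Dg f h"
      unfolding S_def by (subst an) (simp add: mult_ac)
    finally show ?thesis unfolding S_def by simp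
  qed
  have S: "S Df g h - S Df h g = Q (\<lambda>i j k l. (Df k i - Df i k) * g j * h l)" for Df g h
  proof -
    have "S Df h g = Q (\<lambda>i j k l. Df i k * g j * h l)"
      unfolding S_def by (subst sw) (simp add: mult_ac)
    then have "S Df g h - S Df h g = Q (\<lambda>i j k l. Df k i * g j * h l - Df i k * g j * h l)"
      unfolding diff by (simp add: S_def)
    then show ?thesis by (simp add: left_diff_distrib)
  qed
  show "BB a b d Da Db - BB a d b Da Dd + BB b d a Db Dd =
    Q (\<lambda>i j k l. (Da k i - Da i k) * b j * d l + (Db k i - Db i k) * d j * a l + (Dd k i - Dd i k) * a j * b l)"
    unfolding BB add using S[of Da b d] S[of Db d a] S[of Dd a b] by simp
qed

text \<open>Leibniz rule for a frame expression along an arbitrary tangent vector, so that it serves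
  the fields of the frame as well as Hamiltonian vectors.\<close>

lemma tangent_frame_derivation:
  fixes X :: "'i \<Rightarrow> 'm \<Rightarrow> 'm tvec"
  assumes A: "smooth_atlas A" and I: "finite I" and W: "openin (atlas_topology A) W"
    and Xf: "\<And>i. i \<in> I \<Longrightarrow> smooth_vec_on A W (\<lambda>z. X i z f)"
    and Xg: "\<And>i. i \<in> I \<Longrightarrow> smooth_vec_on A W (\<lambda>z. X i z g)"
    and B: "\<And>z. z \<in> W \<Longrightarrow> F z = (\<Sum>i\<in>I. \<Sum>j\<in>I. c i j * (X i z f * X j z g))"
    and z: "z \<in> W" and v: "v \<in> tangent_space A z"
  shows "v F = (\<Sum>i\<in>I. \<Sum>j\<in>I. c i j * (v (\<lambda>y. X i y f) * X j z g + X i z f * v (\<lambda>y. X j y g)))"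
proof -
  have m: "smooth_vec_on A W (\<lambda>z. X i z f * X j z g)" if "i \<in> I" "j \<in> I" for i j
    by (intro smooth_vec_on_mult[OF A] Xf Xg that)
  have s: "smooth_vec_on A W (\<lambda>z. c i j * (X i z f * X j z g))" if "i \<in> I" "j \<in> I" for i j
    by (rule smooth_vec_on_cmult[OF A m[OF that]])
  have s': "smooth_vec_on A W (\<lambda>z. \<Sum>j\<in>I. c i j * (X i z f * X j z g))" if "i \<in> I" for i
    by (intro smooth_vec_on_sum[OF A W] s that)
  have n: "smooth_near A z f" if "smooth_vec_on A W f" for f by (rule smooth_nearI[OF that z])
  have "v F = v (\<lambda>z. \<Sum>i\<in>I. \<Sum>j\<in>I. c i j * (X i z f * X j z g))"
    by (rule tangent_cong[OF A v W z B])
  also have "\<dots> = (\<Sum>i\<in>I. v (\<lambda>z. \<Sum>j\<in>I. c i j * (X i z f * X j z g)))"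
    by (rule tangent_sum[OF A v I]) (rule n[OF s'])
  also have "\<dots> = (\<Sum>i\<in>I. \<Sum>j\<in>I. v (\<lambda>z. c i j * (X i z f * X j z g)))"
    by (rule sum.cong[OF refl]) (rule tangent_sum[OF A v I], rule n[OF s])
  also have "\<dots> = (\<Sum>i\<in>I. \<Sum>j\<in>I. c i j * (v (\<lambda>y. X i y f) * X j z g + X i z f * v (\<lambda>y. X j y g)))"
  proof (intro sum.cong refl)
    fix i j assume ij: "i \<in> I" "j \<in> I"
    have "v (\<lambda>z. c i j * (X i z f * X j z g)) = c i j * v (\<lambda>z. X i z f * X j z g)"
      using tangent_lincomb_fun[OF A v n[OF m[OF ij]] n[OF m[OF ij]], of "c i j" 0] by simp
    also have "v (\<lambda>z. X i z f * X j z g) = X i z f * v (\<lambda>y. X j y g) + v (\<lambda>y. X i y f) * X j z g"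
      by (rule tangent_mult[OF A v n[OF Xf[OF ij(1)]] n[OF Xg[OF ij(2)]]])
    finally show "v (\<lambda>z. c i j * (X i z f * X j z g)) =
        c i j * (v (\<lambda>y. X i y f) * X j z g + X i z f * v (\<lambda>y. X j y g))" by simp
  qed
  finally show ?thesis .
qed

text \<open>Serves both brackets: for fundamental fields the commutators \<open>T\<close> come from
  the bracket of the Lie algebra, for coordinate fields they vanish.\<close>

lemma jacobi_frame:
  fixes X :: "'i \<Rightarrow> 'm \<Rightarrow> 'm tvec"
  assumes A: "smooth_atlas A" and I: "finite I" and c: "\<And>i j. c j i = - c i j"
    and X: "\<And>i z. i \<in> I \<Longrightarrow> z \<in> W \<Longrightarrow> X i z \<in> tangent_space A z"
    and Xs: "\<And>i f. i \<in> I \<Longrightarrow> smooth_vec_on A W f \<Longrightarrow> smooth_vec_on A W (\<lambda>z. X i z f)"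
    and B: "\<And>f g z. smooth_vec_on A W f \<Longrightarrow> smooth_vec_on A W g \<Longrightarrow> z \<in> W \<Longrightarrow>
      B f g z = (\<Sum>i\<in>I. \<Sum>j\<in>I. c i j * (X i z f * X j z g))"
    and fgh: "smooth_vec_on A W f" "smooth_vec_on A W g" "smooth_vec_on A W h" and z: "z \<in> W"
  defines "T \<equiv> \<lambda>k i f. X k z (\<lambda>y. X i y f) - X i z (\<lambda>y. X k y f)"
  shows "smooth_vec_on A W (B f g)"
    and "B (B f g) h z - B (B f h) g z + B (B g h) f z =
      (\<Sum>i\<in>I. \<Sum>j\<in>I. c i j * (\<Sum>k\<in>I. \<Sum>l\<in>I. c k l *
        (T k i f * X j z g * X l z h + T k i g * X j z h * X l z f + T k i h * X j z f * X l z g)))"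
proof -
  have W: "openin (atlas_topology A) W" by (rule smooth_vec_on_open[OF fgh(1)])
  have Bs: "smooth_vec_on A W (B f g)" if "smooth_vec_on A W f" "smooth_vec_on A W g" for f g
  proof (rule smooth_vec_on_cong[OF A])
    show "smooth_vec_on A W (\<lambda>z. \<Sum>i\<in>I. \<Sum>j\<in>I. c i j * (X i z f * X j z g))"
      by (intro smooth_vec_on_sum[OF A W] smooth_vec_on_cmult[OF A] smooth_vec_on_mult[OF A] Xs that)
  qed (simp add: B that)
  then show "smooth_vec_on A W (B f g)" using fgh by blast
  have XB: "X k z (B f g) = (\<Sum>i\<in>I. \<Sum>j\<in>I. c i j * (X k z (\<lambda>y. X i y f) * X j z g + X i z f * X k z (\<lambda>y. X j y g)))"
    if k: "k \<in> I" and fg: "smooth_vec_on A W f" "smooth_vec_on A W g" for k f g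
    by (rule tangent_frame_derivation[OF A I W Xs[OF _ fg(1)] Xs[OF _ fg(2)] B[OF fg] z X[OF k z]])
  have BB: "B (B f g) h z = (\<Sum>k\<in>I. \<Sum>l\<in>I. c k l * (\<Sum>i\<in>I. \<Sum>j\<in>I. c i j *
      (X k z (\<lambda>y. X i y f) * X j z g + X i z f * X k z (\<lambda>y. X j y g))) * X l z h)"
    if fg: "smooth_vec_on A W f" "smooth_vec_on A W g" "smooth_vec_on A W h" for f g h
    unfolding B[OF Bs[OF fg(1,2)] fg(3) z] by (intro sum.cong refl) (simp add: XB fg)
  show "B (B f g) h z - B (B f h) g z + B (B g h) f z =
      (\<Sum>i\<in>I. \<Sum>j\<in>I. c i j * (\<Sum>k\<in>I. \<Sum>l\<in>I. c k l *
        (T k i f * X j z g * X l z h + T k i g * X j z h * X l z f + T k i h * X j z f * X l z g)))"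
    unfolding BB[OF fgh] BB[OF fgh(1,3,2)] BB[OF fgh(2,3,1)] T_def
    by (rule jacobi_algebra(1)[OF c])
qed

section \<open>Brackets of vector fields\<close>

text \<open>Product rule for the pairing of \<open>dd f\<close> with the direction field
  \<open>v\<close>, obtained by expanding the direction in \<open>onb\<close>.\<close>

lemma dd_moving_direction:
  fixes f :: "'a::finite_dim_inner \<Rightarrow> real"
  assumes S: "open S" "x \<in> S" and f: "smooth_on S f" and v: "smooth_on S v"
  shows "dd (\<lambda>s. dd f s (v s)) x h = dd f x (dd v x h) + dd (\<lambda>s. dd f s (v x)) x h"
proof -
  have fb: "((\<lambda>s. dd f s b) has_derivative dd (\<lambda>s. dd f s b) x) (at x)" for b
    by (rule smooth_on_has_derivative[OF smooth_on_dd[OF f] S(2)])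
  have vd: "(v has_derivative dd v x) (at x)" by (rule smooth_on_has_derivative[OF v S(2)])
  have ex: "dd f s w = (\<Sum>b\<in>onb. inner w b * dd f s b)" if "s \<in> S" for s w
    using linear_onb_expand[OF linear_dd[OF smooth_on_differentiable[OF f that]], of w] by simp
  have 1: "dd (\<lambda>s. dd f s (v s)) x h =
      (\<Sum>b\<in>onb. inner (v x) b * dd (\<lambda>s. dd f s b) x h + inner (dd v x h) b * dd f x b)"
  proof -
    have "dd (\<lambda>s. dd f s (v s)) x h = dd (\<lambda>s. \<Sum>b\<in>onb. inner (v s) b * dd f s b) x h"
      by (rule dd_cong[OF S]) (rule ex)
    also have "\<dots> = (\<Sum>b\<in>onb. inner (v x) b * dd (\<lambda>s. dd f s b) x h + inner (dd v x h) b * dd f x b)"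
      by (rule dd_eq, rule has_derivative_sum, rule has_derivative_mult[OF has_derivative_inner_left[OF vd] fb])
    finally show ?thesis .
  qed
  have 2: "dd (\<lambda>s. dd f s (v x)) x h = (\<Sum>b\<in>onb. inner (v x) b * dd (\<lambda>s. dd f s b) x h)"
  proof -
    have "dd (\<lambda>s. dd f s (v x)) x h = dd (\<lambda>s. \<Sum>b\<in>onb. inner (v x) b * dd f s b) x h"
      by (rule dd_cong[OF S]) (rule ex)
    also have "\<dots> = (\<Sum>b\<in>onb. inner (v x) b * dd (\<lambda>s. dd f s b) x h)"
      by (rule dd_eq, rule has_derivative_sum, rule has_derivative_mult_right[OF fb])
    finally show ?thesis .
  qed
  show ?thesis
    unfolding 1 2 sum.distrib by (subst ex[OF S(2), of "dd v x h"]) simp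
qed

text \<open>Tangent vectors come from curves, so the commutator has to be exhibited as a coordinate
  vector. In a chart the second derivatives of \<open>f\<close> cancel by symmetry, and
  \<open>?u\<close> is what remains: the classical component formula
  \<open>DY X - DX Y\<close>.\<close>

lemma field_bracket_tangent:
  assumes A: "smooth_atlas A" and W: "openin (atlas_topology A) W" "x \<in> W"
    and X: "\<And>y. y \<in> W \<Longrightarrow> X y \<in> tangent_space A y" and Y: "\<And>y. y \<in> W \<Longrightarrow> Y y \<in> tangent_space A y"
    and Xs: "\<And>U \<phi> b. (U, \<phi>) \<in> A \<Longrightarrow> smooth_vec_on A (U \<inter> W) (\<lambda>y. X y (\<lambda>z. inner (\<phi> z) b))"
    and Ys: "\<And>U \<phi> b. (U, \<phi>) \<in> A \<Longrightarrow> smooth_vec_on A (U \<inter> W) (\<lambda>y. Y y (\<lambda>z. inner (\<phi> z) b))"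
  shows "field_bracket A X Y x \<in> tangent_space A x"
proof -
  obtain U \<phi> where U: "(U, \<phi>) \<in> A" "x \<in> U"
    using points_chart[OF subsetD[OF openin_imp_points[OF W(1)] W(2)]] .
  define co where "co = (\<lambda>Z s. \<Sum>b\<in>onb. Z (inv_into U \<phi> s) (\<lambda>z. inner (\<phi> z) b) *\<^sub>R b)"
    for Z :: "'a \<Rightarrow> 'a tvec"
  let ?S = "\<phi> ` (U \<inter> W)"
  have S: "open ?S" by (rule openin_image[OF A W(1) U(1)])
  have co_smooth: "smooth_on ?S (co Z)"
    if "\<And>U \<phi> b. (U, \<phi>) \<in> A \<Longrightarrow> smooth_vec_on A (U \<inter> W) (\<lambda>y. Z y (\<lambda>z. inner (\<phi> z) b))" for Z
  proof -
    have "smooth_on ?S (\<lambda>s. Z (inv_into U \<phi> s) (\<lambda>z. inner (\<phi> z) b))" for b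
      using smooth_vec_onD'[OF that[OF U(1)] U(1), of b] by (simp add: Int_absorb1)
    then show ?thesis unfolding co_def by (intro smooth_on_sum smooth_on_scaleR smooth_on_const S)
  qed
  \<comment> \<open>Splits the iterated derivative into a first-order term and a second-order term
    with frozen directions; the latter is symmetric in the two fields.\<close>
  have key: "Y x (\<lambda>y. X y f) =
      dd (\<lambda>s. f (inv_into U \<phi> s)) (\<phi> x) (dd (co X) (\<phi> x) (co Y (\<phi> x))) +
      dd (\<lambda>s. dd (\<lambda>s. f (inv_into U \<phi> s)) s (co X (\<phi> x))) (\<phi> x) (co Y (\<phi> x))"
    if X: "\<And>y. y \<in> W \<Longrightarrow> X y \<in> tangent_space A y" and Y: "Y x \<in> tangent_space A x"
      and coX: "smooth_on ?S (co X)" and f: "smooth_vec_on A W' f" "x \<in> W'" for X Y f W'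
  proof -
    let ?f = "\<lambda>s. f (inv_into U \<phi> s)" and ?T = "\<phi> ` (U \<inter> (W \<inter> W'))"
    have op: "openin (atlas_topology A) (W \<inter> W')" by (rule openin_Int[OF W(1) smooth_vec_on_open[OF f(1)]])
    have T: "open ?T" by (rule openin_image[OF A op U(1)])
    have xT: "\<phi> x \<in> ?T" using U W f by blast
    have fT: "smooth_on ?T ?f" by (rule smooth_on_subset[OF smooth_vec_onD'[OF f(1) U(1)]]) auto
    have cT: "smooth_on ?T (co X)" by (rule smooth_on_subset[OF coX]) auto
    have XT: "X y f = dd ?f (\<phi> y) (co X (\<phi> y))" if y: "y \<in> U \<inter> (W \<inter> W')" for y
    proof -
      have "X y = coordinate_vector A (U, \<phi>) y (co X (\<phi> y))"
        using tangent_expand[OF A U(1) _ X, of y] y by (simp add: co_def chart_inv[OF A U(1)])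
      moreover have "smooth_near A y f" by (rule smooth_nearI[OF f(1)]) (use y in simp)
      ultimately show ?thesis by (simp add: coordinate_vector_smooth)
    qed
    have "Y x (\<lambda>y. X y f) = Y x (\<lambda>y. dd ?f (\<phi> y) (co X (\<phi> y)))"
      by (rule tangent_cong[OF A Y openin_Int[OF openin_chart[OF A U(1)] op]]) (use U W f XT in auto)
    also have "\<dots> = coordinate_vector A (U, \<phi>) x (co Y (\<phi> x)) (\<lambda>y. dd ?f (\<phi> y) (co X (\<phi> y)))"
      using tangent_expand[OF A U Y] by (simp add: co_def chart_inv[OF A U])
    also have "\<dots> = dd (\<lambda>s. dd ?f s (co X s)) (\<phi> x) (co Y (\<phi> x))"
      by (rule coordinate_vector_compose_chart[OF A U T xT smooth_on_dd_dir[OF T fT cT]])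
    also have "\<dots> = dd ?f (\<phi> x) (dd (co X) (\<phi> x) (co Y (\<phi> x))) + dd (\<lambda>s. dd ?f s (co X (\<phi> x))) (\<phi> x) (co Y (\<phi> x))"
      by (rule dd_moving_direction[OF T xT fT cT])
    finally show ?thesis .
  qed
  have cX: "smooth_on ?S (co X)" by (rule co_smooth) (rule Xs)
  have cY: "smooth_on ?S (co Y)" by (rule co_smooth) (rule Ys)
  let ?u = "dd (co Y) (\<phi> x) (co X (\<phi> x)) - dd (co X) (\<phi> x) (co Y (\<phi> x))"
  have "field_bracket A X Y x = coordinate_vector A (U, \<phi>) x ?u"
  proof
    fix f
    show "field_bracket A X Y x f = coordinate_vector A (U, \<phi>) x ?u f"
    proof (cases "smooth_near A x f")
      case True
      then obtain W' where f: "x \<in> W'" "smooth_vec_on A W' f" by (rule smooth_nearE)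
      let ?f = "\<lambda>s. f (inv_into U \<phi> s)"
      have fs: "smooth_on (\<phi> ` (U \<inter> W')) ?f" by (rule smooth_vec_onD'[OF f(2) U(1)])
      have sym: "dd (\<lambda>s. dd ?f s (co X (\<phi> x))) (\<phi> x) (co Y (\<phi> x)) = dd (\<lambda>s. dd ?f s (co Y (\<phi> x))) (\<phi> x) (co X (\<phi> x))"
        by (rule dd_commute[OF openin_image[OF A smooth_vec_on_open[OF f(2)] U(1)] fs]) (use U f in auto)
      have "field_bracket A X Y x f = X x (\<lambda>y. Y y f) - Y x (\<lambda>y. X y f)"
        using True by (simp add: field_bracket_def)
      also have "\<dots> = dd ?f (\<phi> x) (dd (co Y) (\<phi> x) (co X (\<phi> x))) - dd ?f (\<phi> x) (dd (co X) (\<phi> x) (co Y (\<phi> x)))"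
        using key[where X = Y and Y = X, OF Y X[OF W(2)] cY f(2,1)] key[where X = X and Y = Y, OF X Y[OF W(2)] cX f(2,1)] sym
        by simp
      also have "\<dots> = coordinate_vector A (U, \<phi>) x ?u f"
        using True linear_diff[OF linear_dd[OF smooth_near_differentiable[OF A True U]]]
        by (simp add: coordinate_vector_smooth)
      finally show ?thesis .
    qed (simp add: field_bracket_def coordinate_vector_not_smooth)
  qed
  then show ?thesis using coordinate_vector_tangent[OF A U] by simp
qed

section \<open>Actions of Lie groups\<close>

lemma smooth_vec_on_empty: "smooth_vec_on A {} f"
  by (rule smooth_vec_on_charts) (auto intro: smooth_on_local)

section \<open>Lie groups: left invariant fields and the bracket\<close>

locale local_lie_group =
  fixes G :: "('g, 'z) monoid_scheme" and L :: "('g, 'b::finite_dim_inner) atlas"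
  assumes lie: "lie_group G L"
begin

abbreviation \<gg> where "\<gg> \<equiv> lie_algebra G L"

lemma group_G: "group G" using lie by (simp add: lie_group_def)
lemma L: "smooth_atlas L" using lie by (simp add: lie_group_def smooth_manifold_imp_atlas)
lemma points_L: "points L = carrier G" using lie by (simp add: lie_group_def)
lemma one_closed: "\<one>\<^bsub>G\<^esub> \<in> carrier G" using group_G by (simp add: group.is_monoid)
lemma LL: "smooth_atlas (product_atlas L L)" by (rule smooth_atlas_product[OF L L])

lemma carrier_open: "openin (atlas_topology L) (carrier G)"
  using openin_points[of L] by (simp add: points_L)

lemma mult_smooth: "smooth_map_on (product_atlas L L) (carrier G \<times> carrier G) L (\<lambda>(g, h). g \<otimes>\<^bsub>G\<^esub> h)"
  using smooth_map_imp_on[OF LL L, of "\<lambda>(g, h). g \<otimes>\<^bsub>G\<^esub> h"] lie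
  by (simp add: lie_group_def points_product)

lemma inv_smooth: "smooth_map_on L (carrier G) L (\<lambda>g. inv\<^bsub>G\<^esub> g)"
  using smooth_map_imp_on[OF L L, of "\<lambda>g. inv\<^bsub>G\<^esub> g"] lie by (simp add: lie_group_def)

lemma left_mult_smooth:
  assumes "g \<in> carrier G"
  shows "smooth_map_on L (carrier G) L (\<lambda>h. g \<otimes>\<^bsub>G\<^esub> h)"
proof -
  have s: "smooth_map_on L (points L) (product_atlas L L) (\<lambda>h. (g, h))"
    by (rule slice_smooth(1)[OF L L assms[folded points_L] one_closed[folded points_L]])
  have "smooth_map_on L (carrier G) L (\<lambda>h. case (g, h) of (g, h) \<Rightarrow> g \<otimes>\<^bsub>G\<^esub> h)"
    by (rule smooth_map_on_compose_subset[OF L LL s mult_smooth carrier_open]) (use assms in \<open>auto simp: points_L\<close>)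
  then show ?thesis by simp
qed

lemma left_invariant_tangent:
  assumes X: "X \<in> \<gg>" and g: "g \<in> carrier G"
  shows "left_invariant_field G L X g \<in> tangent_space L g"
  using push_tvec_tangent[OF L L left_mult_smooth[OF g] one_closed X] group.is_monoid[OF group_G] g
  by (simp add: left_invariant_field_def monoid.r_one)

lemma left_invariant_apply:
  assumes g: "g \<in> carrier G" and f: "smooth_near L g f"
  shows "left_invariant_field G L X g f = X (\<lambda>h. f (g \<otimes>\<^bsub>G\<^esub> h))"
  using f group.is_monoid[OF group_G] g
  by (simp add: left_invariant_field_def push_tvec_def monoid.r_one o_def)

lemma left_invariant_smooth:
  assumes X: "X \<in> \<gg>" and f: "smooth_vec_on L W f"
  shows "smooth_vec_on L W (\<lambda>g. left_invariant_field G L X g f)"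
proof -
  \<comment> \<open>\<open>smooth_partial\<close> differentiates in the first factor, so the group
    multiplication is taken with its factors exchanged.\<close>
  have sw: "smooth_map_on (product_atlas L L) (carrier G \<times> carrier G) L (\<lambda>z. snd z \<otimes>\<^bsub>G\<^esub> fst z)"
  proof -
    have op: "openin (atlas_topology (product_atlas L L)) (carrier G \<times> carrier G)"
      by (rule openin_Times_atlas[OF L L carrier_open carrier_open])
    have p: "smooth_map_on (product_atlas L L) (carrier G \<times> carrier G) (product_atlas L L) (\<lambda>z. (snd z, fst z))"
      by (rule smooth_map_on_Pair[OF L L LL smooth_map_on_fst_snd(2)[OF L L op] smooth_map_on_fst_snd(1)[OF L L op]])
    have "smooth_map_on (product_atlas L L) (carrier G \<times> carrier G) L (\<lambda>z. case (snd z, fst z) of (g, h) \<Rightarrow> g \<otimes>\<^bsub>G\<^esub> h)"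
      by (rule smooth_map_on_compose_subset[OF LL LL p mult_smooth op]) auto
    then show ?thesis by simp
  qed
  have W: "W \<subseteq> carrier G" using openin_imp_points[OF smooth_vec_on_open[OF f]] by (simp add: points_L)
  let ?\<Omega> = "(carrier G \<times> carrier G) \<inter> (\<lambda>z. snd z \<otimes>\<^bsub>G\<^esub> fst z) -` W"
  have "smooth_vec_on (product_atlas L L) ?\<Omega> (\<lambda>z. f (snd z \<otimes>\<^bsub>G\<^esub> fst z))"
    by (rule smooth_vec_on_pullback[OF LL L sw f])
  from smooth_partial[OF L L this X]
  have "smooth_vec_on L {g. (\<one>\<^bsub>G\<^esub>, g) \<in> ?\<Omega>} (\<lambda>g. X (\<lambda>h. f (g \<otimes>\<^bsub>G\<^esub> h)))" by simp
  moreover have "{g. (\<one>\<^bsub>G\<^esub>, g) \<in> ?\<Omega>} = W"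
    using W one_closed group.is_monoid[OF group_G] by (auto simp: monoid.r_one)
  ultimately have "smooth_vec_on L W (\<lambda>g. X (\<lambda>h. f (g \<otimes>\<^bsub>G\<^esub> h)))" by simp
  then show ?thesis
  proof (rule smooth_vec_on_cong[OF L])
    fix g assume g: "g \<in> W"
    then show "X (\<lambda>h. f (g \<otimes>\<^bsub>G\<^esub> h)) = left_invariant_field G L X g f"
      using left_invariant_apply[OF subsetD[OF W g] smooth_nearI[OF f g]] by simp
  qed
qed

text \<open>Covectors are 0 off the tangent space, so evaluating a differential on the bracket says
  something only once the bracket is known to lie in \<open>\<gg>\<close>.\<close>

lemma lie_bracket_tangent:
  assumes X: "X \<in> \<gg>" and Y: "Y \<in> \<gg>"
  shows "lie_bracket G L X Y \<in> \<gg>"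
  unfolding lie_bracket_def
proof (rule field_bracket_tangent[OF L carrier_open one_closed])
  fix U \<phi> b assume U: "(U, \<phi>) \<in> L"
  have "U \<inter> carrier G = U" using chart_points[OF U] by (auto simp: points_L)
  then show "smooth_vec_on L (U \<inter> carrier G) (\<lambda>y. left_invariant_field G L X y (\<lambda>z. inner (\<phi> z) b))"
    "smooth_vec_on L (U \<inter> carrier G) (\<lambda>y. left_invariant_field G L Y y (\<lambda>z. inner (\<phi> z) b))"
    using left_invariant_smooth[OF X smooth_vec_on_coordinate[OF L U]]
      left_invariant_smooth[OF Y smooth_vec_on_coordinate[OF L U]] by simp_all
qed (rule left_invariant_tangent[OF X] left_invariant_tangent[OF Y], assumption)+

end

text \<open>States what the base and its cotangent bundle have in common, so that each result of the
  locale is available for both actions.\<close>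

locale atlas_action = local_lie_group G L
  for G :: "('g, 'z) monoid_scheme" and L :: "('g, 'b::finite_dim_inner) atlas" +
  fixes A :: "('m, 'a::finite_dim_inner) atlas" and act :: "'g \<Rightarrow> 'm \<Rightarrow> 'm"
  assumes A: "smooth_atlas A"
    and act_smooth: "smooth_map_on (product_atlas L A) (carrier G \<times> points A) A (\<lambda>z. act (fst z) (snd z))"
    and act_one: "\<And>x. x \<in> points A \<Longrightarrow> act \<one>\<^bsub>G\<^esub> x = x"
    and act_mult: "\<And>g h x. g \<in> carrier G \<Longrightarrow> h \<in> carrier G \<Longrightarrow> x \<in> points A \<Longrightarrow> act (g \<otimes>\<^bsub>G\<^esub> h) x = act g (act h x)"
begin

definition fundamental :: "'g tvec \<Rightarrow> 'm \<Rightarrow> 'm tvec" where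
  "fundamental X x = push_tvec A (\<lambda>g. act g x) \<one>\<^bsub>G\<^esub> X"

lemma LA: "smooth_atlas (product_atlas L A)" by (rule smooth_atlas_product[OF L A])

lemma act_points: "g \<in> carrier G \<Longrightarrow> x \<in> points A \<Longrightarrow> act g x \<in> points A"
  using smooth_map_on_points[OF act_smooth, of "(g, x)"] by simp

lemma orbit_smooth:
  assumes "x \<in> points A"
  shows "smooth_map_on L (carrier G) A (\<lambda>g. act g x)"
proof -
  have s: "smooth_map_on L (points L) (product_atlas L A) (\<lambda>g. (g, x))"
    by (rule slice_smooth(2)[OF L A one_closed[folded points_L] assms])
  have "smooth_map_on L (carrier G) A (\<lambda>g. act (fst (g, x)) (snd (g, x)))"
    by (rule smooth_map_on_compose_subset[OF L LA s act_smooth carrier_open]) (use assms in \<open>auto simp: points_L\<close>)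
  then show ?thesis by simp
qed

lemma translation_smooth:
  assumes g: "g \<in> carrier G"
  shows "smooth_map_on A (points A) A (act g)"
\<comment> \<open>\<open>slice_smooth\<close> asks for a point of each factor.\<close>
proof (cases "points A = {}")
  case True
  then show ?thesis
    unfolding smooth_map_on_def by (simp add: smooth_vec_on_empty split_beta)
next
  case False
  then obtain x where x: "x \<in> points A" by blast
  have s: "smooth_map_on A (points A) (product_atlas L A) (\<lambda>x. (g, x))"
    by (rule slice_smooth(1)[OF L A g[folded points_L] x])
  have "smooth_map_on A (points A) A (\<lambda>x. act (fst (g, x)) (snd (g, x)))"
    by (rule smooth_map_on_compose_subset[OF A LA s act_smooth openin_points]) (use g in auto)
  then show ?thesis by simp
qed

lemma act_pullback:
  assumes "smooth_vec_on A W f"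
  shows "smooth_vec_on (product_atlas L A) ((carrier G \<times> points A) \<inter> (\<lambda>z. act (fst z) (snd z)) -` W)
    (\<lambda>z. f (act (fst z) (snd z)))"
  by (rule smooth_vec_on_pullback[OF LA A act_smooth assms])

lemma fundamental_tangent:
  assumes "X \<in> \<gg>" "x \<in> points A"
  shows "fundamental X x \<in> tangent_space A x"
  using push_tvec_tangent[OF L A orbit_smooth[OF assms(2)] one_closed assms(1)]
  by (simp add: fundamental_def act_one[OF assms(2)])

lemma fundamental_apply:
  assumes "x \<in> points A" "smooth_near A x f"
  shows "fundamental X x f = X (\<lambda>g. f (act g x))"
  using assms by (simp add: fundamental_def push_tvec_def act_one o_def)

lemma fundamental_apply_on:
  "smooth_vec_on A W f \<Longrightarrow> x \<in> W \<Longrightarrow> fundamental X x f = X (\<lambda>g. f (act g x))"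
  by (rule fundamental_apply[OF subsetD[OF openin_imp_points[OF smooth_vec_on_open]] smooth_nearI])

lemma fundamental_smooth:
  assumes X: "X \<in> \<gg>" and f: "smooth_vec_on A W f"
  shows "smooth_vec_on A W (\<lambda>x. fundamental X x f)"
proof -
  have W: "W \<subseteq> points A" by (rule openin_imp_points[OF smooth_vec_on_open[OF f]])
  let ?\<Omega> = "(carrier G \<times> points A) \<inter> (\<lambda>z. act (fst z) (snd z)) -` W"
  have "smooth_vec_on A {x. (\<one>\<^bsub>G\<^esub>, x) \<in> ?\<Omega>} (\<lambda>x. X (\<lambda>g. f (act g x)))"
    using smooth_partial[OF L A act_pullback[OF f] X] by simp
  moreover have "{x. (\<one>\<^bsub>G\<^esub>, x) \<in> ?\<Omega>} = W" using W one_closed act_one by auto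
  ultimately have "smooth_vec_on A W (\<lambda>x. X (\<lambda>g. f (act g x)))" by simp
  then show ?thesis by (rule smooth_vec_on_cong[OF A]) (rule fundamental_apply_on[OF f, symmetric])
qed

text \<open>Every iterated derivative is a mixed derivative of \<open>K\<close>, the function
  \<open>F\<close> of a product, at the unit. For left invariant fields the outer vector acts on the
  first factor; for the action it acts on the second, because \<open>act h (act g x)\<close> is the
  action of \<open>h\<close> times \<open>g\<close>. Exchanging the derivatives by
  \<open>partial_commute\<close> therefore turns one commutator into the negative of the
  other.\<close>

lemma fundamental_bracket:
  assumes X: "X \<in> \<gg>" and Y: "Y \<in> \<gg>" and f: "smooth_vec_on A W f" and x: "x \<in> W"
  shows "fundamental X x (\<lambda>y. fundamental Y y f) - fundamental Y x (\<lambda>y. fundamental X y f) =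
    - lie_bracket G L X Y (\<lambda>g. f (act g x))"
proof -
  interpret group G by (rule group_G)
  have xA: "x \<in> points A" using openin_imp_points[OF smooth_vec_on_open[OF f]] x by blast
  define F where "F = (\<lambda>g. f (act g x))"
  let ?N = "carrier G \<inter> (\<lambda>g. act g x) -` W"
  have F: "smooth_vec_on L ?N F"
    unfolding F_def by (rule smooth_vec_on_pullback[OF L A orbit_smooth[OF xA] f])
  have N: "openin (atlas_topology L) ?N" by (rule smooth_vec_on_open[OF F])
  have oneN: "\<one>\<^bsub>G\<^esub> \<in> ?N" using x xA by (simp add: act_one)
  define K where "K = (\<lambda>z. F (fst z \<otimes>\<^bsub>G\<^esub> snd z))"
  let ?\<Omega> = "(carrier G \<times> carrier G) \<inter> (\<lambda>(g, h). g \<otimes>\<^bsub>G\<^esub> h) -` ?N"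
  have K: "smooth_vec_on (product_atlas L L) ?\<Omega> K"
    using smooth_vec_on_pullback[OF LL L mult_smooth F] by (simp add: K_def case_prod_beta')
  have one\<Omega>: "(\<one>\<^bsub>G\<^esub>, \<one>\<^bsub>G\<^esub>) \<in> ?\<Omega>" using oneN by simp
  have li: "left_invariant_field G L X \<one>\<^bsub>G\<^esub> (\<lambda>g. left_invariant_field G L Y g F) = X (\<lambda>g. Y (\<lambda>h. K (g, h)))"
    if X: "X \<in> \<gg>" and Y: "Y \<in> \<gg>" for X Y
  proof -
    have "left_invariant_field G L X \<one>\<^bsub>G\<^esub> (\<lambda>g. left_invariant_field G L Y g F) =
        X (\<lambda>g. left_invariant_field G L Y (\<one>\<^bsub>G\<^esub> \<otimes>\<^bsub>G\<^esub> g) F)"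
      by (rule left_invariant_apply[OF one_closed smooth_nearI[OF left_invariant_smooth[OF Y F] oneN]])
    also have "\<dots> = X (\<lambda>g. Y (\<lambda>h. K (g, h)))"
      by (rule tangent_cong[OF L X N oneN])
        (simp add: left_invariant_apply[OF _ smooth_nearI[OF F]] K_def)
    finally show ?thesis .
  qed
  have br: "lie_bracket G L X Y F = X (\<lambda>g. Y (\<lambda>h. K (g, h))) - Y (\<lambda>g. X (\<lambda>h. K (g, h)))"
    using smooth_nearI[OF F oneN] by (simp add: lie_bracket_def field_bracket_def li[OF X Y] li[OF Y X])
  have act2: "fundamental X x (\<lambda>y. fundamental Y y f) = Y (\<lambda>h. X (\<lambda>g. K (h, g)))"
    if X: "X \<in> \<gg>" and Y: "Y \<in> \<gg>" for X Y
  proof -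
    have "fundamental X x (\<lambda>y. fundamental Y y f) = X (\<lambda>g. fundamental Y (act g x) f)"
      by (rule fundamental_apply_on[OF fundamental_smooth[OF Y f] x])
    also have "\<dots> = X (\<lambda>g. Y (\<lambda>h. K (h, g)))"
    proof (rule tangent_cong[OF L X N oneN])
      fix g assume g: "g \<in> ?N"
      have "fundamental Y (act g x) f = Y (\<lambda>h. f (act h (act g x)))"
        by (rule fundamental_apply_on[OF f]) (use g in simp)
      also have "\<dots> = Y (\<lambda>h. K (h, g))"
        by (rule tangent_cong[OF L Y carrier_open one_closed]) (use g xA in \<open>simp add: K_def F_def act_mult\<close>)
      finally show "fundamental Y (act g x) f = Y (\<lambda>h. K (h, g))" .
    qed
    also have "\<dots> = Y (\<lambda>h. X (\<lambda>g. K (h, g)))"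
      by (rule partial_commute[OF L L K Y X one\<Omega>, symmetric])
    finally show ?thesis .
  qed
  show ?thesis
    unfolding act2[OF X Y] act2[OF Y X] F_def[symmetric] br by simp
qed

lemma induced_apply:
  assumes w: "w \<in> exterior_power 2 \<gg>" and x: "x \<in> points A" and f: "smooth_near A x f" "smooth_near A x g"
  shows "mvec_apply A (induced_mvec_field G L A act w) [f, g] x =
    w [fun_differential L \<one>\<^bsub>G\<^esub> (\<lambda>a. f (act a x)), fun_differential L \<one>\<^bsub>G\<^esub> (\<lambda>a. g (act a x))]"
proof -
  have "pull_covec L A (\<lambda>a. act a x) \<one>\<^bsub>G\<^esub> (fun_differential A (act \<one>\<^bsub>G\<^esub> x) f) =
      fun_differential L \<one>\<^bsub>G\<^esub> (\<lambda>a. f (act a x))" if "smooth_near A x f" for f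
    by (rule pull_covec_differential[OF L A orbit_smooth[OF x] one_closed]) (simp add: act_one[OF x] that)
  then show ?thesis
    using f by (simp add: mvec_apply_def induced_mvec_field_def push_mvec_def act_one[OF x] fun_differential_dual[OF A])
qed

lemma induced_exterior:
  assumes "w \<in> exterior_power 2 \<gg>" "x \<in> points A"
  shows "induced_mvec_field G L A act w x \<in> exterior_power 2 (tangent_space A x)"
  using push_mvec_exterior[OF L A orbit_smooth[OF assms(2)] one_closed assms(1)]
  by (simp add: induced_mvec_field_def act_one[OF assms(2)])

end

text \<open>Expanding the determinants gives six terms. Exchanging \<open>(i, j)\<close> with
  \<open>(k, l)\<close> and using the antisymmetry of the commutators matches them in pairs, so the
  vanishing sum is twice the wanted one.\<close>

lemma jacobi_wedge_algebra:
  fixes I :: "'i set" and c :: "'i \<Rightarrow> 'i \<Rightarrow> real"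
  assumes c: "\<And>i j. c j i = - c i j"
    and s: "\<And>i k. sa k i = - sa i k" "\<And>i k. sb k i = - sb i k" "\<And>i k. sd k i = - sd i k"
    and 0: "(\<Sum>i\<in>I. \<Sum>j\<in>I. c i j * (\<Sum>k\<in>I. \<Sum>l\<in>I. c k l * (sa i k * (b j * d l - d j * b l) -
      sb i k * (a j * d l - d j * a l) + sd i k * (a j * b l - b j * a l)))) = 0"
  shows "(\<Sum>i\<in>I. \<Sum>j\<in>I. c i j * (\<Sum>k\<in>I. \<Sum>l\<in>I. c k l *
      (sa i k * b j * d l + sb i k * d j * a l + sd i k * a j * b l))) = 0"
proof -
  define Q where "Q = (\<lambda>F :: 'i \<Rightarrow> 'i \<Rightarrow> 'i \<Rightarrow> 'i \<Rightarrow> real. \<Sum>i\<in>I. \<Sum>j\<in>I. c i j * (\<Sum>k\<in>I. \<Sum>l\<in>I. c k l * F i j k l))"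
  have swap: "Q F = Q (\<lambda>i j k l. F k l i j)" for F
    unfolding Q_def by (rule jacobi_algebra(3)[OF c])
  have add: "Q (\<lambda>i j k l. F i j k l + F' i j k l) = Q F + Q F'" for F F'
    unfolding Q_def by (rule jacobi_algebra(4)[OF c])
  have diff: "Q (\<lambda>i j k l. F i j k l - F' i j k l) = Q F - Q F'" for F F'
    unfolding Q_def by (rule jacobi_algebra(5)[OF c])
  have sw: "Q (\<lambda>i j k l. s i k * h j * g l) = - Q (\<lambda>i j k l. s i k * g j * h l)"
    if s: "\<And>i k. s k i = - s i k" for s :: "'i \<Rightarrow> 'i \<Rightarrow> real" and g h :: "'i \<Rightarrow> real"
  proof -
    have "Q (\<lambda>i j k l. s i k * h j * g l) = Q (\<lambda>i j k l. s k i * h l * g j)" by (rule swap)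
    also have "\<dots> = Q (\<lambda>i j k l. - (s i k * g j * h l))"
    proof -
      have "s k i * h l * g j = - (s i k * g j * h l)" for i j k l using s[of k i] by simp
      then show ?thesis by presburger
    qed
    also have "\<dots> = - Q (\<lambda>i j k l. s i k * g j * h l)" by (simp add: Q_def sum_negf)
    finally show ?thesis .
  qed
  have "0 = Q (\<lambda>i j k l. ((sa i k * b j * d l - sa i k * d j * b l) - (sb i k * a j * d l - sb i k * d j * a l)) +
      (sd i k * a j * b l - sd i k * b j * a l))"
    using 0 unfolding Q_def by (simp add: algebra_simps)
  also have "\<dots> = ((Q (\<lambda>i j k l. sa i k * b j * d l) - Q (\<lambda>i j k l. sa i k * d j * b l)) -
      (Q (\<lambda>i j k l. sb i k * a j * d l) - Q (\<lambda>i j k l. sb i k * d j * a l))) +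
      (Q (\<lambda>i j k l. sd i k * a j * b l) - Q (\<lambda>i j k l. sd i k * b j * a l))"
    unfolding add diff ..
  also have "\<dots> = 2 * (Q (\<lambda>i j k l. sa i k * b j * d l) + Q (\<lambda>i j k l. sb i k * d j * a l) + Q (\<lambda>i j k l. sd i k * a j * b l))"
    using sw[where s = sa and h = d and g = b, OF s(1)] sw[where s = sb and h = a and g = d, OF s(2)]
      sw[where s = sd and h = b and g = a, OF s(3)] by simp
  finally show ?thesis unfolding add[symmetric] by (simp add: Q_def)
qed

section \<open>Bivector fields induced by an action\<close>

context atlas_action
begin

text \<open>Packages what later proofs take from \<open>[r, r] = 0\<close>: one frame of Lie algebra
  elements, valid on all open sets at once, together with the Jacobi identity. It is used for the
  induced fields, for the deformed structure and for nondegeneracy.\<close>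

lemma induced_frame:
  assumes w: "w \<in> exterior_power 2 \<gg>" and schouten: "lie_schouten G L 2 w 2 w = (\<lambda>\<alpha>s. 0)"
  obtains I :: "(nat \<times> bool) set" and e c where "finite I" "\<And>i. i \<in> I \<Longrightarrow> e i \<in> \<gg>"
    "\<And>i j. c j i = - c i j"
    "\<And>W f g z. smooth_vec_on A W f \<Longrightarrow> smooth_vec_on A W g \<Longrightarrow> z \<in> W \<Longrightarrow>
      mvec_apply A (induced_mvec_field G L A act w) [f, g] z =
      (\<Sum>i\<in>I. \<Sum>j\<in>I. c i j * (fundamental (e i) z f * fundamental (e j) z g))"
    "\<And>W f g h z. smooth_vec_on A W f \<Longrightarrow> smooth_vec_on A W g \<Longrightarrow> smooth_vec_on A W h \<Longrightarrow> z \<in> W \<Longrightarrow>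
      mvec_apply A (induced_mvec_field G L A act w) [mvec_apply A (induced_mvec_field G L A act w) [f, g], h] z -
      mvec_apply A (induced_mvec_field G L A act w) [mvec_apply A (induced_mvec_field G L A act w) [f, h], g] z +
      mvec_apply A (induced_mvec_field G L A act w) [mvec_apply A (induced_mvec_field G L A act w) [g, h], f] z = 0"
proof (rule schouten_frame[OF L one_closed[folded points_L] w schouten])
  fix I :: "(nat \<times> bool) set" and e c assume I: "finite I" and e: "\<And>i. i \<in> I \<Longrightarrow> e i \<in> \<gg>"
    and c: "\<And>i j. c j i = - c i j"
    and wI: "\<And>\<alpha> \<beta>. \<alpha> \<in> cotangent_space L \<one>\<^bsub>G\<^esub> \<Longrightarrow> \<beta> \<in> cotangent_space L \<one>\<^bsub>G\<^esub> \<Longrightarrow>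
      w [\<alpha>, \<beta>] = (\<Sum>i\<in>I. \<Sum>j\<in>I. c i j * (\<alpha> (e i) * \<beta> (e j)))"
    and sI: "\<And>\<alpha>s. (\<Sum>i\<in>I. \<Sum>j\<in>I. c i j * (\<Sum>k\<in>I. \<Sum>l\<in>I. c k l *
      wedge \<gg> [lie_bracket G L (e i) (e k), e j, e l] \<alpha>s)) = 0"
  let ?B = "\<lambda>f g. mvec_apply A (induced_mvec_field G L A act w) [f, g]"
  have pts: "W \<subseteq> points A" if "smooth_vec_on A W f" for W and f :: "'m \<Rightarrow> real"
    by (rule openin_imp_points[OF smooth_vec_on_open[OF that]])
  have fd: "fun_differential L \<one>\<^bsub>G\<^esub> (\<lambda>a. f (act a z)) X = fundamental X z f"
    if "smooth_vec_on A W f" "z \<in> W" "X \<in> \<gg>" for W z X and f :: "'m \<Rightarrow> real"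
    using that fundamental_apply_on[OF that(1,2)] by (simp add: fun_differential_def)
  have B: "?B f g z = (\<Sum>i\<in>I. \<Sum>j\<in>I. c i j * (fundamental (e i) z f * fundamental (e j) z g))"
    if "smooth_vec_on A W f" "smooth_vec_on A W g" "z \<in> W" for W f g z
  proof -
    have z: "z \<in> points A" using pts[OF that(1)] that(3) by blast
    have "?B f g z = w [fun_differential L \<one>\<^bsub>G\<^esub> (\<lambda>a. f (act a z)), fun_differential L \<one>\<^bsub>G\<^esub> (\<lambda>a. g (act a z))]"
      by (rule induced_apply[OF w z smooth_nearI[OF that(1,3)] smooth_nearI[OF that(2,3)]])
    also have "\<dots> = (\<Sum>i\<in>I. \<Sum>j\<in>I. c i j * (fundamental (e i) z f * fundamental (e j) z g))"
      unfolding wI[OF fun_differential_dual[OF L] fun_differential_dual[OF L]]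
      by (intro sum.cong refl) (simp add: fd[OF that(1,3)] fd[OF that(2,3)] e)
    finally show ?thesis .
  qed
  have J: "?B (?B f g) h z - ?B (?B f h) g z + ?B (?B g h) f z = 0"
    if fgh: "smooth_vec_on A W f" "smooth_vec_on A W g" "smooth_vec_on A W h" and z: "z \<in> W" for W f g h z
  proof -
    let ?X = "\<lambda>i z. fundamental (e i) z"
    \<comment> \<open>The order of the two fields is chosen so that the minus sign of
      \<open>fundamental_bracket\<close> cancels: \<open>T i k f\<close> is the bracket of
      \<open>e i\<close> and \<open>e k\<close> applied to \<open>f\<close> along the orbit.\<close>
    define T where "T = (\<lambda>i k f. ?X k z (\<lambda>y. ?X i y f) - ?X i z (\<lambda>y. ?X k y f))"
    define a where "a = (\<lambda>f j. ?X j z f)"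
    have JT: "?B (?B f g) h z - ?B (?B f h) g z + ?B (?B g h) f z = (\<Sum>i\<in>I. \<Sum>j\<in>I. c i j * (\<Sum>k\<in>I. \<Sum>l\<in>I. c k l *
        (T i k f * a g j * a h l + T i k g * a h j * a f l + T i k h * a f j * a g l)))"
      unfolding T_def a_def
      by (rule jacobi_frame(2)[OF A I c _ _ B fgh z])
        (use fundamental_tangent[OF e] pts[OF fgh(1)] fundamental_smooth[OF e] in blast)+
    let ?\<alpha> = "\<lambda>f. fun_differential L \<one>\<^bsub>G\<^esub> (\<lambda>g. f (act g z))"
    have \<alpha>: "?\<alpha> f \<in> cotangent_space L \<one>\<^bsub>G\<^esub>" for f by (rule fun_differential_dual[OF L])
    have T: "?\<alpha> f (lie_bracket G L (e i) (e k)) = T i k f" if "smooth_vec_on A W f" "i \<in> I" "k \<in> I" for f i k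
      using fundamental_bracket[OF e[OF that(2)] e[OF that(3)] that(1) z] lie_bracket_tangent[OF e[OF that(2)] e[OF that(3)]]
      by (simp add: T_def fun_differential_def)
    have W: "wedge \<gg> [lie_bracket G L (e i) (e k), e j, e l] [?\<alpha> f, ?\<alpha> g, ?\<alpha> h] =
        T i k f * (a g j * a h l - a h j * a g l) - T i k g * (a f j * a h l - a h j * a f l) +
        T i k h * (a f j * a g l - a g j * a f l)" if "i \<in> I" "j \<in> I" "k \<in> I" "l \<in> I" for i j k l
      using that by (simp add: wedge_3[OF \<alpha> \<alpha> \<alpha>] T fgh fd[OF fgh(1) z] fd[OF fgh(2) z] fd[OF fgh(3) z] e a_def)
    have Z: "(\<Sum>i\<in>I. \<Sum>j\<in>I. c i j * (\<Sum>k\<in>I. \<Sum>l\<in>I. c k l * (T i k f * (a g j * a h l - a h j * a g l) -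
        T i k g * (a f j * a h l - a h j * a f l) + T i k h * (a f j * a g l - a g j * a f l)))) = 0"
      using sI[of "[?\<alpha> f, ?\<alpha> g, ?\<alpha> h]"] by (simp add: W cong: sum.cong)
    have anti: "T k i f = - T i k f" for i k f by (simp add: T_def)
    show ?thesis
      unfolding JT
      by (rule jacobi_wedge_algebra[where sa = "\<lambda>i k. T i k f" and sb = "\<lambda>i k. T i k g" and sd = "\<lambda>i k. T i k h", OF c])
        (rule anti, rule anti, rule anti, rule Z)
  qed
  show thesis by (rule that[OF I e c B J])
qed

theorem induced_poisson:
  assumes w: "w \<in> exterior_power 2 \<gg>" and schouten: "lie_schouten G L 2 w 2 w = (\<lambda>\<alpha>s. 0)"
  shows "poisson_bivector_field A (induced_mvec_field G L A act w)"
proof (rule induced_frame[OF assms])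
  fix I :: "(nat \<times> bool) set" and e c assume I: "finite I" and e: "\<And>i. i \<in> I \<Longrightarrow> e i \<in> \<gg>"
    and c: "\<And>i j. c j i = - c i j"
    and B: "\<And>W f g z. smooth_vec_on A W f \<Longrightarrow> smooth_vec_on A W g \<Longrightarrow> z \<in> W \<Longrightarrow>
      mvec_apply A (induced_mvec_field G L A act w) [f, g] z =
      (\<Sum>i\<in>I. \<Sum>j\<in>I. c i j * (fundamental (e i) z f * fundamental (e j) z g))"
    and J: "\<And>W f g h z. smooth_vec_on A W f \<Longrightarrow> smooth_vec_on A W g \<Longrightarrow> smooth_vec_on A W h \<Longrightarrow> z \<in> W \<Longrightarrow>
      mvec_apply A (induced_mvec_field G L A act w) [mvec_apply A (induced_mvec_field G L A act w) [f, g], h] z -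
      mvec_apply A (induced_mvec_field G L A act w) [mvec_apply A (induced_mvec_field G L A act w) [f, h], g] z +
      mvec_apply A (induced_mvec_field G L A act w) [mvec_apply A (induced_mvec_field G L A act w) [g, h], f] z = 0"
  show ?thesis
  proof (rule poisson_bivectorI[OF A multivector_field_2I])
    show "induced_mvec_field G L A act w x \<in> exterior_power 2 (tangent_space A x)" if "x \<in> points A" for x
      by (rule induced_exterior[OF w that])
    fix W and f g :: "'m \<Rightarrow> real" assume fg: "smooth_vec_on A W f" "smooth_vec_on A W g"
    have "smooth_vec_on A W (\<lambda>z. \<Sum>i\<in>I. \<Sum>j\<in>I. c i j * (fundamental (e i) z f * fundamental (e j) z g))"
      by (intro smooth_vec_on_sum[OF A smooth_vec_on_open[OF fg(1)]] smooth_vec_on_cmult[OF A] smooth_vec_on_mult[OF A]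
          fundamental_smooth e fg)
    then show "smooth_vec_on A W (mvec_apply A (induced_mvec_field G L A act w) [f, g])"
      by (rule smooth_vec_on_cong[OF A]) (rule B[OF fg, symmetric])
  qed (rule J)
qed

end

section \<open>The cotangent bundle\<close>

lemma push_coordinate_vector:
  fixes B :: "('n, 'b::finite_dim_inner) atlas"
  assumes A: "smooth_atlas A" and B: "smooth_atlas B" and F: "smooth_map_on A W B F" "x \<in> W"
    and U: "(U, \<phi>) \<in> A" "x \<in> U" and V: "(V, \<psi>) \<in> B" "F x \<in> V"
  shows "push_tvec B F x (coordinate_vector A (U, \<phi>) x u) =
    coordinate_vector B (V, \<psi>) (F x) (dd (\<lambda>s. \<psi> (F (inv_into U \<phi> s))) (\<phi> x) u)"
proof -
  let ?v = "coordinate_vector A (U, \<phi>) x u"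
  have s: "smooth_vec_on A (W \<inter> F -` V) (\<lambda>y. \<psi> (F y))" by (rule smooth_map_onD[OF F(1) V(1)])
  have d: "(\<lambda>s. \<psi> (F (inv_into U \<phi> s))) differentiable at (\<phi> x)"
    by (rule smooth_on_differentiable[OF smooth_vec_onD'[OF s U(1)]]) (use U V F in auto)
  have c: "push_tvec B F x ?v (\<lambda>y. inner (\<psi> y) b) = inner (dd (\<lambda>s. \<psi> (F (inv_into U \<phi> s))) (\<phi> x) u) b" for b
  proof -
    have n: "smooth_near B (F x) (\<lambda>y. inner (\<psi> y) b)" by (rule smooth_nearI[OF smooth_vec_on_coordinate[OF B V(1)] V(2)])
    have "push_tvec B F x ?v (\<lambda>y. inner (\<psi> y) b) = ?v (\<lambda>y. inner (\<psi> (F y)) b)"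
      by (rule push_tvec_smooth[where B = B and F = F and x = x, OF n])
    also have "\<dots> = dd (\<lambda>s. inner (\<psi> (F (inv_into U \<phi> s))) b) (\<phi> x) u"
      by (rule coordinate_vector_smooth[OF smooth_near_pullback[OF A B F n]])
    also have "\<dots> = inner (dd (\<lambda>s. \<psi> (F (inv_into U \<phi> s))) (\<phi> x) u) b"
      using dd_inner[OF d, of b u] by (simp add: inner_commute)
    finally show ?thesis .
  qed
  show ?thesis
    using tangent_expand[OF B V push_tvec_tangent[OF A B F coordinate_vector_tangent[OF A U]], of u]
    by (simp add: c onb_expand)
qed

text \<open>This is the push-forward by the identity map, read in two charts.\<close>

lemma coordinate_vector_transition:
  assumes A: "smooth_atlas A" and U: "(U, \<phi>) \<in> A" "x \<in> U" and V: "(V, \<psi>) \<in> A" "x \<in> V"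
  shows "coordinate_vector A (V, \<psi>) x u = coordinate_vector A (U, \<phi>) x (dd (\<phi> \<circ> inv_into V \<psi>) (\<psi> x) u)"
proof -
  have x: "x \<in> points A" using U chart_points by blast
  show ?thesis
    using push_coordinate_vector[OF A A smooth_map_on_id[OF A openin_points] x V U, of u]
      push_tvec_id[OF coordinate_vector_tangent[OF A V]] by (simp add: o_def)
qed

text \<open>Companion of \<open>smooth_partial\<close>: there the vector sits at one fixed point,
  here it is a chart field whose base point moves too, and smoothness is joint in both
  factors.\<close>

lemma smooth_vertical:
  fixes A :: "('m, 'a::finite_dim_inner) atlas" and B :: "('n, 'b::finite_dim_inner) atlas"
  assumes A: "smooth_atlas A" and B: "smooth_atlas B"
    and f: "smooth_vec_on (product_atlas A B) \<Omega> f" and V: "(V, \<psi>) \<in> B"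
  shows "smooth_vec_on (product_atlas A B) (\<Omega> \<inter> (points A \<times> V))
    (\<lambda>z. coordinate_vector B (V, \<psi>) (snd z) w (\<lambda>b. f (fst z, b)))"
proof (rule smooth_vec_on_local[OF smooth_atlas_product[OF A B]])
  note P = smooth_atlas_product[OF A B]
  fix z assume z: "z \<in> \<Omega> \<inter> (points A \<times> V)"
  then have "fst z \<in> points A" by auto
  then obtain U \<phi> where U: "(U, \<phi>) \<in> A" "fst z \<in> U" by (rule points_chart)
  define K where "K = (\<lambda>z. f (inv_into U \<phi> (fst z), inv_into V \<psi> (snd z)))"
  let ?W = "U \<times> V \<inter> \<Omega>"
  have op: "openin (atlas_topology (product_atlas A B)) ?W"
    by (rule openin_Int[OF openin_chart[OF P product_atlasI[OF U(1) V]] smooth_vec_on_open[OF f]])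
  have K: "smooth_on (map_prod \<phi> \<psi> ` ?W) K"
    unfolding K_def by (rule partial_vector_chart(3)[OF A B f U V, of "snd z"]) (use z in auto)
  have "smooth_vec_on (product_atlas A B) ?W (\<lambda>z. dd K (map_prod \<phi> \<psi> z) (0, w))"
    by (rule smooth_vec_on_compose[OF P smooth_vec_on_subset[OF smooth_vec_on_chart[OF P product_atlasI[OF U(1) V]] op] smooth_on_dd[OF K]])
      auto
  then have "smooth_vec_on (product_atlas A B) ?W (\<lambda>z. coordinate_vector B (V, \<psi>) (snd z) w (\<lambda>b. f (fst z, b)))"
  proof (rule smooth_vec_on_cong[OF P])
    fix y assume y: "y \<in> ?W"
    then show "dd K (map_prod \<phi> \<psi> y) (0, w) = coordinate_vector B (V, \<psi>) (snd y) w (\<lambda>b. f (fst y, b))"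
      using partial_vector_chart(2)[OF A B f U(1) _ V, of "fst y" "snd y" w]
      by (auto simp: K_def)
  qed
  moreover have "?W \<subseteq> \<Omega> \<inter> (points A \<times> V)" using chart_points[OF U(1)] by auto
  ultimately show "\<exists>W'. z \<in> W' \<and> W' \<subseteq> \<Omega> \<inter> (points A \<times> V) \<and>
      smooth_vec_on (product_atlas A B) W' (\<lambda>z. coordinate_vector B (V, \<psi>) (snd z) w (\<lambda>b. f (fst z, b)))"
    using z U by (intro exI[of _ ?W] conjI) auto
qed

text \<open>The second component of \<open>cotangent_chart\<close>. It is also applied to the
  cotangent atlas itself, where it lists the components of covectors of the bundle.\<close>

definition momentum :: "('m, 'a::finite_dim_inner) atlas \<Rightarrow> ('m, 'a) chart \<Rightarrow> 'm \<Rightarrow> 'm covec \<Rightarrow> 'a" where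
  "momentum A c x \<alpha> = (\<Sum>b\<in>onb. \<alpha> (coordinate_vector A c x b) *\<^sub>R b)"

lemma inner_momentum:
  assumes A: "smooth_atlas A" and U: "(U, \<phi>) \<in> A" "x \<in> U" and \<alpha>: "\<alpha> \<in> cotangent_space A x"
  shows "inner (momentum A (U, \<phi>) x \<alpha>) u = \<alpha> (coordinate_vector A (U, \<phi>) x u)"
  unfolding dual_expand[OF A U \<alpha>, of u] momentum_def
  by (simp add: inner_sum_left inner_commute[of u] mult.commute)

text \<open>With \<open>differential_momentum\<close> this makes \<open>momentum\<close> a bijection
  onto the model space, whose inverse sends \<open>p\<close> to the differential of
  \<open>inner (\<phi> y) p\<close>.\<close>

lemma momentum_differential:
  assumes A: "smooth_atlas A" and U: "(U, \<phi>) \<in> A" "x \<in> U"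
  shows "momentum A (U, \<phi>) x (fun_differential A x (\<lambda>y. inner (\<phi> y) p)) = p"
proof -
  have "inner (momentum A (U, \<phi>) x (fun_differential A x (\<lambda>y. inner (\<phi> y) p))) u = inner p u" for u
    using inner_momentum[OF A U fun_differential_dual[OF A]] coordinate_vector_tangent[OF A U, of u]
      coordinate_vector_coordinate[OF A U, of u p]
    by (simp add: fun_differential_def inner_commute)
  then show ?thesis by (metis vector_eq_rdot)
qed

lemma differential_momentum:
  assumes A: "smooth_atlas A" and U: "(U, \<phi>) \<in> A" "x \<in> U" and \<alpha>: "\<alpha> \<in> cotangent_space A x"
  shows "fun_differential A x (\<lambda>y. inner (\<phi> y) (momentum A (U, \<phi>) x \<alpha>)) = \<alpha>"
proof -
  have "(\<lambda>y. inner (\<phi> y) (momentum A (U, \<phi>) x \<alpha>)) = (\<lambda>y. \<Sum>b\<in>onb. \<alpha> (coordinate_vector A (U, \<phi>) x b) * inner (\<phi> y) b)"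
    by (simp add: momentum_def inner_sum_right)
  then show ?thesis using cotangent_differential(2)[OF A U \<alpha>] by simp
qed

section \<open>The cotangent atlas\<close>

abbreviation cot_set where "cot_set A U \<equiv> (SIGMA x:U. cotangent_space A x)"
abbreviation cot_map where "cot_map A U \<phi> \<equiv> (\<lambda>z. (\<phi> (fst z), momentum A (U, \<phi>) (fst z) (snd z)))"

lemma cotangent_chart_eq: "cotangent_chart A (U, \<phi>) = (cot_set A U, cot_map A U \<phi>)"
  by (auto simp: cotangent_chart_def momentum_def fun_eq_iff)

lemma cotangent_atlasI: "(U, \<phi>) \<in> A \<Longrightarrow> (cot_set A U, cot_map A U \<phi>) \<in> cotangent_atlas A"
  unfolding cotangent_atlas_def cotangent_chart_eq[symmetric] by (rule imageI)

lemma cotangent_atlasE: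
  assumes "(V, \<psi>) \<in> cotangent_atlas A"
  obtains U \<phi> where "(U, \<phi>) \<in> A" "V = cot_set A U" "\<psi> = cot_map A U \<phi>"
proof -
  obtain c where c: "c \<in> A" "(V, \<psi>) = cotangent_chart A c"
    using assms unfolding cotangent_atlas_def by blast
  obtain U \<phi> where U: "c = (U, \<phi>)" by (cases c)
  show ?thesis by (rule that[of U \<phi>]) (use c in \<open>simp_all add: U cotangent_chart_eq\<close>)
qed

lemma points_cotangent: "points (cotangent_atlas A) = cotangent_points A"
proof
  show "points (cotangent_atlas A) \<subseteq> cotangent_points A"
  proof
    fix z assume "z \<in> points (cotangent_atlas A)"
    then obtain V \<psi> where V: "(V, \<psi>) \<in> cotangent_atlas A" "z \<in> V" by (rule points_chart)
    from V(1) obtain U \<phi> where "(U, \<phi>) \<in> A" "V = cot_set A U" by (rule cotangent_atlasE)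
    then show "z \<in> cotangent_points A" using V(2) chart_points unfolding cotangent_points_def by fast
  qed
  show "cotangent_points A \<subseteq> points (cotangent_atlas A)"
  proof
    fix z assume z: "z \<in> cotangent_points A"
    then have "fst z \<in> points A" by (auto simp: cotangent_points_def)
    then obtain U \<phi> where U: "(U, \<phi>) \<in> A" "fst z \<in> U" by (rule points_chart)
    then have "z \<in> cot_set A U" using z by (auto simp: cotangent_points_def)
    then show "z \<in> points (cotangent_atlas A)" using chart_points[OF cotangent_atlasI[OF U(1)]] by blast
  qed
qed

lemma cot_map_image:
  assumes A: "smooth_atlas A" and U: "(U, \<phi>) \<in> A" and W: "W \<subseteq> U"
  shows "cot_map A U \<phi> ` cot_set A W = \<phi> ` W \<times> UNIV"
proof
  show "\<phi> ` W \<times> UNIV \<subseteq> cot_map A U \<phi> ` cot_set A W"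
  proof
    fix y assume "y \<in> \<phi> ` W \<times> (UNIV :: 'b set)"
    then obtain x p where y: "y = (\<phi> x, p)" "x \<in> W" by auto
    have "y = cot_map A U \<phi> (x, fun_differential A x (\<lambda>y. inner (\<phi> y) p))"
      using momentum_differential[OF A U, of x p] y W by auto
    then show "y \<in> cot_map A U \<phi> ` cot_set A W"
      by (rule image_eqI) (use y fun_differential_dual[OF A] in auto)
  qed
qed auto

text \<open>The sum is the transposed Jacobian of the inverse coordinate change applied to the
  momentum; it comes from rewriting the coordinate vectors of one chart in the other.\<close>

lemma momentum_transition:
  assumes A: "smooth_atlas A" and U: "(U, \<phi>) \<in> A" "x \<in> U" and V: "(V, \<psi>) \<in> A" "x \<in> V"
    and \<alpha>: "\<alpha> \<in> cotangent_space A x"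
  shows "momentum A (V, \<psi>) x \<alpha> = (\<Sum>b\<in>onb. inner (momentum A (U, \<phi>) x \<alpha>) (dd (\<phi> \<circ> inv_into V \<psi>) (\<psi> x) b) *\<^sub>R b)"
  unfolding inner_momentum[OF A U \<alpha>] coordinate_vector_transition[OF A U V, symmetric] by (simp add: momentum_def)

lemma inj_cot_map:
  assumes A: "smooth_atlas A" and U: "(U, \<phi>) \<in> A"
  shows "inj_on (cot_map A U \<phi>) (cot_set A U)"
proof (rule inj_onI)
  fix y z assume y: "y \<in> cot_set A U" and z: "z \<in> cot_set A U" and eq: "cot_map A U \<phi> y = cot_map A U \<phi> z"
  have f: "fst y = fst z" using y z eq inj_onD[OF chart_inj[OF A U], of "fst y" "fst z"] by auto
  have d: "fun_differential A (fst z) (\<lambda>u. inner (\<phi> u) (momentum A (U, \<phi>) (fst z) (snd z))) = snd z" if "z \<in> cot_set A U" for z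
    by (rule differential_momentum[OF A U]) (use that in auto)
  have "momentum A (U, \<phi>) (fst y) (snd y) = momentum A (U, \<phi>) (fst z) (snd z)" using eq by simp
  then have "snd y = snd z" using d[OF y] d[OF z] unfolding f by metis
  with f show "y = z" by (rule prod_eqI)
qed

lemma inv_cot_map:
  assumes A: "smooth_atlas A" and U: "(U, \<phi>) \<in> A" and "z \<in> cot_set A U"
  shows "inv_into (cot_set A U) (cot_map A U \<phi>) (cot_map A U \<phi> z) = z"
  by (rule inv_into_f_f[OF inj_cot_map[OF A U] assms(3)])

text \<open>A transition map acts by \<open>?\<tau>\<close> on positions and linearly on momenta,
  with coefficients from the Jacobian of the inverse transition \<open>?\<sigma>\<close> at the new
  position.\<close>

lemma smooth_atlas_cotangent:
  assumes A: "smooth_atlas A"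
  shows "smooth_atlas (cotangent_atlas A)"
proof (rule smooth_atlasI)
  fix V \<psi> assume "(V, \<psi>) \<in> cotangent_atlas A"
  then obtain U \<phi> where "(U, \<phi>) \<in> A" "V = cot_set A U" "\<psi> = cot_map A U \<phi>" by (rule cotangent_atlasE)
  then show "inj_on \<psi> V" using inj_cot_map[OF A] by simp
next
  fix V \<psi> V' \<psi>' assume c: "(V, \<psi>) \<in> cotangent_atlas A" "(V', \<psi>') \<in> cotangent_atlas A"
  from c(1) obtain U \<phi> where U: "(U, \<phi>) \<in> A" "V = cot_set A U" "\<psi> = cot_map A U \<phi>" by (rule cotangent_atlasE)
  from c(2) obtain U' \<phi>' where U': "(U', \<phi>') \<in> A" "V' = cot_set A U'" "\<psi>' = cot_map A U' \<phi>'" by (rule cotangent_atlasE)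
  have VV: "V \<inter> V' = cot_set A (U \<inter> U')" unfolding U U' by auto
  have im: "\<psi> ` (V \<inter> V') = \<phi> ` (U \<inter> U') \<times> UNIV"
    unfolding VV U(3) by (rule cot_map_image[OF A U(1)]) auto
  have op: "open (\<phi> ` (U \<inter> U') \<times> (UNIV :: 'b set))"
    using chart_open_Int[OF A U(1) U'(1)] open_UNIV by (rule open_Times)
  then show "open (\<psi> ` (V \<inter> V'))" by (simp only: im)
  let ?S = "\<phi> ` (U \<inter> U') \<times> (UNIV :: 'b set)" and ?\<tau> = "\<phi>' \<circ> inv_into U \<phi>" and ?\<sigma> = "\<phi> \<circ> inv_into U' \<phi>'"
  have \<tau>: "smooth_on ?S (\<lambda>y. ?\<tau> (fst y))"
    by (rule smooth_on_compose[OF op smooth_on_bounded_linear[OF bounded_linear_fst] chart_transition[OF A U(1) U'(1)]]) auto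
  have \<sigma>: "smooth_on (\<phi>' ` (U' \<inter> U)) ?\<sigma>" by (rule chart_transition[OF A U'(1) U(1)])
  have "smooth_on ?S (\<lambda>y. dd ?\<sigma> (?\<tau> (fst y)) b)" for b
    by (rule smooth_on_compose[OF op \<tau> smooth_on_dd[OF \<sigma>]]) (use chart_inv[OF A U(1)] in auto)
  then have "smooth_on ?S (\<lambda>y. (?\<tau> (fst y), \<Sum>b\<in>onb. inner (snd y) (dd ?\<sigma> (?\<tau> (fst y)) b) *\<^sub>R b))"
    by (intro smooth_on_Pair[OF op] \<tau> smooth_on_sum[OF op] smooth_on_scaleR[OF op] smooth_on_inner[OF op]
        smooth_on_bounded_linear[OF bounded_linear_snd] smooth_on_const)
  then show "smooth_on (\<psi> ` (V \<inter> V')) (\<psi>' \<circ> inv_into V \<psi>)"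
    unfolding im
  proof (rule smooth_on_cong[OF _ op])
    fix y assume "y \<in> ?S"
    then have "y \<in> \<psi> ` (V \<inter> V')" by (simp only: im)
    then obtain z where z: "z \<in> V" "z \<in> V'" "y = \<psi> z" by blast
    have zz: "fst z \<in> U" "fst z \<in> U'" "snd z \<in> cotangent_space A (fst z)" using z U U' by auto
    have "inv_into V \<psi> y = z" using inv_cot_map[OF A U(1)] z U by simp
    then show "(?\<tau> (fst y), \<Sum>b\<in>onb. inner (snd y) (dd ?\<sigma> (?\<tau> (fst y)) b) *\<^sub>R b) = (\<psi>' \<circ> inv_into V \<psi>) y"
      using momentum_transition[OF A U(1) zz(1) U'(1) zz(2,3)] z(3) U(3) U'(3) zz
      by (simp add: chart_inv[OF A U(1)])
  qed
qed

lemma cotangent_projection_smooth: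
  assumes A: "smooth_atlas A"
  shows "smooth_map_on (cotangent_atlas A) (cotangent_points A) A fst"
proof -
  note T = smooth_atlas_cotangent[OF A]
  show ?thesis
  proof (rule smooth_map_onI[OF T A openin_points[of "cotangent_atlas A", unfolded points_cotangent]])
    fix z assume z: "z \<in> cotangent_points A"
    then have "fst z \<in> points A" by (auto simp: cotangent_points_def)
    then obtain U \<phi> where U: "(U, \<phi>) \<in> A" "fst z \<in> U" by (rule points_chart)
    have "smooth_vec_on (cotangent_atlas A) (cot_set A U) (\<lambda>z. fst (cot_map A U \<phi> z))"
      by (rule smooth_vec_on_compose[OF T smooth_vec_on_chart[OF T cotangent_atlasI[OF U(1)]] smooth_on_bounded_linear[OF bounded_linear_fst, of UNIV]])
        auto
    then show "\<exists>W' V \<psi>. z \<in> W' \<and> (V, \<psi>) \<in> A \<and> fst ` W' \<subseteq> V \<and> smooth_vec_on (cotangent_atlas A) W' (\<lambda>x. \<psi> (fst x))"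
      using z U by (intro exI[of _ "cot_set A U"] exI[of _ U] exI[of _ \<phi>]) (auto simp: cotangent_points_def)
  qed
qed

subsection \<open>Cotangent lifts are symplectic\<close>

lemma linear_pair_expand:
  fixes f :: "'a::finite_dim_inner \<times> 'b::finite_dim_inner \<Rightarrow> real"
  assumes "linear f"
  shows "f (v, w) = (\<Sum>b\<in>onb. inner v b * f (b, 0)) + (\<Sum>b\<in>onb. inner w b * f (0, b))"
proof -
  have l1: "linear (\<lambda>v. f (v, 0))" and l2: "linear (\<lambda>w. f (0, w))"
    using linear_add[OF assms, of "(v, 0)" "(w, 0)" for v w] linear_add[OF assms, of "(0, v)" "(0, w)" for v w]
      linear_cmul[OF assms, of c "(v, 0)" for c v] linear_cmul[OF assms, of c "(0, w)" for c w]
    by (auto intro!: linearI)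
  have "f (v, w) = f (v, 0) + f (0, w)" using linear_add[OF assms, of "(v, 0)" "(0, w)"] by simp
  then show ?thesis using linear_onb_expand[OF l1, of v] linear_onb_expand[OF l2, of w] by simp
qed

text \<open>If \<open>S\<close> preserves the symplectic form and is onto, it maps the Hamiltonian vector of \<open>g \<circ> S\<close> to
  that of \<open>g\<close>, and the Poisson bracket of linear forms is \<open>{f, g} = f X\<^sub>g\<close>.\<close>

lemma symplectic_linear_bracket:
  fixes S :: "'a::finite_dim_inner \<times> 'a \<Rightarrow> 'a \<times> 'a" and f g :: "'a \<times> 'a \<Rightarrow> real"
  assumes S: "linear S" "surj S" and f: "linear f" and g: "linear g"
    and symp: "\<And>v w. inner (fst (S v)) (snd (S w)) - inner (fst (S w)) (snd (S v)) = inner (fst v) (snd w) - inner (fst w) (snd v)"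
  shows "(\<Sum>b\<in>onb. f (S (b, 0)) * g (S (0, b)) - g (S (b, 0)) * f (S (0, b))) =
    (\<Sum>b\<in>onb. f (b, 0) * g (0, b) - g (b, 0) * f (0, b))"
proof -
  \<comment> \<open>The Hamiltonian vector
    \<open>(\<partial>g/\<partial>p, - \<partial>g/\<partial>q)\<close>.\<close>
  define ham where "ham = (\<lambda>g :: 'a \<times> 'a \<Rightarrow> real. (\<Sum>b\<in>onb. g (0, b) *\<^sub>R b, - (\<Sum>b\<in>onb. g (b, 0) *\<^sub>R b)))"
  have br: "(\<Sum>b\<in>onb. f (b, 0) * g (0, b) - g (b, 0) * f (0, b)) = f (ham g)" if f: "linear f" for f g :: "'a \<times> 'a \<Rightarrow> real"
  proof -
    have i: "inner (\<Sum>b\<in>onb. k b *\<^sub>R b) c = k c" if c: "c \<in> onb" for k and c :: 'a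
    proof -
      have "inner (\<Sum>b\<in>onb. k b *\<^sub>R b) c = (\<Sum>b\<in>onb. if b = c then k b else 0)"
        unfolding inner_sum_left by (rule sum.cong) (simp_all add: c inner_onb)
      then show ?thesis using c by simp
    qed
    show ?thesis
      unfolding ham_def by (subst linear_pair_expand[OF f]) (simp add: i sum_subtractf sum_negf mult.commute)
  qed
  have om: "inner (fst (ham g)) (snd w) - inner (fst w) (snd (ham g)) = g w" if g: "linear g" for g w
    using linear_pair_expand[OF g, of "fst w" "snd w"]
    by (simp add: ham_def inner_sum_left inner_sum_right inner_commute mult.commute)
  have fS: "linear (\<lambda>v. f (S v))" and gS: "linear (\<lambda>v. g (S v))"
    using linear_compose[OF S(1) f] linear_compose[OF S(1) g] by (simp_all add: o_def)
  have "S (ham (\<lambda>v. g (S v))) = ham g"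
  proof -
    let ?h = "ham (\<lambda>v. g (S v))"
    \<comment> \<open>\<open>symp\<close> moves the symplectic form from \<open>w = S v\<close> back
      to \<open>v\<close>, where \<open>om\<close> evaluates it. Since \<open>S\<close> is onto,
      this holds for every \<open>w\<close>, and the form is nondegenerate.\<close>
    have eq: "inner (fst (S ?h)) (snd w) - inner (fst w) (snd (S ?h)) = inner (fst (ham g)) (snd w) - inner (fst w) (snd (ham g))" for w
    proof -
      obtain v where v: "w = S v" using S(2) by (metis surjD)
      show ?thesis unfolding om[OF g] unfolding v symp om[OF gS] ..
    qed
    have "inner (fst (S ?h)) p = inner (fst (ham g)) p" for p using eq[of "(0, p)"] by simp
    moreover have "inner (snd (S ?h)) q = inner (snd (ham g)) q" for q using eq[of "(q, 0)"] by (simp add: inner_commute)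
    ultimately show ?thesis by (metis prod_eqI vector_eq_rdot)
  qed
  then show ?thesis using br[OF fS, of "\<lambda>v. g (S v)"] br[OF f, of g] by simp
qed

text \<open>Differentiating \<open>\<langle>snd (\<Psi> (q, p)), D\<sigma>(q) u\<rangle> = \<langle>p, u\<rangle>\<close> expresses the second component of \<open>D\<Psi>\<close>;
  the terms with the second derivative of \<open>\<sigma>\<close> cancel in the symplectic form by symmetry.\<close>

lemma cotangent_lift_bracket:
  fixes \<Psi> :: "'a::finite_dim_inner \<times> 'a \<Rightarrow> 'a \<times> 'a" and F H :: "'a \<times> 'a \<Rightarrow> real"
  assumes S: "open S" "z \<in> S" and \<Psi>: "smooth_on S \<Psi>"
    and S': "open S'" "\<And>y. y \<in> S \<Longrightarrow> fst y \<in> S'" and \<sigma>: "smooth_on S' \<sigma>"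
    and fst: "\<And>y. y \<in> S \<Longrightarrow> fst (\<Psi> y) = \<sigma> (fst y)"
    and snd: "\<And>y u. y \<in> S \<Longrightarrow> inner (snd (\<Psi> y)) (dd \<sigma> (fst y) u) = inner (snd y) u"
    and onto: "\<And>w. \<exists>u. dd \<sigma> (fst z) u = w"
    and F: "F differentiable at (\<Psi> z)" and H: "H differentiable at (\<Psi> z)"
  shows "(\<Sum>b\<in>onb. dd (\<lambda>y. F (\<Psi> y)) z (b, 0) * dd (\<lambda>y. H (\<Psi> y)) z (0, b) -
      dd (\<lambda>y. H (\<Psi> y)) z (b, 0) * dd (\<lambda>y. F (\<Psi> y)) z (0, b)) =
    (\<Sum>b\<in>onb. dd F (\<Psi> z) (b, 0) * dd H (\<Psi> z) (0, b) - dd H (\<Psi> z) (b, 0) * dd F (\<Psi> z) (0, b))"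
proof -
  let ?P = "dd \<Psi> z" and ?q = "fst z"
  define K where "K = (\<lambda>u w. dd (\<lambda>s. dd \<sigma> s u) ?q w)"
  have q: "?q \<in> S'" by (rule S'(2)[OF S(2)])
  have K_sym: "K u w = K w u" for u w unfolding K_def by (rule dd_commute[OF S'(1) \<sigma> q])
  have K_lin: "linear (\<lambda>u. K u w)" for w
  proof -
    have "linear (\<lambda>u. K w u)"
      unfolding K_def using linear_dd[OF smooth_on_differentiable[OF smooth_on_dd[OF \<sigma>] q], of w] .
    moreover have "(\<lambda>u. K u w) = (\<lambda>u. K w u)" using K_sym by (rule ext)
    ultimately show ?thesis by simp
  qed
  have d\<Psi>: "(\<Psi> has_derivative ?P) (at z)" by (rule smooth_on_has_derivative[OF \<Psi> S(2)])
  have d\<sigma>: "linear (dd \<sigma> ?q)" by (rule linear_dd[OF smooth_on_differentiable[OF \<sigma> q]])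
  have P1: "fst (?P v) = dd \<sigma> ?q (fst v)" for v
  proof -
    have "fst (?P v) = dd (\<lambda>y. fst (\<Psi> y)) z v" by (rule dd_eq[OF has_derivative_fst[OF d\<Psi>], symmetric])
    also have "\<dots> = dd (\<lambda>y. \<sigma> (fst y)) z v" by (rule dd_cong[OF S fst])
    also have "\<dots> = dd \<sigma> ?q (fst v)"
      by (rule dd_eq[OF has_derivative_compose[OF has_derivative_fst[OF has_derivative_ident] smooth_on_has_derivative[OF \<sigma> q]]])
    finally show ?thesis .
  qed
  have P2: "inner (snd (?P v)) (dd \<sigma> ?q u) = inner (snd v) u - inner (snd (\<Psi> z)) (K u (fst v))" for v u
  proof -
    have 1: "((\<lambda>y. snd (\<Psi> y)) has_derivative (\<lambda>v. snd (?P v))) (at z)" by (rule has_derivative_snd[OF d\<Psi>])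
    have 2: "((\<lambda>y. dd \<sigma> (fst y) u) has_derivative (\<lambda>v. K u (fst v))) (at z)"
      unfolding K_def
      by (rule has_derivative_compose[OF has_derivative_fst[OF has_derivative_ident] smooth_on_has_derivative[OF smooth_on_dd[OF \<sigma>] q]])
    have "inner (snd (\<Psi> z)) (K u (fst v)) + inner (snd (?P v)) (dd \<sigma> ?q u) = dd (\<lambda>y. inner (snd (\<Psi> y)) (dd \<sigma> (fst y) u)) z v"
      by (rule dd_eq[OF has_derivative_inner[OF 1 2], symmetric])
    also have "\<dots> = dd (\<lambda>y. inner (snd y) u) z v" by (rule dd_cong[OF S snd])
    also have "\<dots> = inner (snd v) u"
      by (rule dd_eq[OF has_derivative_inner_left[OF has_derivative_snd[OF has_derivative_ident]]])
    finally show ?thesis by simp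
  qed
  have symp: "inner (fst (?P v)) (snd (?P w)) - inner (fst (?P w)) (snd (?P v)) = inner (fst v) (snd w) - inner (fst w) (snd v)" for v w
    using P2[of w "fst v"] P2[of v "fst w"] K_sym[of "fst v" "fst w"] by (simp add: P1 inner_commute)
  have "surj ?P"
  proof (rule surjI)
    fix y :: "'a \<times> 'a"
    define w where "w = (SOME w. dd \<sigma> ?q w = fst y)"
    have w: "dd \<sigma> ?q w = fst y" unfolding w_def by (rule someI_ex[OF onto])
    \<comment> \<open>Solves \<open>P2\<close> for the momentum part of a preimage with position
      part \<open>w\<close>; the summand with \<open>K\<close> compensates the second-order
      term.\<close>
    define \<rho> where "\<rho> = (\<Sum>b\<in>onb. (inner (snd y) (dd \<sigma> ?q b) + inner (snd (\<Psi> z)) (K b w)) *\<^sub>R b)"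
    have \<rho>: "inner \<rho> u = inner (snd y) (dd \<sigma> ?q u) + inner (snd (\<Psi> z)) (K u w)" for u
    proof -
      have l: "linear (\<lambda>u. inner (snd y) (dd \<sigma> ?q u) + inner (snd (\<Psi> z)) (K u w))"
        using linear_add[OF d\<sigma>] linear_cmul[OF d\<sigma>] linear_add[OF K_lin] linear_cmul[OF K_lin]
        by (intro linearI) (simp_all add: inner_add_right algebra_simps)
      show ?thesis
        unfolding \<rho>_def inner_sum_left by (subst linear_onb_expand[OF l, of u]) (simp add: inner_commute mult.commute)
    qed
    have "inner (snd (?P (w, \<rho>))) (dd \<sigma> ?q u) = inner (snd y) (dd \<sigma> ?q u)" for u
      using P2[of "(w, \<rho>)" u] \<rho>[of u] by simp
    then have "inner (snd (?P (w, \<rho>))) v = inner (snd y) v" for v using onto[of v] by metis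
    then have "snd (?P (w, \<rho>)) = snd y" by (metis vector_eq_rdot)
    moreover have "fst (?P (w, \<rho>)) = fst y" using P1[of "(w, \<rho>)"] w by simp
    ultimately show "?P ((\<lambda>y. let w = (SOME w. dd \<sigma> ?q w = fst y) in
        (w, \<Sum>b\<in>onb. (inner (snd y) (dd \<sigma> ?q b) + inner (snd (\<Psi> z)) (K b w)) *\<^sub>R b)) y) = y"
      by (simp add: Let_def w_def[symmetric] \<rho>_def[symmetric] prod_eq_iff)
  qed
  have dF: "dd (\<lambda>y. F (\<Psi> y)) z v = dd F (\<Psi> z) (?P v)" and dH: "dd (\<lambda>y. H (\<Psi> y)) z v = dd H (\<Psi> z) (?P v)" for v
    using dd_compose[OF smooth_on_differentiable[OF \<Psi> S(2)]] F H by blast+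
  show ?thesis
    unfolding dF dH
    by (rule symplectic_linear_bracket[OF has_derivative_linear[OF d\<Psi>] \<open>surj ?P\<close> linear_dd[OF F] linear_dd[OF H] symp])
qed

section \<open>The lifted action\<close>

context atlas_action
begin

abbreviation T where "T \<equiv> cotangent_atlas A"
abbreviation lift where "lift \<equiv> lifted_action G A act"

lemma T: "smooth_atlas T" by (rule smooth_atlas_cotangent[OF A])
lemma LT: "smooth_atlas (product_atlas L T)" by (rule smooth_atlas_product[OF L T])

lemma inv_closed: "g \<in> carrier G \<Longrightarrow> inv\<^bsub>G\<^esub> g \<in> carrier G"
  by (rule group.inv_closed[OF group_G])

lemma act_inv:
  assumes "g \<in> carrier G" "x \<in> points A"
  shows "act (inv\<^bsub>G\<^esub> g) (act g x) = x" "act g (act (inv\<^bsub>G\<^esub> g) x) = x"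
  using act_mult[OF inv_closed[OF assms(1)] assms] act_mult[OF assms(1) inv_closed[OF assms(1)] assms(2)]
    group.l_inv[OF group_G assms(1)] group.r_inv[OF group_G assms(1)] act_one[OF assms(2)] by simp_all

lemma lift_eq:
  assumes "z \<in> cotangent_points A"
  shows "lift g z = (act g (fst z), pull_covec A A (act (inv\<^bsub>G\<^esub> g)) (act g (fst z)) (snd z))"
  using assms by (cases z) (simp add: lifted_action_def)

lemma lift_points:
  assumes g: "g \<in> carrier G" and z: "z \<in> cotangent_points A"
  shows "lift g z \<in> cotangent_points A"
proof -
  have x: "fst z \<in> points A" "snd z \<in> cotangent_space A (fst z)" using z by (auto simp: cotangent_points_def)
  have "pull_covec A A (act (inv\<^bsub>G\<^esub> g)) (act g (fst z)) (snd z) \<in> cotangent_space A (act g (fst z))"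
    by (rule pull_covec_dual[OF A A translation_smooth[OF inv_closed[OF g]] act_points[OF g x(1)]])
      (simp add: act_inv[OF g x(1)] x(2))
  then show ?thesis using act_points[OF g x(1)] by (simp add: lift_eq[OF z] cotangent_points_def)
qed

lemma pull_covec_cong:
  assumes "x \<in> points A" "\<And>y. y \<in> points A \<Longrightarrow> F y = H y"
  shows "pull_covec A B F x = pull_covec A B H x"
proof (intro ext)
  fix \<alpha> v
  show "pull_covec A B F x \<alpha> v = pull_covec A B H x \<alpha> v"
    using push_tvec_cong[OF A _ openin_points assms(1), of v F H B] assms(2) by (simp add: pull_covec_def)
qed

lemma lift_one:
  assumes z: "z \<in> cotangent_points A"
  shows "lift \<one>\<^bsub>G\<^esub> z = z"
proof -
  have x: "fst z \<in> points A" "snd z \<in> cotangent_space A (fst z)" using z by (auto simp: cotangent_points_def)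
  have "pull_covec A A (act \<one>\<^bsub>G\<^esub>) (fst z) = pull_covec A A (\<lambda>y. y) (fst z)"
    by (rule pull_covec_cong[OF x(1) act_one])
  moreover have "pull_covec A A (\<lambda>y. y) (fst z) (snd z) = snd z"
    using x(2) by (auto simp: pull_covec_def push_tvec_id dual_space_def fun_eq_iff)
  ultimately show ?thesis
    by (simp add: lift_eq[OF z] act_one[OF x(1)] monoid.inv_one[OF group.is_monoid[OF group_G]])
qed

text \<open>Inversion and pull-back both reverse products, so the lift is again a left
  action.\<close>

lemma lift_mult:
  assumes g: "g \<in> carrier G" and h: "h \<in> carrier G" and z: "z \<in> cotangent_points A"
  shows "lift (g \<otimes>\<^bsub>G\<^esub> h) z = lift g (lift h z)"
proof -
  have x: "fst z \<in> points A" using z by (auto simp: cotangent_points_def)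
  let ?y = "act g (act h (fst z))"
  have y: "?y \<in> points A" by (intro act_points g h x)
  have gy: "act (inv\<^bsub>G\<^esub> g) ?y = act h (fst z)" by (rule act_inv(1)[OF g act_points[OF h x]])
  have "pull_covec A A (act (inv\<^bsub>G\<^esub> g)) ?y (pull_covec A A (act (inv\<^bsub>G\<^esub> h)) (act (inv\<^bsub>G\<^esub> g) ?y) (snd z)) =
      pull_covec A A (\<lambda>y. act (inv\<^bsub>G\<^esub> h) (act (inv\<^bsub>G\<^esub> g) y)) ?y (snd z)"
    by (rule pull_covec_compose[OF A A A translation_smooth[OF inv_closed[OF g]] y translation_smooth[OF inv_closed[OF h]]])
      (simp add: gy act_points[OF h x])
  also have "pull_covec A A (\<lambda>y. act (inv\<^bsub>G\<^esub> h) (act (inv\<^bsub>G\<^esub> g) y)) ?y = pull_covec A A (act (inv\<^bsub>G\<^esub> (g \<otimes>\<^bsub>G\<^esub> h))) ?y"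
    by (rule pull_covec_cong[OF y])
      (simp add: group.inv_mult_group[OF group_G g h] act_mult[OF inv_closed[OF h] inv_closed[OF g]])
  finally show ?thesis
    by (subst lift_eq[OF lift_points[OF h z]]) (simp add: lift_eq[OF z] act_mult[OF g h x] gy)
qed

text \<open>Makes smoothness visible: the new momentum is linear in the old one, and the
  coefficients are derivatives of a chart composed with the inverse translation.\<close>

lemma lift_momentum:
  assumes g: "g \<in> carrier G" and z: "z \<in> cot_set A U" and U: "(U, \<phi>) \<in> A" and V: "(V, \<psi>) \<in> A" "act g (fst z) \<in> V"
  shows "momentum A (V, \<psi>) (act g (fst z)) (snd (lift g z)) =
    (\<Sum>b\<in>onb. (\<Sum>e\<in>onb. coordinate_vector A (V, \<psi>) (act g (fst z)) b (\<lambda>y. inner (\<phi> (act (inv\<^bsub>G\<^esub> g) y)) e) *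
      inner (momentum A (U, \<phi>) (fst z) (snd z)) e) *\<^sub>R b)"
proof -
  have x: "fst z \<in> U" and \<alpha>: "snd z \<in> cotangent_space A (fst z)" using z by auto
  have xA: "fst z \<in> points A" using chart_points[OF U] x by blast
  have zc: "z \<in> cotangent_points A" using xA \<alpha> by (cases z) (simp add: cotangent_points_def)
  let ?y = "act g (fst z)" and ?F = "act (inv\<^bsub>G\<^esub> g)"
  have y: "?y \<in> points A" by (rule act_points[OF g xA])
  have Fy: "?F ?y = fst z" by (rule act_inv(1)[OF g xA])
  note F = translation_smooth[OF inv_closed[OF g]]
  have "snd (lift g z) (coordinate_vector A (V, \<psi>) ?y b) =
      (\<Sum>e\<in>onb. coordinate_vector A (V, \<psi>) ?y b (\<lambda>y. inner (\<phi> (?F y)) e) * inner (momentum A (U, \<phi>) (fst z) (snd z)) e)" for b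
  proof -
    let ?v = "coordinate_vector A (V, \<psi>) ?y b"
    have v: "?v \<in> tangent_space A ?y" by (rule coordinate_vector_tangent[OF A V])
    have p: "push_tvec A ?F ?y ?v \<in> tangent_space A (fst z)"
      using push_tvec_tangent[OF A A F y v] by (simp add: Fy)
    have pe: "push_tvec A ?F ?y ?v (\<lambda>y. inner (\<phi> y) e) = ?v (\<lambda>y. inner (\<phi> (?F y)) e)" for e
      by (rule push_tvec_smooth) (simp add: Fy smooth_nearI[OF smooth_vec_on_coordinate[OF A U] x])
    have "snd (lift g z) ?v = snd z (push_tvec A ?F ?y ?v)"
      using v by (simp add: lift_eq[OF zc] pull_covec_def)
    also have "\<dots> = snd z (coordinate_vector A (U, \<phi>) (fst z) (\<Sum>e\<in>onb. ?v (\<lambda>y. inner (\<phi> (?F y)) e) *\<^sub>R e))"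
      using tangent_expand[OF A U x p] by (simp add: pe)
    also have "\<dots> = inner (momentum A (U, \<phi>) (fst z) (snd z)) (\<Sum>e\<in>onb. ?v (\<lambda>y. inner (\<phi> (?F y)) e) *\<^sub>R e)"
      by (rule inner_momentum[OF A U x \<alpha>, symmetric])
    finally show ?thesis by (simp add: inner_sum_right)
  qed
  then show ?thesis unfolding momentum_def[of A "(V, \<psi>)"] by simp
qed

lemma lift_smooth:
  "smooth_map_on (product_atlas L T) (carrier G \<times> cotangent_points A) T (\<lambda>y. lift (fst y) (snd y))"
proof (rule smooth_map_onI[OF LT T])
  let ?D = "carrier G \<times> cotangent_points A"
  show op: "openin (atlas_topology (product_atlas L T)) ?D"
    using openin_Times_atlas[OF L T openin_points openin_points] by (simp add: points_L points_cotangent)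
  note pr = smooth_map_on_fst_snd[OF L T op]
  have px: "smooth_map_on (product_atlas L T) ?D A (\<lambda>y. fst (snd y))"
    by (rule smooth_map_on_compose_subset[OF LT T pr(2) cotangent_projection_smooth[OF A] op]) auto
  have pi: "smooth_map_on (product_atlas L T) ?D L (\<lambda>y. inv\<^bsub>G\<^esub> (fst y))"
    by (rule smooth_map_on_compose_subset[OF LT L pr(1) inv_smooth op]) auto
  have "smooth_map_on (product_atlas L T) ?D A (\<lambda>y. act (fst (fst y, fst (snd y))) (snd (fst y, fst (snd y))))"
    by (rule smooth_map_on_compose_subset[OF LT LA smooth_map_on_Pair[OF L A LT pr(1) px] act_smooth op])
      (auto simp: cotangent_points_def)
  then have pg: "smooth_map_on (product_atlas L T) ?D A (\<lambda>y. act (fst y) (fst (snd y)))" by simp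
  have pp: "smooth_map_on (product_atlas L T) ?D (product_atlas L A) (\<lambda>y. (inv\<^bsub>G\<^esub> (fst y), act (fst y) (fst (snd y))))"
    by (rule smooth_map_on_Pair[OF L A LT pi pg])
  fix y0 assume y0: "y0 \<in> ?D"
  have x0: "fst (snd y0) \<in> points A" using y0 by (auto simp: cotangent_points_def)
  obtain U \<phi> where U: "(U, \<phi>) \<in> A" "fst (snd y0) \<in> U" using points_chart[OF x0] .
  obtain V \<psi> where V: "(V, \<psi>) \<in> A" "act (fst y0) (fst (snd y0)) \<in> V"
    using points_chart[OF smooth_map_on_points[OF pg y0]] .
  let ?W = "(?D \<inter> (\<lambda>y. act (fst y) (fst (snd y))) -` V) \<inter> (?D \<inter> snd -` cot_set A U)"
  have W: "openin (atlas_topology (product_atlas L T)) ?W"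
    by (intro openin_Int smooth_map_on_vimage[OF LT A pg openin_chart[OF A V(1)]]
        smooth_map_on_vimage[OF LT T pr(2) openin_chart[OF T cotangent_atlasI[OF U(1)]]])
  have s1: "smooth_vec_on (product_atlas L T) ?W (\<lambda>y. \<psi> (act (fst y) (fst (snd y))))"
    by (rule smooth_vec_on_subset[OF smooth_map_onD[OF pg V(1)] W]) auto
  have "smooth_vec_on (product_atlas L T) (?D \<inter> snd -` cot_set A U) (\<lambda>y. cot_map A U \<phi> (snd y))"
    by (rule smooth_map_onD[OF pr(2) cotangent_atlasI[OF U(1)]])
  then have "smooth_vec_on (product_atlas L T) ?W (\<lambda>y. cot_map A U \<phi> (snd y))"
    by (rule smooth_vec_on_subset[OF _ W]) auto
  then have "smooth_vec_on (product_atlas L T) ?W (\<lambda>y. snd (cot_map A U \<phi> (snd y)))"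
    by (rule smooth_vec_on_compose[OF LT _ smooth_on_bounded_linear[OF bounded_linear_snd, of UNIV]]) auto
  then have s2: "smooth_vec_on (product_atlas L T) ?W (\<lambda>y. momentum A (U, \<phi>) (fst (snd y)) (snd (snd y)))" by simp
  \<comment> \<open>The coefficients live on the product of \<open>L\<close> and \<open>A\<close>: a
    chart field differentiates the coordinates of \<open>act g x\<close> in \<open>x\<close>, and
    the result is pulled back along the map from \<open>y\<close> to the inverse group element and
    the moved base point.\<close>
  have s3: "smooth_vec_on (product_atlas L T) ?W (\<lambda>y. coordinate_vector A (V, \<psi>) (act (fst y) (fst (snd y))) b
      (\<lambda>y'. inner (\<phi> (act (inv\<^bsub>G\<^esub> (fst y)) y')) e))" for b e
  proof -
    let ?\<Omega> = "(carrier G \<times> points A) \<inter> (\<lambda>z. act (fst z) (snd z)) -` U"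
    have "smooth_vec_on (product_atlas L A) ?\<Omega> (\<lambda>z. inner (\<phi> (act (fst z) (snd z))) e)"
      by (rule act_pullback[OF smooth_vec_on_coordinate[OF A U(1)]])
    from smooth_vertical[OF L A this V(1), of b]
    have "smooth_vec_on (product_atlas L A) (?\<Omega> \<inter> (points L \<times> V))
      (\<lambda>z. coordinate_vector A (V, \<psi>) (snd z) b (\<lambda>y'. inner (\<phi> (act (fst z) y')) e))" by simp
    from smooth_vec_on_pullback[OF LT LA pp this]
    have "smooth_vec_on (product_atlas L T) (?D \<inter> (\<lambda>y. (inv\<^bsub>G\<^esub> (fst y), act (fst y) (fst (snd y)))) -` (?\<Omega> \<inter> (points L \<times> V)))
      (\<lambda>y. coordinate_vector A (V, \<psi>) (act (fst y) (fst (snd y))) b (\<lambda>y'. inner (\<phi> (act (inv\<^bsub>G\<^esub> (fst y)) y')) e))"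
      by simp
    then show ?thesis
    proof (rule smooth_vec_on_subset[OF _ W])
      show "?W \<subseteq> ?D \<inter> (\<lambda>y. (inv\<^bsub>G\<^esub> (fst y), act (fst y) (fst (snd y)))) -` (?\<Omega> \<inter> (points L \<times> V))"
      proof
        fix y assume y: "y \<in> ?W"
        then have "fst y \<in> carrier G" "fst (snd y) \<in> points A" "fst (snd y) \<in> U" "act (fst y) (fst (snd y)) \<in> V"
          by (auto simp: cotangent_points_def)
        then show "y \<in> ?D \<inter> (\<lambda>y. (inv\<^bsub>G\<^esub> (fst y), act (fst y) (fst (snd y)))) -` (?\<Omega> \<inter> (points L \<times> V))"
          using y by (simp add: inv_closed act_points act_inv points_L)
      qed
    qed
  qed
  have "smooth_vec_on (product_atlas L T) ?W (\<lambda>y. (\<psi> (act (fst y) (fst (snd y))),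
      \<Sum>b\<in>onb. (\<Sum>e\<in>onb. coordinate_vector A (V, \<psi>) (act (fst y) (fst (snd y))) b
      (\<lambda>y'. inner (\<phi> (act (inv\<^bsub>G\<^esub> (fst y)) y')) e) * inner (momentum A (U, \<phi>) (fst (snd y)) (snd (snd y))) e) *\<^sub>R b))"
    by (intro smooth_vec_on_Pair[OF LT] s1 smooth_vec_on_sum[OF LT W] smooth_vec_on_scaleR[OF LT] smooth_vec_on_mult[OF LT]
        s3 smooth_vec_on_inner[OF LT] s2 smooth_vec_on_const W)
  then have "smooth_vec_on (product_atlas L T) ?W (\<lambda>y. cot_map A V \<psi> (lift (fst y) (snd y)))"
  proof (rule smooth_vec_on_cong[OF LT])
    fix y assume y: "y \<in> ?W"
    then have "fst y \<in> carrier G" "snd y \<in> cot_set A U" "act (fst y) (fst (snd y)) \<in> V" "snd y \<in> cotangent_points A" by auto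
    then show "(\<psi> (act (fst y) (fst (snd y))),
      \<Sum>b\<in>onb. (\<Sum>e\<in>onb. coordinate_vector A (V, \<psi>) (act (fst y) (fst (snd y))) b
      (\<lambda>y'. inner (\<phi> (act (inv\<^bsub>G\<^esub> (fst y)) y')) e) * inner (momentum A (U, \<phi>) (fst (snd y)) (snd (snd y))) e) *\<^sub>R b) =
      cot_map A V \<psi> (lift (fst y) (snd y))"
      using lift_momentum[of "fst y" "snd y" U \<phi> V \<psi>] U(1) V(1) by (simp add: lift_eq)
  qed
  moreover have "(\<lambda>y. lift (fst y) (snd y)) ` ?W \<subseteq> cot_set A V"
  proof
    fix w assume "w \<in> (\<lambda>y. lift (fst y) (snd y)) ` ?W"
    then obtain y where y: "y \<in> ?W" "w = lift (fst y) (snd y)" by blast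
    then have "w \<in> cotangent_points A" "fst w \<in> V" using lift_points by (auto simp: lift_eq)
    then show "w \<in> cot_set A V" by (cases w) (simp add: cotangent_points_def)
  qed
  moreover have "y0 \<in> ?W" using y0 U V by (auto simp: cotangent_points_def)
  ultimately show "\<exists>W' V \<psi>. y0 \<in> W' \<and> (V, \<psi>) \<in> T \<and> (\<lambda>y. lift (fst y) (snd y)) ` W' \<subseteq> V \<and>
      smooth_vec_on (product_atlas L T) W' (\<lambda>y. \<psi> (lift (fst y) (snd y)))"
    using cotangent_atlasI[OF V(1)] by (intro exI[of _ ?W] exI[of _ "cot_set A V"] exI[of _ "cot_map A V \<psi>"] conjI)
qed

end

section \<open>The canonical Poisson structure\<close>

text \<open>A linear form on the cotangent space is evaluation at a tangent vector; here its
  components are the values of \<open>w\<close> on the coordinate differentials paired with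
  \<open>\<beta>\<close>.\<close>

lemma bivector_contract:
  assumes A: "smooth_atlas A" and x: "x \<in> points A" and w: "w \<in> exterior_power 2 (tangent_space A x)"
    and \<beta>: "\<beta> \<in> cotangent_space A x"
  shows "\<exists>v\<in>tangent_space A x. \<forall>\<alpha>\<in>cotangent_space A x. w [\<alpha>, \<beta>] = \<alpha> v"
proof -
  obtain U \<phi> where U: "(U, \<phi>) \<in> A" "x \<in> U" using points_chart[OF x] .
  let ?\<epsilon> = "\<lambda>i. fun_differential A x (\<lambda>y. inner (\<phi> y) i)"
  let ?v = "coordinate_vector A (U, \<phi>) x (\<Sum>i\<in>onb. w [?\<epsilon> i, \<beta>] *\<^sub>R i)"
  have "w [\<alpha>, \<beta>] = \<alpha> ?v" if \<alpha>: "\<alpha> \<in> cotangent_space A x" for \<alpha>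
    unfolding inner_momentum[OF A U \<alpha>, symmetric] bivector_expand_left[OF A U w \<alpha> \<beta>]
    by (simp add: inner_sum_right inner_momentum[OF A U \<alpha>] mult.commute)
  then show ?thesis using coordinate_vector_tangent[OF A U] by blast
qed

text \<open>Makes the bracket with \<open>h\<close> a derivation at \<open>x\<close>, so that the
  rules for tangent vectors can be quoted. The equation covers every \<open>f\<close>, since both
  sides see \<open>f\<close> only through \<open>fun_differential\<close>.\<close>

lemma hamiltonian_vector:
  assumes A: "smooth_atlas A" and x: "x \<in> points A" and \<pi>: "\<pi> x \<in> exterior_power 2 (tangent_space A x)"
  shows "\<exists>v\<in>tangent_space A x. \<forall>f. mvec_apply A \<pi> [f, h] x = v f"
proof -
  obtain v where v: "v \<in> tangent_space A x" "\<forall>\<alpha>\<in>cotangent_space A x. \<pi> x [\<alpha>, fun_differential A x h] = \<alpha> v"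
    using bivector_contract[OF A x \<pi> fun_differential_dual[OF A]] by blast
  then have "mvec_apply A \<pi> [f, h] x = v f" for f
    using fun_differential_dual[OF A, of x f] by (simp add: mvec_apply_def) (simp add: fun_differential_def)
  then show ?thesis using v(1) by blast
qed

lemma mvec_apply_antisym:
  assumes A: "smooth_atlas A" and \<pi>: "\<pi> x \<in> exterior_power 2 (tangent_space A x)"
  shows "mvec_apply A \<pi> [f, h] x = - mvec_apply A \<pi> [h, f] x"
  unfolding mvec_apply_def list.map by (rule bivector_antisym[OF \<pi> fun_differential_dual[OF A] fun_differential_dual[OF A]])

lemma coordinate_field_smooth:
  assumes A: "smooth_atlas A" and U: "(U, \<phi>) \<in> A" and f: "smooth_vec_on A W f"
  shows "smooth_vec_on A (W \<inter> U) (\<lambda>y. coordinate_vector A (U, \<phi>) y w f)"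
proof -
  have op: "openin (atlas_topology A) (W \<inter> U)" by (rule openin_Int[OF smooth_vec_on_open[OF f] openin_chart[OF A U]])
  have "smooth_vec_on A (W \<inter> U) (\<lambda>y. dd (\<lambda>s. f (inv_into U \<phi> s)) (\<phi> y) w)"
    by (rule smooth_vec_on_compose[OF A smooth_vec_on_subset[OF smooth_vec_on_chart[OF A U] op] smooth_on_dd[OF smooth_vec_onD'[OF f U]]])
      auto
  then show ?thesis
    by (rule smooth_vec_on_cong[OF A]) (use smooth_nearI[OF f] coordinate_vector_smooth in force)
qed

lemma coordinate_field_commute:
  assumes A: "smooth_atlas A" and U: "(U, \<phi>) \<in> A" and f: "smooth_vec_on A W f" and x: "x \<in> W \<inter> U"
  shows "coordinate_vector A (U, \<phi>) x v (\<lambda>y. coordinate_vector A (U, \<phi>) y w f) =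
    coordinate_vector A (U, \<phi>) x w (\<lambda>y. coordinate_vector A (U, \<phi>) y v f)"
proof -
  let ?f = "\<lambda>s. f (inv_into U \<phi> s)" and ?S = "\<phi> ` (U \<inter> W)"
  have S: "open ?S" "\<phi> x \<in> ?S" using openin_image[OF A smooth_vec_on_open[OF f] U] x by auto
  have fs: "smooth_on ?S ?f" by (rule smooth_vec_onD'[OF f U])
  have xU: "x \<in> U" using x by simp
  have "coordinate_vector A (U, \<phi>) x v (\<lambda>y. coordinate_vector A (U, \<phi>) y w f) = dd (\<lambda>s. dd ?f s w) (\<phi> x) v" for v w
  proof -
    have "coordinate_vector A (U, \<phi>) x v (\<lambda>y. coordinate_vector A (U, \<phi>) y w f) =
        coordinate_vector A (U, \<phi>) x v (\<lambda>y. dd ?f (\<phi> y) w)"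
    proof (rule tangent_cong[OF A coordinate_vector_tangent[OF A U xU]
          openin_Int[OF smooth_vec_on_open[OF f] openin_chart[OF A U]] x])
      fix y assume "y \<in> W \<inter> U"
      then show "coordinate_vector A (U, \<phi>) y w f = dd ?f (\<phi> y) w"
        by (intro coordinate_vector_smooth smooth_nearI[OF f]) simp
    qed
    also have "\<dots> = dd (\<lambda>s. dd ?f s w) (\<phi> x) v"
      by (rule coordinate_vector_compose_chart[OF A U xU S smooth_on_dd[OF fs]])
    finally show ?thesis .
  qed
  then show ?thesis using dd_commute[OF S(1) fs S(2)] by simp
qed

abbreviation cot_coord where
  "cot_coord A U \<phi> \<equiv> coordinate_vector (cotangent_atlas A) (cot_set A U, cot_map A U \<phi>)"

text \<open>The canonical bracket with the chart as a parameter. \<open>canonical_poisson\<close>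
  fixes a chart only through a choice at each point, so points and charts are compared on this
  expression.\<close>

definition chart_bracket ::
    "('m, 'a::finite_dim_inner) atlas \<Rightarrow> 'm set \<Rightarrow> ('m \<Rightarrow> 'a) \<Rightarrow> 'm \<times> 'm covec \<Rightarrow>
      ('m \<times> 'm covec \<Rightarrow> real) \<Rightarrow> ('m \<times> 'm covec \<Rightarrow> real) \<Rightarrow> real" where
  "chart_bracket A U \<phi> z f h = (\<Sum>b\<in>onb. cot_coord A U \<phi> z (b, 0) f * cot_coord A U \<phi> z (0, b) h -
    cot_coord A U \<phi> z (b, 0) h * cot_coord A U \<phi> z (0, b) f)"

lemma canonical_poisson_chart:
  assumes "z \<in> cotangent_points A"
  obtains U \<phi> where "(U, \<phi>) \<in> A" "z \<in> cot_set A U"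
    "canonical_poisson A z = (\<lambda>\<beta>s. \<Sum>b\<in>onb. wedge (tangent_space (cotangent_atlas A) z)
      [cot_coord A U \<phi> z (b, 0), cot_coord A U \<phi> z (0, b)] \<beta>s)"
proof -
  define c where "c = (SOME c. c \<in> A \<and> fst z \<in> fst c)"
  have z: "fst z \<in> points A" "snd z \<in> cotangent_space A (fst z)" using assms by (auto simp: cotangent_points_def)
  obtain U \<phi> where "(U, \<phi>) \<in> A" "fst z \<in> U" using points_chart[OF z(1)] .
  then have "\<exists>c. c \<in> A \<and> fst z \<in> fst c" by (intro exI[of _ "(U, \<phi>)"]) simp
  then have c: "c \<in> A \<and> fst z \<in> fst c" unfolding c_def by (rule someI_ex)
  obtain U \<phi> where U: "c = (U, \<phi>)" by (cases c)
  have zU: "z \<in> cot_set A U" using z c U by (cases z) simp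
  show ?thesis
    by (rule that[of U \<phi>])
      (use c zU in \<open>simp_all add: canonical_poisson_def Let_def c_def[symmetric] U cotangent_chart_eq\<close>)
qed

lemma canonical_poisson_exterior:
  assumes "z \<in> cotangent_points A"
  shows "canonical_poisson A z \<in> exterior_power 2 (tangent_space (cotangent_atlas A) z)"
proof (rule canonical_poisson_chart[OF assms])
  fix U \<phi> assume "canonical_poisson A z = (\<lambda>\<beta>s. \<Sum>b\<in>onb. wedge (tangent_space (cotangent_atlas A) z)
      [cot_coord A U \<phi> z (b, 0), cot_coord A U \<phi> z (0, b)] \<beta>s)"
  then show ?thesis by (simp add: exterior_power_sum wedge_exterior)
qed

lemma canonical_poisson_apply_chart:
  assumes A: "smooth_atlas A" and z: "z \<in> cotangent_points A"
  obtains U \<phi> where "(U, \<phi>) \<in> A" "z \<in> cot_set A U"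
    "\<And>f h. mvec_apply (cotangent_atlas A) (canonical_poisson A) [f, h] z = chart_bracket A U \<phi> z f h"
proof (rule canonical_poisson_chart[OF z])
  fix U \<phi> assume U: "(U, \<phi>) \<in> A" "z \<in> cot_set A U"
    and c: "canonical_poisson A z = (\<lambda>\<beta>s. \<Sum>b\<in>onb. wedge (tangent_space (cotangent_atlas A) z)
      [cot_coord A U \<phi> z (b, 0), cot_coord A U \<phi> z (0, b)] \<beta>s)"
  note T = smooth_atlas_cotangent[OF A]
  have t: "cot_coord A U \<phi> z w \<in> tangent_space (cotangent_atlas A) z" for w
    by (rule coordinate_vector_tangent[OF T cotangent_atlasI[OF U(1)] U(2)])
  have "mvec_apply (cotangent_atlas A) (canonical_poisson A) [f, h] z = chart_bracket A U \<phi> z f h" for f h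
    by (simp add: mvec_apply_def c chart_bracket_def wedge_2 form_lists_2 fun_differential_dual[OF T])
      (simp add: fun_differential_def t)
  then show thesis by (rule that[OF U])
qed

section \<open>Invariance of the canonical bracket under the lifted action\<close>

context atlas_action
begin

lemma lifted_action_atlas: "atlas_action G L T lift"
proof unfold_locales
  show "smooth_atlas T" by (rule T)
  show "smooth_map_on (product_atlas L T) (carrier G \<times> points T) T (\<lambda>z. lift (fst z) (snd z))"
    unfolding points_cotangent by (rule lift_smooth)
  show "lift \<one>\<^bsub>G\<^esub> x = x" if "x \<in> points T" for x
    using that by (simp add: points_cotangent lift_one)
  show "lift (g \<otimes>\<^bsub>G\<^esub> h) x = lift g (lift h x)" if "g \<in> carrier G" "h \<in> carrier G" "x \<in> points T" for g h x
    using that by (simp add: points_cotangent lift_mult)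
qed

lemma lift_translation_smooth:
  assumes g: "g \<in> carrier G"
  shows "smooth_map_on T (cotangent_points A) T (lift g)"
  using atlas_action.translation_smooth[OF lifted_action_atlas g] by (simp only: points_cotangent)

lemma push_act_inverse:
  assumes g: "g \<in> carrier G" and x: "x \<in> points A" and v: "v \<in> tangent_space A x"
  shows "push_tvec A (act (inv\<^bsub>G\<^esub> g)) (act g x) (push_tvec A (act g) x v) = v"
proof -
  have "push_tvec A (act (inv\<^bsub>G\<^esub> g)) (act g x) (push_tvec A (act g) x v) = push_tvec A (\<lambda>y. act (inv\<^bsub>G\<^esub> g) (act g y)) x v"
    by (rule push_tvec_compose[where F = "act g" and x = x, OF A A translation_smooth[OF inv_closed[OF g]] act_points[OF g x]])
  also have "\<dots> = push_tvec A (\<lambda>y. y) x v"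
    by (rule push_tvec_cong[OF A v openin_points x]) (rule act_inv(1)[OF g])
  finally show ?thesis by (simp add: push_tvec_id[OF v])
qed

text \<open>The lift by \<open>g\<close>, read in charts, is a map \<open>\<Psi>\<close> over the
  base map \<open>\<sigma>\<close>, for which the hypotheses of
  \<open>cotangent_lift_bracket\<close> are verified. The two charts are arbitrary, so the unit
  element covers a change of chart.\<close>

lemma chart_bracket_lift:
  assumes g: "g \<in> carrier G" and z: "z \<in> cot_set A U" and U: "(U, \<phi>) \<in> A" and V: "(V, \<psi>) \<in> A" "act g (fst z) \<in> V"
    and f: "smooth_near T (lift g z) f" and h: "smooth_near T (lift g z) h"
  shows "chart_bracket A V \<psi> (lift g z) f h = chart_bracket A U \<phi> z (\<lambda>y. f (lift g y)) (\<lambda>y. h (lift g y))"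
proof -
  let ?C = "cot_set A U" and ?\<kappa> = "cot_map A U \<phi>" and ?C' = "cot_set A V" and ?\<kappa>' = "cot_map A V \<psi>"
  have cU: "(?C, ?\<kappa>) \<in> T" and cV: "(?C', ?\<kappa>') \<in> T" using cotangent_atlasI U V by blast+
  note F = lift_translation_smooth[OF g]
  have zc: "y \<in> cotangent_points A" if "y \<in> ?C" for y
    using that chart_points[OF U] by (auto simp: cotangent_points_def)
  have C': "lift g y \<in> ?C' \<longleftrightarrow> act g (fst y) \<in> V" if "y \<in> ?C" for y
    using lift_points[OF g zc[OF that]] lift_eq[OF zc[OF that], of g] by (auto simp: cotangent_points_def)
  let ?O = "cotangent_points A \<inter> lift g -` ?C'"
  have sm: "smooth_vec_on T ?O (\<lambda>y. ?\<kappa>' (lift g y))" by (rule smooth_map_onD[OF F cV])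
  define S where "S = ?\<kappa> ` (?C \<inter> ?O)"
  define \<Psi> where "\<Psi> = (\<lambda>s. ?\<kappa>' (lift g (inv_into ?C ?\<kappa> s)))"
  define S' where "S' = \<phi> ` (U \<inter> (points A \<inter> act g -` V))"
  define \<sigma> where "\<sigma> = (\<lambda>s. \<psi> (act g (inv_into U \<phi> s)))"
  have S: "open S" unfolding S_def by (rule openin_image[OF T smooth_vec_on_open[OF sm] cU])
  have \<Psi>: "smooth_on S \<Psi>" unfolding S_def \<Psi>_def by (rule smooth_vec_onD'[OF sm cU])
  have sa: "smooth_vec_on A (points A \<inter> act g -` V) (\<lambda>y. \<psi> (act g y))"
    by (rule smooth_map_onD[OF translation_smooth[OF g] V(1)])
  have S': "open S'" unfolding S'_def by (rule openin_image[OF A smooth_vec_on_open[OF sa] U])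
  have \<sigma>: "smooth_on S' \<sigma>" unfolding S'_def \<sigma>_def by (rule smooth_vec_onD'[OF sa U])
  have inv: "inv_into ?C ?\<kappa> (?\<kappa> y) = y" if "y \<in> ?C" for y by (rule inv_cot_map[OF A U that])
  have zO: "z \<in> ?C \<inter> ?O" using z zc[OF z] C'[OF z] V by auto
  have zS: "?\<kappa> z \<in> S" unfolding S_def using zO by blast
  have yS: "\<exists>y. s = ?\<kappa> y \<and> y \<in> ?C \<inter> ?O" if "s \<in> S" for s
    using that unfolding S_def by (elim imageE) (intro exI conjI)
  have yf: "y \<in> ?C" "y \<in> cotangent_points A" "fst y \<in> U" "fst y \<in> points A"
      "snd y \<in> cotangent_space A (fst y)" "act g (fst y) \<in> V" "lift g y \<in> ?C'" if y: "y \<in> ?C \<inter> ?O" for y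
  proof -
    show "y \<in> ?C" "y \<in> cotangent_points A" "lift g y \<in> ?C'" using y by simp_all
    then show "fst y \<in> U" "fst y \<in> points A" "snd y \<in> cotangent_space A (fst y)" "act g (fst y) \<in> V"
      using C'[of y] by (auto simp: cotangent_points_def)
  qed
  have push: "push_tvec A (act g) (fst y) (coordinate_vector A (U, \<phi>) (fst y) u) =
      coordinate_vector A (V, \<psi>) (act g (fst y)) (dd \<sigma> (\<phi> (fst y)) u)" if "fst y \<in> U" "act g (fst y) \<in> V" for y u
    unfolding \<sigma>_def
    by (rule push_coordinate_vector[OF A A translation_smooth[OF g] _ U that(1) V(1) that(2)]) (use that chart_points[OF U] in blast)
  have 1: "fst s \<in> S'" if s: "s \<in> S" for s
  proof -
    from yS[OF s] obtain y where y: "s = ?\<kappa> y" "y \<in> ?C \<inter> ?O" by (elim exE conjE)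
    show ?thesis unfolding S'_def y(1) using yf[OF y(2)] by simp
  qed
  have 2: "fst (\<Psi> s) = \<sigma> (fst s)" if s: "s \<in> S" for s
  proof -
    from yS[OF s] obtain y where y1: "s = ?\<kappa> y" "y \<in> ?C \<inter> ?O" by (elim exE conjE)
    note y = y1(1) yf[OF y1(2)]
    have "fst (\<Psi> s) = \<psi> (fst (lift g y))" unfolding \<Psi>_def y(1) inv[OF y(2)] by simp
    then show ?thesis using y by (simp add: \<sigma>_def lift_eq chart_inv[OF A U])
  qed
  \<comment> \<open>The lifted covector on a pushed-forward vector is the original covector on the
    original vector, since the push-forwards by \<open>act g\<close> and by the inverse
    cancel.\<close>
  have 3: "inner (snd (\<Psi> s)) (dd \<sigma> (fst s) u) = inner (snd s) u" if s: "s \<in> S" for s u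
  proof -
    from yS[OF s] obtain y where y1: "s = ?\<kappa> y" "y \<in> ?C \<inter> ?O" by (elim exE conjE)
    note y = y1(1) yf[OF y1(2)]
    have ly: "fst (lift g y) = act g (fst y)" using lift_eq[OF y(3)] by simp
    have \<alpha>: "snd (lift g y) \<in> cotangent_space A (act g (fst y))" using y(8) ly by auto
    let ?v = "coordinate_vector A (U, \<phi>) (fst y) u"
    have v: "?v \<in> tangent_space A (fst y)" by (rule coordinate_vector_tangent[OF A U y(4)])
    have pv: "push_tvec A (act g) (fst y) ?v \<in> tangent_space A (act g (fst y))"
      by (rule push_tvec_tangent[OF A A translation_smooth[OF g] y(5) v])
    have "inner (snd (\<Psi> s)) (dd \<sigma> (fst s) u) = inner (momentum A (V, \<psi>) (act g (fst y)) (snd (lift g y))) (dd \<sigma> (\<phi> (fst y)) u)"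
      unfolding \<Psi>_def y(1) inv[OF y(2)] by (simp add: ly)
    also have "\<dots> = snd (lift g y) (push_tvec A (act g) (fst y) ?v)"
      unfolding push[OF y(4,7)] by (rule inner_momentum[OF A V(1) y(7) \<alpha>])
    also have "\<dots> = snd y (push_tvec A (act (inv\<^bsub>G\<^esub> g)) (act g (fst y)) (push_tvec A (act g) (fst y) ?v))"
      using pv by (simp add: lift_eq[OF y(3)] pull_covec_def)
    also have "\<dots> = snd y ?v" by (simp only: push_act_inverse[OF g y(5) v])
    also have "\<dots> = inner (snd s) u" using inner_momentum[OF A U y(4,6), of u] y(1) by simp
    finally show ?thesis .
  qed
  \<comment> \<open>A preimage of \<open>w\<close> is found by pushing the coordinate vector back
    with the inverse of \<open>g\<close>.\<close>
  have 4: "\<exists>u. dd \<sigma> (fst (?\<kappa> z)) u = w" for w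
  proof -
    have x: "fst z \<in> U" "fst z \<in> points A" using z chart_points[OF U] by auto
    let ?y = "act g (fst z)" and ?v = "coordinate_vector A (V, \<psi>) (act g (fst z)) w"
    have v: "?v \<in> tangent_space A ?y" by (rule coordinate_vector_tangent[OF A V])
    have y: "?y \<in> points A" by (rule act_points[OF g x(2)])
    have "push_tvec A (act (inv\<^bsub>G\<^esub> g)) ?y ?v \<in> tangent_space A (fst z)"
      using push_tvec_tangent[OF A A translation_smooth[OF inv_closed[OF g]] y v] by (simp add: act_inv[OF g x(2)])
    then obtain u where u: "push_tvec A (act (inv\<^bsub>G\<^esub> g)) ?y ?v = coordinate_vector A (U, \<phi>) (fst z) u"
      using tangent_coordinate[OF A U x(1)] by blast
    have "push_tvec A (act g) (fst z) (push_tvec A (act (inv\<^bsub>G\<^esub> g)) ?y ?v) = ?v"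
      using push_act_inverse[OF inv_closed[OF g] y v]
      by (simp add: act_inv[OF g x(2)] group.inv_inv[OF group_G g])
    then have "coordinate_vector A (V, \<psi>) ?y (dd \<sigma> (\<phi> (fst z)) u) = ?v"
      unfolding u push[OF x(1) V(2)] .
    then have "inner (dd \<sigma> (\<phi> (fst z)) u) b = inner w b" for b
      using coordinate_vector_coordinate[OF A V, of _ b] by metis
    then have "dd \<sigma> (\<phi> (fst z)) u = w" by (metis vector_eq_rdot)
    then show ?thesis by auto
  qed
  have lz: "lift g z \<in> ?C'" using zO by simp
  define f' where "f' = (\<lambda>s. f (inv_into ?C' ?\<kappa>' s))"
  define h' where "h' = (\<lambda>s. h (inv_into ?C' ?\<kappa>' s))"
  have \<Psi>z: "\<Psi> (?\<kappa> z) = ?\<kappa>' (lift g z)" unfolding \<Psi>_def inv[OF z] ..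
  have f': "f' differentiable at (\<Psi> (?\<kappa> z))" and h': "h' differentiable at (\<Psi> (?\<kappa> z))"
    unfolding f'_def h'_def \<Psi>z using smooth_near_differentiable[OF T _ cV lz] f h by blast+
  have l: "cot_coord A U \<phi> z w (\<lambda>y. k (lift g y)) = dd (\<lambda>s. k (inv_into ?C' ?\<kappa>' (\<Psi> s))) (?\<kappa> z) w"
    if k: "smooth_near T (lift g z) k" for k w
  proof -
    have "cot_coord A U \<phi> z w (\<lambda>y. k (lift g y)) = dd (\<lambda>s. k (lift g (inv_into ?C ?\<kappa> s))) (?\<kappa> z) w"
      by (rule coordinate_vector_smooth[OF smooth_near_pullback[OF T T F zc[OF z] k]])
    also have "\<dots> = dd (\<lambda>s. k (inv_into ?C' ?\<kappa>' (\<Psi> s))) (?\<kappa> z) w"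
    proof (rule dd_cong[OF S zS])
      fix s assume s: "s \<in> S"
      from yS[OF s] obtain y where y1: "s = ?\<kappa> y" "y \<in> ?C \<inter> ?O" by (elim exE conjE)
      note y = y1(1) yf(1,7)[OF y1(2)]
      show "k (lift g (inv_into ?C ?\<kappa> s)) = k (inv_into ?C' ?\<kappa>' (\<Psi> s))"
        unfolding \<Psi>_def y(1) inv[OF y(2)] inv_cot_map[OF A V(1) y(3)] ..
    qed
    finally show ?thesis .
  qed
  have r: "cot_coord A V \<psi> (lift g z) w k = dd (\<lambda>s. k (inv_into ?C' ?\<kappa>' s)) (\<Psi> (?\<kappa> z)) w"
    if k: "smooth_near T (lift g z) k" for k w
    unfolding \<Psi>z by (rule coordinate_vector_smooth[OF k])
  show ?thesis
    unfolding chart_bracket_def l[OF f] l[OF h] r[OF f] r[OF h]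
    by (rule cotangent_lift_bracket[OF S zS \<Psi> S' 1 \<sigma> 2 3 4 f'[unfolded f'_def] h'[unfolded h'_def], symmetric])
qed

definition cbr :: "('m \<times> 'm covec \<Rightarrow> real) \<Rightarrow> ('m \<times> 'm covec \<Rightarrow> real) \<Rightarrow> 'm \<times> 'm covec \<Rightarrow> real" where
  "cbr f h = mvec_apply T (canonical_poisson A) [f, h]"

text \<open>Chart independence is the case of the unit element in \<open>chart_bracket_lift\<close>:
  its lift is the identity on the cotangent bundle, and only the charts differ.\<close>

lemma cbr_chart:
  assumes z: "z \<in> cot_set A U" and U: "(U, \<phi>) \<in> A"
    and f: "smooth_near T z f" and h: "smooth_near T z h"
  shows "cbr f h z = chart_bracket A U \<phi> z f h"
proof -
  have zc: "z \<in> cotangent_points A" using z chart_points[OF U] by (auto simp: cotangent_points_def)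
  have x: "fst z \<in> points A" using z chart_points[OF U] by auto
  show ?thesis
  proof (rule canonical_poisson_apply_chart[OF A zc])
    fix V \<psi> assume V: "(V, \<psi>) \<in> A" "z \<in> cot_set A V"
      and c: "\<And>f h. mvec_apply T (canonical_poisson A) [f, h] z = chart_bracket A V \<psi> z f h"
    have k: "cot_coord A U \<phi> z w (\<lambda>y. k (lift \<one>\<^bsub>G\<^esub> y)) = cot_coord A U \<phi> z w k" for k w
      by (rule tangent_cong[OF T coordinate_vector_tangent[OF T cotangent_atlasI[OF U] z] openin_points])
        (simp_all add: points_cotangent zc lift_one)
    have "chart_bracket A V \<psi> z f h = chart_bracket A U \<phi> z (\<lambda>y. f (lift \<one>\<^bsub>G\<^esub> y)) (\<lambda>y. h (lift \<one>\<^bsub>G\<^esub> y))"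
      using chart_bracket_lift[OF one_closed z U V(1), of f h] V(2) f h by (auto simp: lift_one[OF zc] act_one[OF x])
    then show ?thesis by (simp add: cbr_def c chart_bracket_def k)
  qed
qed

text \<open>The right-hand side keeps the point and the chart fixed while \<open>g\<close> varies;
  this form can be differentiated along the group.\<close>

lemma cbr_lift:
  assumes g: "g \<in> carrier G" and z: "z \<in> cot_set A U" and U: "(U, \<phi>) \<in> A"
    and f: "smooth_near T (lift g z) f" and h: "smooth_near T (lift g z) h"
  shows "cbr f h (lift g z) = chart_bracket A U \<phi> z (\<lambda>y. f (lift g y)) (\<lambda>y. h (lift g y))"
proof -
  have zc: "z \<in> cotangent_points A" and x: "fst z \<in> points A"
    using z chart_points[OF U] by (auto simp: cotangent_points_def)
  obtain V \<psi> where V: "(V, \<psi>) \<in> A" "act g (fst z) \<in> V" using points_chart[OF act_points[OF g x]] .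
  have "lift g z \<in> cot_set A V"
    using lift_points[OF g zc] V(2) lift_eq[OF zc, of g] by (auto simp: cotangent_points_def)
  from cbr_chart[OF this V(1) f h] show ?thesis
    using chart_bracket_lift[OF g z U V f h] by simp
qed

text \<open>Local frame for the canonical structure: \<open>(b, False)\<close> stands for \<open>\<partial>/\<partial>q\<^sub>b\<close> and \<open>(b, True)\<close> for
  \<open>\<partial>/\<partial>p\<^sub>b\<close>.\<close>

lemma cbr_smooth_jacobi:
  assumes f: "smooth_vec_on T W f" and h: "smooth_vec_on T W h"
  shows "smooth_vec_on T W (cbr f h)"
    and "smooth_vec_on T W k \<Longrightarrow> z \<in> W \<Longrightarrow> cbr (cbr f h) k z - cbr (cbr f k) h z + cbr (cbr h k) f z = 0"
proof -
  define c where "c = (\<lambda>p q :: 'a \<times> bool. if fst p = fst q \<and> snd p \<noteq> snd q then (if snd p then - 1 else 1 :: real) else 0)"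
  have c: "c j i = - c i j" for i j
    unfolding c_def by (cases "fst i = fst j"; cases "snd i"; cases "snd j") simp_all
  let ?I = "(onb :: 'a set) \<times> (UNIV :: bool set)"
  have I: "finite ?I" by simp
  have pts: "W \<subseteq> cotangent_points A" using openin_imp_points[OF smooth_vec_on_open[OF f]] by (simp only: points_cotangent)
  have frame: "smooth_vec_on T (W \<inter> cot_set A U) (cbr f h) \<and>
    (smooth_vec_on T W k \<longrightarrow> cbr (cbr f h) k z - cbr (cbr f k) h z + cbr (cbr h k) f z = 0)"
    if U: "(U, \<phi>) \<in> A" and z: "z \<in> W \<inter> cot_set A U" for U \<phi> z k
  proof -
    note cU = cotangent_atlasI[OF U]
    have op: "openin (atlas_topology T) (cot_set A U)" by (rule openin_chart[OF T cU])
    let ?W = "W \<inter> cot_set A U"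
    define X where "X = (\<lambda>(i :: 'a \<times> bool) z. cot_coord A U \<phi> z (if snd i then (0, fst i) else (fst i, 0)))"
    have X: "X i z \<in> tangent_space T z" if "i \<in> ?I" "z \<in> ?W" for i z
      unfolding X_def by (rule coordinate_vector_tangent[OF T cU]) (use that in blast)
    have Xs: "smooth_vec_on T ?W (\<lambda>z. X i z f)" if "i \<in> ?I" "smooth_vec_on T ?W f" for i f
      using coordinate_field_smooth[OF T cU that(2)] unfolding X_def by (simp add: Int_assoc)
    have B: "cbr f h z = (\<Sum>i\<in>?I. \<Sum>j\<in>?I. c i j * (X i z f * X j z h))"
      if "smooth_vec_on T ?W f" "smooth_vec_on T ?W h" "z \<in> ?W" for f h z
    proof -
      have "cbr f h z = chart_bracket A U \<phi> z f h"
        by (rule cbr_chart[OF _ U smooth_nearI[OF that(1,3)] smooth_nearI[OF that(2,3)]]) (use that in blast)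
      then show ?thesis
        unfolding c_def sum_UNIV_bool_pairs[OF finite_onb] by (simp add: chart_bracket_def X_def mult.commute)
    qed
    have s: "smooth_vec_on T ?W f" if "smooth_vec_on T W f" for f by (rule smooth_vec_on_Int[OF that op])
    \<comment> \<open>Coordinate fields commute, so every term of the Jacobi sum from
      \<open>jacobi_frame\<close> vanishes.\<close>
    have com: "X k z (\<lambda>y. X i y f) = X i z (\<lambda>y. X k y f)" if "smooth_vec_on T W f" for i k f
      unfolding X_def by (rule coordinate_field_commute[OF T cU that z])
    have "cbr (cbr f h) k z - cbr (cbr f k) h z + cbr (cbr h k) f z = 0" if k: "smooth_vec_on T W k"
    proof -
      have "cbr (cbr f h) k z - cbr (cbr f k) h z + cbr (cbr h k) f z =
        (\<Sum>i\<in>?I. \<Sum>j\<in>?I. c i j * (\<Sum>k'\<in>?I. \<Sum>l\<in>?I. c k' l *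
        ((X k' z (\<lambda>y. X i y f) - X i z (\<lambda>y. X k' y f)) * X j z h * X l z k +
         (X k' z (\<lambda>y. X i y h) - X i z (\<lambda>y. X k' y h)) * X j z k * X l z f +
         (X k' z (\<lambda>y. X i y k) - X i z (\<lambda>y. X k' y k)) * X j z f * X l z h)))"
        by (rule jacobi_frame(2)[where X = X and B = cbr and c = c and W = "?W", OF T I c])
          (fact X Xs B s[OF f] s[OF h] s[OF k] z)+
      then show ?thesis by (simp add: com[OF f] com[OF h] com[OF k])
    qed
    moreover have "smooth_vec_on T ?W (cbr f h)"
      by (rule jacobi_frame(1)[where X = X and B = cbr and c = c and W = "?W", OF T I c])
        (fact X Xs B s[OF f] s[OF h] z)+
    ultimately show ?thesis by blast
  qed
  have ch: "\<exists>U \<phi>. (U, \<phi>) \<in> A \<and> z \<in> cot_set A U" if "z \<in> W" for z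
  proof -
    have z: "fst z \<in> points A" "snd z \<in> cotangent_space A (fst z)" using that pts by (auto simp: cotangent_points_def)
    obtain U \<phi> where "(U, \<phi>) \<in> A" "fst z \<in> U" using points_chart[OF z(1)] .
    then show ?thesis using z(2) by (intro exI[of _ U] exI[of _ \<phi>]) (cases z, simp)
  qed
  show "smooth_vec_on T W (cbr f h)"
  proof (rule smooth_vec_on_local[OF T])
    fix z assume z: "z \<in> W"
    then obtain U \<phi> where U: "(U, \<phi>) \<in> A" "z \<in> cot_set A U" using ch by blast
    then show "\<exists>W'. z \<in> W' \<and> W' \<subseteq> W \<and> smooth_vec_on T W' (cbr f h)"
      using frame[OF U(1), of z] z by (intro exI[of _ "W \<inter> cot_set A U"]) blast
  qed
  show "cbr (cbr f h) k z - cbr (cbr f k) h z + cbr (cbr h k) f z = 0" if "smooth_vec_on T W k" "z \<in> W"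
    using ch[OF that(2)] frame[of _ _ z k] that by blast
qed

text \<open>\<open>cbr_lift\<close> is differentiated in \<open>g\<close> at the unit. On its
  right-hand side the coordinate vectors at \<open>z\<close> stay fixed and only the functions move,
  so \<open>X\<close> passes into the two arguments by the Leibniz rule on \<open>L\<close>.\<close>

lemma cbr_derivation:
  assumes X: "X \<in> \<gg>" and f: "smooth_vec_on T W f" and h: "smooth_vec_on T W h" and z: "z \<in> W"
  defines "E \<equiv> atlas_action.fundamental G T lift X"
  shows "E z (cbr f h) = cbr (\<lambda>y. E y f) h z + cbr f (\<lambda>y. E y h) z"
proof -
  interpret TT: atlas_action G L T lift by (rule lifted_action_atlas)
  have zc: "z \<in> cotangent_points A"
    using openin_imp_points[OF smooth_vec_on_open[OF f]] z by (auto simp: points_cotangent)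
  then have x: "fst z \<in> points A" "snd z \<in> cotangent_space A (fst z)" by (auto simp: cotangent_points_def)
  obtain U \<phi> where U: "(U, \<phi>) \<in> A" "fst z \<in> U" using points_chart[OF x(1)] .
  have zU: "z \<in> cot_set A U" using U(2) x(2) by (cases z) simp
  note cU = cotangent_atlasI[OF U(1)]
  let ?D = "\<lambda>w. cot_coord A U \<phi> z w"
  have D: "?D w \<in> tangent_space T z" for w by (rule coordinate_vector_tangent[OF T cU zU])
  let ?\<Omega> = "(carrier G \<times> points T) \<inter> (\<lambda>z. lift (fst z) (snd z)) -` W"
  have K: "smooth_vec_on (product_atlas L T) ?\<Omega> (\<lambda>y. k (lift (fst y) (snd y)))"
    if "smooth_vec_on T W k" for k :: "'m \<times> 'm covec \<Rightarrow> real"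
    by (rule TT.act_pullback[OF that])
  have zT: "z \<in> points T" using zc by (simp only: points_cotangent)
  let ?N = "carrier G \<inter> (\<lambda>g. lift g z) -` W"
  have N: "openin (atlas_topology L) ?N"
    by (rule smooth_map_on_vimage[OF L T TT.orbit_smooth[OF zT] smooth_vec_on_open[OF f]])
  have oneN: "\<one>\<^bsub>G\<^esub> \<in> ?N" using z zT one_closed by (simp add: TT.act_one)
  \<comment> \<open>The Leibniz rule along \<open>X\<close> asks for factors that are smooth in the
    group variable.\<close>
  have PS: "smooth_near L \<one>\<^bsub>G\<^esub> (\<lambda>g. ?D w (\<lambda>y. k (lift g y)))" if k: "smooth_vec_on T W k" for k w
  proof -
    have sl: "smooth_map_on L (points L) (product_atlas L T) (\<lambda>g. (g, z))"
      by (rule slice_smooth(2)[OF L T one_closed[folded points_L] zT])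
    have "smooth_vec_on (product_atlas L T) (?\<Omega> \<inter> (points L \<times> cot_set A U))
      (\<lambda>y. cot_coord A U \<phi> (snd y) w (\<lambda>b. k (lift (fst y) b)))"
      using smooth_vertical[OF L T K[OF k] cU, of w] by simp
    from smooth_vec_on_pullback[OF L LT sl this]
    have "smooth_vec_on L (points L \<inter> (\<lambda>g. (g, z)) -` (?\<Omega> \<inter> (points L \<times> cot_set A U))) (\<lambda>g. ?D w (\<lambda>y. k (lift g y)))"
      by (simp only: fst_conv snd_conv)
    then show ?thesis by (rule smooth_nearI) (use one_closed zT zU z in \<open>auto simp: points_L TT.act_one\<close>)
  qed
  have P1: "?D w (\<lambda>y. k (lift \<one>\<^bsub>G\<^esub> y)) = ?D w k" for k w
    by (rule tangent_cong[OF T D openin_points zT]) (rule arg_cong[of _ _ k], rule TT.act_one)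
  \<comment> \<open>Here \<open>X\<close> differentiates in the group and \<open>?D w\<close> on the
    bundle, so they commute by \<open>partial_commute\<close>.\<close>
  have PX: "X (\<lambda>g. ?D w (\<lambda>y. k (lift g y))) = ?D w (\<lambda>y. E y k)" if k: "smooth_vec_on T W k" for k w
  proof -
    have "X (\<lambda>g. ?D w (\<lambda>y. k (lift g y))) = ?D w (\<lambda>y. X (\<lambda>g. k (lift g y)))"
      using partial_commute[OF L T K[OF k] X D[of w]] one_closed zT z by (simp add: TT.act_one)
    also have "\<dots> = ?D w (\<lambda>y. E y k)"
      unfolding E_def
      by (rule tangent_cong[OF T D smooth_vec_on_open[OF k] z]) (rule TT.fundamental_apply_on[OF k, symmetric])
    finally show ?thesis .
  qed
  have prod: "X (\<lambda>g. ?D v (\<lambda>y. k (lift g y)) * ?D w (\<lambda>y. l (lift g y))) =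
      ?D v k * ?D w (\<lambda>y. E y l) + ?D v (\<lambda>y. E y k) * ?D w l"
    if "smooth_vec_on T W k" "smooth_vec_on T W l" for k l v w
    using tangent_mult[OF L X PS[OF that(1)] PS[OF that(2)], of v w] by (simp add: P1 PX that)
  have prod_near: "smooth_near L \<one>\<^bsub>G\<^esub> (\<lambda>g. ?D v (\<lambda>y. k (lift g y)) * ?D w (\<lambda>y. l (lift g y)))"
    if kl: "smooth_vec_on T W k" "smooth_vec_on T W l" for k l v w
  proof -
    obtain W1 where W1: "\<one>\<^bsub>G\<^esub> \<in> W1" "smooth_vec_on L W1 (\<lambda>g. ?D v (\<lambda>y. k (lift g y)))"
      using smooth_nearE[OF PS[OF kl(1), of v]] .
    obtain W2 where W2: "\<one>\<^bsub>G\<^esub> \<in> W2" "smooth_vec_on L W2 (\<lambda>g. ?D w (\<lambda>y. l (lift g y)))"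
      using smooth_nearE[OF PS[OF kl(2), of w]] .
    have "smooth_vec_on L (W1 \<inter> W2) (\<lambda>g. ?D v (\<lambda>y. k (lift g y)) * ?D w (\<lambda>y. l (lift g y)))"
      by (rule smooth_vec_on_mult[OF L smooth_vec_on_Int[OF W1(2) smooth_vec_on_open[OF W2(2)]]
        smooth_vec_on_subset[OF W2(2) openin_Int[OF smooth_vec_on_open[OF W1(2)] smooth_vec_on_open[OF W2(2)]]]]) simp
    then show ?thesis by (rule smooth_nearI) (use W1 W2 in simp)
  qed
  have diff: "X (\<lambda>g. ?D (b, 0) (\<lambda>y. f (lift g y)) * ?D (0, b) (\<lambda>y. h (lift g y)) -
      ?D (b, 0) (\<lambda>y. h (lift g y)) * ?D (0, b) (\<lambda>y. f (lift g y))) =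
      (?D (b, 0) f * ?D (0, b) (\<lambda>y. E y h) + ?D (b, 0) (\<lambda>y. E y f) * ?D (0, b) h) -
      (?D (b, 0) h * ?D (0, b) (\<lambda>y. E y f) + ?D (b, 0) (\<lambda>y. E y h) * ?D (0, b) f)" for b
    using tangent_lincomb_fun[OF L X prod_near[OF f h] prod_near[OF h f], of 1 "(b, 0)" "(0, b)" "-1" "(b, 0)" "(0, b)"]
    by (simp add: prod f h)
  have near: "smooth_near L \<one>\<^bsub>G\<^esub> (\<lambda>g. ?D (b, 0) (\<lambda>y. f (lift g y)) * ?D (0, b) (\<lambda>y. h (lift g y)) -
      ?D (b, 0) (\<lambda>y. h (lift g y)) * ?D (0, b) (\<lambda>y. f (lift g y)))" for b
  proof -
    obtain W1 where W1: "\<one>\<^bsub>G\<^esub> \<in> W1" "smooth_vec_on L W1 (\<lambda>g. ?D (b, 0) (\<lambda>y. f (lift g y)) * ?D (0, b) (\<lambda>y. h (lift g y)))"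
      using smooth_nearE[OF prod_near[OF f h, of "(b, 0)" "(0, b)"]] .
    obtain W2 where W2: "\<one>\<^bsub>G\<^esub> \<in> W2" "smooth_vec_on L W2 (\<lambda>g. ?D (b, 0) (\<lambda>y. h (lift g y)) * ?D (0, b) (\<lambda>y. f (lift g y)))"
      using smooth_nearE[OF prod_near[OF h f, of "(b, 0)" "(0, b)"]] .
    have "smooth_vec_on L (W1 \<inter> W2) (\<lambda>g. ?D (b, 0) (\<lambda>y. f (lift g y)) * ?D (0, b) (\<lambda>y. h (lift g y)) -
      ?D (b, 0) (\<lambda>y. h (lift g y)) * ?D (0, b) (\<lambda>y. f (lift g y)))"
      by (rule smooth_vec_on_diff[OF L smooth_vec_on_Int[OF W1(2) smooth_vec_on_open[OF W2(2)]]
        smooth_vec_on_subset[OF W2(2) openin_Int[OF smooth_vec_on_open[OF W1(2)] smooth_vec_on_open[OF W2(2)]]]]) simp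
    then show ?thesis by (rule smooth_nearI) (use W1 W2 in simp)
  qed
  have Es: "smooth_vec_on T W (\<lambda>y. E y k)" if "smooth_vec_on T W k" for k
    unfolding E_def by (rule TT.fundamental_smooth[OF X that])
  have "E z (cbr f h) = X (\<lambda>g. cbr f h (lift g z))"
    unfolding E_def by (rule TT.fundamental_apply_on[OF cbr_smooth_jacobi(1)[OF f h] z])
  also have "\<dots> = X (\<lambda>g. chart_bracket A U \<phi> z (\<lambda>y. f (lift g y)) (\<lambda>y. h (lift g y)))"
  proof (rule tangent_cong[OF L X N oneN])
    fix g assume g: "g \<in> ?N"
    show "cbr f h (lift g z) = chart_bracket A U \<phi> z (\<lambda>y. f (lift g y)) (\<lambda>y. h (lift g y))"
      by (rule cbr_lift[OF _ zU U(1) smooth_nearI[OF f] smooth_nearI[OF h]]) (use g in auto)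
  qed
  also have "\<dots> = (\<Sum>b\<in>onb. (?D (b, 0) f * ?D (0, b) (\<lambda>y. E y h) + ?D (b, 0) (\<lambda>y. E y f) * ?D (0, b) h) -
      (?D (b, 0) h * ?D (0, b) (\<lambda>y. E y f) + ?D (b, 0) (\<lambda>y. E y h) * ?D (0, b) f))"
    unfolding chart_bracket_def by (subst tangent_sum[OF L X finite_onb near]) (simp_all add: diff)
  also have "\<dots> = chart_bracket A U \<phi> z (\<lambda>y. E y f) h + chart_bracket A U \<phi> z f (\<lambda>y. E y h)"
    unfolding chart_bracket_def sum.distrib[symmetric] by (rule sum.cong) simp_all
  also have "\<dots> = cbr (\<lambda>y. E y f) h z + cbr f (\<lambda>y. E y h) z"
    using cbr_chart[OF zU U(1) smooth_nearI[OF Es[OF f] z] smooth_nearI[OF h z]]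
      cbr_chart[OF zU U(1) smooth_nearI[OF f z] smooth_nearI[OF Es[OF h] z]] by simp
  finally show ?thesis .
qed

end

section \<open>The deformed Poisson structure on the cotangent bundle\<close>

lemma mvec_apply_add:
  assumes A: "smooth_atlas A" and x: "x \<in> points A" and \<pi>: "\<pi> x \<in> exterior_power 2 (tangent_space A x)"
    and fg: "smooth_near A x f" "smooth_near A x g"
  shows "mvec_apply A \<pi> [\<lambda>y. f y + g y, h] x = mvec_apply A \<pi> [f, h] x + mvec_apply A \<pi> [g, h] x"
proof -
  obtain v where v: "v \<in> tangent_space A x" "\<forall>f. mvec_apply A \<pi> [f, h] x = v f"
    using hamiltonian_vector[where \<pi> = \<pi> and h = h, OF A x \<pi>] by blast
  show ?thesis using tangent_lincomb_fun[OF A v(1) fg, of 1 1] v(2) by simp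
qed

lemma inner_onb_sum:
  fixes v w :: "'a::finite_dim_inner"
  shows "(\<Sum>b\<in>onb. inner v b * inner w b) = inner v w"
proof -
  have "inner v w = inner v (\<Sum>b\<in>onb. inner w b *\<^sub>R b)" by (simp add: onb_expand)
  then show ?thesis by (simp add: inner_sum_right mult.commute)
qed

text \<open>\<open>k i f g\<close> stands for the canonical bracket of \<open>E\<^sub>i f\<close>
  with \<open>g\<close>, and \<open>a f j\<close> for \<open>E\<^sub>j f\<close>. The two sums in
  \<open>M\<close> are the mixed terms of one double bracket after the derivation property and the
  Leibniz rule. Antisymmetry of \<open>c\<close> brings each \<open>M\<close> to four terms
  \<open>R\<close>, and the twelve terms of the alternating sum cancel in pairs.\<close>

lemma mixed_jacobi_algebra:
  fixes I :: "'i set" and c :: "'i \<Rightarrow> 'i \<Rightarrow> real" and a :: "'f \<Rightarrow> 'i \<Rightarrow> real" and k :: "'i \<Rightarrow> 'f \<Rightarrow> 'f \<Rightarrow> real"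
  assumes c: "\<And>i j. c j i = - c i j"
  defines "M \<equiv> \<lambda>f g h. (\<Sum>i\<in>I. \<Sum>j\<in>I. c i j * ((k i f g - k i g f) * a h j)) +
    (\<Sum>i\<in>I. \<Sum>j\<in>I. c i j * (k i f h * a g j + a f i * k j g h))"
  shows "M f g h - M f h g + M g h f = 0"
proof -
  define R where "R = (\<lambda>u v. \<Sum>i\<in>I. \<Sum>j\<in>I. c i j * (u i * v j :: real))"
  have R: "R u v = - R v u" for u v
  proof -
    have "R u v = (\<Sum>j\<in>I. \<Sum>i\<in>I. c i j * (u i * v j))" unfolding R_def by (rule sum.swap)
    also have "\<dots> = (\<Sum>j\<in>I. \<Sum>i\<in>I. - c j i * (u i * v j))"
      by (intro sum.cong refl) (rule arg_cong2[where f = "(*)", OF c refl])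
    also have "\<dots> = - R v u" unfolding R_def by (simp add: sum_negf mult.commute)
    finally show ?thesis .
  qed
  have M: "M f g h = R (\<lambda>i. k i f g) (a h) - R (\<lambda>i. k i g f) (a h) + R (\<lambda>i. k i f h) (a g) - R (\<lambda>i. k i g h) (a f)" for f g h
  proof -
    have "M f g h = R (\<lambda>i. k i f g) (a h) - R (\<lambda>i. k i g f) (a h) + R (\<lambda>i. k i f h) (a g) + R (a f) (\<lambda>i. k i g h)"
      unfolding M_def R_def by (simp add: sum.distrib[symmetric] sum_subtractf[symmetric] algebra_simps)
    then show ?thesis using R[of "a f" "\<lambda>i. k i g h"] by simp
  qed
  show ?thesis unfolding M by simp
qed

context atlas_action
begin

abbreviation r_lift where "r_lift w \<equiv> induced_mvec_field G L T lift w"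
abbreviation deformed where "deformed w \<equiv> (\<lambda>z \<beta>s. r_lift w z \<beta>s + canonical_poisson A z \<beta>s)"

theorem deformed_poisson:
  assumes w: "w \<in> exterior_power 2 \<gg>" and schouten: "lie_schouten G L 2 w 2 w = (\<lambda>\<alpha>s. 0)"
  shows "poisson_bivector_field T (deformed w)"
proof -
  interpret TT: atlas_action G L T lift by (rule lifted_action_atlas)
  show ?thesis
  proof (rule TT.induced_frame[OF w schouten])
    fix I :: "(nat \<times> bool) set" and e c
    assume I: "finite I" and e: "\<And>i. i \<in> I \<Longrightarrow> e i \<in> \<gg>" and c: "\<And>i j. c j i = - c i j"
      and B: "\<And>W f g z. smooth_vec_on T W f \<Longrightarrow> smooth_vec_on T W g \<Longrightarrow> z \<in> W \<Longrightarrow>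
        mvec_apply T (r_lift w) [f, g] z = (\<Sum>i\<in>I. \<Sum>j\<in>I. c i j * (TT.fundamental (e i) z f * TT.fundamental (e j) z g))"
      and J: "\<And>W f g h z. smooth_vec_on T W f \<Longrightarrow> smooth_vec_on T W g \<Longrightarrow> smooth_vec_on T W h \<Longrightarrow> z \<in> W \<Longrightarrow>
        mvec_apply T (r_lift w) [mvec_apply T (r_lift w) [f, g], h] z -
        mvec_apply T (r_lift w) [mvec_apply T (r_lift w) [f, h], g] z +
        mvec_apply T (r_lift w) [mvec_apply T (r_lift w) [g, h], f] z = 0"
    define b where "b = (\<lambda>f h. mvec_apply T (r_lift w) [f, h])"
    let ?E = "\<lambda>i z. TT.fundamental (e i) z"
    have D: "mvec_apply T (deformed w) [f, h] = (\<lambda>z. b f h z + cbr f h z)" for f h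
      by (simp add: mvec_apply_def b_def cbr_def fun_eq_iff)
    have rx: "r_lift w z \<in> exterior_power 2 (tangent_space T z)" if "z \<in> points T" for z
      by (rule TT.induced_exterior[OF w that])
    have cx: "canonical_poisson A z \<in> exterior_power 2 (tangent_space T z)" if "z \<in> points T" for z
      using canonical_poisson_exterior that by (simp add: points_cotangent)
    have bs: "smooth_vec_on T W (b f h)" if fh: "smooth_vec_on T W f" "smooth_vec_on T W h" for W f h
    proof (rule smooth_vec_on_cong[OF T])
      show "smooth_vec_on T W (\<lambda>z. \<Sum>i\<in>I. \<Sum>j\<in>I. c i j * (?E i z f * ?E j z h))"
        by (intro smooth_vec_on_sum[OF T smooth_vec_on_open[OF fh(1)]] smooth_vec_on_cmult[OF T] smooth_vec_on_mult[OF T]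
            TT.fundamental_smooth e fh)
    qed (simp add: b_def B[OF fh])
    show ?thesis
    proof (rule poisson_bivectorI[OF T multivector_field_2I])
      show "deformed w z \<in> exterior_power 2 (tangent_space T z)" if "z \<in> points T" for z
        by (rule exterior_power_add[OF rx[OF that] cx[OF that]])
      show "smooth_vec_on T W (mvec_apply T (deformed w) [f, g])"
        if "smooth_vec_on T W f" "smooth_vec_on T W g" for W f g
        unfolding D by (rule smooth_vec_on_add[OF T bs[OF that] cbr_smooth_jacobi(1)[OF that]])
      fix z W and f g h :: "'m \<times> 'm covec \<Rightarrow> real"
      assume z: "z \<in> W" and fgh: "smooth_vec_on T W f" "smooth_vec_on T W g" "smooth_vec_on T W h"
      have zT: "z \<in> points T" using openin_imp_points[OF smooth_vec_on_open[OF fgh(1)]] z by blast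
      have n: "smooth_near T z f" if "smooth_vec_on T W f" for f by (rule smooth_nearI[OF that z])
      \<comment> \<open>Additivity in the first argument splits the Jacobi sum into that of the
        induced field, that of the canonical structure, and the mixed terms in parentheses.\<close>
      have DD: "mvec_apply T (deformed w) [mvec_apply T (deformed w) [f, g], h] z =
          b (b f g) h z + cbr (cbr f g) h z + (b (cbr f g) h z + cbr (b f g) h z)"
        if "smooth_vec_on T W f" "smooth_vec_on T W g" for f g h
        using mvec_apply_add[where \<pi> = "r_lift w" and h = h, OF T zT rx[OF zT] n[OF bs[OF that]] n[OF cbr_smooth_jacobi(1)[OF that]]]
          mvec_apply_add[where \<pi> = "canonical_poisson A" and h = h, OF T zT cx[OF zT] n[OF bs[OF that]] n[OF cbr_smooth_jacobi(1)[OF that]]]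
        unfolding D by (simp add: b_def cbr_def)
      define k where "k = (\<lambda>i f h. cbr (\<lambda>y. ?E i y f) h z)"
      define a where "a = (\<lambda>f j. ?E j z f)"
      have mixed: "b (cbr f g) h z + cbr (b f g) h z =
          (\<Sum>i\<in>I. \<Sum>j\<in>I. c i j * ((k i f g - k i g f) * a h j)) +
          (\<Sum>i\<in>I. \<Sum>j\<in>I. c i j * (k i f h * a g j + a f i * k j g h))"
        if fgh: "smooth_vec_on T W f" "smooth_vec_on T W g" "smooth_vec_on T W h" for f g h
      proof -
        have "b (cbr f g) h z = (\<Sum>i\<in>I. \<Sum>j\<in>I. c i j * (?E i z (cbr f g) * ?E j z h))"
          unfolding b_def by (rule B[OF cbr_smooth_jacobi(1)[OF fgh(1,2)] fgh(3) z])
        also have "\<dots> = (\<Sum>i\<in>I. \<Sum>j\<in>I. c i j * ((k i f g - k i g f) * a h j))"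
        proof (intro sum.cong refl)
          fix i j assume i: "i \<in> I"
          have "?E i z (cbr f g) = k i f g + cbr f (\<lambda>y. ?E i y g) z"
            unfolding k_def by (rule cbr_derivation[OF e[OF i] fgh(1,2) z])
          also have "cbr f (\<lambda>y. ?E i y g) z = - k i g f"
            unfolding k_def cbr_def by (rule mvec_apply_antisym[where \<pi> = "canonical_poisson A", OF T cx[OF zT]])
          finally show "c i j * (?E i z (cbr f g) * ?E j z h) = c i j * ((k i f g - k i g f) * a h j)"
            by (simp add: a_def)
        qed
        finally have 1: "b (cbr f g) h z = (\<Sum>i\<in>I. \<Sum>j\<in>I. c i j * ((k i f g - k i g f) * a h j))" .
        \<comment> \<open>The Hamiltonian vector of \<open>h\<close> turns
          \<open>cbr (b f g) h z\<close> into a derivative of the frame expression of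
          \<open>b f g\<close>, to which \<open>tangent_frame_derivation\<close> applies.\<close>
        obtain v where v: "v \<in> tangent_space T z" "\<forall>f. cbr f h z = v f"
          using hamiltonian_vector[where \<pi> = "canonical_poisson A" and h = h, OF T zT cx[OF zT]] unfolding cbr_def by blast
        have Bz: "b f g z = (\<Sum>i\<in>I. \<Sum>j\<in>I. c i j * (?E i z f * ?E j z g))" if "z \<in> W" for z
          unfolding b_def by (rule B[OF fgh(1,2) that])
        have "v (b f g) = (\<Sum>i\<in>I. \<Sum>j\<in>I. c i j * (v (\<lambda>y. ?E i y f) * ?E j z g + ?E i z f * v (\<lambda>y. ?E j y g)))"
          by (rule tangent_frame_derivation[where X = ?E and W = W, OF T I smooth_vec_on_open[OF fgh(1)] _ _ Bz z v(1)])
            (intro TT.fundamental_smooth e fgh; assumption)+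
        then have "cbr (b f g) h z = (\<Sum>i\<in>I. \<Sum>j\<in>I. c i j * (k i f h * a g j + a f i * k j g h))"
          using v(2) by (simp add: k_def a_def)
        with 1 show ?thesis by simp
      qed
      have bJ: "b (b f g) h z - b (b f h) g z + b (b g h) f z = 0" unfolding b_def by (rule J[OF fgh z])
      have cJ: "cbr (cbr f g) h z - cbr (cbr f h) g z + cbr (cbr g h) f z = 0"
        by (rule cbr_smooth_jacobi(2)[OF fgh z])
      show "mvec_apply T (deformed w) [mvec_apply T (deformed w) [f, g], h] z -
          mvec_apply T (deformed w) [mvec_apply T (deformed w) [f, h], g] z +
          mvec_apply T (deformed w) [mvec_apply T (deformed w) [g, h], f] z = 0"
        unfolding DD[OF fgh(1,2)] DD[OF fgh(1,3)] DD[OF fgh(2,3)]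
          mixed[OF fgh] mixed[OF fgh(1,3,2)] mixed[OF fgh(2,3,1)]
        using bJ cJ mixed_jacobi_algebra[where c = c and I = I and a = a and k = k and f = f and g = g and h = h, OF c]
        by linarith
    qed
  qed
qed

section \<open>Projection of the induced and deformed structures to the base\<close>

lemma pull_projection_dual:
  assumes "z \<in> cotangent_points A" "\<alpha> \<in> cotangent_space A (fst z)"
  shows "pull_covec T A fst z \<alpha> \<in> cotangent_space T z"
  by (rule pull_covec_dual[OF T A cotangent_projection_smooth[OF A] assms])

text \<open>The projection carries the lifted orbit map of \<open>z\<close> to the orbit map of its
  base point, so the claim is functoriality of the pull-back of covectors.\<close>

theorem induced_related: "related_mvec_fields T A fst (r_lift w) (induced_mvec_field G L A act w)"
  unfolding related_mvec_fields_def points_cotangent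
proof (intro ballI ext)
  interpret TT: atlas_action G L T lift by (rule lifted_action_atlas)
  fix z \<alpha>s assume z: "z \<in> cotangent_points A"
  have x: "fst z \<in> points A" using z by (auto simp: cotangent_points_def)
  have zT: "z \<in> points T" using z by (simp only: points_cotangent)
  have l1: "lift \<one>\<^bsub>G\<^esub> z = z" by (rule lift_one[OF z])
  have orb: "(\<lambda>g. fst (lift g z)) = (\<lambda>g. act g (fst z))" by (simp add: lift_eq[OF z])
  show "push_mvec T A fst z (r_lift w z) \<alpha>s = induced_mvec_field G L A act w (fst z) \<alpha>s"
  proof (cases "set \<alpha>s \<subseteq> cotangent_space A (fst z)")
    case True
    have c: "pull_covec L T (\<lambda>g. lift g z) \<one>\<^bsub>G\<^esub> (pull_covec T A fst z \<alpha>) = pull_covec L A (\<lambda>g. act g (fst z)) \<one>\<^bsub>G\<^esub> \<alpha>" for \<alpha>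
      using pull_covec_compose[OF L T A TT.orbit_smooth[OF zT] one_closed cotangent_projection_smooth[OF A], of \<alpha>] z
      by (simp only: l1 orb)
    have "set (map (pull_covec T A fst z) \<alpha>s) \<subseteq> cotangent_space T z"
      using True pull_projection_dual[OF z] by auto
    then show ?thesis
      using True by (simp add: push_mvec_def induced_mvec_field_def l1 act_one[OF x] c o_def)
  qed (simp add: push_mvec_def induced_mvec_field_def act_one[OF x])
qed

lemma canonical_pull_projection:
  assumes z: "z \<in> cotangent_points A" and \<alpha>s: "set \<alpha>s \<subseteq> cotangent_space A (fst z)"
  shows "canonical_poisson A z (map (pull_covec T A fst z) \<alpha>s) = 0"
proof (rule canonical_poisson_chart[OF z])
  fix U \<phi> assume U: "(U, \<phi>) \<in> A" "z \<in> cot_set A U"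
    and c: "canonical_poisson A z = (\<lambda>\<beta>s. \<Sum>b\<in>onb. wedge (tangent_space T z)
      [cot_coord A U \<phi> z (b, 0), cot_coord A U \<phi> z (0, b)] \<beta>s)"
  note cU = cotangent_atlasI[OF U(1)]
  have x: "fst z \<in> U" using U(2) by auto
  have D: "cot_coord A U \<phi> z v \<in> tangent_space T z" for v by (rule coordinate_vector_tangent[OF T cU U(2)])
  have p: "push_tvec A fst z (cot_coord A U \<phi> z (0, b)) = coordinate_vector A (U, \<phi>) (fst z) 0" for b
  proof -
    have "dd (\<lambda>s. \<phi> (fst (inv_into (cot_set A U) (cot_map A U \<phi>) s))) (cot_map A U \<phi> z) (0, b) = dd fst (cot_map A U \<phi> z) (0, b)"
    proof (rule dd_cong[OF chart_open[OF T cU]])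
      show "cot_map A U \<phi> z \<in> cot_map A U \<phi> ` cot_set A U" using U(2) by (rule imageI)
      fix s assume "s \<in> cot_map A U \<phi> ` cot_set A U"
      then obtain y where y: "s = cot_map A U \<phi> y" "y \<in> cot_set A U" by (rule imageE)
      show "\<phi> (fst (inv_into (cot_set A U) (cot_map A U \<phi>) s)) = fst s"
        unfolding y(1) inv_cot_map[OF A U(1) y(2)] by simp
    qed
    also have "\<dots> = 0" using dd_eq[OF bounded_linear_imp_has_derivative[OF bounded_linear_fst], of "cot_map A U \<phi> z" "(0, b)"] by simp
    finally show ?thesis
      using push_coordinate_vector[OF T A cotangent_projection_smooth[OF A] z cU U(2) U(1) x, of "(0, b)"] by simp
  qed
  have zero: "pull_covec T A fst z \<alpha> (cot_coord A U \<phi> z (0, b)) = 0" if \<alpha>: "\<alpha> \<in> cotangent_space A (fst z)" for \<alpha> b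
    using inner_momentum[OF A U(1) x \<alpha>, of 0] by (simp add: pull_covec_def D p)
  have "wedge (tangent_space T z) [cot_coord A U \<phi> z (b, 0), cot_coord A U \<phi> z (0, b)] (map (pull_covec T A fst z) \<alpha>s) = 0" for b
  proof (cases "length \<alpha>s = 2")
    case True
    then obtain \<alpha> \<beta> where "\<alpha>s = [\<alpha>, \<beta>]" by (auto simp: length_Suc_conv numeral_2_eq_2)
    then show ?thesis using \<alpha>s by (simp add: wedge_2 zero)
  qed (simp add: wedge_2 form_lists_def)
  then show ?thesis by (simp add: c)
qed

theorem deformed_related: "related_mvec_fields T A fst (deformed w) (induced_mvec_field G L A act w)"
  unfolding related_mvec_fields_def
proof (intro ballI ext)
  fix z \<alpha>s assume z: "z \<in> points T"
  then have zc: "z \<in> cotangent_points A" by (simp only: points_cotangent)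
  have "push_mvec T A fst z (deformed w z) \<alpha>s = push_mvec T A fst z (r_lift w z) \<alpha>s"
    using canonical_pull_projection[OF zc] by (simp add: push_mvec_def)
  then show "push_mvec T A fst z (deformed w z) \<alpha>s = induced_mvec_field G L A act w (fst z) \<alpha>s"
    using induced_related[of w] z by (simp add: related_mvec_fields_def)
qed

text \<open>A covector is represented by the function linear in the chart with the same components,
  so \<open>chart_bracket\<close> collapses to the standard pairing of positions and momenta. This
  is the invertible part of the deformed structure.\<close>

lemma canonical_momentum:
  assumes U: "(U, \<phi>) \<in> A" and z: "z \<in> cot_set A U"
    and \<alpha>: "\<alpha> \<in> cotangent_space T z" and \<beta>: "\<beta> \<in> cotangent_space T z"
  defines "m \<equiv> momentum T (cot_set A U, cot_map A U \<phi>) z"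
  shows "canonical_poisson A z [\<alpha>, \<beta>] = inner (fst (m \<alpha>)) (snd (m \<beta>)) - inner (fst (m \<beta>)) (snd (m \<alpha>))"
proof -
  note cU = cotangent_atlasI[OF U]
  let ?f = "\<lambda>\<alpha> y. inner (cot_map A U \<phi> y) (m \<alpha>)"
  have d: "fun_differential T z (?f \<alpha>) = \<alpha>" if "\<alpha> \<in> cotangent_space T z" for \<alpha>
    unfolding m_def by (rule differential_momentum[OF T cU z that])
  have n: "smooth_near T z (?f \<alpha>)" for \<alpha> by (rule smooth_nearI[OF smooth_vec_on_coordinate[OF T cU] z])
  have q: "cot_coord A U \<phi> z v (?f \<alpha>) = inner v (m \<alpha>)" for v \<alpha> by (rule coordinate_vector_coordinate[OF T cU z])
  have "canonical_poisson A z [\<alpha>, \<beta>] = cbr (?f \<alpha>) (?f \<beta>) z"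
    by (simp add: cbr_def mvec_apply_def d[OF \<alpha>] d[OF \<beta>])
  also have "\<dots> = (\<Sum>b\<in>onb. inner (fst (m \<alpha>)) b * inner (snd (m \<beta>)) b - inner (fst (m \<beta>)) b * inner (snd (m \<alpha>)) b)"
    unfolding cbr_chart[OF z U n n] chart_bracket_def q
    by (rule sum.cong) (simp_all add: inner_prod_def inner_commute)
  finally show ?thesis by (simp add: sum_subtractf inner_onb_sum)
qed

text \<open>On a covector in the kernel the values \<open>t\<^sub>i\<close> on the fundamental fields satisfy \<open>t = t m\<close>, where
  the matrix \<open>m\<close> involves the momentum components of those fields, hence vanishes on the zero section.\<close>

theorem deformed_nondegenerate:
  assumes w: "w \<in> exterior_power 2 \<gg>" and schouten: "lie_schouten G L 2 w 2 w = (\<lambda>\<alpha>s. 0)"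
    and x: "x \<in> points A"
  shows "\<exists>W. openin (atlas_topology T) W \<and> (x, \<lambda>v. 0) \<in> W \<and> (\<forall>z\<in>W. nondegenerate_at T (deformed w) z)"
proof -
  interpret TT: atlas_action G L T lift by (rule lifted_action_atlas)
  obtain U \<phi> where U: "(U, \<phi>) \<in> A" "x \<in> U" using points_chart[OF x] .
  note cU = cotangent_atlasI[OF U(1)]
  let ?C = "cot_set A U" and ?\<kappa> = "cot_map A U \<phi>"
  have C: "openin (atlas_topology T) ?C" by (rule openin_chart[OF T cU])
  have Cp: "?C \<subseteq> cotangent_points A" using chart_points[OF U(1)] by (auto simp: cotangent_points_def)
  show ?thesis
  proof (rule TT.induced_frame[OF w schouten])
    fix I :: "(nat \<times> bool) set" and e c
    assume I: "finite I" and e: "\<And>i. i \<in> I \<Longrightarrow> e i \<in> \<gg>"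
      and B: "\<And>W f g z. smooth_vec_on T W f \<Longrightarrow> smooth_vec_on T W g \<Longrightarrow> z \<in> W \<Longrightarrow>
        mvec_apply T (r_lift w) [f, g] z = (\<Sum>i\<in>I. \<Sum>j\<in>I. c i j * (TT.fundamental (e i) z f * TT.fundamental (e j) z g))"
    let ?E = "\<lambda>i z. TT.fundamental (e i) z"
    \<comment> \<open>Coordinates of the fundamental fields: \<open>fst\<close> is the position
      part, \<open>snd\<close> the momentum part.\<close>
    define u where "u = (\<lambda>i z. \<Sum>b\<in>onb. ?E i z (\<lambda>y. inner (?\<kappa> y) b) *\<^sub>R b)"
    have E: "?E i z = cot_coord A U \<phi> z (u i z)" if "i \<in> I" "z \<in> ?C" for i z
      unfolding u_def
      by (rule tangent_expand[OF T cU that(2) TT.fundamental_tangent[OF e[OF that(1)]]])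
        (use that Cp points_cotangent in blast)
    have us: "smooth_vec_on T ?C (u i)" if "i \<in> I" for i
      unfolding u_def
      by (intro smooth_vec_on_sum[OF T C] smooth_vec_on_scaleR[OF T] smooth_vec_on_const[OF C]
          TT.fundamental_smooth[OF e[OF that]] smooth_vec_on_coordinate[OF T cU])
    have us1: "smooth_vec_on T ?C (\<lambda>z. fst (u i z))" and us2: "smooth_vec_on T ?C (\<lambda>z. snd (u i z))" if "i \<in> I" for i
      by (rule smooth_vec_on_compose[OF T us[OF that] smooth_on_bounded_linear[OF bounded_linear_fst, of UNIV]], simp)
        (rule smooth_vec_on_compose[OF T us[OF that] smooth_on_bounded_linear[OF bounded_linear_snd, of UNIV]], simp)
    \<comment> \<open>The coefficient matrix \<open>c\<close> times the matrix of symplectic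
      pairings of the fundamental fields; each summand contains a momentum part.\<close>
    define m where "m = (\<lambda>i k z. \<Sum>j\<in>I. c i j * (inner (fst (u j z)) (snd (u k z)) - inner (snd (u j z)) (fst (u k z))))"
    have ms: "smooth_vec_on T ?C (\<lambda>z. m i k z)" if "i \<in> I" "k \<in> I" for i k
      unfolding m_def
      by (intro smooth_vec_on_sum[OF T C] smooth_vec_on_cmult[OF T] smooth_vec_on_diff[OF T] smooth_vec_on_inner[OF T] us1 us2 that)
    \<comment> \<open>Squared Frobenius norm of \<open>m\<close>: a smooth function, so the
      condition \<open>N z < 1\<close> is open.\<close>
    define N where "N = (\<lambda>z. \<Sum>i\<in>I. \<Sum>k\<in>I. m i k z * m i k z)"
    have Ns: "smooth_vec_on T ?C N"
      unfolding N_def by (intro smooth_vec_on_sum[OF T C] smooth_vec_on_mult[OF T] ms)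
    let ?W = "?C \<inter> N -` {..<1}"
    have W: "openin (atlas_topology T) ?W" by (rule openin_smooth_vimage[OF T Ns open_lessThan])
    have z0: "(x, \<lambda>v. 0) \<in> ?C" using U(2) dual_space_zero by simp
    let ?z0 = "(x, \<lambda>v. 0) :: 'm \<times> 'm covec"
    have z0c: "?z0 \<in> cotangent_points A" using z0 Cp by blast
    have u0: "snd (u j ?z0) = 0" if j: "j \<in> I" for j
    proof -
      have "inner (snd (u j ?z0)) p = 0" for p
      proof -
        let ?f = "\<lambda>y. inner (?\<kappa> y) (0, p)"
        have "inner (snd (u j ?z0)) p = inner (u j ?z0) (0, p)" by (simp add: inner_prod_def)
        also have "\<dots> = ?E j ?z0 ?f"
          unfolding E[OF j z0] by (rule coordinate_vector_coordinate[OF T cU z0, symmetric])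
        also have "\<dots> = e j (\<lambda>g. ?f (lift g ?z0))"
          by (rule TT.fundamental_apply_on[OF smooth_vec_on_coordinate[OF T cU] z0])
        \<comment> \<open>Pull-back takes the zero covector to itself, so the lifted orbit of
          \<open>?z0\<close> has no momentum.\<close>
        also have "(\<lambda>g. ?f (lift g ?z0)) = (\<lambda>g. 0)"
          by (simp add: lift_eq[OF z0c] momentum_def pull_covec_def inner_prod_def)
        also have "e j (\<lambda>g. 0) = 0" by (rule tangent_const[OF L e[OF j]])
        finally show ?thesis .
      qed
      from this[of "snd (u j ?z0)"] show ?thesis by simp
    qed
    have "N ?z0 = 0" unfolding N_def m_def by (simp add: u0)
    then have "?z0 \<in> ?W" using z0 by simp
    moreover have "nondegenerate_at T (deformed w) z" if z: "z \<in> ?W" for z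
      unfolding nondegenerate_at_def
    proof (intro ballI impI)
      fix \<alpha> assume \<alpha>: "\<alpha> \<in> cotangent_space T z" and ker: "\<forall>\<beta>\<in>cotangent_space T z. deformed w z [\<alpha>, \<beta>] = 0"
      have zC: "z \<in> ?C" and Nz: "N z < 1" using z by auto
      let ?m = "momentum T (?C, ?\<kappa>) z"
      let ?f = "\<lambda>v y. inner (?\<kappa> y) v"
      have fs: "smooth_vec_on T ?C (?f v)" for v by (rule smooth_vec_on_coordinate[OF T cU])
      have Ef: "?E i z (?f v) = inner (u i z) v" if "i \<in> I" for i v
        unfolding E[OF that zC] by (rule coordinate_vector_coordinate[OF T cU zC])
      have d\<alpha>: "fun_differential T z (?f (?m \<alpha>)) = \<alpha>" by (rule differential_momentum[OF T cU zC \<alpha>])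
      define t where "t = (\<lambda>i. inner (u i z) (?m \<alpha>))"
      \<comment> \<open>The contraction of the induced bivector with \<open>\<alpha>\<close>: its
        value on \<open>\<alpha>\<close> and a covector with components \<open>n\<close> is
        \<open>inner s n\<close>.\<close>
      define s where "s = (\<Sum>i\<in>I. \<Sum>j\<in>I. (c i j * t i) *\<^sub>R u j z)"
      have main: "inner s n + inner (fst (?m \<alpha>)) (snd n) - inner (fst n) (snd (?m \<alpha>)) = 0" for n
      proof -
        let ?\<beta> = "fun_differential T z (?f n)"
        have \<beta>: "?\<beta> \<in> cotangent_space T z" by (rule fun_differential_dual[OF T])
        have "r_lift w z [\<alpha>, ?\<beta>] = mvec_apply T (r_lift w) [?f (?m \<alpha>), ?f n] z"
          by (simp add: mvec_apply_def d\<alpha>)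
        also have "\<dots> = (\<Sum>i\<in>I. \<Sum>j\<in>I. c i j * (t i * inner (u j z) n))"
          unfolding B[OF fs fs zC] t_def by (intro sum.cong refl) (simp add: Ef)
        also have "\<dots> = inner s n" unfolding s_def inner_sum_left by (simp add: mult.assoc)
        finally have r: "r_lift w z [\<alpha>, ?\<beta>] = inner s n" .
        have c: "canonical_poisson A z [\<alpha>, ?\<beta>] = inner (fst (?m \<alpha>)) (snd n) - inner (fst n) (snd (?m \<alpha>))"
          using canonical_momentum[OF U(1) zC \<alpha> \<beta>] momentum_differential[OF T cU zC, of n] by simp
        show ?thesis using ker[rule_format, OF \<beta>] r c by simp
      qed
      \<comment> \<open>Testing \<open>main\<close> on \<open>(0, n)\<close>, and below on
        \<open>(n, 0)\<close>, inverts the canonical part: the components of \<open>\<alpha>\<close>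
        are determined by \<open>s\<close>.\<close>
      have m1: "fst (?m \<alpha>) = - snd s"
      proof -
        have "inner (fst (?m \<alpha>) + snd s) n = 0" for n
          using main[of "(0, n)"] by (simp add: inner_prod_def inner_add_left)
        from this[of "fst (?m \<alpha>) + snd s"] have "fst (?m \<alpha>) + snd s = 0" by simp
        then show ?thesis by (simp add: eq_neg_iff_add_eq_0)
      qed
      have m2: "snd (?m \<alpha>) = fst s"
      proof -
        have "inner (fst s - snd (?m \<alpha>)) n = 0" for n
          using main[of "(n, 0)"] by (simp add: inner_prod_def inner_diff_left inner_diff_right inner_commute)
        from this[of "fst s - snd (?m \<alpha>)"] show ?thesis by simp
      qed
      have tm: "t k = (\<Sum>i\<in>I. t i * m i k z)" for k
      proof -
        have f1: "fst s = (\<Sum>i\<in>I. \<Sum>j\<in>I. (c i j * t i) *\<^sub>R fst (u j z))"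
          and f2: "snd s = (\<Sum>i\<in>I. \<Sum>j\<in>I. (c i j * t i) *\<^sub>R snd (u j z))"
          unfolding s_def by (simp_all add: fst_sum snd_sum)
        have "t k = inner (fst s) (snd (u k z)) - inner (snd s) (fst (u k z))"
          unfolding t_def by (simp add: inner_prod_def m1 m2 inner_commute)
        also have "\<dots> = (\<Sum>i\<in>I. t i * m i k z)"
          unfolding f1 f2 m_def inner_sum_left sum_subtractf[symmetric] sum_distrib_left
          by (intro sum.cong refl) (simp add: algebra_simps)
        finally show ?thesis .
      qed
      \<comment> \<open>Cauchy-Schwarz for each \<open>k\<close>, applied to \<open>t = t m\<close>;
        summing over \<open>k\<close> bounds the squared norm of \<open>t\<close> by itself times
        \<open>N z\<close>, and \<open>N z < 1\<close> leaves only \<open>t = 0\<close>.\<close>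
      have "(\<Sum>k\<in>I. (t k)\<^sup>2) \<le> (\<Sum>k\<in>I. (\<Sum>i\<in>I. (t i)\<^sup>2) * (\<Sum>i\<in>I. (m i k z)\<^sup>2))"
        by (rule sum_mono) (subst tm, rule Cauchy_Schwarz_ineq_sum)
      also have "\<dots> = (\<Sum>i\<in>I. (t i)\<^sup>2) * N z"
        unfolding N_def sum_distrib_left[symmetric] by (subst (2) sum.swap) (simp add: power2_eq_square)
      finally have le: "(\<Sum>k\<in>I. (t k)\<^sup>2) \<le> (\<Sum>i\<in>I. (t i)\<^sup>2) * N z" .
      have "(\<Sum>k\<in>I. (t k)\<^sup>2) = 0"
      proof (rule ccontr)
        assume "(\<Sum>k\<in>I. (t k)\<^sup>2) \<noteq> 0"
        moreover have "(\<Sum>k\<in>I. (t k)\<^sup>2) \<ge> 0" by (simp add: sum_nonneg)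
        ultimately have "(\<Sum>k\<in>I. (t k)\<^sup>2) > 0" by simp
        then have "(\<Sum>i\<in>I. (t i)\<^sup>2) * N z < (\<Sum>i\<in>I. (t i)\<^sup>2) * 1" using Nz by (intro mult_strict_left_mono)
        then show False using le by simp
      qed
      then have "t i = 0" if "i \<in> I" for i using that I by (simp add: sum_nonneg_eq_0_iff)
      then have "s = 0" unfolding s_def by simp
      then have "?m \<alpha> = 0" using m1 m2 by (simp add: prod_eq_iff)
      then have "fun_differential T z (\<lambda>y. 0) = \<alpha>" using d\<alpha> by simp
      moreover have "fun_differential T z (\<lambda>y. 0) = (\<lambda>v. 0)"
        using tangent_const[OF T] by (simp add: fun_differential_def fun_eq_iff)
      ultimately show "\<alpha> = (\<lambda>v. 0)" by simp
    qed
    ultimately show ?thesis using W by (intro exI[of _ ?W] conjI ballI)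
  qed
qed

end

theorem mainTheorem3:
  fixes G :: "('g, 'z) monoid_scheme"
    and L :: "('g, 'b::finite_dim_inner) atlas"
    and M :: "('m, 'a::finite_dim_inner) atlas"
    and act :: "'g \<Rightarrow> 'm \<Rightarrow> 'm"
    and r :: "'g mvec"
  assumes "lie_group G L"
    and "smooth_manifold M"
    and "smooth_action G L M act"
    and "r \<in> exterior_power 2 (lie_algebra G L)"
    and "lie_schouten G L 2 r 2 r = (\<lambda>\<alpha>s. 0)"
  shows "let T = cotangent_atlas M;
             r\<^sub>M = induced_mvec_field G L M act r;
             r\<^sub>T = induced_mvec_field G L T (lifted_action G M act) r;
             \<pi>\<^sub>T = (\<lambda>z \<beta>s. r\<^sub>T z \<beta>s + canonical_poisson M z \<beta>s)
         in poisson_bivector_field M r\<^sub>M \<and>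
            (poisson_bivector_field T r\<^sub>T \<and> related_mvec_fields T M cotangent_projection r\<^sub>T r\<^sub>M) \<and>
            (poisson_bivector_field T \<pi>\<^sub>T \<and> related_mvec_fields T M cotangent_projection \<pi>\<^sub>T r\<^sub>M) \<and>
            (\<exists>W. openin (atlas_topology T) W \<and> zero_section M \<subseteq> W \<and>
                 (\<forall>z\<in>W. nondegenerate_at T \<pi>\<^sub>T z))"
proof -
  have M: "smooth_atlas M" by (rule smooth_manifold_imp_atlas[OF assms(2)])
  interpret local_lie_group G L by (unfold_locales) (rule assms(1))
  have ga: "group_action G (points M) act"
    and sm: "smooth_map (product_atlas L M) M (\<lambda>(g, x). act g x)"
    using assms(3) by (auto simp: smooth_action_def)
  interpret atlas_action G L M act
  proof unfold_locales
    show "smooth_atlas M" by (rule M)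
    show "smooth_map_on (product_atlas L M) (carrier G \<times> points M) M (\<lambda>z. act (fst z) (snd z))"
      using smooth_map_imp_on[OF smooth_atlas_product[OF L M] M sm]
      by (simp add: points_product points_L case_prod_beta')
    show "act \<one>\<^bsub>G\<^esub> x = x" if "x \<in> points M" for x
      using group_action.id_eq_one[OF ga] that by (metis restrict_apply')
    show "act (g \<otimes>\<^bsub>G\<^esub> h) x = act g (act h x)" if "g \<in> carrier G" "h \<in> carrier G" "x \<in> points M" for g h x
      using group_action.composition_rule[OF ga that(3,1,2)] .
  qed
  interpret TT: atlas_action G L T lift by (rule lifted_action_atlas)
  let ?P = "\<lambda>x W. openin (atlas_topology T) W \<and> (x, \<lambda>v. 0) \<in> W \<and> (\<forall>z\<in>W. nondegenerate_at T (deformed r) z)"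
  \<comment> \<open>Contains the neighbourhoods found at the single points of the zero section;
    nondegeneracy is a pointwise property and so survives the union.\<close>
  define W where "W = \<Union> {W. openin (atlas_topology T) W \<and> (\<forall>z\<in>W. nondegenerate_at T (deformed r) z)}"
  have "openin (atlas_topology T) W" unfolding W_def by (rule openin_Union) simp
  moreover have "zero_section M \<subseteq> W"
  proof
    fix z assume "z \<in> zero_section M"
    then obtain x where x: "z = (x, \<lambda>v. 0)" "x \<in> points M" by (auto simp: zero_section_def)
    obtain W' where "?P x W'" using deformed_nondegenerate[OF assms(4,5) x(2)] by blast
    then show "z \<in> W" unfolding W_def x(1) by blast
  qed
  moreover have "\<forall>z\<in>W. nondegenerate_at T (deformed r) z" unfolding W_def by blast
  ultimately have "\<exists>W. openin (atlas_topology T) W \<and> zero_section M \<subseteq> W \<and> (\<forall>z\<in>W. nondegenerate_at T (deformed r) z)"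
    by blast
  then show ?thesis
    unfolding Let_def
    using induced_poisson[OF assms(4,5)] TT.induced_poisson[OF assms(4,5)] induced_related
      deformed_poisson[OF assms(4,5)] deformed_related by (intro conjI)
qed

end
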